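(* Let $X(t)=(i(t),x(t))$ be the process generated by $(L,D(L))$ (see context) with stickiness parameter $\eta>0$. Then there exist a nonsticky diffusion $\tilde Y$ on $\Gamma$ (generated by $(L,D(L))$ with the same $\sigma,b,\rho_i$ but stickiness $0$) and a strictly increasing continuous (random) function $V^{-1}$ such that $X$ and $\tilde Y(V^{-1}(\cdot))$ are indistinguishable. Moreover there exists a nondecreasing process $\ell_X$, adapted to the completion of the natural filtration of $X$ with respect to the family $(\mathbf P_{\mathsf x})_{\mathsf x\in\Gamma}$, such that almost surely $\ell_X$ increases only when $X=\mathsf v$, $\eta\ell_X(t)=\int_0^t\mathbf 1_{\{X(s)=\mathsf v\}}ds$, and $\ell_X(t)=\ell_{\tilde Y}(V^{-1}(t))$ almost surely, where $\ell_{\tilde Y}$ is the vertex local time of $\tilde Y$ (see context).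
   Context: Star graph: fix $N\ge1$. $\Gamma$ is the quotient of the disjoint union of $N$ copies of $[0,\infty)$ obtained by identifying all the origins; points are written $(i,x)$, and $\mathsf v=(\cdot,0)$ is the unique vertex; metric $d((j,x),(i,y))=|x-y|$ if $i=j$, $x+y$ otherwise. A function $f:\Gamma\to\mathbb R$ is identified with $(f_1,\dots,f_N)$, $f_i(x)=f(i,x)$, $f_i(0)=f_j(0)$; derivatives are edgewise (one-sided at $0$). $C_0(\Gamma)$: continuous functions vanishing at infinity on each edge. $C^2(\Gamma)$: continuous $f$ with each $f_i\in C^2([0,\infty))$. $PC(\Gamma)$: functions with each $f_i$ bounded continuous on $(0,\infty)$ and continuously extendable to $[0,\infty)$. Coefficients $\sigma,b\in PC(\Gamma)$ with $\sigma>\sigma_0>0$. $Lf(i,x)=\frac12\sigma_i^2(x)f_i''(x)+b_i(x)f_i'(x)$ for $x>0$, and $Lf(\mathsf v)$ is the common value of $\lim_{x\to0}L_if(x)$ when these coincide. For a stickiness parameter $\eta\ge0$ and $\rho_i>0$, $\sum_i\rho_i=1$: $D(L)=\{f\in C^2(\Gamma)\cap C_0(\Gamma): Lf\in C_0(\Gamma),\ \eta Lf(\mathsf v)=\sum_i\rho_if_i'(0)\}$; it generates a strongly continuous semigroup on $C_0(\Gamma)$ associated with a conservative continuous-path Markov process $X=(i,x)$, with laws $\mathbf P_{\mathsf x}$ for starting point $\mathsf x$; nonsticky means $\eta=0$. Known fact (Freidlin–Sheu) for a nonsticky diffusion $Y=(j,y)$ with natural filtration $(\mathcal G_t)$: $\int_0^t\mathbf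 1_{\{y(s)=0\}}ds=0$ for all $t$, and there are a Brownian motion $W$ and a continuous nondecreasing $(\mathcal G_t)$-adapted process $\ell_Y$ increasing only when $y=0$ with $dy(t)=\sigma_{j(t)}(y(t))dW(t)+b_{j(t)}(y(t))dt+d\ell_Y(t)$ and $\big(\sum_i 2\rho_i/\sigma_i^2(0)\big)\ell_Y(t)=\lim_{\delta\to0}\delta^{-1}\int_0^t\mathbf 1_{\{y(s)\le\delta\}}ds$ in $L^1$ (the vertex local time of $Y$). *)

theory Defs
  imports "HOL-Probability.Probability"
begin

type_synonym point = "nat \<times> real"

text \<open>Points of the star graph with N edges, in normalized form: (i,x) with i < N,
  x \<ge> 0, and the vertex always represented as (0,0).\<close>
definition Gam :: "nat \<Rightarrow> point set" where
  "Gam N = {(i, x). i < N \<and> 0 \<le> x \<and> (x = 0 \<longrightarrow> i = 0)}"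

definition vtx :: point where "vtx = (0, 0)"

definition gdist :: "point \<Rightarrow> point \<Rightarrow> real" where
  "gdist p q = (if fst p = fst q then \<bar>snd p - snd q\<bar> else snd p + snd q)"

definition Gmeas :: "point measure" where
  "Gmeas = count_space UNIV \<Otimes>\<^sub>M borel"

definition gev :: "(nat \<Rightarrow> real \<Rightarrow> real) \<Rightarrow> point \<Rightarrow> real" where
  "gev f p = f (fst p) (snd p)"

definition C0 :: "nat \<Rightarrow> (nat \<Rightarrow> real \<Rightarrow> real) set" where
  "C0 N = {f. (\<forall>i<N. \<forall>j<N. f i 0 = f j 0) \<and>
              (\<forall>i<N. continuous_on {0..} (f i) \<and> ((f i) \<longlongrightarrow> 0) at_top)}"

definition d1 :: "(real \<Rightarrow> real) \<Rightarrow> real \<Rightarrow> real" where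
  "d1 g x = vector_derivative g (at x within {0..})"

definition C2 :: "nat \<Rightarrow> (nat \<Rightarrow> real \<Rightarrow> real) set" where
  "C2 N = {f. (\<forall>i<N. \<forall>j<N. f i 0 = f j 0) \<and>
              (\<forall>i<N. continuous_on {0..} (f i) \<and>
                 (\<forall>x\<ge>0. (f i has_vector_derivative d1 (f i) x) (at x within {0..})) \<and>
                 (\<forall>x\<ge>0. (d1 (f i) has_vector_derivative d1 (d1 (f i)) x) (at x within {0..})) \<and>
                 continuous_on {0..} (d1 (d1 (f i))))}"

text \<open>The operator L; the coefficients sigma i, b i are the continuous extensions
  of the edgewise coefficients to [0,\<infinity>), so L f at x = 0 is the limit value.\<close>
definition Lop :: "(nat \<Rightarrow> real \<Rightarrow> real) \<Rightarrow> (nat \<Rightarrow> real \<Rightarrow> real) \<Rightarrow>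
                   (nat \<Rightarrow> real \<Rightarrow> real) \<Rightarrow> nat \<Rightarrow> real \<Rightarrow> real" where
  "Lop \<sigma> b f i x = (\<sigma> i x)\<^sup>2 / 2 * d1 (d1 (f i)) x + b i x * d1 (f i) x"

definition DL :: "nat \<Rightarrow> (nat \<Rightarrow> real \<Rightarrow> real) \<Rightarrow> (nat \<Rightarrow> real \<Rightarrow> real) \<Rightarrow> (nat \<Rightarrow> real) \<Rightarrow> real
                  \<Rightarrow> (nat \<Rightarrow> real \<Rightarrow> real) set" where
  "DL N \<sigma> b \<rho> \<eta> = {f. f \<in> C2 N \<and> f \<in> C0 N \<and> Lop \<sigma> b f \<in> C0 N \<and>
                       \<eta> * Lop \<sigma> b f 0 0 = (\<Sum>i<N. \<rho> i * d1 (f i) 0)}"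

definition natfilt :: "(point \<Rightarrow> 'w measure) \<Rightarrow> (real \<Rightarrow> 'w \<Rightarrow> point) \<Rightarrow> real \<Rightarrow> 'w measure" where
  "natfilt P X t = sigma (space (P vtx))
     {X s -` A \<inter> space (P vtx) | s A. 0 \<le> s \<and> s \<le> t \<and> A \<in> sets Gmeas}"

definition compl_filt :: "nat \<Rightarrow> (point \<Rightarrow> 'w measure) \<Rightarrow> (real \<Rightarrow> 'w \<Rightarrow> point) \<Rightarrow> real \<Rightarrow> 'w set set" where
  "compl_filt N P X t = {A. A \<subseteq> space (P vtx) \<and>
      (\<forall>p\<in>Gam N. \<exists>B\<in>sets (natfilt P X t). \<exists>Z\<in>null_sets (P p). (A - B) \<union> (B - A) \<subseteq> Z)}"

definition Tsg :: "(point \<Rightarrow> 'w measure) \<Rightarrow> (real \<Rightarrow> 'w \<Rightarrow> point) \<Rightarrow> real \<Rightarrow>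
                   (nat \<Rightarrow> real \<Rightarrow> real) \<Rightarrow> point \<Rightarrow> real" where
  "Tsg P X t f p = (\<integral>w. gev f (X t w) \<partial>(P p))"

definition unif_right0 :: "nat \<Rightarrow> (real \<Rightarrow> point \<Rightarrow> real) \<Rightarrow> (point \<Rightarrow> real) \<Rightarrow> bool" where
  "unif_right0 N F g = (\<forall>e>0. \<exists>d>0. \<forall>t. 0 < t \<and> t < d \<longrightarrow> (\<forall>p\<in>Gam N. \<bar>F t p - g p\<bar> \<le> e))"

definition path_cont :: "(real \<Rightarrow> point) \<Rightarrow> bool" where
  "path_cont \<gamma> = (\<forall>t\<ge>0. \<forall>e>0. \<exists>d>0. \<forall>s\<ge>0. \<bar>s - t\<bar> < d \<longrightarrow> gdist (\<gamma> s) (\<gamma> t) < e)"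

definition generated_process ::
  "nat \<Rightarrow> (nat \<Rightarrow> real \<Rightarrow> real) \<Rightarrow> (nat \<Rightarrow> real \<Rightarrow> real) \<Rightarrow> (nat \<Rightarrow> real) \<Rightarrow> real
   \<Rightarrow> (point \<Rightarrow> 'w measure) \<Rightarrow> (real \<Rightarrow> 'w \<Rightarrow> point) \<Rightarrow> bool" where
  "generated_process N \<sigma> b \<rho> \<eta> P X \<longleftrightarrow>
     (\<forall>p q. sets (P p) = sets (P q)) \<and>
     (\<forall>p\<in>Gam N. prob_space (P p)) \<and>
     (\<forall>t. \<forall>w\<in>space (P vtx). X t w \<in> Gam N) \<and>
     (\<forall>t\<ge>0. X t \<in> measurable (P vtx) Gmeas) \<and>
     (\<forall>w\<in>space (P vtx). path_cont (\<lambda>t. X t w)) \<and>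
     (\<forall>p\<in>Gam N. AE w in P p. X 0 w = p) \<and>
     (\<forall>p\<in>Gam N. \<forall>f\<in>C0 N. \<forall>s\<ge>0. \<forall>t\<ge>0.
        AE w in P p. real_cond_exp (P p) (natfilt P X t) (\<lambda>w. gev f (X (t + s) w)) w
                     = Tsg P X s f (X t w)) \<and>
     (\<forall>t\<ge>0. \<forall>f\<in>C0 N. \<exists>g\<in>C0 N. \<forall>p\<in>Gam N. Tsg P X t f p = gev g p) \<and>
     (\<forall>f\<in>C0 N. unif_right0 N (\<lambda>t. Tsg P X t f) (gev f)) \<and>
     (\<forall>f. (f \<in> C0 N \<and> (\<exists>g\<in>C0 N. unif_right0 N (\<lambda>t p. (Tsg P X t f p - gev f p) / t) (gev g)))
          \<longleftrightarrow> f \<in> DL N \<sigma> b \<rho> \<eta>) \<and>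
     (\<forall>f\<in>DL N \<sigma> b \<rho> \<eta>. unif_right0 N (\<lambda>t p. (Tsg P X t f p - gev f p) / t) (gev (Lop \<sigma> b f)))"

definition vertex_local_time ::
  "nat \<Rightarrow> (nat \<Rightarrow> real \<Rightarrow> real) \<Rightarrow> (nat \<Rightarrow> real) \<Rightarrow> (point \<Rightarrow> 'w measure)
   \<Rightarrow> (real \<Rightarrow> 'w \<Rightarrow> point) \<Rightarrow> (real \<Rightarrow> 'w \<Rightarrow> real) \<Rightarrow> bool" where
  "vertex_local_time N \<sigma> \<rho> P Y l \<longleftrightarrow>
     (\<forall>w\<in>space (P vtx). continuous_on {0..} (\<lambda>t. l t w) \<and> mono_on {0..} (\<lambda>t. l t w)) \<and>
     (\<forall>t\<ge>0. l t \<in> borel_measurable (natfilt P Y t)) \<and>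
     (\<forall>p\<in>Gam N. \<forall>t\<ge>0. integrable (P p) (l t) \<and>
        ((\<lambda>\<delta>. \<integral>w. \<bar>(1 / \<delta>) * integral {0..t} (\<lambda>s. if snd (Y s w) \<le> \<delta> then 1 else 0)
                    - (\<Sum>i<N. 2 * \<rho> i / (\<sigma> i 0)\<^sup>2) * l t w\<bar> \<partial>(P p)) \<longlongrightarrow> 0) (at_right 0))"

end

theory Submission
  imports Defs
begin

text \<open>
  The nonsticky diffusion is \<open>X\<close> with the time spent at the vertex cut out. Let
  \<open>A t\<close> and \<open>S t\<close> be the times up to \<open>t\<close> spent off and at the
  vertex, let \<open>tau\<close> be the inverse of \<open>A\<close>, and set
  \<open>Y = X \<circ> tau\<close>, \<open>lX = S / \<eta>\<close>, \<open>lY = lX \<circ> tau\<close> and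
  \<open>Vinv = A\<close>. For a \<open>C2\<close> function \<open>f\<close> whose \<open>L f\<close>
  vanishes at infinity but may be discontinuous at the vertex, put
  \<open>\<kappa> f = (\<Sum>i<N. \<rho> i * d1 (f i) 0)\<close>. Approximation by elements of the domain
  shows that \<open>f(X)\<close> minus the integral of \<open>L f(X)\<close> over the time off the vertex
  minus \<open>\<kappa> f * lX\<close> is a martingale. If \<open>f\<close> has the nonsticky boundary
  condition \<open>\<kappa> f = 0\<close>, optional stopping at \<open>tau\<close> turns this into the
  martingale problem for \<open>Y\<close>. That problem is well posed: the nonsticky resolvent equation is
  solved by correcting the resolvent of \<open>X\<close> with a multiple of one solution of
  \<open>\<phi> = h * L \<phi>\<close> that violates the boundary condition, and the implicit Euler scheme
  built from these resolvents determines the semigroup of \<open>Y\<close>. Finally, \<open>lY\<close> is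
  the vertex local time because suitable functions of size \<open>O(d)\<close> near the vertex have
  \<open>\<kappa> = - (\<Sum>i<N. 2 * \<rho> i / (\<sigma> i 0)^2)\<close> and \<open>L\<close> close to
  the indicator of \<open>x \<le> d\<close> divided by \<open>d\<close>, and a second moment estimate makes
  the martingale of such a function small.
\<close>

section \<open>Functions on the star graph\<close>

text \<open>Only the sticky semigroup is given: there is no stochastic calculus, no strong Markov
  property and no nonsticky process to compare with. Everything about \<open>Y\<close> is read off
  from bounded martingales of \<open>X\<close>, and no differential equation is solved. In
  particular, norm estimates for the nonsticky resolvent come from the paths of \<open>Y\<close>,
  which exist by then, and not from a maximum principle. The function \<open>flux_fn\<close> has
  unit flux, vanishes at the vertex, and so does its generator. It does three jobs. Its martingale,
  stopped when the clock reaches a level, bounds the expected local time, so the clock cannot stop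
  for good. During a stay at the vertex it would be constant while its compensator grows, so the
  clock cannot pause. And it violates the sticky boundary condition, which makes it the source of
  the function that repairs the resolvent. The delicate point about null sets is that
  \<open>lY\<close> must be adapted to the uncompleted filtration of \<open>Y\<close> for all
  starting points at once. Hence a single exceptional event has to serve every law.\<close>

lemma trivial_limit_at_within_atLeast:
  fixes x :: real
  assumes "x \<ge> 0"
  shows "at x within {0..} \<noteq> bot"
proof -
  have "at x within {x<..} \<le> at x within {0..}"
    using assms by (intro at_le) auto
  moreover have "at x within {x<..} \<noteq> bot"
    by (simp add: trivial_limit_at_right_real)
  ultimately show ?thesis
    by (metis bot.extremum_uniqueI)
qed

lemma d1I:
  assumes "(g has_vector_derivative D) (at x within {0..})" and "x \<ge> 0"
  shows "d1 g x = D"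
  unfolding d1_def
  using trivial_limit_at_within_atLeast[OF assms(2)] assms(1)
  by (metis vector_derivative_within)

lemma has_vector_derivative_cong_atLeast:
  assumes "\<And>y. y \<ge> 0 \<Longrightarrow> f y = g y" and "x \<ge> (0::real)"
  shows "(f has_vector_derivative D) (at x within {0..}) \<longleftrightarrow> (g has_vector_derivative D) (at x within {0..})"
  using has_vector_derivative_transform[of x "{0..}" g f D] has_vector_derivative_transform[of x "{0..}" f g D] assms
  by fastforce

lemma d1_cong:
  assumes "\<And>y. y \<ge> 0 \<Longrightarrow> f y = g y" and "x \<ge> 0"
  shows "d1 f x = d1 g x"
  unfolding d1_def vector_derivative_def
  using has_vector_derivative_cong_atLeast[of f g x] assms by presburger

text \<open>Explicit candidates \<open>f1\<close>, \<open>f2\<close> replace the choice hidden in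
  \<open>vector_derivative\<close>. The choice is forced because every point of the half-line is a
  limit point of it.\<close>

lemma C2I:
  assumes "\<And>i j. i < N \<Longrightarrow> j < N \<Longrightarrow> f i 0 = f j 0"
    and "\<And>i x. i < N \<Longrightarrow> x \<ge> 0 \<Longrightarrow> (f i has_vector_derivative f1 i x) (at x within {0..})"
    and "\<And>i x. i < N \<Longrightarrow> x \<ge> 0 \<Longrightarrow> (f1 i has_vector_derivative f2 i x) (at x within {0..})"
    and "\<And>i. i < N \<Longrightarrow> continuous_on {0..} (f2 i)"
  shows "f \<in> C2 N"
    and "\<And>i x. i < N \<Longrightarrow> x \<ge> 0 \<Longrightarrow> d1 (f i) x = f1 i x"
    and "\<And>i x. i < N \<Longrightarrow> x \<ge> 0 \<Longrightarrow> d1 (d1 (f i)) x = f2 i x"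
proof -
  show a: "d1 (f i) x = f1 i x" if "i < N" "x \<ge> 0" for i x
    using d1I assms(2) that by blast
  then show b: "d1 (d1 (f i)) x = f2 i x" if "i < N" "x \<ge> 0" for i x
    using d1I[OF assms(3)] that d1_cong[of "d1 (f i)" "f1 i" x] by auto
  have c: "continuous_on {0..} (f i)" if "i < N" for i
    using assms(2)[OF that] by (metis atLeast_iff continuous_on_eq_continuous_within has_vector_derivative_continuous)
  have d: "continuous_on {0..} (d1 (d1 (f i)))" if "i < N" for i
    using assms(4)[OF that] continuous_on_cong[of "{0..}" "{0..}" "d1 (d1 (f i))" "f2 i"] b[OF that] by auto
  show "f \<in> C2 N"
    unfolding C2_def mem_Collect_eq
  proof (intro conjI allI impI)
    show "(f i has_vector_derivative d1 (f i) x) (at x within {0..})" if "i < N" "0 \<le> x" for i x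
      using assms(2)[OF that] a[OF that] by simp
    show "(d1 (f i) has_vector_derivative d1 (d1 (f i)) x) (at x within {0..})" if "i < N" "0 \<le> x" for i x
      using assms(3)[OF that] b[OF that] a[OF that(1)] has_vector_derivative_cong_atLeast[OF _ that(2)] by metis
    show "f i 0 = f j 0" if "i < N" "j < N" for i j using assms(1) that by blast
  qed (use c d in auto)
qed

definition comb :: "real \<Rightarrow> (nat \<Rightarrow> real \<Rightarrow> real) \<Rightarrow> real \<Rightarrow> (nat \<Rightarrow> real \<Rightarrow> real) \<Rightarrow> nat \<Rightarrow> real \<Rightarrow> real" where
  "comb \<alpha> f \<beta> g = (\<lambda>i x. \<alpha> * f i x + \<beta> * g i x)"

lemma C2D:
  assumes "f \<in> C2 N" "i < N"
  shows "\<And>x. x \<ge> 0 \<Longrightarrow> (f i has_vector_derivative d1 (f i) x) (at x within {0..})"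
    and "\<And>x. x \<ge> 0 \<Longrightarrow> (d1 (f i) has_vector_derivative d1 (d1 (f i)) x) (at x within {0..})"
    and "continuous_on {0..} (f i)"
    and "continuous_on {0..} (d1 (f i))"
    and "continuous_on {0..} (d1 (d1 (f i)))"
    and "\<And>j. j < N \<Longrightarrow> f i 0 = f j 0"
proof -
  show *: "(d1 (f i) has_vector_derivative d1 (d1 (f i)) x) (at x within {0..})" if "x \<ge> 0" for x
    using assms that unfolding C2_def by blast
  show "continuous_on {0..} (d1 (f i))"
    using * by (metis atLeast_iff continuous_on_eq_continuous_within has_vector_derivative_continuous)
qed (use assms in \<open>unfold C2_def, blast+\<close>)

lemma C2_comb:
  assumes "f \<in> C2 N" "g \<in> C2 N"
  shows "comb \<alpha> f \<beta> g \<in> C2 N"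
    and "\<And>i x. i < N \<Longrightarrow> x \<ge> 0 \<Longrightarrow> d1 (comb \<alpha> f \<beta> g i) x = \<alpha> * d1 (f i) x + \<beta> * d1 (g i) x"
    and "\<And>i x. i < N \<Longrightarrow> x \<ge> 0 \<Longrightarrow> d1 (d1 (comb \<alpha> f \<beta> g i)) x = \<alpha> * d1 (d1 (f i)) x + \<beta> * d1 (d1 (g i)) x"
proof -
  note f = C2D[OF assms(1)] and g = C2D[OF assms(2)]
  have 1: "comb \<alpha> f \<beta> g i 0 = comb \<alpha> f \<beta> g j 0" if "i < N" "j < N" for i j
    using f(6)[OF that] g(6)[OF that] by (simp add: comb_def)
  have 2: "(comb \<alpha> f \<beta> g i has_vector_derivative (\<lambda>i x. \<alpha> * d1 (f i) x + \<beta> * d1 (g i) x) i x) (at x within {0..})"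
    if "i < N" "x \<ge> 0" for i x
    unfolding comb_def using f(1)[OF that] g(1)[OF that]
    by (auto intro!: derivative_eq_intros simp: has_real_derivative_iff_has_vector_derivative[symmetric])
  have 3: "((\<lambda>i x. \<alpha> * d1 (f i) x + \<beta> * d1 (g i) x) i has_vector_derivative (\<lambda>i x. \<alpha> * d1 (d1 (f i)) x + \<beta> * d1 (d1 (g i)) x) i x) (at x within {0..})"
    if "i < N" "x \<ge> 0" for i x
    using f(2)[OF that] g(2)[OF that]
    by (auto intro!: derivative_eq_intros simp: has_real_derivative_iff_has_vector_derivative[symmetric])
  have 4: "continuous_on {0..} ((\<lambda>i x. \<alpha> * d1 (d1 (f i)) x + \<beta> * d1 (d1 (g i)) x) i)" if "i < N" for i
    using f(5)[OF that] g(5)[OF that] by (auto intro!: continuous_intros)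
  show "comb \<alpha> f \<beta> g \<in> C2 N"
    and "\<And>i x. i < N \<Longrightarrow> x \<ge> 0 \<Longrightarrow> d1 (comb \<alpha> f \<beta> g i) x = \<alpha> * d1 (f i) x + \<beta> * d1 (g i) x"
    and "\<And>i x. i < N \<Longrightarrow> x \<ge> 0 \<Longrightarrow> d1 (d1 (comb \<alpha> f \<beta> g i)) x = \<alpha> * d1 (d1 (f i)) x + \<beta> * d1 (d1 (g i)) x"
    using C2I[of N "comb \<alpha> f \<beta> g", OF 1 2 3 4] by auto
qed

lemma Lop_comb:
  assumes "f \<in> C2 N" "g \<in> C2 N" "i < N" "x \<ge> 0"
  shows "Lop \<sigma> b (comb \<alpha> f \<beta> g) i x = \<alpha> * Lop \<sigma> b f i x + \<beta> * Lop \<sigma> b g i x"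
  unfolding Lop_def C2_comb(2,3)[OF assms] by (simp add: algebra_simps)

lemma Lop_cong:
  assumes "\<And>y. y \<ge> 0 \<Longrightarrow> f i y = g i y" and "x \<ge> 0"
  shows "Lop \<sigma> b f i x = Lop \<sigma> b g i x"
  using d1_cong[of "f i" "g i"] d1_cong[of "d1 (f i)" "d1 (g i)"] assms by (simp add: Lop_def)

text \<open>Functions are total, but only edges below \<open>N\<close> and nonnegative arguments
  carry meaning. The function classes are invariant under this equality, which takes the place of
  literal equality in uniqueness statements.\<close>

definition feq :: "nat \<Rightarrow> (nat \<Rightarrow> real \<Rightarrow> real) \<Rightarrow> (nat \<Rightarrow> real \<Rightarrow> real) \<Rightarrow> bool" where
  "feq N f g \<longleftrightarrow> (\<forall>i<N. \<forall>x\<ge>0. f i x = g i x)"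

text \<open>Stands for a sup norm of at most \<open>K\<close>, taken over the arguments that
  matter.\<close>

definition bd :: "nat \<Rightarrow> (nat \<Rightarrow> real \<Rightarrow> real) \<Rightarrow> real \<Rightarrow> bool" where
  "bd N f K \<longleftrightarrow> (\<forall>i<N. \<forall>x\<ge>0. \<bar>f i x\<bar> \<le> K)"

lemma C0_cong: "feq N f g \<Longrightarrow> f \<in> C0 N \<Longrightarrow> g \<in> C0 N"
  unfolding C0_def feq_def mem_Collect_eq
proof (intro conjI allI impI; elim conjE)
  fix i assume *: "\<forall>i<N. \<forall>x\<ge>0. f i x = g i x" "i < N"
    "\<forall>i<N. continuous_on {0..} (f i) \<and> (f i \<longlongrightarrow> 0) at_top"
  show "continuous_on {0..} (g i)"
    using * continuous_on_cong[of "{0..}" "{0..}" "f i" "g i"] by simp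
  have "eventually (\<lambda>x. f i x = g i x) at_top"
    using eventually_ge_at_top[of 0] by eventually_elim (use * in auto)
  then show "(g i \<longlongrightarrow> 0) at_top"
    using * tendsto_cong by blast
qed (metis order_refl)

lemma C2_cong:
  assumes "feq N f g" "f \<in> C2 N"
  shows "g \<in> C2 N"
proof (rule C2I(1))
  note f = C2D[OF assms(2)]
  show "g i 0 = g j 0" if "i < N" "j < N" for i j
    using f(6)[OF that] that assms(1) unfolding feq_def by (metis order_refl)
  show "(g i has_vector_derivative (\<lambda>i. d1 (f i)) i x) (at x within {0..})" if "i < N" "x \<ge> 0" for i x
    using f(1)[OF that] has_vector_derivative_cong_atLeast[of "f i" "g i" x] assms(1) that unfolding feq_def by auto
  show "((\<lambda>i. d1 (f i)) i has_vector_derivative (\<lambda>i. d1 (d1 (f i))) i x) (at x within {0..})" if "i < N" "x \<ge> 0" for i x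
    using f(2) that by auto
  show "continuous_on {0..} ((\<lambda>i. d1 (d1 (f i))) i)" if "i < N" for i using f(5) that by auto
qed

lemma DL_cong:
  assumes "feq N f g" "f \<in> DL N \<sigma> b \<rho> \<eta>" "N \<ge> 1"
  shows "g \<in> DL N \<sigma> b \<rho> \<eta>"
proof -
  have "feq N (Lop \<sigma> b f) (Lop \<sigma> b g)"
    using assms(1) Lop_cong unfolding feq_def by blast
  moreover have "(\<Sum>i<N. \<rho> i * d1 (f i) 0) = (\<Sum>i<N. \<rho> i * d1 (g i) 0)"
    using assms(1) unfolding feq_def by (intro sum.cong refl arg_cong2[where f="(*)"] d1_cong) auto
  moreover have "Lop \<sigma> b f 0 0 = Lop \<sigma> b g 0 0"
    using calculation(1) assms(3) unfolding feq_def by simp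
  ultimately show ?thesis
    using assms(2) C2_cong[OF assms(1)] C0_cong[OF assms(1)] C0_cong[of N "Lop \<sigma> b f" "Lop \<sigma> b g"]
    unfolding DL_def by auto
qed

lemma C0_comb: "f \<in> C0 N \<Longrightarrow> g \<in> C0 N \<Longrightarrow> comb \<alpha> f \<beta> g \<in> C0 N"
  unfolding C0_def comb_def mem_Collect_eq
proof (intro conjI allI impI; elim conjE)
  fix i assume *: "i < N" "\<forall>i<N. continuous_on {0..} (f i) \<and> (f i \<longlongrightarrow> 0) at_top"
    "\<forall>i<N. continuous_on {0..} (g i) \<and> (g i \<longlongrightarrow> 0) at_top"
  show "continuous_on {0..} (\<lambda>x. \<alpha> * f i x + \<beta> * g i x)" using * by (auto intro!: continuous_intros)
  have "((\<lambda>x. \<alpha> * f i x + \<beta> * g i x) \<longlongrightarrow> \<alpha> * 0 + \<beta> * 0) at_top" using * by (intro tendsto_intros) auto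
  then show "((\<lambda>x. \<alpha> * f i x + \<beta> * g i x) \<longlongrightarrow> 0) at_top" by simp
qed metis

lemma DL_comb:
  assumes "f \<in> DL N \<sigma> b \<rho> \<eta>" "g \<in> DL N \<sigma> b \<rho> \<eta>" "N \<ge> 1"
  shows "comb \<alpha> f \<beta> g \<in> DL N \<sigma> b \<rho> \<eta>"
proof -
  have C2: "f \<in> C2 N" "g \<in> C2 N" using assms unfolding DL_def by auto
  have "feq N (comb \<alpha> (Lop \<sigma> b f) \<beta> (Lop \<sigma> b g)) (Lop \<sigma> b (comb \<alpha> f \<beta> g))"
    unfolding feq_def using Lop_comb[OF C2] by (simp add: comb_def)
  then have "Lop \<sigma> b (comb \<alpha> f \<beta> g) \<in> C0 N"
    using C0_cong C0_comb assms unfolding DL_def by blast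
  moreover have "(\<Sum>i<N. \<rho> i * d1 (comb \<alpha> f \<beta> g i) 0) = \<alpha> * (\<Sum>i<N. \<rho> i * d1 (f i) 0) + \<beta> * (\<Sum>i<N. \<rho> i * d1 (g i) 0)"
    unfolding sum_distrib_left sum.distrib[symmetric]
    by (intro sum.cong) (auto simp: C2_comb(2)[OF C2] algebra_simps)
  moreover have "Lop \<sigma> b (comb \<alpha> f \<beta> g) 0 0 = \<alpha> * Lop \<sigma> b f 0 0 + \<beta> * Lop \<sigma> b g 0 0"
    using assms(3) by (intro Lop_comb[OF C2]) auto
  ultimately show ?thesis
    using assms C2_comb(1)[OF C2] C0_comb[of f N g] unfolding DL_def by (auto simp: algebra_simps)
qed

lemma bounded_on_atLeast:
  fixes f :: "real \<Rightarrow> real"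
  assumes "continuous_on {0..} f" "(f \<longlongrightarrow> 0) at_top"
  shows "\<exists>K. \<forall>x\<ge>0. \<bar>f x\<bar> \<le> K"
proof -
  have "eventually (\<lambda>x. dist (f x) 0 < 1) at_top" using assms(2) tendstoD by fastforce
  then obtain a where a: "\<And>x. x \<ge> a \<Longrightarrow> \<bar>f x\<bar> < 1" unfolding eventually_at_top_linorder by auto
  have "compact (f ` {0..a})"
    by (intro compact_continuous_image continuous_on_subset[OF assms(1)]) auto
  then obtain K where K: "\<And>x. x \<in> {0..a} \<Longrightarrow> \<bar>f x\<bar> \<le> K"
    using compact_imp_bounded bounded_real by (metis image_eqI)
  have "\<bar>f x\<bar> \<le> max K 1" if "x \<ge> 0" for x
    using a[of x] K[of x] that by fastforce
  then show ?thesis by blast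
qed

lemma edge_bound:
  assumes "\<And>i. i < N \<Longrightarrow> \<exists>K. \<forall>x\<ge>0. \<bar>f i x\<bar> \<le> K"
  shows "\<exists>K\<ge>0. bd N f K"
proof -
  obtain K where K: "\<And>i x. i < N \<Longrightarrow> x \<ge> 0 \<Longrightarrow> \<bar>f i x\<bar> \<le> K i" using assms by metis
  have "\<bar>f i x\<bar> \<le> (\<Sum>j<N. \<bar>K j\<bar>)" if "i < N" "x \<ge> 0" for i x
    using K[OF that] member_le_sum[of i "{..<N}" "\<lambda>j. \<bar>K j\<bar>"] that by force
  then show ?thesis unfolding bd_def by (intro exI[of _ "\<Sum>j<N. \<bar>K j\<bar>"]) (auto intro: sum_nonneg)
qed

lemma C0_bounded: "f \<in> C0 N \<Longrightarrow> \<exists>K\<ge>0. bd N f K"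
  by (intro edge_bound bounded_on_atLeast) (auto simp: C0_def)

text \<open>Uniform limits keep continuity, the common value at the origin and the decay. Used for
  the Feller property of \<open>Y\<close>, whose semigroup is only reached through uniform
  approximation.\<close>

lemma C0_closed:
  assumes "\<And>e. e > 0 \<Longrightarrow> \<exists>g\<in>C0 N. \<forall>i<N. \<forall>x\<ge>0. \<bar>f i x - g i x\<bar> \<le> e"
  shows "f \<in> C0 N"
proof -
  obtain g where g: "\<And>n. g n \<in> C0 N" "\<And>n i x. i < N \<Longrightarrow> x \<ge> 0 \<Longrightarrow> \<bar>f i x - g n i x\<bar> \<le> 1 / Suc n"
  proof -
    have "\<forall>n. \<exists>g\<in>C0 N. \<forall>i<N. \<forall>x\<ge>0. \<bar>f i x - g i x\<bar> \<le> 1 / Suc n"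
      using assms by simp
    then show ?thesis using that by metis
  qed
  have u: "uniform_limit {0..} (\<lambda>n x. g n i x) (f i) sequentially" if "i < N" for i
    unfolding uniform_limit_iff
  proof (intro allI impI)
    fix e :: real assume "e > 0"
    then obtain m where m: "1 / Suc m < e" by (metis nat_approx_posE)
    show "\<forall>\<^sub>F n in sequentially. \<forall>x\<in>{0..}. dist (g n i x) (f i x) < e"
      using eventually_ge_at_top[of m]
    proof eventually_elim
      case (elim n)
      have "1 / Suc n \<le> 1 / Suc m" using elim by (simp add: frac_le)
      then have "1 / Suc n < e" using m by simp
      then show ?case using g(2)[OF that, of _ n] by (auto simp: dist_real_def abs_minus_commute intro: le_less_trans)
    qed
  qed
  have c: "continuous_on {0..} (f i)" if "i < N" for i
    using u[OF that] g(1) that by (intro uniform_limit_theorem[OF _ u[OF that]]) (auto simp: C0_def)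
  have l: "(f i \<longlongrightarrow> 0) at_top" if "i < N" for i
  proof (rule tendstoI)
    fix e :: real assume "e > 0"
    then obtain m where m: "1 / Suc m < e / 2" by (metis nat_approx_posE half_gt_zero)
    have "\<forall>\<^sub>F x in at_top. dist (g m i x) 0 < e / 2" using g(1)[of m] that \<open>e > 0\<close> unfolding C0_def
      by (intro tendstoD) auto
    then show "\<forall>\<^sub>F x in at_top. dist (f i x) 0 < e"
      using eventually_ge_at_top[of 0]
    proof eventually_elim
      case (elim x) then show ?case using g(2)[OF that, of x m] m by auto
    qed
  qed
  have "f i 0 = f j 0" if "i < N" "j < N" for i j
  proof (rule LIMSEQ_unique)
    have lim: "(\<lambda>n. g n k 0) \<longlonglongrightarrow> f k 0" if "k < N" for k
      using tendsto_uniform_limitI[OF u[OF that], of 0] by simp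
    show "(\<lambda>n. g n i 0) \<longlonglongrightarrow> f i 0" using lim that by auto
    have "g n i 0 = g n j 0" for n using g(1)[of n] that unfolding C0_def by blast
    then show "(\<lambda>n. g n i 0) \<longlonglongrightarrow> f j 0" using lim[of j] that by auto
  qed
  then show ?thesis using c l unfolding C0_def by blast
qed

section \<open>Points, paths and measurability\<close>

text \<open>The pair \<open>(i, 0)\<close> is a normal form only for \<open>i = 0\<close>, so edge
  coordinates must be normalized before they denote a point of \<open>Gam N\<close>.\<close>

definition pt :: "nat \<Rightarrow> real \<Rightarrow> point" where
  "pt i x = (if x = 0 then vtx else (i, x))"

lemma vtx_in_Gam: "N \<ge> 1 \<Longrightarrow> vtx \<in> Gam N"
  by (simp add: vtx_def Gam_def)

lemma pt_in_Gam: "i < N \<Longrightarrow> x \<ge> 0 \<Longrightarrow> pt i x \<in> Gam N"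
  by (auto simp: pt_def vtx_def Gam_def)

lemma gev_pt:
  assumes "\<And>i j. i < N \<Longrightarrow> j < N \<Longrightarrow> f i 0 = f j 0" "i < N"
  shows "gev f (pt i x) = f i x"
proof -
  have "f 0 0 = f i 0" using assms by (metis gr0I less_zeroE not_gr_zero le_less_trans zero_le)
  then show ?thesis by (simp add: gev_def pt_def vtx_def)
qed

lemma GamE:
  assumes "p \<in> Gam N"
  obtains "fst p < N" "snd p \<ge> 0" "p = pt (fst p) (snd p)"
  using assms that by (auto simp: Gam_def pt_def vtx_def)

lemma snd_eq_0_iff: "p \<in> Gam N \<Longrightarrow> snd p = 0 \<longleftrightarrow> p = vtx"
  by (auto simp: Gam_def vtx_def)

lemma gev_bd: "bd N f K \<Longrightarrow> p \<in> Gam N \<Longrightarrow> \<bar>gev f p\<bar> \<le> K"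
  unfolding bd_def gev_def by (auto elim!: GamE)

text \<open>A small ball around a point off the vertex stays on one edge, so continuity on that edge
  suffices. Around the vertex the ball meets every edge, and the common value at the origin is what
  makes the estimates fit together.\<close>

lemma continuous_on_gev_path:
  assumes "path_cont \<gamma>" "\<And>t. t \<ge> 0 \<Longrightarrow> \<gamma> t \<in> Gam N"
    and compat: "\<And>i j. i < N \<Longrightarrow> j < N \<Longrightarrow> f i 0 = f j 0"
    and cont: "\<And>i. i < N \<Longrightarrow> continuous_on {0..} (f i)"
  shows "continuous_on {0..} (\<lambda>t. gev f (\<gamma> t))"
  unfolding continuous_on_iff
proof (intro ballI allI impI)
  fix t e :: real assume t: "t \<in> {0..}" and e: "e > 0"
  define i x where "i = fst (\<gamma> t)" "x = snd (\<gamma> t)"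
  have ix: "i < N" "x \<ge> 0" "\<gamma> t = (i, x)" "x = 0 \<Longrightarrow> i = 0"
    using assms(2)[of t] t by (auto simp: Gam_def i_x_def)
  have "\<exists>d>0. \<forall>q\<in>Gam N. gdist q (\<gamma> t) < d \<longrightarrow> \<bar>gev f q - gev f (\<gamma> t)\<bar> < e"
  proof (cases "x = 0")
    case False
    then have x: "x > 0" using ix by simp
    obtain d where d: "d > 0" "\<And>y. y \<ge> 0 \<Longrightarrow> \<bar>y - x\<bar> < d \<Longrightarrow> \<bar>f i y - f i x\<bar> < e"
      using cont[OF ix(1)] ix(2) e unfolding continuous_on_iff dist_real_def by (metis atLeast_iff)
    have "\<bar>gev f q - gev f (\<gamma> t)\<bar> < e" if q: "q \<in> Gam N" "gdist q (\<gamma> t) < min d x" for q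
    proof -
      have "fst q = i"
        using q ix by (cases q) (auto simp: gdist_def Gam_def split: if_splits)
      then show ?thesis using q ix d(2)[of "snd q"]
        by (cases q) (auto simp: gdist_def Gam_def gev_def)
    qed
    then show ?thesis using d x by (intro exI[of _ "min d x"]) auto
  next
    case True
    have "\<forall>j<N. \<exists>d>0. \<forall>y\<ge>0. \<bar>y\<bar> < d \<longrightarrow> \<bar>f j y - f j 0\<bar> < e"
    proof (intro allI impI)
      fix j assume "j < N"
      from cont[OF this] e have "\<exists>d>0. \<forall>y\<in>{0..}. dist y 0 < d \<longrightarrow> dist (f j y) (f j 0) < e"
        unfolding continuous_on_iff by (metis atLeast_iff order_refl)
      then show "\<exists>d>0. \<forall>y\<ge>0. \<bar>y\<bar> < d \<longrightarrow> \<bar>f j y - f j 0\<bar> < e" by (auto simp: dist_real_def)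
    qed
    then obtain d where d: "\<And>j. j < N \<Longrightarrow> d j > 0" "\<And>j y. j < N \<Longrightarrow> y \<ge> 0 \<Longrightarrow> \<bar>y\<bar> < d j \<Longrightarrow> \<bar>f j y - f j 0\<bar> < e"
      by metis
    \<comment> \<open>One radius for all edges; the 1 keeps the minimum over a nonempty set.\<close>
    define D where "D = Min (insert 1 (d ` {..<N}))"
    have D: "D > 0" "\<And>j. j < N \<Longrightarrow> D \<le> d j" using d(1) by (auto simp: D_def)
    have "\<bar>gev f q - gev f (\<gamma> t)\<bar> < e" if q: "q \<in> Gam N" "gdist q (\<gamma> t) < D" for q
    proof -
      obtain j y where jy: "q = (j, y)" "j < N" "y \<ge> 0" using q(1) by (auto simp: Gam_def)
      have "y < D" using q(2) ix True jy by (auto simp: gdist_def split: if_splits)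
      then show ?thesis using d(2)[OF jy(2,3)] D(2)[OF jy(2)] jy True ix compat[OF jy(2) ix(1)]
        by (auto simp: gev_def)
    qed
    then show ?thesis using D by blast
  qed
  then obtain d where d: "d > 0" "\<And>q. q \<in> Gam N \<Longrightarrow> gdist q (\<gamma> t) < d \<Longrightarrow> \<bar>gev f q - gev f (\<gamma> t)\<bar> < e"
    by blast
  obtain d' where d': "d' > 0" "\<And>s. s \<ge> 0 \<Longrightarrow> \<bar>s - t\<bar> < d' \<Longrightarrow> gdist (\<gamma> s) (\<gamma> t) < d"
    using assms(1) t d(1) unfolding path_cont_def by (metis atLeast_iff)
  show "\<exists>d>0. \<forall>s\<in>{0..}. dist s t < d \<longrightarrow> dist (gev f (\<gamma> s)) (gev f (\<gamma> t)) < e"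
    using d' d assms(2) by (intro exI[of _ d']) (auto simp: dist_real_def)
qed

definition GM :: "nat \<Rightarrow> point measure" where
  "GM N = restrict_space Gmeas (Gam N)"

text \<open>Unlike the edge index, these functions are continuous on the graph, and together they
  determine the point. Measurability of maps into the graph is tested on them.\<close>

definition coord :: "nat \<Rightarrow> nat \<Rightarrow> real \<Rightarrow> real" where
  "coord i = (\<lambda>j x. if j = i then x else 0)"

lemma space_Gmeas[simp]: "space Gmeas = UNIV"
  by (simp add: Gmeas_def space_pair_measure)

lemma space_GM[simp]: "space (GM N) = Gam N"
  by (simp add: GM_def space_restrict_space)

lemma fst_Gmeas[measurable]: "fst \<in> measurable Gmeas (count_space UNIV)"
  and snd_Gmeas[measurable]: "snd \<in> borel_measurable Gmeas"
  unfolding Gmeas_def by auto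

lemma vtx_in_sets[measurable]: "{vtx} \<in> sets Gmeas"
proof -
  have "{vtx} = {p \<in> space Gmeas. fst p = 0 \<and> snd p = 0}" by (auto simp: vtx_def)
  also have "\<dots> \<in> sets Gmeas" by measurable
  finally show ?thesis .
qed

lemma measurable_GM_D:
  assumes "h \<in> measurable M (GM N)"
  shows "h \<in> measurable M Gmeas" "\<And>w. w \<in> space M \<Longrightarrow> h w \<in> Gam N"
  using assms unfolding GM_def by (auto simp: measurable_restrict_space2_iff)

lemma measurable_GM_I0:
  assumes "h \<in> measurable M Gmeas" "\<And>w. w \<in> space M \<Longrightarrow> h w \<in> Gam N"
  shows "h \<in> measurable M (GM N)"
  using assms unfolding GM_def by (intro measurable_restrict_space2) auto

text \<open>The distance to the vertex is the sum of the coordinates. A positive index is detected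
  by a positive coordinate; index 0, which also carries the vertex, is the complement of the
  countably many others.\<close>

lemma measurable_GM_I:
  assumes Gam: "\<And>w. w \<in> space M \<Longrightarrow> h w \<in> Gam N"
    and c: "\<And>i. i < N \<Longrightarrow> (\<lambda>w. gev (coord i) (h w)) \<in> borel_measurable M"
  shows "h \<in> measurable M (GM N)"
proof (rule measurable_GM_I0)
  have s: "snd (h w) = (\<Sum>i<N. gev (coord i) (h w))" if "w \<in> space M" for w
    using Gam[OF that] by (auto simp: gev_def coord_def Gam_def)
  have 1: "(\<lambda>w. snd (h w)) \<in> borel_measurable M"
    using c by (subst measurable_cong[OF s]) auto
  have pos: "{w \<in> space M. fst (h w) = i} \<in> sets M" if "i > 0" for i
  proof (cases "i < N")
    case True
    have "{w \<in> space M. fst (h w) = i} = {w \<in> space M. gev (coord i) (h w) > 0}"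
      using Gam that by (force simp: gev_def coord_def Gam_def)
    then show ?thesis using c[OF True] by simp
  next
    case False
    then have "{w \<in> space M. fst (h w) = i} = {}" using Gam by (force simp: Gam_def)
    then show ?thesis by (simp only: sets.empty_sets)
  qed
  have zero: "{w \<in> space M. fst (h w) = 0} = space M - (\<Union>i\<in>{0<..}. {w \<in> space M. fst (h w) = i})"
    by auto
  have "{w \<in> space M. fst (h w) = i} \<in> sets M" for i
    using pos by (cases "i = 0") (auto simp only: zero intro!: sets.Diff sets.countable_UN' countableI_type)
  then have 2: "(\<lambda>w. fst (h w)) \<in> measurable M (count_space UNIV)"
    by (auto simp: measurable_count_space_eq2_countable vimage_def Int_def conj_commute)
  have "(\<lambda>w. (fst (h w), snd (h w))) \<in> measurable M Gmeas"
    unfolding Gmeas_def using 1 2 by (rule measurable_Pair[rotated])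
  then show "h \<in> measurable M Gmeas" by simp
qed (use Gam in auto)

lemma gev_measurable:
  assumes "\<And>i. i < N \<Longrightarrow> continuous_on {0..} (f i)"
  shows "gev f \<in> borel_measurable (GM N)"
proof -
  have m: "(\<lambda>x. f i (max 0 x)) \<in> borel_measurable borel" if "i < N" for i
    by (intro borel_measurable_continuous_onI continuous_on_compose2[OF assms[OF that]] continuous_intros) auto
  have [measurable]: "fst \<in> measurable (GM N) (count_space UNIV)" "snd \<in> borel_measurable (GM N)"
    unfolding GM_def by (auto intro: measurable_restrict_space1)
  have "(\<lambda>p. \<Sum>i<N. if fst p = i then f i (max 0 (snd p)) else 0) \<in> borel_measurable (GM N)"
    using m by (intro borel_measurable_sum) (auto intro!: measurable_If measurable_compose[OF _ m])
  moreover have "gev f \<in> borel_measurable (GM N) \<longleftrightarrow>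
      (\<lambda>p. \<Sum>i<N. if fst p = i then f i (max 0 (snd p)) else 0) \<in> borel_measurable (GM N)"
    by (rule measurable_cong) (auto simp: gev_def Gam_def)
  ultimately show ?thesis by blast
qed

text \<open>The process is the limit of step processes frozen at grid times rounded down. Clamping
  the time to the interval means that only times up to \<open>t\<close> enter, so \<open>M\<close>
  may be the member at time \<open>t\<close> of a filtration: this is progressive
  measurability.\<close>

lemma joint_measurable_real:
  fixes \<Phi> :: "real \<Rightarrow> 'w \<Rightarrow> real"
  assumes "t \<ge> 0"
    and c: "\<And>w. w \<in> space M \<Longrightarrow> continuous_on {0..t} (\<lambda>s. \<Phi> s w)"
    and m: "\<And>s. s \<in> {0..t} \<Longrightarrow> \<Phi> s \<in> borel_measurable M"
  shows "(\<lambda>z. \<Phi> (max 0 (min (fst z) t)) (snd z)) \<in> borel_measurable (borel \<Otimes>\<^sub>M M)"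
proof (rule borel_measurable_LIMSEQ_real)
  define g :: "nat \<Rightarrow> real \<times> 'w \<Rightarrow> int" where "g n z = \<lfloor>real (Suc n) * max 0 (min (fst z) t)\<rfloor>" for n z
  have g[measurable]: "g n \<in> measurable (borel \<Otimes>\<^sub>M M) (count_space UNIV)" for n
    unfolding g_def by measurable
  define u where "u n z = \<Phi> (max 0 (min (of_int (g n z) / real (Suc n)) t)) (snd z)" for n z
  show "u n \<in> borel_measurable (borel \<Otimes>\<^sub>M M)" for n
    unfolding u_def
  proof (rule measurable_compose_countable[where g="g n" and f="\<lambda>k z. \<Phi> (max 0 (min (of_int k / real (Suc n)) t)) (snd z)"])
    fix k :: int
    show "(\<lambda>z. \<Phi> (max 0 (min (of_int k / real (Suc n)) t)) (snd z)) \<in> borel_measurable (borel \<Otimes>\<^sub>M M)"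
      using assms(1) by (intro measurable_compose[OF measurable_snd] m) auto
  qed simp
  fix z :: "real \<times> 'w" assume z: "z \<in> space (borel \<Otimes>\<^sub>M M)"
  define s where "s = max 0 (min (fst z) t)"
  have s: "s \<in> {0..t}" using assms(1) by (auto simp: s_def)
  have *: "max 0 (min (of_int (g n z) / real (Suc n)) t) = of_int (g n z) / real (Suc n)
     \<and> \<bar>of_int (g n z) / real (Suc n) - s\<bar> \<le> 1 / real (Suc n)" for n
  proof -
    have f: "of_int (g n z) \<le> real (Suc n) * s" "real (Suc n) * s < of_int (g n z) + 1"
      unfolding g_def s_def[symmetric] by linarith+
    have "g n z \<ge> 0" unfolding g_def s_def[symmetric] using s by simp
    moreover have le: "of_int (g n z) / real (Suc n) \<le> s" using f(1) by (simp add: divide_le_eq mult.commute)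
    moreover have "s < (of_int (g n z) + 1) / real (Suc n)" using f(2) by (simp add: less_divide_eq mult.commute)
    ultimately show ?thesis using s by (auto simp: add_divide_distrib)
  qed
  have lim: "(\<lambda>n. of_int (g n z) / real (Suc n)) \<longlonglongrightarrow> s"
  proof (rule LIM_zero_cancel, rule Lim_null_comparison)
    show "\<forall>\<^sub>F n in sequentially. norm (of_int (g n z) / real (Suc n) - s) \<le> 1 / real (Suc n)"
      using * by auto
    show "(\<lambda>n. 1 / real (Suc n)) \<longlonglongrightarrow> 0" by (rule LIMSEQ_Suc[OF lim_1_over_n])
  qed
  have "(\<lambda>n. \<Phi> (of_int (g n z) / real (Suc n)) (snd z)) \<longlonglongrightarrow> \<Phi> s (snd z)"
  proof (rule continuous_on_tendsto_compose[OF c lim s])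
    show "snd z \<in> space M" using z by (auto simp: space_pair_measure)
    have "of_int (g n z) / real (Suc n) \<in> {0..t}" for n
      using *[of n] assms(1) by (metis atLeastAtMost_iff max.bounded_iff max.cobounded1 min.cobounded2)
    then show "\<forall>\<^sub>F n in sequentially. of_int (g n z) / real (Suc n) \<in> {0..t}" by simp
  qed
  then show "(\<lambda>n. u n z) \<longlonglongrightarrow> \<Phi> (max 0 (min (fst z) t)) (snd z)"
    unfolding u_def s_def[symmetric] using * by simp
qed

lemma joint_measurable_GM:
  assumes "t \<ge> 0" and Gam: "\<And>w s. w \<in> space M \<Longrightarrow> s \<ge> 0 \<Longrightarrow> X s w \<in> Gam N"
    and p: "\<And>w. w \<in> space M \<Longrightarrow> path_cont (\<lambda>t. X t w)"
    and m: "\<And>s. s \<in> {0..t} \<Longrightarrow> X s \<in> measurable M Gmeas"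
  shows "(\<lambda>z. X (max 0 (min (fst z) t)) (snd z)) \<in> measurable (borel \<Otimes>\<^sub>M M) (GM N)"
proof (rule measurable_GM_I)
  show "X (max 0 (min (fst z) t)) (snd z) \<in> Gam N" if "z \<in> space (borel \<Otimes>\<^sub>M M)" for z
    using that by (intro Gam) (auto simp: space_pair_measure)
  fix i assume "i < N"
  have lt_const: "continuous_on {0..} (coord i j)" for j
    by (cases "j = i") (auto simp: coord_def[abs_def] intro!: continuous_intros)
  show "(\<lambda>z. gev (coord i) (X (max 0 (min (fst z) t)) (snd z))) \<in> borel_measurable (borel \<Otimes>\<^sub>M M)"
  proof (rule joint_measurable_real[OF assms(1)])
    show "continuous_on {0..t} (\<lambda>s. gev (coord i) (X s w))" if "w \<in> space M" for w
    proof (rule continuous_on_subset[of "{0..}"])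
      show "continuous_on {0..} (\<lambda>s. gev (coord i) (X s w))"
        by (rule continuous_on_gev_path[OF p[OF that] Gam[OF that]])
          (use lt_const in \<open>auto simp: coord_def\<close>)
    qed auto
    show "(\<lambda>w. gev (coord i) (X s w)) \<in> borel_measurable M" if "s \<in> {0..t}" for s
    proof (rule measurable_compose[OF _ gev_measurable[OF lt_const]])
      show "X s \<in> measurable M (GM N)"
        using that by (intro measurable_GM_I0 m Gam) auto
    qed
  qed
qed

section \<open>Optional stopping and integral identities\<close>

lemma abs_indicator_mult_le:
  fixes x :: real
  shows "\<bar>x\<bar> \<le> C \<Longrightarrow> \<bar>indicator A w * x\<bar> \<le> C"
  by (auto simp: indicator_def split: if_splits)

text \<open>No filtration appears. The martingale property is assumed in the integrated form
  \<open>eq\<close>, on the part of \<Lambda> where \<open>T\<close> lies strictly below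
  \<open>s\<close>. Approximating \<open>T\<close> from above by a grid consumes exactly this, and
  the caller is free to verify adaptedness only up to null sets.\<close>

lemma optional_stopping:
  fixes M :: "real \<Rightarrow> 'w \<Rightarrow> real"
  assumes "finite_measure Q" "q \<le> h"
    and meas: "\<And>s. s \<in> {q..h} \<Longrightarrow> M s \<in> borel_measurable Q"
    and bound: "\<And>s w. s \<in> {q..h} \<Longrightarrow> w \<in> space Q \<Longrightarrow> \<bar>M s w\<bar> \<le> C"
    and cont: "\<And>w. w \<in> space Q \<Longrightarrow> continuous_on {q..h} (\<lambda>s. M s w)"
    and T[measurable]: "T \<in> borel_measurable Q"
    and T_in: "\<And>w. w \<in> space Q \<Longrightarrow> T w \<in> {q..h}"
    and [measurable]: "\<Lambda> \<in> sets Q"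
    and eq: "\<And>s t. q \<le> s \<Longrightarrow> s \<le> t \<Longrightarrow> t \<le> h \<Longrightarrow>
       (\<integral>w. indicator (\<Lambda> \<inter> {w \<in> space Q. T w < s}) w * M t w \<partial>Q) =
       (\<integral>w. indicator (\<Lambda> \<inter> {w \<in> space Q. T w < s}) w * M h w \<partial>Q)"
  shows "(\<integral>w. indicator \<Lambda> w * M (T w) w \<partial>Q) = (\<integral>w. indicator \<Lambda> w * M h w \<partial>Q)"
proof (cases "q = h")
  case True
  then have "T w = h" if "w \<in> space Q" for w using T_in[OF that] by auto
  then show ?thesis by (intro Bochner_Integration.integral_cong) auto
next
  case False
  then have qh: "q < h" using assms(2) by simp
  interpret finite_measure Q by fact
  define d where "d n = (h - q) / real (Suc n)" for n
  define s where "s n k = q + real k * d n" for n k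
  have d: "d n > 0" for n using qh by (simp add: d_def)
  have s_last: "s n (Suc n) = h" for n by (simp add: s_def d_def)
  have s_mono: "s n k \<le> s n l" if "k \<le> l" for n k l
    using that d[of n] by (simp add: s_def mult_right_mono)
  have s_in: "s n k \<in> {q..h}" if "k \<le> Suc n" for n k
    using s_mono[of 0 k n] s_mono[OF that, of n] s_last[of n] by (simp add: s_def)
  define Z :: "nat \<Rightarrow> nat \<Rightarrow> 'w \<Rightarrow> real"
    where "Z n k w = indicator (\<Lambda> \<inter> {w \<in> space Q. T w < s n k}) w" for n k w
  \<comment> \<open>The increment of \<open>Z n\<close> from \<open>k\<close> to
    \<open>Suc k\<close> marks the grid cell that contains \<open>T\<close>. Subtracting
    \<open>M h\<close> gives every summand mean zero and leaves \<open>M h\<close> when no cell is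
    hit, that is for \<open>T = h\<close>.\<close>
  define R where "R n w = indicator \<Lambda> w * M h w + (\<Sum>k<Suc n. (Z n (Suc k) w - Z n k w) * (M (s n (Suc k)) w - M h w))" for n w
  \<comment> \<open>The case \<open>T = h\<close> is separate because no grid point lies strictly
    beyond \<open>h\<close>.\<close>
  define \<tau> where "\<tau> n w = (if T w = h then h else s n (Suc (nat \<lfloor>(T w - q) / d n\<rfloor>)))" for n w
  have Rtau: "R n w = indicator \<Lambda> w * M (\<tau> n w) w \<and> \<tau> n w \<in> {q..h} \<and> \<bar>\<tau> n w - T w\<bar> \<le> d n" if w: "w \<in> space Q" for n w
  proof -
    have Tw: "q \<le> T w" "T w \<le> h" using T_in[OF w] by auto
    show ?thesis
    proof (cases "T w = h")
      case True
      have "(Z n (Suc k) w - Z n k w) * (M (s n (Suc k)) w - M h w) = 0" if "k < Suc n" for k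
        using True s_in[of "Suc k" n] s_in[of k n] that by (auto simp: Z_def indicator_def)
      then have "(\<Sum>k<Suc n. (Z n (Suc k) w - Z n k w) * (M (s n (Suc k)) w - M h w)) = 0"
        by (intro sum.neutral) blast
      then have "R n w = indicator \<Lambda> w * M h w" unfolding R_def by (simp del: sum.lessThan_Suc)
      then show ?thesis using True qh d[of n] by (simp add: \<tau>_def)
    next
      case False
      then have Th: "T w < h" using Tw by simp
      define k where "k = nat \<lfloor>(T w - q) / d n\<rfloor>"
      have "0 \<le> (T w - q) / d n" using Tw d[of n] by simp
      then have k: "real k \<le> (T w - q) / d n" "(T w - q) / d n < real k + 1" unfolding k_def by linarith+
      then have k1: "s n k \<le> T w" "T w < s n (Suc k)" using d[of n]
        by (simp_all add: s_def field_simps)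
      have kn: "k < Suc n"
      proof (rule ccontr)
        assume "\<not> k < Suc n"
        then have "s n (Suc n) \<le> s n k" by (intro s_mono) simp
        then show False using k1(1) Th s_last[of n] by simp
      qed
      have Z: "Z n l w = indicator \<Lambda> w * (if k < l then 1 else 0)" for l
      proof (cases "k < l")
        case True
        then have "T w < s n l" using k1(2) s_mono[of "Suc k" l n] by simp
        then show ?thesis using True w by (auto simp: Z_def indicator_def)
      next
        case False
        then have "\<not> T w < s n l" using k1(1) s_mono[of l k n] by simp
        then show ?thesis using False w by (auto simp: Z_def indicator_def)
      qed
      have "(\<Sum>l<Suc n. (Z n (Suc l) w - Z n l w) * (M (s n (Suc l)) w - M h w)) =
          (\<Sum>l<Suc n. if l = k then indicator \<Lambda> w * (M (s n (Suc k)) w - M h w) else 0)"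
        by (intro sum.cong) (auto simp: Z)
      also have "\<dots> = indicator \<Lambda> w * (M (s n (Suc k)) w - M h w)" using kn by (subst sum.delta) auto
      finally have "R n w = indicator \<Lambda> w * M (s n (Suc k)) w" unfolding R_def by (simp add: algebra_simps)
      moreover have "\<tau> n w = s n (Suc k)" using False by (simp add: \<tau>_def k_def)
      moreover have "s n (Suc k) - s n k = d n" by (simp add: s_def algebra_simps)
      ultimately show ?thesis using k1 s_in[of "Suc k" n] kn by simp
    qed
  qed
  have [measurable]: "M h \<in> borel_measurable Q" "k < Suc n \<Longrightarrow> M (s n (Suc k)) \<in> borel_measurable Q" for n k
    using meas[of h] meas[OF s_in[of "Suc k" n]] assms(2) by auto
  have [measurable]: "Z n k \<in> borel_measurable Q" for n k unfolding Z_def by measurable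
  have [measurable]: "R n \<in> borel_measurable Q" for n unfolding R_def by measurable
  have lim: "(\<lambda>n. R n w) \<longlonglongrightarrow> indicator \<Lambda> w * M (T w) w" if w: "w \<in> space Q" for w
  proof -
    have d0: "d \<longlonglongrightarrow> 0"
      using LIMSEQ_Suc[OF lim_const_over_n[of "h - q"]] by (simp add: d_def[abs_def])
    have "(\<lambda>n. \<tau> n w) \<longlonglongrightarrow> T w"
    proof (rule LIM_zero_cancel, rule Lim_null_comparison[OF _ d0])
      show "\<forall>\<^sub>F n in sequentially. norm (\<tau> n w - T w) \<le> d n" using Rtau[OF w] by simp
    qed
    then have "(\<lambda>n. M (\<tau> n w) w) \<longlonglongrightarrow> M (T w) w"
      using Rtau[OF w] by (intro continuous_on_tendsto_compose[OF cont[OF w] _ T_in[OF w]]) auto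
    then show ?thesis using Rtau[OF w] by (simp add: tendsto_mult_left)
  qed
  have bR: "norm (R n w) \<le> C" if "w \<in> space Q" for n w
    using Rtau[OF that, of n] bound[of "\<tau> n w" w] that by (auto intro: abs_indicator_mult_le)
  have mT: "(\<lambda>w. indicator \<Lambda> w * M (T w) w) \<in> borel_measurable Q"
    by (rule borel_measurable_LIMSEQ_real[OF lim]) auto
  have "(\<lambda>n. \<integral>w. R n w \<partial>Q) \<longlonglongrightarrow> (\<integral>w. indicator \<Lambda> w * M (T w) w \<partial>Q)"
    by (rule integral_dominated_convergence[where w="\<lambda>_. C"]) (use mT lim bR in auto)
  moreover have "(\<integral>w. R n w \<partial>Q) = (\<integral>w. indicator \<Lambda> w * M h w \<partial>Q)" for n
  proof -
    have iZ: "integrable Q (\<lambda>w. Z n j w * M t w)" if "t \<in> {q..h}" for j t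
    proof (rule integrable_const_bound[where B=C])
      show "AE w in Q. norm (Z n j w * M t w) \<le> C"
        using bound[OF that] by (intro AE_I2) (simp add: Z_def abs_indicator_mult_le)
      show "(\<lambda>w. Z n j w * M t w) \<in> borel_measurable Q" using meas[OF that] by measurable
    qed
    have iL: "integrable Q (\<lambda>w. indicator \<Lambda> w * M h w)"
    proof (rule integrable_const_bound[where B=C])
      show "AE w in Q. norm (indicator \<Lambda> w * M h w) \<le> C"
        using bound[of h] assms(2) by (intro AE_I2) (simp add: abs_indicator_mult_le)
    qed measurable
    have hin: "h \<in> {q..h}" using assms(2) by simp
    have z: "(\<integral>w. Z n j w * M t w \<partial>Q) = (\<integral>w. Z n j w * M h w \<partial>Q)" if "s n j \<le> t" "t \<in> {q..h}" "j \<le> Suc n" for j t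
      unfolding Z_def using that s_in[OF that(3)] by (intro eq) auto
    have "(\<integral>w. R n w \<partial>Q) = (\<integral>w. indicator \<Lambda> w * M h w \<partial>Q) + (\<Sum>k<Suc n. \<integral>w. (Z n (Suc k) w - Z n k w) * (M (s n (Suc k)) w - M h w) \<partial>Q)"
      unfolding R_def
    proof (subst Bochner_Integration.integral_add)
      show "integrable Q (\<lambda>w. \<Sum>k<Suc n. (Z n (Suc k) w - Z n k w) * (M (s n (Suc k)) w - M h w))"
        using iZ[OF s_in] iZ[OF hin]
        by (intro Bochner_Integration.integrable_sum) (auto simp: left_diff_distrib right_diff_distrib simp del: sum.lessThan_Suc)
      show "(\<integral>w. indicator \<Lambda> w * M h w \<partial>Q) + (\<integral>w. (\<Sum>k<Suc n. (Z n (Suc k) w - Z n k w) * (M (s n (Suc k)) w - M h w)) \<partial>Q) =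
        (\<integral>w. indicator \<Lambda> w * M h w \<partial>Q) + (\<Sum>k<Suc n. \<integral>w. (Z n (Suc k) w - Z n k w) * (M (s n (Suc k)) w - M h w) \<partial>Q)"
        using iZ[OF s_in] iZ[OF hin]
        by (subst Bochner_Integration.integral_sum) (auto simp: left_diff_distrib right_diff_distrib simp del: sum.lessThan_Suc)
    qed (rule iL)
    also have "(\<Sum>k<Suc n. \<integral>w. (Z n (Suc k) w - Z n k w) * (M (s n (Suc k)) w - M h w) \<partial>Q) = 0"
    proof (intro sum.neutral ballI)
      fix k assume "k \<in> {..<Suc n}"
      then have k: "Suc k \<le> Suc n" "k \<le> Suc n" by auto
      note i = iZ[OF s_in[OF k(1)]] iZ[OF hin]
      have "(\<integral>w. (Z n (Suc k) w - Z n k w) * (M (s n (Suc k)) w - M h w) \<partial>Q) =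
         ((\<integral>w. Z n (Suc k) w * M (s n (Suc k)) w \<partial>Q) - (\<integral>w. Z n (Suc k) w * M h w \<partial>Q))
         - ((\<integral>w. Z n k w * M (s n (Suc k)) w \<partial>Q) - (\<integral>w. Z n k w * M h w \<partial>Q))"
        using i by (simp add: left_diff_distrib right_diff_distrib)
      also have "\<dots> = 0"
        using z[of "Suc k" "s n (Suc k)"] z[of k "s n (Suc k)"] s_in[OF k(1)] k s_mono[of k "Suc k" n] by simp
      finally show "(\<integral>w. (Z n (Suc k) w - Z n k w) * (M (s n (Suc k)) w - M h w) \<partial>Q) = 0" .
    qed
    finally show ?thesis by simp
  qed
  ultimately show ?thesis by (simp add: LIMSEQ_const_iff)
qed

text \<open>The square is a double integral over the plane. The diagonal is a null set and the two
  halves off it contribute equally, so it is twice the integral over pairs with the second time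
  later.\<close>

lemma square_integral:
  fixes H :: "real \<Rightarrow> real"
  assumes H: "integrable lborel H"
  shows "(\<integral>u. H u \<partial>lborel)\<^sup>2 = 2 * (\<integral>u. H u * (\<integral>v. indicator {u<..} v * H v \<partial>lborel) \<partial>lborel)"
proof -
  have [measurable]: "H \<in> borel_measurable borel" using H by auto
  have iI: "integrable lborel (\<lambda>v. indicator S v * H v)" if "S \<in> sets borel" for S :: "real set"
    using integrable_mult_indicator[of S lborel H] H that by simp
  have "integrable (lborel \<Otimes>\<^sub>M lborel) (\<lambda>z. H (fst z) * H (snd z))"
  proof (rule lborel_pair.Fubini_integrable)
    show "integrable lborel (\<lambda>x. \<integral>y. norm (H (fst (x, y)) * H (snd (x, y))) \<partial>lborel)"
      using H by (simp add: abs_mult)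
    show "AE x in lborel. integrable lborel (\<lambda>y. H (fst (x, y)) * H (snd (x, y)))"
      using H by simp
  qed measurable
  moreover have Sm: "{z. fst z < snd z} \<in> sets (borel \<Otimes>\<^sub>M borel :: (real \<times> real) measure)"
  proof -
    have "{z :: real \<times> real. fst z < snd z} = {z \<in> space (borel \<Otimes>\<^sub>M borel). fst z < snd z}"
      by (simp add: space_pair_measure)
    also have "\<dots> \<in> sets (borel \<Otimes>\<^sub>M borel)" by measurable
    finally show ?thesis .
  qed
  ultimately have p: "integrable (lborel \<Otimes>\<^sub>M lborel) (\<lambda>z. indicator {z. fst z < snd z} z * (H (fst z) * H (snd z)))"
    using Sm integrable_mult_indicator[of "{z. fst z < snd z}" "lborel \<Otimes>\<^sub>M lborel" "\<lambda>z. H (fst z) * H (snd z)"]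
    by (simp add: space_pair_measure)
  have ind: "(indicator {z. fst z < snd z} (u, v) :: real) = indicator {u<..} v" for u v :: real
    by (auto simp: indicator_def)
  have ind': "(indicator {u<..} v :: real) = indicator {..<v} u" for u v :: real
    by (auto simp: indicator_def)
  have "integrable (lborel \<Otimes>\<^sub>M lborel) (case_prod (\<lambda>u v. indicator {u<..} v * (H u * H v)))"
    using p by (rule back_subst[where P="integrable _"]) (auto simp: fun_eq_iff ind)
  from lborel_pair.Fubini_integral[OF this]
  have swap: "(\<integral>v. (\<integral>u. indicator {..<v} u * (H u * H v) \<partial>lborel) \<partial>lborel) =
      (\<integral>u. (\<integral>v. indicator {u<..} v * (H u * H v) \<partial>lborel) \<partial>lborel)"
    unfolding ind' .
  define U where "U u = (\<integral>v. indicator {u<..} v * H v \<partial>lborel)" for u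
  define D where "D u = (\<integral>v. indicator {..<u} v * H v \<partial>lborel)" for u
  have UD: "U u + D u = integral\<^sup>L lborel H" for u
  proof -
    have "U u + D u = (\<integral>v. indicator {u<..} v * H v + indicator {..<u} v * H v \<partial>lborel)"
      unfolding U_def D_def using iI by simp
    also have "\<dots> = integral\<^sup>L lborel H"
      using AE_lborel_singleton[of u]
      by (intro integral_cong_AE) (auto simp: indicator_def)
    finally show ?thesis .
  qed
  have sw: "(\<integral>u. H u * D u \<partial>lborel) = (\<integral>u. H u * U u \<partial>lborel)"
    using swap unfolding D_def U_def by (simp add: mult.left_commute mult.commute[of "indicator _ _"] mult.assoc)
  have bU: "integrable lborel (\<lambda>u. H u * U u)"
  proof -
    have "integrable lborel (\<lambda>u. \<integral>v. indicator {z. fst z < snd z} (u, v) * (H u * H v) \<partial>lborel)"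
      using lborel_pair.integrable_fst'[OF p] by simp
    then show ?thesis unfolding U_def by (simp add: ind mult.left_commute)
  qed
  have eqD: "H u * D u = H u * integral\<^sup>L lborel H - H u * U u" for u
    using UD[of u] by (simp add: right_diff_distrib[symmetric])
  have "(\<integral>u. H u * D u \<partial>lborel) = (integral\<^sup>L lborel H)\<^sup>2 - (\<integral>u. H u * U u \<partial>lborel)"
    unfolding eqD using H bU by (simp add: power2_eq_square)
  with sw show ?thesis by (simp add: U_def)
qed

text \<open>A semigroup only offers right difference quotients. Since they converge uniformly in the
  base point, the left quotient at \<open>x\<close> can be read as a right quotient at a nearby
  earlier point, and continuity of \<open>k\<close> moves the limit back to
  \<open>x\<close>.\<close>

lemma uniform_right_derivative_FTC:
  fixes m k :: "real \<Rightarrow> real" and c :: real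
  assumes cm: "continuous_on {c..} m" and ck: "continuous_on {c..} k"
    and r: "\<And>e. e > 0 \<Longrightarrow> \<exists>d>0. \<forall>s\<ge>c. \<forall>h. 0 < h \<and> h < d \<longrightarrow> \<bar>(m (s + h) - m s) / h - k s\<bar> \<le> e"
    and ab: "c \<le> a" "a \<le> b"
  shows "(k has_integral (m b - m a)) {a..b}"
proof (rule fundamental_theorem_of_calculus_interior[OF ab(2)])
  show "continuous_on {a..b} m" using cm by (rule continuous_on_subset) (use ab in auto)
  fix x assume x: "x \<in> {a<..<b}"
  then have x0: "x > c" using ab by simp
  have "((\<lambda>y. (m y - m x) / (y - x)) \<longlongrightarrow> k x) (at x)"
  proof (rule tendstoI)
    fix e :: real assume e: "e > 0"
    obtain d where d: "d > 0" "\<And>s h. s \<ge> c \<Longrightarrow> 0 < h \<Longrightarrow> h < d \<Longrightarrow> \<bar>(m (s + h) - m s) / h - k s\<bar> \<le> e / 3"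
      using r[of "e / 3"] e by auto
    obtain d' where d': "d' > 0" "\<And>y. y \<ge> c \<Longrightarrow> \<bar>y - x\<bar> < d' \<Longrightarrow> \<bar>k y - k x\<bar> < e / 3"
      using ck x0 e unfolding continuous_on_iff dist_real_def
      by (metis atLeast_iff divide_pos_pos less_eq_real_def zero_less_numeral)
    have "dist ((m y - m x) / (y - x)) (k x) < e" if y: "y \<noteq> x" "dist y x < min (x - c) (min d d')" for y
    proof (cases "y > x")
      case True
      then have "\<bar>(m (x + (y - x)) - m x) / (y - x) - k x\<bar> \<le> e / 3"
        using y x0 by (intro d(2)) (auto simp: dist_real_def)
      then show ?thesis using e by (simp add: dist_real_def)
    next
      case False
      have "\<bar>(m (y + (x - y)) - m y) / (x - y) - k y\<bar> \<le> e / 3"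
        using y x0 False by (intro d(2)) (auto simp: dist_real_def)
      moreover have "(m x - m y) / (x - y) = (m y - m x) / (y - x)"
        by (metis minus_diff_eq minus_divide_divide)
      moreover have "\<bar>k y - k x\<bar> < e / 3" using y x0 by (intro d'(2)) (auto simp: dist_real_def)
      ultimately have "\<bar>(m y - m x) / (y - x) - k y\<bar> \<le> e / 3 \<and> \<bar>k y - k x\<bar> < e / 3" by simp
      then show ?thesis unfolding dist_real_def using e by linarith
    qed
    then show "\<forall>\<^sub>F y in at x. dist ((m y - m x) / (y - x)) (k x) < e"
      unfolding eventually_at using x0 d(1) d'(1) by (intro exI[of _ "min (x - c) (min d d')"]) auto
  qed
  then show "(m has_vector_derivative k x) (at x)"
    by (simp add: has_field_derivative_iff has_real_derivative_iff_has_vector_derivative[symmetric])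
qed

lemma time_change_integral:
  fixes A \<tau> g :: "real \<Rightarrow> real"
  assumes [measurable]: "S \<in> sets borel" "g \<in> borel_measurable borel"
    and A: "\<And>t. t \<ge> 0 \<Longrightarrow> A t = measure lborel ({0..t} \<inter> S)"
    and \<tau>: "\<And>t. t \<ge> 0 \<Longrightarrow> \<tau> t \<ge> 0" "\<And>t. t \<ge> 0 \<Longrightarrow> A (\<tau> t) = t" "\<And>s. s \<ge> 0 \<Longrightarrow> \<tau> (A s) = s"
    and t: "t \<ge> 0"
  shows "(\<integral>r. indicator {0..t} r * g (\<tau> r) \<partial>lborel) = (\<integral>u. indicator ({0..\<tau> t} \<inter> S) u * g u \<partial>lborel)"
proof -
  have fin: "emeasure lborel ({0..u} \<inter> S) < \<infinity>" for u
    by (rule le_less_trans[OF emeasure_mono[of _ "{0..u}"]]) (auto simp: emeasure_lborel_Icc_eq)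
  have Amono: "A r \<le> A s" if "0 \<le> r" "r \<le> s" for r s
    using that fin by (simp add: A) (intro measure_mono_fmeasurable, auto simp: fmeasurable_def)
  have A0: "A s \<ge> 0" if "s \<ge> 0" for s using that by (simp add: A)
  have Aless: "A r < A s" if "0 \<le> r" "r < s" for r s
    using Amono[of r s] that \<tau>(3)[of r] \<tau>(3)[of s] by (metis less_eq_real_def less_irrefl order_trans)
  have Ale_iff: "A r \<le> A s \<longleftrightarrow> r \<le> s" if "0 \<le> r" "0 \<le> s" for r s
    using Amono[of r s] Aless[of s r] that by (meson leD not_le)
  \<comment> \<open>Extended to negative arguments by the value at 0, both maps are monotone on the
    whole line and hence Borel.\<close>
  define A' where "A' u = A (max 0 u)" for u
  define \<tau>' where "\<tau>' r = \<tau> (max 0 r)" for r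
  have "mono A'" unfolding A'_def by (intro monoI Amono) auto
  then have [measurable]: "A' \<in> borel_measurable borel" by (rule borel_measurable_mono)
  have "mono \<tau>'"
  proof (rule monoI)
    fix r s :: real assume "r \<le> s"
    then show "\<tau>' r \<le> \<tau>' s" unfolding \<tau>'_def using Ale_iff[of "\<tau> (max 0 r)" "\<tau> (max 0 s)"] \<tau>(1,2)
      by (metis max.cobounded1 max.mono order_refl)
  qed
  then have [measurable]: "\<tau>' \<in> borel_measurable borel" by (rule borel_measurable_mono)
  define M1 where "M1 = distr (density lborel (indicator ({0..\<tau> t} \<inter> S))) borel A'"
  define M2 where "M2 = density lborel (indicator {0..t} :: real \<Rightarrow> ennreal)"
  have e1: "emeasure M1 {x<..} = emeasure lborel ({0..\<tau> t} \<inter> S \<inter> {u. x < A' u})" for x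
  proof -
    have "A' -` {x<..} = {u. x < A' u}" by auto
    then have "emeasure M1 {x<..} = emeasure (density lborel (indicator ({0..\<tau> t} \<inter> S))) {u. x < A' u}"
      unfolding M1_def by (subst emeasure_distr) auto
    also have "\<dots> = emeasure lborel ({0..\<tau> t} \<inter> S \<inter> {u. x < A' u})"
      using measurable_sets[of A' borel borel "{x<..}"] \<open>A' -` {x<..} = {u. x < A' u}\<close>
      by (intro emeasure_restricted) auto
    finally show ?thesis .
  qed
  have e2: "emeasure M2 {x<..} = emeasure lborel ({0..t} \<inter> {x<..})" for x
    unfolding M2_def by (intro emeasure_restricted) auto
  have m_eq: "emeasure lborel ({0..u} \<inter> S) = ennreal (A u)" if "u \<ge> 0" for u
    using fin[of u] A[OF that] by (simp add: emeasure_eq_ennreal_measure)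
  have "M1 = M2"
  proof (rule measure_eqI_lessThan)
    show "sets M1 = sets borel" "sets M2 = sets borel" by (auto simp: M1_def M2_def)
    show "emeasure M1 {x<..} < \<infinity>" for x
      unfolding e1 using emeasure_mono[of "{0..\<tau> t} \<inter> S \<inter> {u. x < A' u}" "{0..\<tau> t} \<inter> S" lborel] fin[of "\<tau> t"]
      by (auto intro: le_less_trans)
    show "emeasure M1 {x<..} = emeasure M2 {x<..}" for x
    proof (cases "x < 0")
      case True
      then have "{0..\<tau> t} \<inter> S \<inter> {u. x < A' u} = {0..\<tau> t} \<inter> S" "{0..t} \<inter> {x<..} = {0..t}"
        using A0 by (auto simp: A'_def intro: less_le_trans)
      then show ?thesis unfolding e1 e2 using m_eq[OF \<tau>(1)[OF t]] \<tau>(2)[OF t] t by simp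
    next
      case False
      show ?thesis
      proof (cases "x < t")
        case True
        have x: "0 \<le> x" "x < t" using True False by auto
        have tx: "\<tau> x \<le> \<tau> t" using Ale_iff[of "\<tau> x" "\<tau> t"] \<tau> x t by simp
        have "x < A' u \<longleftrightarrow> \<tau> x < u" for u
        proof -
          have "x < A' u \<longleftrightarrow> \<not> A (max 0 u) \<le> A (\<tau> x)" using \<tau>(2)[OF x(1)] by (auto simp: A'_def)
          also have "\<dots> \<longleftrightarrow> \<not> max 0 u \<le> \<tau> x" using Ale_iff[of "max 0 u" "\<tau> x"] \<tau>(1)[OF x(1)] by simp
          finally show ?thesis using \<tau>(1)[OF x(1)] by auto
        qed
        then have sx: "{u. x < A' u} = {\<tau> x<..}" by blast
        have tx0: "0 \<le> \<tau> x" using \<tau>(1)[OF x(1)] .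
        have s: "{0..\<tau> t} \<inter> S \<inter> {u. x < A' u} = ({0..\<tau> t} \<inter> S) - ({0..\<tau> x} \<inter> S)"
          unfolding sx using tx0 by (auto simp only: Int_iff Diff_iff atLeastAtMost_iff greaterThan_iff not_le) 
        have "emeasure lborel (({0..\<tau> t} \<inter> S) - ({0..\<tau> x} \<inter> S)) = ennreal (A (\<tau> t)) - ennreal (A (\<tau> x))"
          unfolding m_eq[OF \<tau>(1)[OF t], symmetric] m_eq[OF tx0, symmetric]
        proof (rule emeasure_Diff)
          show "{0..\<tau> x} \<inter> S \<subseteq> {0..\<tau> t} \<inter> S" using tx by force
        qed (use fin[of "\<tau> x"] in auto)
        also have "\<dots> = ennreal (t - x)" unfolding \<tau>(2)[OF t] \<tau>(2)[OF x(1)] using x by (simp add: ennreal_minus)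
        finally have "emeasure M1 {x<..} = ennreal (t - x)" unfolding e1 s .
        moreover have "{0..t} \<inter> {x<..} = {x<..t}" using x by auto
        ultimately show ?thesis unfolding e2 using x by simp
      next
        case False
        then have "\<not> x < A' u" if "u \<in> {0..\<tau> t}" for u
          using that Ale_iff[of u "\<tau> t"] \<tau>(1,2)[OF t] by (simp add: A'_def max_def)
        then have "{0..\<tau> t} \<inter> S \<inter> {u. x < A' u} = {}" by auto
        moreover have "{0..t} \<inter> {x<..} = {}" using False by auto
        ultimately show ?thesis unfolding e1 e2 by simp
      qed
    qed
  qed
  have "(\<integral>r. indicator {0..t} r * g (\<tau> r) \<partial>lborel) = (\<integral>r. indicator {0..t} r * g (\<tau>' r) \<partial>lborel)"
    by (intro Bochner_Integration.integral_cong) (auto simp: \<tau>'_def indicator_def)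
  also have "\<dots> = (\<integral>r. g (\<tau>' r) \<partial>M2)"
    unfolding M2_def
    using integral_density[of "\<lambda>r. g (\<tau>' r)" lborel "indicator {0..t}"] by (simp add: ennreal_indicator)
  also have "\<dots> = (\<integral>r. g (\<tau>' r) \<partial>M1)" using \<open>M1 = M2\<close> by simp
  also have "\<dots> = (\<integral>u. g (\<tau>' (A' u)) \<partial>density lborel (indicator ({0..\<tau> t} \<inter> S)))"
    unfolding M1_def by (rule integral_distr) measurable
  also have "\<dots> = (\<integral>u. indicator ({0..\<tau> t} \<inter> S) u * g (\<tau>' (A' u)) \<partial>lborel)"
    using integral_density[of "\<lambda>u. g (\<tau>' (A' u))" lborel "indicator ({0..\<tau> t} \<inter> S)"] by (simp add: ennreal_indicator)
  also have "\<dots> = (\<integral>u. indicator ({0..\<tau> t} \<inter> S) u * g u \<partial>lborel)"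
    using A0 by (intro Bochner_Integration.integral_cong) (auto simp: \<tau>'_def A'_def indicator_def \<tau>(3))
  finally show ?thesis .
qed

lemma bounded_Fubini:
  fixes \<phi> :: "real \<times> 'w \<Rightarrow> real"
  assumes "finite_measure Q" and [measurable]: "\<phi> \<in> borel_measurable (borel \<Otimes>\<^sub>M Q)"
    and b: "\<And>u w. w \<in> space Q \<Longrightarrow> \<bar>\<phi> (u, w)\<bar> \<le> C"
  shows "(\<integral>w. (\<integral>u. indicator {s..t} u * \<phi> (u, w) \<partial>lborel) \<partial>Q) = (\<integral>u. indicator {s..t} u * (\<integral>w. \<phi> (u, w) \<partial>Q) \<partial>lborel)"
    and "(\<lambda>w. \<integral>u. indicator {s..t} u * \<phi> (u, w) \<partial>lborel) \<in> borel_measurable Q"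
    and "integrable Q (\<lambda>w. \<integral>u. indicator {s..t} u * \<phi> (u, w) \<partial>lborel)"
    and "integrable lborel (\<lambda>u. indicator {s..t} u * (\<integral>w. \<phi> (u, w) \<partial>Q))"
proof -
  interpret finite_measure Q by fact
  obtain r where r: "emeasure Q (space Q) = ennreal r" using emeasure_real by blast
  have sf: "sigma_finite_measure Q" by unfold_locales
  interpret pair_sigma_finite lborel Q ..
  have i: "integrable (lborel \<Otimes>\<^sub>M Q) (\<lambda>(u, w). indicator {s..t} u * \<phi> (u, w))"
  proof (rule integrableI_bounded_set[where A="{s..t} \<times> space Q" and B=C])
    show "emeasure (lborel \<Otimes>\<^sub>M Q) ({s..t} \<times> space Q) < \<infinity>"
      using r by (subst sigma_finite_measure.emeasure_pair_measure_Times[OF sf])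
          (auto simp: emeasure_lborel_Icc_eq ennreal_mult_less_top)
    show "AE x in lborel \<Otimes>\<^sub>M Q. x \<in> {s..t} \<times> space Q \<longrightarrow> norm (case x of (u, w) \<Rightarrow> indicator {s..t} u * \<phi> (u, w)) \<le> C"
      using b by (intro AE_I2) (auto simp: space_pair_measure abs_indicator_mult_le)
    show "AE x in lborel \<Otimes>\<^sub>M Q. x \<notin> {s..t} \<times> space Q \<longrightarrow> (case x of (u, w) \<Rightarrow> indicator {s..t} u * \<phi> (u, w)) = 0"
      by (intro AE_I2) (auto simp: indicator_def space_pair_measure)
  qed measurable
  from Fubini_integral[OF i]
  show "(\<integral>w. (\<integral>u. indicator {s..t} u * \<phi> (u, w) \<partial>lborel) \<partial>Q) = (\<integral>u. indicator {s..t} u * (\<integral>w. \<phi> (u, w) \<partial>Q) \<partial>lborel)"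
    by simp
  show "integrable Q (\<lambda>w. \<integral>u. indicator {s..t} u * \<phi> (u, w) \<partial>lborel)" using integrable_snd[OF i] by simp
  then show "(\<lambda>w. \<integral>u. indicator {s..t} u * \<phi> (u, w) \<partial>lborel) \<in> borel_measurable Q" by auto
  show "integrable lborel (\<lambda>u. indicator {s..t} u * (\<integral>w. \<phi> (u, w) \<partial>Q))" using integrable_fst[OF i] by simp
qed

lemma integral_abs_le:
  fixes f g :: "'a \<Rightarrow> real"
  assumes "integrable M f" "integrable M g" "\<And>x. x \<in> space M \<Longrightarrow> \<bar>f x\<bar> \<le> g x"
  shows "\<bar>integral\<^sup>L M f\<bar> \<le> integral\<^sup>L M g"
proof -
  have "\<bar>integral\<^sup>L M f\<bar> \<le> (\<integral>x. \<bar>f x\<bar> \<partial>M)" using integral_norm_bound[of M f] by simp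
  also have "\<dots> \<le> integral\<^sup>L M g" using assms by (intro integral_mono) auto
  finally show ?thesis .
qed

text \<open>A function that is not integrable has integral 0 by convention, which satisfies the
  bound as well. So no measurability has to be checked when this is applied.\<close>

lemma (in prob_space) abs_expectation_le:
  fixes f :: "'a \<Rightarrow> real"
  assumes "\<And>w. w \<in> space M \<Longrightarrow> \<bar>f w\<bar> \<le> e"
  shows "\<bar>expectation f\<bar> \<le> e"
proof (cases "integrable M f")
  case True
  then show ?thesis using integral_abs_le[OF True, of "\<lambda>_. e"] assms by (simp add: prob_space)
next
  case False
  have "e \<ge> 0" using assms not_empty by (metis abs_ge_zero ex_in_conv order_trans)
  then show ?thesis using not_integrable_integral_eq[OF False] by simp
qed

section \<open>Additive functionals and martingales of the sticky process\<close>

text \<open>The path properties shared by \<open>X\<close> and the time-changed process, so that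
  facts about occupation integrals are proved once for both.\<close>

definition cprocess :: "nat \<Rightarrow> (point \<Rightarrow> 'w measure) \<Rightarrow> (real \<Rightarrow> 'w \<Rightarrow> point) \<Rightarrow> bool" where
  "cprocess N P Z \<longleftrightarrow>
     (\<forall>t\<ge>0. \<forall>w\<in>space (P vtx). Z t w \<in> Gam N) \<and>
     (\<forall>w\<in>space (P vtx). path_cont (\<lambda>t. Z t w)) \<and>
     (\<forall>t\<ge>0. Z t \<in> measurable (P vtx) Gmeas)"

lemma space_natfilt[simp]: "space (natfilt P Z t) = space (P vtx)"
  unfolding natfilt_def by (rule space_measure_of) auto

lemma sets_natfilt:
  "sets (natfilt P Z t) = sigma_sets (space (P vtx))
     {Z s -` A \<inter> space (P vtx) | s A. 0 \<le> s \<and> s \<le> t \<and> A \<in> sets Gmeas}"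
  unfolding natfilt_def by (rule sets_measure_of) auto

lemma natfilt_mono: "s \<le> t \<Longrightarrow> sets (natfilt P Z s) \<subseteq> sets (natfilt P Z t)"
  unfolding sets_natfilt by (rule sigma_sets_mono') (auto intro: order_trans)

lemma measurable_natfilt:
  assumes "0 \<le> s" "s \<le> t"
  shows "Z s \<in> measurable (natfilt P Z t) Gmeas"
proof (rule measurableI)
  fix A assume "A \<in> sets Gmeas"
  then show "Z s -` A \<inter> space (natfilt P Z t) \<in> sets (natfilt P Z t)"
    unfolding sets_natfilt space_natfilt using assms by (intro sigma_sets.Basic) auto
qed simp

lemma natfilt_sub:
  assumes "cprocess N P Z"
  shows "sets (natfilt P Z t) \<subseteq> sets (P vtx)"
  unfolding sets_natfilt
proof (rule sets.sigma_sets_subset)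
  show "{Z s -` A \<inter> space (P vtx) | s A. 0 \<le> s \<and> s \<le> t \<and> A \<in> sets Gmeas} \<subseteq> sets (P vtx)"
    using assms unfolding cprocess_def by (auto intro: measurable_sets)
qed

text \<open>A \<sigma>-algebra made by \<open>sigma\<close> carries the zero measure. Finiteness is
  what admits Fubini, whose measurability part then holds relative to the filtration.\<close>

lemma finite_measure_natfilt: "finite_measure (natfilt P Z t)"
  by (rule finite_measureI) (simp add: natfilt_def emeasure_sigma)

definition occ :: "(real \<Rightarrow> 'w \<Rightarrow> point) \<Rightarrow> (point \<Rightarrow> real) \<Rightarrow> real \<Rightarrow> real \<Rightarrow> 'w \<Rightarrow> real" where
  "occ Z G s t w = (\<integral>u. indicator {s..t} u * G (Z u w) \<partial>lborel)"

lemma cprocess_GM: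
  assumes "cprocess N P Z" "0 \<le> s" "s \<le> t"
  shows "Z s \<in> measurable (natfilt P Z t) (GM N)"
  using assms by (intro measurable_GM_I0 measurable_natfilt) (auto simp: cprocess_def)

lemma joint_measurable_natfilt:
  assumes "cprocess N P Z" "0 \<le> t" "G \<in> borel_measurable (GM N)"
  shows "(\<lambda>z. G (Z (max 0 (min (fst z) t)) (snd z))) \<in> borel_measurable (borel \<Otimes>\<^sub>M natfilt P Z t)"
proof (rule measurable_compose[OF joint_measurable_GM assms(3)])
  show "Z s \<in> measurable (natfilt P Z t) Gmeas" if "s \<in> {0..t}" for s
    using that by (intro measurable_natfilt) auto
qed (use assms in \<open>auto simp: cprocess_def\<close>)

lemma path_measurable:
  assumes "cprocess N P Z" "0 \<le> t" "G \<in> borel_measurable (GM N)" "w \<in> space (P vtx)"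
  shows "(\<lambda>u. G (Z (max 0 (min u t)) w)) \<in> borel_measurable borel"
proof -
  have "(\<lambda>u. (u, w)) \<in> measurable borel (borel \<Otimes>\<^sub>M natfilt P Z t)"
    using assms(4) by (intro measurable_Pair2') simp
  from measurable_compose[OF this joint_measurable_natfilt[OF assms(1-3)]] show ?thesis by simp
qed

text \<open>The clamp is invisible under the indicator, but it makes the integrand meaningful and
  jointly measurable for all real times.\<close>

lemma occ_eq_clamped:
  assumes "0 \<le> s"
  shows "occ Z G s t w = (\<integral>u. indicator {s..t} u * G (Z (max 0 (min u t)) w) \<partial>lborel)"
  unfolding occ_def using assms
  by (intro Bochner_Integration.integral_cong refl) (auto simp: indicator_def max_def min_def)

lemma occ_integrable:
  fixes G :: "point \<Rightarrow> real"
  assumes Z: "cprocess N P Z" and G: "G \<in> borel_measurable (GM N)" and w: "w \<in> space (P vtx)"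
    and b: "\<And>p. p \<in> Gam N \<Longrightarrow> \<bar>G p\<bar> \<le> C" and s: "0 \<le> s"
  shows "integrable lborel (\<lambda>u. indicator {s..t} u * G (Z u w))"
proof (cases "s \<le> t")
  case True
  have "integrable lborel (\<lambda>u. indicator {s..t} u *\<^sub>R G (Z (max 0 (min u t)) w))"
  proof (rule integrableI_bounded_set_indicator[where B=C])
    show "(\<lambda>u. G (Z (max 0 (min u t)) w)) \<in> borel_measurable lborel"
      using path_measurable[OF Z _ G w, of t] s True by simp
    show "AE u in lborel. u \<in> {s..t} \<longrightarrow> norm (G (Z (max 0 (min u t)) w)) \<le> C"
      using Z w s by (intro AE_I2 impI) (auto intro!: b simp: cprocess_def)
  qed (auto simp: emeasure_lborel_Icc_eq)
  then show ?thesis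
    by (rule Bochner_Integration.integrable_cong[THEN iffD1, rotated 2])
      (use s in \<open>auto simp: indicator_def max_def min_def\<close>)
qed simp

lemma occ_measurable:
  assumes Z: "cprocess N P Z" and G: "G \<in> borel_measurable (GM N)"
    and b: "\<And>p. p \<in> Gam N \<Longrightarrow> \<bar>G p\<bar> \<le> C" and s: "0 \<le> s" "s \<le> t"
  shows "occ Z G s t \<in> borel_measurable (natfilt P Z t)"
proof -
  have "(\<lambda>w. \<integral>u. indicator {s..t} u * (\<lambda>z. G (Z (max 0 (min (fst z) t)) (snd z))) (u, w) \<partial>lborel) \<in> borel_measurable (natfilt P Z t)"
    using s Z by (intro bounded_Fubini(2)[OF finite_measure_natfilt joint_measurable_natfilt[OF Z _ G], where C=C])
      (auto intro!: b simp: cprocess_def)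
  then show ?thesis using occ_eq_clamped[OF s(1), of Z G t] by (simp add: fun_eq_iff[symmetric] cong: measurable_cong)
qed

lemma occ_bound:
  assumes Z: "cprocess N P Z" and G: "G \<in> borel_measurable (GM N)" and w: "w \<in> space (P vtx)"
    and b: "\<And>p. p \<in> Gam N \<Longrightarrow> \<bar>G p\<bar> \<le> C" and s: "0 \<le> s" "s \<le> t"
  shows "\<bar>occ Z G s t w\<bar> \<le> C * (t - s)"
proof -
  have "\<bar>occ Z G s t w\<bar> \<le> (\<integral>u. \<bar>indicator {s..t} u * G (Z u w)\<bar> \<partial>lborel)"
    unfolding occ_def using integral_norm_bound[of lborel "\<lambda>u. indicator {s..t} u * G (Z u w)"] by simp
  also have "\<dots> \<le> (\<integral>u. C * indicator {s..t} u \<partial>lborel)"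
  proof (rule integral_mono)
    show "integrable lborel (\<lambda>u. \<bar>indicator {s..t} u * G (Z u w)\<bar>)"
      using occ_integrable[OF Z G w b s(1)] by auto
    show "\<bar>indicator {s..t} u * G (Z u w)\<bar> \<le> C * indicator {s..t} u" if "u \<in> space lborel" for u
      using b[of "Z u w"] Z w s(1) by (auto simp: indicator_def cprocess_def)
  qed (use s in auto)
  also have "\<dots> = C * (t - s)" using s by simp
  finally show ?thesis .
qed

lemma occ_add:
  assumes Z: "cprocess N P Z" and G: "G \<in> borel_measurable (GM N)" and w: "w \<in> space (P vtx)"
    and b: "\<And>p. p \<in> Gam N \<Longrightarrow> \<bar>G p\<bar> \<le> C" and s: "0 \<le> s" "s \<le> t" "t \<le> r"
  shows "occ Z G s r w = occ Z G s t w + occ Z G t r w"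
proof -
  have "occ Z G s t w + occ Z G t r w = (\<integral>u. indicator {s..t} u * G (Z u w) + indicator {t..r} u * G (Z u w) \<partial>lborel)"
    unfolding occ_def using occ_integrable[OF Z G w b, of s t] occ_integrable[OF Z G w b, of t r] s by simp
  also have "\<dots> = (\<integral>u. indicator {s..r} u * G (Z u w) \<partial>lborel)"
  proof (rule integral_cong_AE)
    show "AE u in lborel. indicator {s..t} u * G (Z u w) + indicator {t..r} u * G (Z u w) = indicator {s..r} u * G (Z u w)"
      by (rule AE_mp[OF AE_lborel_singleton[of t]], rule AE_I2) (use s in \<open>auto simp: indicator_def\<close>)
    show "(\<lambda>u. indicator {s..t} u * G (Z u w) + indicator {t..r} u * G (Z u w)) \<in> borel_measurable lborel"
      using occ_integrable[OF Z G w b, of s t] occ_integrable[OF Z G w b, of t r] s by (intro borel_measurable_add) auto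
    show "(\<lambda>u. indicator {s..r} u * G (Z u w)) \<in> borel_measurable lborel"
      using occ_integrable[OF Z G w b s(1)] by auto
  qed
  finally show ?thesis by (simp add: occ_def)
qed

lemma occ_continuous:
  assumes Z: "cprocess N P Z" and G: "G \<in> borel_measurable (GM N)" and w: "w \<in> space (P vtx)"
    and b: "\<And>p. p \<in> Gam N \<Longrightarrow> \<bar>G p\<bar> \<le> C" and s: "0 \<le> s"
  shows "continuous_on {s..} (\<lambda>t. occ Z G s t w)"
proof -
  have C0: "C \<ge> 0" using b[of "Z 0 w"] Z w by (force simp: cprocess_def)
  have l: "\<bar>occ Z G s t w - occ Z G s r w\<bar> \<le> C * \<bar>t - r\<bar>" if "s \<le> r" "r \<le> t" for r t
    using occ_add[OF Z G w b s that] occ_bound[OF Z G w b _ that(2)] s that by auto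
  have "C-lipschitz_on {s..} (\<lambda>t. occ Z G s t w)"
  proof (rule lipschitz_onI[OF _ C0])
    fix x y assume "x \<in> {s..}" "y \<in> {s..}"
    then show "dist (occ Z G s x w) (occ Z G s y w) \<le> C * dist x y"
      using l[of x y] l[of y x] by (cases "x \<le> y") (auto simp: dist_real_def abs_minus_commute)
  qed
  then show ?thesis by (rule lipschitz_on_continuous_on)
qed

lemma occ_lin:
  assumes Z: "cprocess N P Z" and G: "G \<in> borel_measurable (GM N)" and H: "H \<in> borel_measurable (GM N)"
    and w: "w \<in> space (P vtx)"
    and b: "\<And>p. p \<in> Gam N \<Longrightarrow> \<bar>G p\<bar> \<le> C" "\<And>p. p \<in> Gam N \<Longrightarrow> \<bar>H p\<bar> \<le> C'" and s: "0 \<le> s"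
  shows "occ Z (\<lambda>p. x * G p + y * H p) s t w = x * occ Z G s t w + y * occ Z H s t w"
proof -
  have "occ Z (\<lambda>p. x * G p + y * H p) s t w =
      (\<integral>u. x * (indicator {s..t} u * G (Z u w)) + y * (indicator {s..t} u * H (Z u w)) \<partial>lborel)"
    unfolding occ_def by (intro Bochner_Integration.integral_cong) (auto simp: algebra_simps)
  also have "\<dots> = x * occ Z G s t w + y * occ Z H s t w"
    unfolding occ_def using occ_integrable[OF Z G w b(1) s, of t] occ_integrable[OF Z H w b(2) s, of t] by simp
  finally show ?thesis .
qed

lemma occ_mono:
  assumes Z: "cprocess N P Z" and G: "G \<in> borel_measurable (GM N)" and H: "H \<in> borel_measurable (GM N)"
    and w: "w \<in> space (P vtx)"
    and b: "\<And>p. p \<in> Gam N \<Longrightarrow> \<bar>G p\<bar> \<le> C" "\<And>p. p \<in> Gam N \<Longrightarrow> \<bar>H p\<bar> \<le> C'" and s: "0 \<le> s"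
    and le: "\<And>p. p \<in> Gam N \<Longrightarrow> G p \<le> H p"
  shows "occ Z G s t w \<le> occ Z H s t w"
  unfolding occ_def
proof (rule integral_mono[OF occ_integrable[OF Z G w b(1) s] occ_integrable[OF Z H w b(2) s]])
  show "indicator {s..t} u * G (Z u w) \<le> indicator {s..t} u * H (Z u w)" for u
    using le[of "Z u w"] Z w s by (auto simp: indicator_def cprocess_def)
qed

section \<open>The sticky process: standing facts and Dynkin's formula\<close>

locale sticky =
  fixes N :: nat and \<sigma> b :: "nat \<Rightarrow> real \<Rightarrow> real" and \<rho> :: "nat \<Rightarrow> real"
    and \<eta> \<sigma>0 :: real and P :: "point \<Rightarrow> 'w measure" and X :: "real \<Rightarrow> 'w \<Rightarrow> point"
  assumes N1: "N \<ge> 1"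
    and \<sigma>_cont: "\<forall>i<N. continuous_on {0..} (\<sigma> i) \<and> bounded (\<sigma> i ` {0..})"
    and b_cont: "\<forall>i<N. continuous_on {0..} (b i) \<and> bounded (b i ` {0..})"
    and \<sigma>0: "\<sigma>0 > 0" and \<sigma>_low: "\<forall>i<N. \<forall>x>0. \<sigma> i x > \<sigma>0"
    and \<rho>_pos: "\<forall>i<N. \<rho> i > 0" and \<rho>_sum: "(\<Sum>i<N. \<rho> i) = 1"
    and \<eta>: "\<eta> > 0"
    and gen: "generated_process N \<sigma> b \<rho> \<eta> P X"
begin

abbreviation "\<Omega> \<equiv> space (P vtx)"
abbreviation "L \<equiv> Lop \<sigma> b"
abbreviation "D \<equiv> DL N \<sigma> b \<rho>"
abbreviation "F \<equiv> natfilt P X"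

lemma sets_P: "sets (P p) = sets (P vtx)" and space_P: "space (P p) = \<Omega>"
proof -
  show 1: "sets (P p) = sets (P vtx)" using gen unfolding generated_process_def by blast
  show "space (P p) = \<Omega>" using sets_eq_imp_space_eq[OF 1] .
qed

lemma space_PD: "w \<in> space (P p) \<Longrightarrow> w \<in> \<Omega>"
  using space_P by blast

lemma prob: "p \<in> Gam N \<Longrightarrow> prob_space (P p)"
  using gen unfolding generated_process_def by blast

lemma X_Gam: "w \<in> \<Omega> \<Longrightarrow> X t w \<in> Gam N"
  using gen unfolding generated_process_def by blast

lemma X_cp: "cprocess N P X"
  using gen unfolding generated_process_def cprocess_def by blast

lemma X_meas[measurable]: "0 \<le> t \<Longrightarrow> X t \<in> measurable (P p) (GM N)"
proof -
  assume "0 \<le> t"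
  then have "X t \<in> measurable (P vtx) (GM N)"
    using X_cp by (intro measurable_GM_I0) (auto simp: cprocess_def)
  then show ?thesis using measurable_cong_sets[OF sets_P refl] by blast
qed

lemma F_sub: "\<Lambda> \<in> sets (F t) \<Longrightarrow> \<Lambda> \<in> sets (P p)"
  using natfilt_sub[OF X_cp] sets_P by blast

lemma F_meas: "f \<in> borel_measurable (F t) \<Longrightarrow> f \<in> borel_measurable (P p)"
  using natfilt_sub[OF X_cp, of t] sets_P[of p] space_P[of p]
  by (auto simp: measurable_def subset_iff)

lemma F_subalg: "subalgebra (P p) (F t)"
  unfolding subalgebra_def using F_sub space_P by (metis space_natfilt subsetI)

lemma C0_compat: "f \<in> C0 N \<Longrightarrow> i < N \<Longrightarrow> j < N \<Longrightarrow> f i 0 = f j 0"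
  and C0_cont: "f \<in> C0 N \<Longrightarrow> i < N \<Longrightarrow> continuous_on {0..} (f i)"
  unfolding C0_def by blast+

lemma gev_meas[measurable]: "f \<in> C0 N \<Longrightarrow> gev f \<in> borel_measurable (GM N)"
  by (rule gev_measurable) (rule C0_cont)

lemma gev_path: "f \<in> C0 N \<Longrightarrow> w \<in> \<Omega> \<Longrightarrow> continuous_on {0..} (\<lambda>t. gev f (X t w))"
  using X_cp by (intro continuous_on_gev_path[of _ N] C0_cont C0_compat) (auto simp: cprocess_def)

lemma gev_X_meas[measurable]: "f \<in> C0 N \<Longrightarrow> 0 \<le> t \<Longrightarrow> (\<lambda>w. gev f (X t w)) \<in> borel_measurable (P p)"
  by (rule measurable_compose[OF X_meas gev_meas])

lemma gev_X_integrable: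
  assumes "f \<in> C0 N" "0 \<le> t" "p \<in> Gam N"
  shows "integrable (P p) (\<lambda>w. gev f (X t w))"
proof -
  interpret prob_space "P p" by (rule prob) fact
  obtain K where "bd N f K" using C0_bounded[OF assms(1)] by blast
  show ?thesis
  proof (rule integrable_const_bound[where B=K])
    show "AE w in P p. norm (gev f (X t w)) \<le> K"
      unfolding real_norm_def by (intro AE_I2 gev_bd[OF \<open>bd N f K\<close> X_Gam] space_PD[of _ p])
    show "(\<lambda>w. gev f (X t w)) \<in> borel_measurable (P p)" by (rule gev_X_meas[OF assms(1,2)])
  qed
qed

lemma Tsg_C0: "f \<in> C0 N \<Longrightarrow> 0 \<le> t \<Longrightarrow> \<exists>g\<in>C0 N. \<forall>p\<in>Gam N. Tsg P X t f p = gev g p"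
  using gen unfolding generated_process_def by blast

lemma Tsg_meas[measurable]:
  assumes "f \<in> C0 N" "0 \<le> t"
  shows "Tsg P X t f \<in> borel_measurable (GM N)"
proof -
  obtain g where "g \<in> C0 N" "\<forall>p\<in>Gam N. Tsg P X t f p = gev g p" using Tsg_C0[OF assms] by blast
  moreover have "Tsg P X t f \<in> borel_measurable (GM N) \<longleftrightarrow> gev g \<in> borel_measurable (GM N)"
    using calculation by (intro measurable_cong) auto
  ultimately show ?thesis using gev_meas by blast
qed

lemma Tsg_bound:
  assumes "f \<in> C0 N" "0 \<le> t" "bd N f K" "p \<in> Gam N"
  shows "\<bar>Tsg P X t f p\<bar> \<le> K"
proof -
  interpret prob_space "P p" by (rule prob) fact
  have le: "\<bar>gev f (X t w)\<bar> \<le> K" if "w \<in> space (P p)" for w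
    using gev_bd[OF assms(3) X_Gam[OF space_PD[OF that]]] .
  have "Tsg P X t f p \<le> K" unfolding Tsg_def
    by (intro integral_le_const gev_X_integrable assms AE_I2) (use le in \<open>force\<close>)
  moreover have "Tsg P X t f p \<ge> - K" unfolding Tsg_def
    by (intro integral_ge_const gev_X_integrable assms AE_I2) (use le in \<open>force\<close>)
  ultimately show ?thesis by simp
qed

lemma sigma_finite_subalg: "p \<in> Gam N \<Longrightarrow> sigma_finite_subalgebra (P p) (F t)"
proof (rule finite_measure_subalgebra_is_sigma_finite)
  assume "p \<in> Gam N"
  then show "finite_measure_subalgebra (P p) (F t)"
    unfolding finite_measure_subalgebra_def finite_measure_subalgebra_axioms_def
    using F_subalg prob prob_space.finite_measure by blast
qed

text \<open>The conditional expectation is traded for integrals over events of the past, which is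
  the form in which martingale identities are stated and pass to limits.\<close>

lemma markov:
  assumes "f \<in> C0 N" "0 \<le> t" "0 \<le> h" "p \<in> Gam N" "\<Lambda> \<in> sets (F t)"
  shows "(\<integral>w. indicator \<Lambda> w * gev f (X (t + h) w) \<partial>P p) = (\<integral>w. indicator \<Lambda> w * Tsg P X h f (X t w) \<partial>P p)"
proof -
  interpret sigma_finite_subalgebra "P p" "F t" by (rule sigma_finite_subalg) fact
  have ae: "AE w in P p. real_cond_exp (P p) (F t) (\<lambda>w. gev f (X (t + h) w)) w = Tsg P X h f (X t w)"
    using gen assms(1-4) unfolding generated_process_def by blast
  have "(\<integral>w\<in>\<Lambda>. gev f (X (t + h) w) \<partial>P p) = (\<integral>w\<in>\<Lambda>. real_cond_exp (P p) (F t) (\<lambda>w. gev f (X (t + h) w)) w \<partial>P p)"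
    using assms by (intro real_cond_exp_intA gev_X_integrable) auto
  also have "\<dots> = (\<integral>w\<in>\<Lambda>. Tsg P X h f (X t w) \<partial>P p)"
    unfolding set_lebesgue_integral_def
  proof (rule integral_cong_AE)
    show "AE w in P p. indicat_real \<Lambda> w *\<^sub>R real_cond_exp (P p) (F t) (\<lambda>w. gev f (X (t + h) w)) w = indicat_real \<Lambda> w *\<^sub>R Tsg P X h f (X t w)"
      using ae by eventually_elim simp
    show "(\<lambda>w. indicat_real \<Lambda> w *\<^sub>R Tsg P X h f (X t w)) \<in> borel_measurable (P p)"
      using measurable_compose[OF X_meas Tsg_meas] F_sub[OF assms(5)] assms by (intro borel_measurable_scaleR) auto
    show "(\<lambda>w. indicat_real \<Lambda> w *\<^sub>R real_cond_exp (P p) (F t) (\<lambda>w. gev f (X (t + h) w)) w) \<in> borel_measurable (P p)"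
      using F_sub[OF assms(5)] by (intro borel_measurable_scaleR) auto
  qed
  finally show ?thesis by (simp add: set_lebesgue_integral_def)
qed

lemma dominated_path:
  assumes Gp: "p \<in> Gam N" and \<Lambda>: "\<Lambda> \<in> sets (P p)" and f: "f \<in> C0 N"
  shows "continuous_on {0..} (\<lambda>t. \<integral>w. indicator \<Lambda> w * gev f (X t w) \<partial>P p)"
proof -
  interpret prob_space "P p" by (rule prob) fact
  obtain K where K: "bd N f K" using C0_bounded[OF f] by blast
  show ?thesis
    unfolding continuous_on_sequentially comp_def
  proof (intro allI impI ballI, elim conjE)
    fix x :: "nat \<Rightarrow> real" and a assume x: "\<forall>n. x n \<in> {0..}" "x \<longlonglongrightarrow> a" "a \<in> {0..}"
    show "(\<lambda>n. \<integral>w. indicator \<Lambda> w * gev f (X (x n) w) \<partial>P p) \<longlonglongrightarrow> (\<integral>w. indicator \<Lambda> w * gev f (X a w) \<partial>P p)"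
    proof (rule integral_dominated_convergence[where w="\<lambda>_. K"])
      show "AE w in P p. (\<lambda>n. indicator \<Lambda> w * gev f (X (x n) w)) \<longlonglongrightarrow> indicator \<Lambda> w * gev f (X a w)"
        using x by (intro AE_I2 tendsto_mult_left continuous_on_tendsto_compose[OF gev_path[OF f space_PD[of _ p]]]) simp_all
      show "AE w in P p. norm (indicator \<Lambda> w * gev f (X (x n) w)) \<le> K" for n
        unfolding real_norm_def by (intro AE_I2 abs_indicator_mult_le gev_bd[OF K X_Gam] space_PD[of _ p])
    qed (use x f \<Lambda> in \<open>auto intro!: borel_measurable_times gev_X_meas\<close>)
  qed
qed

text \<open>The martingale problem for the pair of \<phi> and \<open>G\<close>, under every starting
  law. The compensator takes an arbitrary \<open>G\<close>, since it will be needed for generators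
  that are discontinuous at the vertex.\<close>

definition mart :: "(point \<Rightarrow> real) \<Rightarrow> (point \<Rightarrow> real) \<Rightarrow> bool" where
  "mart \<phi> G \<longleftrightarrow> (\<forall>p\<in>Gam N. \<forall>s t. 0 \<le> s \<and> s \<le> t \<longrightarrow> (\<forall>\<Lambda>\<in>sets (F s).
     (\<integral>w. indicator \<Lambda> w * (\<phi> (X t w) - \<phi> (X s w) - occ X G s t w) \<partial>P p) = 0))"

lemma DL_D:
  assumes "f \<in> D \<theta>"
  shows "f \<in> C2 N" "f \<in> C0 N" "L f \<in> C0 N" "\<theta> * L f 0 0 = (\<Sum>i<N. \<rho> i * d1 (f i) 0)"
  using assms unfolding DL_def by auto

text \<open>Dynkin's formula. By the Markov property the expectation of \<open>f\<close> over
  \<Lambda> has right difference quotients that converge uniformly in time to the expectation of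
  \<open>L f\<close>; the fundamental theorem integrates this, and Fubini moves the time integral
  inside.\<close>

lemma mart_DL:
  assumes f: "f \<in> D \<eta>"
  shows "mart (gev f) (gev (L f))"
  unfolding mart_def
proof (intro ballI allI impI, elim conjE)
  fix p s t \<Lambda> assume p: "p \<in> Gam N" and st: "0 \<le> s" "s \<le> t" and \<Lambda>: "\<Lambda> \<in> sets (F s)"
  note fD = DL_D[OF f]
  interpret prob_space "P p" by (rule prob) fact
  have \<Lambda>P[measurable]: "\<Lambda> \<in> sets (P p)" using F_sub[OF \<Lambda>] .
  define m where "m g r = (\<integral>w. indicator \<Lambda> w * gev g (X r w) \<partial>P p)" for g r
  have int: "integrable (P p) (\<lambda>w. indicator \<Lambda> w * gev g (X r w))" if "g \<in> C0 N" "0 \<le> r" for g r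
    using integrable_mult_indicator[OF \<Lambda>P gev_X_integrable[OF that p]] by simp
  obtain K where K: "bd N (L f) K" using C0_bounded[OF fD(3)] by blast
  have gen_f: "unif_right0 N (\<lambda>t p. (Tsg P X t f p - gev f p) / t) (gev (L f))"
    using gen f unfolding generated_process_def by blast
  have "(m (L f) has_integral (m f t - m f s)) {s..t}"
  proof (rule uniform_right_derivative_FTC[where c=s])
    show "continuous_on {s..} (m f)"
      unfolding m_def by (rule continuous_on_subset[OF dominated_path[OF p \<Lambda>P fD(2)]]) (use st in simp)
    show "continuous_on {s..} (m (L f))"
      unfolding m_def by (rule continuous_on_subset[OF dominated_path[OF p \<Lambda>P fD(3)]]) (use st in simp)
    fix e :: real assume e: "e > 0"
    have "\<exists>d>0. \<forall>t. 0 < t \<and> t < d \<longrightarrow> (\<forall>p\<in>Gam N. \<bar>(Tsg P X t f p - gev f p) / t - gev (L f) p\<bar> \<le> e)"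
      using gen_f e unfolding unif_right0_def by (elim allE[of _ e]) simp
    then obtain d where d: "d > 0" "\<And>h q. 0 < h \<Longrightarrow> h < d \<Longrightarrow> q \<in> Gam N \<Longrightarrow> \<bar>(Tsg P X h f q - gev f q) / h - gev (L f) q\<bar> \<le> e"
      by (elim exE conjE) simp
    have "\<bar>(m f (r + h) - m f r) / h - m (L f) r\<bar> \<le> e" if "s \<le> r" "0 < h" "h < d" for r h
    proof -
      have \<Lambda>r: "\<Lambda> \<in> sets (F r)" using natfilt_mono[OF that(1)] \<Lambda> by blast
      have iT: "integrable (P p) (\<lambda>w. indicator \<Lambda> w * Tsg P X h f (X r w))"
      proof -
        obtain g where g: "g \<in> C0 N" "\<forall>p\<in>Gam N. Tsg P X h f p = gev g p" using Tsg_C0[OF fD(2) less_imp_le[OF \<open>0 < h\<close>]] by blast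
        have "integrable (P p) (\<lambda>w. indicator \<Lambda> w * gev g (X r w))" using int[OF g(1)] that st by simp
        then show ?thesis by (rule Bochner_Integration.integrable_cong[THEN iffD1, rotated 2]) (use g X_Gam[OF space_PD[of _ p]] in simp_all)
      qed
      have "(m f (r + h) - m f r) / h - m (L f) r =
          (\<integral>w. indicator \<Lambda> w * ((Tsg P X h f (X r w) - gev f (X r w)) / h - gev (L f) (X r w)) \<partial>P p)"
      proof -
        have "m f (r + h) = (\<integral>w. indicator \<Lambda> w * Tsg P X h f (X r w) \<partial>P p)"
          unfolding m_def using that st by (intro markov fD p \<Lambda>r) auto
        then show ?thesis unfolding m_def using iT int[OF fD(2)] int[OF fD(3)] that st
          by (simp add: right_diff_distrib diff_divide_distrib)
      qed
      also have "\<bar>\<dots>\<bar> \<le> e"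
        using d(2)[OF \<open>0 < h\<close> \<open>h < d\<close> X_Gam[OF space_PD[of _ p]]] by (intro abs_expectation_le abs_indicator_mult_le)
      finally show ?thesis .
    qed
    then show "\<exists>d>0. \<forall>r\<ge>s. \<forall>h. 0 < h \<and> h < d \<longrightarrow> \<bar>(m f (r + h) - m f r) / h - m (L f) r\<bar> \<le> e"
      using d(1) by blast
  qed (use st in auto)
  moreover have "set_integrable lborel {s..t} (m (L f))"
    unfolding m_def
    by (rule borel_integrable_atLeastAtMost'[OF continuous_on_subset[OF dominated_path[OF p \<Lambda>P fD(3)]]]) (use st in simp)
  ultimately have 1: "m f t - m f s = (\<integral>u. indicator {s..t} u * m (L f) u \<partial>lborel)"
    using set_borel_integral_eq_integral(2)[of "{s..t}" "m (L f)"] by (simp add: integral_unique set_lebesgue_integral_def)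
  define \<phi> where "\<phi> z = indicator \<Lambda> (snd z) * gev (L f) (X (max 0 (min (fst z) t)) (snd z))" for z
  have sub: "measurable (borel \<Otimes>\<^sub>M F t) borel \<subseteq> (measurable (borel \<Otimes>\<^sub>M P p) borel :: (real \<times> 'w \<Rightarrow> real) set)"
  proof
    fix g :: "real \<times> 'w \<Rightarrow> real" assume g: "g \<in> measurable (borel \<Otimes>\<^sub>M F t) borel"
    have "snd \<in> measurable (borel \<Otimes>\<^sub>M P p) (F t)"
      using measurable_compose[OF measurable_snd measurable_from_subalg[OF F_subalg measurable_ident]] by simp
    from measurable_Pair[OF measurable_fst this]
    have "(\<lambda>z. z) \<in> measurable (borel \<Otimes>\<^sub>M P p) (borel \<Otimes>\<^sub>M F t)" by simp
    from measurable_compose[OF this g] show "g \<in> measurable (borel \<Otimes>\<^sub>M P p) borel" by simp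
  qed
  have \<phi>m: "\<phi> \<in> borel_measurable (borel \<Otimes>\<^sub>M P p)"
    unfolding \<phi>_def
  proof (rule borel_measurable_times)
    show "(\<lambda>x. indicat_real \<Lambda> (snd x)) \<in> borel_measurable (borel \<Otimes>\<^sub>M P p)" by measurable
    show "(\<lambda>x. gev (L f) (X (max 0 (min (fst x) t)) (snd x))) \<in> borel_measurable (borel \<Otimes>\<^sub>M P p)"
      using joint_measurable_natfilt[OF X_cp _ gev_meas[OF fD(3)], of t] st sub by auto
  qed
  have \<phi>b: "\<bar>\<phi> (u, w)\<bar> \<le> K" if "w \<in> space (P p)" for u w
    unfolding \<phi>_def using gev_bd[OF K X_Gam[OF space_PD[OF that]]] by (simp add: abs_indicator_mult_le)
  have in_eq: "(\<integral>u. indicator {s..t} u * \<phi> (u, w) \<partial>lborel) = indicator \<Lambda> w * occ X (gev (L f)) s t w" for w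
    unfolding occ_eq_clamped[OF st(1)] \<phi>_def by (simp add: mult.left_commute)
  have "(\<integral>w. indicator \<Lambda> w * occ X (gev (L f)) s t w \<partial>P p) = (\<integral>u. indicator {s..t} u * (\<integral>w. \<phi> (u, w) \<partial>P p) \<partial>lborel)"
    using bounded_Fubini(1)[OF finite_measure_axioms \<phi>m \<phi>b, of s t] unfolding in_eq .
  also have "\<dots> = (\<integral>u. indicator {s..t} u * m (L f) u \<partial>lborel)"
    using st by (intro Bochner_Integration.integral_cong) (auto simp: \<phi>_def m_def indicator_def max_def min_def)
  finally have 2: "(\<integral>w. indicator \<Lambda> w * occ X (gev (L f)) s t w \<partial>P p) = m f t - m f s" using 1 by simp
  have i3: "integrable (P p) (\<lambda>w. indicator \<Lambda> w * occ X (gev (L f)) s t w)"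
    using bounded_Fubini(3)[OF finite_measure_axioms \<phi>m \<phi>b, of s t] unfolding in_eq .
  show "(\<integral>w. indicator \<Lambda> w * (gev f (X t w) - gev f (X s w) - occ X (gev (L f)) s t w) \<partial>P p) = 0"
    using 2 i3 int[OF fD(2), of t] int[OF fD(2), of s] st by (simp add: right_diff_distrib m_def)
qed

end

section \<open>The resolvent of the sticky process\<close>

lemma joint_measurable_real_atLeast:
  fixes \<Phi> :: "real \<Rightarrow> 'w \<Rightarrow> real"
  assumes c: "\<And>w. w \<in> space M \<Longrightarrow> continuous_on {0..} (\<lambda>s. \<Phi> s w)"
    and m: "\<And>s. s \<ge> 0 \<Longrightarrow> \<Phi> s \<in> borel_measurable M"
  shows "(\<lambda>z. \<Phi> (max 0 (fst z)) (snd z)) \<in> borel_measurable (borel \<Otimes>\<^sub>M M)"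
proof (rule borel_measurable_LIMSEQ_real)
  show "(\<lambda>z. \<Phi> (max 0 (min (fst z) (real n))) (snd z)) \<in> borel_measurable (borel \<Otimes>\<^sub>M M)" for n
    by (rule joint_measurable_real) (auto intro: continuous_on_subset[OF c] m)
  fix z :: "real \<times> 'w"
  have "\<forall>\<^sub>F n in sequentially. \<Phi> (max 0 (min (fst z) (real n))) (snd z) = \<Phi> (max 0 (fst z)) (snd z)"
    using eventually_ge_at_top[of "nat \<lceil>fst z\<rceil>"]
  proof eventually_elim
    case (elim n)
    then have "fst z \<le> real n" by linarith
    then show ?case by simp
  qed
  then show "(\<lambda>n. \<Phi> (max 0 (min (fst z) (real n))) (snd z)) \<longlonglongrightarrow> \<Phi> (max 0 (fst z)) (snd z)"
    by (rule tendsto_eventually)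
qed

text \<open>The resolvent \<open>(1 - h L)^-1\<close> averages the semigroup over an exponential
  time of mean \<open>h\<close>. Taking the standard exponential law as a probability measure makes
  bounds and dominated convergence immediate.\<close>

definition expm :: "real measure" where
  "expm = density lborel (exponential_density 1)"

lemma prob_space_expm: "prob_space expm"
  unfolding expm_def by (rule prob_space_exponential_density) simp

lemma sets_expm[simp, measurable_cong]: "sets expm = sets borel" and space_expm[simp]: "space expm = UNIV"
  by (auto simp: expm_def)

lemma integral_expm:
  assumes [measurable]: "a \<in> borel_measurable borel"
  shows "(\<integral>t. a t \<partial>expm) = (\<integral>t. indicator {0..} t * (exp (- t) * a t) \<partial>lborel :: real)"
proof -
  have "(\<integral>t. a t \<partial>expm) = (\<integral>t. exponential_density 1 t * a t \<partial>lborel)"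
    unfolding expm_def by (subst integral_density) (auto simp: exponential_density_nonneg)
  also have "\<dots> = (\<integral>t. indicator {0..} t * (exp (- t) * a t) \<partial>lborel)"
    by (intro Bochner_Integration.integral_cong) (auto simp: exponential_density_def indicator_def)
  finally show ?thesis .
qed

lemma integrable_expm:
  fixes a :: "real \<Rightarrow> real"
  assumes [measurable]: "a \<in> borel_measurable borel" and "\<And>t. \<bar>a t\<bar> \<le> K"
  shows "integrable lborel (\<lambda>t. indicator {0..} t * (exp (- t) * a t))"
proof -
  interpret prob_space expm by (rule prob_space_expm)
  have "integrable expm a"
    using assms(2) by (intro integrable_const_bound[where B=K]) auto
  then have "integrable lborel (\<lambda>t. exponential_density 1 t * a t)"
    unfolding expm_def by (subst (asm) integrable_density) (auto simp: exponential_density_nonneg)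
  then show ?thesis
    by (rule Bochner_Integration.integrable_cong[THEN iffD1, rotated 2]) (auto simp: exponential_density_def indicator_def)
qed

text \<open>Lack of memory: a shift by \<open>u\<close> multiplies the exponential density by
  \<open>exp u\<close> and cuts off the part before \<open>u\<close>.\<close>

lemma integral_expm_shift:
  fixes a :: "real \<Rightarrow> real"
  assumes [measurable]: "a \<in> borel_measurable borel" and b: "\<And>t. \<bar>a t\<bar> \<le> K" and u: "u \<ge> 0"
  shows "(\<integral>t. a (max 0 t + u) \<partial>expm) = exp u * ((\<integral>t. a t \<partial>expm) - (\<integral>t. indicator {0..u} t * (exp (- t) * a t) \<partial>lborel))"
proof -
  have i: "integrable lborel (\<lambda>t. indicator {0..} t * (exp (- t) * a t))" by (rule integrable_expm[OF _ b]) simp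
  have i2: "integrable lborel (\<lambda>t. indicator {0..u} t * (exp (- t) * a t))"
    using integrable_mult_indicator[OF _ i, of "{0..u}"]
    by (rule Bochner_Integration.integrable_cong[THEN iffD1, rotated 2]) (auto simp: indicator_def)
  have flux_fn: "exp u * (exp (- x - u) * y) = exp (- x) * y" for x y :: real
    by (simp add: mult.assoc[symmetric] mult_exp_exp)
  have "(\<integral>t. a (max 0 t + u) \<partial>expm) = (\<integral>t. indicator {0..} t * (exp (- t) * a (max 0 t + u)) \<partial>lborel)"
    by (rule integral_expm) simp
  also have "\<dots> = (\<integral>t. exp u * (indicator {u..} (u + 1 * t) * (exp (- (u + 1 * t)) * a (u + 1 * t))) \<partial>lborel)"
    by (intro Bochner_Integration.integral_cong) (auto simp: indicator_def add.commute flux_fn)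
  also have "\<dots> = exp u * (\<integral>t. indicator {u..} t * (exp (- t) * a t) \<partial>lborel)"
    by (subst lborel_integral_real_affine[of 1 _ u]) auto
  also have "(\<integral>t. indicator {u..} t * (exp (- t) * a t) \<partial>lborel)
     = (\<integral>t. indicator {0..} t * (exp (- t) * a t) - indicator {0..u} t * (exp (- t) * a t) \<partial>lborel)"
  proof (rule integral_cong_AE)
    show "AE t in lborel. indicator {u..} t * (exp (- t) * a t) =
        indicator {0..} t * (exp (- t) * a t) - indicator {0..u} t * (exp (- t) * a t)"
      by (rule AE_mp[OF AE_lborel_singleton[of u]], rule AE_I2) (use u in \<open>auto simp: indicator_def\<close>)
  qed measurable
  also have "\<dots> = (\<integral>t. a t \<partial>expm) - (\<integral>t. indicator {0..u} t * (exp (- t) * a t) \<partial>lborel)"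
    using i i2 by (simp add: integral_expm)
  finally show ?thesis .
qed

lemma expm_tail:
  assumes "e > 0"
  shows "\<exists>M>0. measure expm {M<..} \<le> e"
proof -
  interpret prob_space expm by (rule prob_space_expm)
  interpret real_distribution expm by unfold_locales simp_all
  have "\<forall>\<^sub>F x in at_top. dist (cdf expm x) 1 < e"
    by (rule tendstoD[OF cdf_lim_at_top_prob assms])
  moreover have "\<forall>\<^sub>F x in at_top. x > (0::real)" by (rule eventually_gt_at_top)
  ultimately have "\<forall>\<^sub>F x in at_top. 0 < x \<and> dist (cdf expm x) 1 < e" by eventually_elim auto
  then obtain M where M: "M > 0" "dist (cdf expm M) 1 < e"
    unfolding eventually_at_top_linorder by blast
  have "{M<..} = space expm - {..M}" by auto
  then have "measure expm {M<..} = 1 - cdf expm M"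
    unfolding cdf_def using prob_compl[of "{..M}"] by simp
  then show ?thesis using M by (intro exI[of _ M]) (auto simp: dist_real_def)
qed

lemma exp_minus_1_le: "0 \<le> u \<Longrightarrow> u \<le> 1 \<Longrightarrow> exp u - 1 \<le> u + u\<^sup>2" for u :: real
  using exp_bound[of u] by simp

context sticky
begin

lemma gev_pt_C0: "f \<in> C0 N \<Longrightarrow> i < N \<Longrightarrow> gev f (pt i x) = f i x"
  using gev_pt[of N f i x] C0_compat by blast

lemma generator_domain:
  assumes "f \<in> C0 N" "g \<in> C0 N" "unif_right0 N (\<lambda>t p. (Tsg P X t f p - gev f p) / t) (gev g)"
  shows "f \<in> D \<eta>"
proof -
  have "(f \<in> C0 N \<and> (\<exists>g\<in>C0 N. unif_right0 N (\<lambda>t p. (Tsg P X t f p - gev f p) / t) (gev g))) \<longleftrightarrow> f \<in> D \<eta>"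
    using gen unfolding generated_process_def by (elim conjE) (erule spec)
  then show ?thesis using assms by blast
qed

lemma Tsg_continuous:
  assumes "f \<in> C0 N" "p \<in> Gam N"
  shows "continuous_on {0..} (\<lambda>t. Tsg P X t f p)"
proof -
  have "continuous_on {0..} (\<lambda>t. \<integral>w. indicator (space (P p)) w * gev f (X t w) \<partial>P p)"
    by (rule dominated_path[OF assms(2) _ assms(1)]) simp
  moreover have "(\<integral>w. indicator (space (P p)) w * gev f (X t w) \<partial>P p) = Tsg P X t f p" for t
    unfolding Tsg_def by (intro Bochner_Integration.integral_cong) auto
  ultimately show ?thesis by simp
qed

lemma Tsg_X_integral:
  assumes "f \<in> C0 N" "p \<in> Gam N" "0 \<le> s" "0 \<le> t"
  shows "(\<integral>w. Tsg P X t f (X s w) \<partial>P p) = Tsg P X (s + t) f p"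
proof -
  have \<Omega>: "space (P vtx) \<in> sets (F s)" using sets.top[of "F s"] by simp
  have i: "indicator \<Omega> w = (1::real)" if "w \<in> space (P p)" for w using space_PD[OF that] by simp
  have "(\<integral>w. Tsg P X t f (X s w) \<partial>P p) = (\<integral>w. indicator \<Omega> w * Tsg P X t f (X s w) \<partial>P p)"
    by (intro Bochner_Integration.integral_cong) (simp_all add: i)
  also have "\<dots> = (\<integral>w. indicator \<Omega> w * gev f (X (s + t) w) \<partial>P p)"
    by (rule markov[OF assms(1,3,4,2) \<Omega>, symmetric])
  also have "\<dots> = Tsg P X (s + t) f p"
    unfolding Tsg_def by (intro Bochner_Integration.integral_cong) (simp_all add: i)
  finally show ?thesis .
qed

text \<open>The sticky resolvent. The law \<open>expm\<close> lives on all reals, so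
  \<open>max 0\<close> keeps the semigroup at nonnegative times.\<close>

definition J :: "real \<Rightarrow> (nat \<Rightarrow> real \<Rightarrow> real) \<Rightarrow> nat \<Rightarrow> real \<Rightarrow> real" where
  "J h f i x = (\<integral>t. Tsg P X (h * max 0 t) f (pt i x) \<partial>expm)"

context
  fixes f and h :: real assumes f: "f \<in> C0 N" and h: "h > 0"
begin

lemma ray_measurable: "p \<in> Gam N \<Longrightarrow> (\<lambda>t. Tsg P X (h * max 0 t) f p) \<in> borel_measurable borel"
  by (intro borel_measurable_continuous_onI continuous_on_compose2[OF Tsg_continuous[OF f]] continuous_intros)
    (use h in auto)

lemma J_C0: "J h f \<in> C0 N"
proof -
  interpret E: prob_space expm by (rule prob_space_expm)
  obtain K where K: "bd N f K" using C0_bounded[OF f] by blast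
  have h0: "0 \<le> h * max 0 t" for t using h by simp
  have G: "\<exists>g. \<forall>t. g t \<in> C0 N \<and> (\<forall>p\<in>Gam N. Tsg P X (h * max 0 t) f p = gev (g t) p)"
    using Tsg_C0[OF f h0] by metis
  then obtain g where g: "\<And>t. g t \<in> C0 N" "\<And>t p. p \<in> Gam N \<Longrightarrow> Tsg P X (h * max 0 t) f p = gev (g t) p" by blast
  have gx: "Tsg P X (h * max 0 t) f (pt i x) = g t i x" if "i < N" "x \<ge> 0" for t i x
    using g(2)[OF pt_in_Gam[OF that]] gev_pt_C0[OF g(1) that(1)] by simp
  have b: "norm (Tsg P X (h * max 0 t) f (pt i x)) \<le> K" if "i < N" "x \<ge> 0" for t i x
    using Tsg_bound[OF f h0 K pt_in_Gam[OF that]] by simp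
  have conv: "(\<lambda>n. J h f i (x n)) \<longlonglongrightarrow> l"
    if i: "i < N" and x: "\<And>n. x n \<ge> 0" and lim: "\<And>t. (\<lambda>n. g t i (x n)) \<longlonglongrightarrow> a t" and l: "l = (\<integral>t. a t \<partial>expm)"
    for i x a l
    unfolding J_def l
  proof (rule integral_dominated_convergence[where w="\<lambda>_. K"])
    show "(\<lambda>t. Tsg P X (h * max 0 t) f (pt i (x n))) \<in> borel_measurable expm" for n
      using ray_measurable[OF pt_in_Gam[OF i x]] by simp
    then have "(\<lambda>t. g t i (x n)) \<in> borel_measurable expm" for n
      by (simp only: gx[OF i x])
    then show "a \<in> borel_measurable expm"
      by (rule borel_measurable_LIMSEQ_real[OF lim])
    show "AE t in expm. (\<lambda>n. Tsg P X (h * max 0 t) f (pt i (x n))) \<longlonglongrightarrow> a t"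
      using lim by (simp only: gx[OF i x]) simp
    show "AE t in expm. norm (Tsg P X (h * max 0 t) f (pt i (x n))) \<le> K" for n
      using b[OF i x] by simp
  qed simp
  show ?thesis
    unfolding C0_def mem_Collect_eq
  proof (intro conjI allI impI)
    show "J h f i 0 = J h f j 0" for i j by (simp add: J_def pt_def)
    fix i assume i: "i < N"
    show "continuous_on {0..} (J h f i)"
      unfolding continuous_on_sequentially comp_def
    proof (intro allI impI ballI, elim conjE)
      fix x :: "nat \<Rightarrow> real" and a assume x: "\<forall>n. x n \<in> {0..}" "x \<longlonglongrightarrow> a" "a \<in> {0..}"
      show "(\<lambda>n. J h f i (x n)) \<longlonglongrightarrow> J h f i a"
      proof (rule conv[OF i])
        show "(\<lambda>n. g t i (x n)) \<longlonglongrightarrow> g t i a" for t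
          using x by (intro continuous_on_tendsto_compose[OF C0_cont[OF g(1) i]]) auto
        show "J h f i a = (\<integral>t. g t i a \<partial>expm)" using x gx[OF i] by (simp add: J_def)
      qed (use x in auto)
    qed
    show "(J h f i \<longlongrightarrow> 0) at_top"
    proof (rule tendsto_at_topI_sequentially)
      fix x :: "nat \<Rightarrow> real" assume x: "filterlim x at_top sequentially"
      have "(\<lambda>n. J h f i (max 0 (x n))) \<longlonglongrightarrow> 0"
      proof (rule conv[OF i])
        have x': "filterlim (\<lambda>n. max 0 (x n)) at_top sequentially"
          by (rule filterlim_at_top_mono[OF x]) simp
        show "(\<lambda>n. g t i (max 0 (x n))) \<longlonglongrightarrow> 0" for t
          using g(1)[of t] i by (intro filterlim_compose[OF _ x', of "g t i"]) (simp add: C0_def)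
      qed auto
      moreover have "\<forall>\<^sub>F n in sequentially. J h f i (max 0 (x n)) = J h f i (x n)"
        using filterlim_at_top[THEN iffD1, OF x, rule_format, of 0] by eventually_elim (simp add: max_def)
      ultimately show "(\<lambda>n. J h f i (x n)) \<longlonglongrightarrow> 0" using tendsto_cong by fastforce
    qed
  qed
qed

lemma gev_J: "p \<in> Gam N \<Longrightarrow> gev (J h f) p = (\<integral>t. Tsg P X (h * max 0 t) f p \<partial>expm)"
proof -
  assume p: "p \<in> Gam N"
  from p obtain "fst p < N" "p = pt (fst p) (snd p)" by (rule GamE)
  then show ?thesis using gev_pt_C0[OF J_C0, of "fst p" "snd p"] by (simp add: J_def)
qed

lemma Tsg_J:
  assumes p: "p \<in> Gam N" and s: "0 \<le> s"
  shows "Tsg P X s (J h f) p = (\<integral>t. Tsg P X (s + h * max 0 t) f p \<partial>expm)"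
proof -
  interpret E: prob_space expm by (rule prob_space_expm)
  interpret Q: prob_space "P p" by (rule prob) fact
  interpret pair_prob_space expm "P p" ..
  obtain K where K: "bd N f K" using C0_bounded[OF f] by blast
  have h0: "0 \<le> h * max 0 t" for t using h by simp
  define \<Phi> where "\<Phi> r w = Tsg P X (h * r) f (X s w)" for r w
  have m: "(\<lambda>z. \<Phi> (max 0 (fst z)) (snd z)) \<in> borel_measurable (borel \<Otimes>\<^sub>M P p)"
  proof (rule joint_measurable_real_atLeast)
    show "continuous_on {0..} (\<lambda>r. \<Phi> r w)" if "w \<in> space (P p)" for w
      unfolding \<Phi>_def using h
      by (intro continuous_on_compose2[OF Tsg_continuous[OF f X_Gam[OF space_PD[OF that]]]] continuous_intros) auto
    show "\<Phi> r \<in> borel_measurable (P p)" if "r \<ge> 0" for r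
      unfolding \<Phi>_def using h that s by (intro measurable_compose[OF X_meas Tsg_meas[OF f]]) auto
  qed
  have m': "sets (expm \<Otimes>\<^sub>M P p) = sets (borel \<Otimes>\<^sub>M P p)" by (intro sets_pair_measure_cong) simp_all
  have int: "integrable (expm \<Otimes>\<^sub>M P p) (\<lambda>(t, w). \<Phi> (max 0 t) w)"
  proof (rule P.integrable_const_bound[where B=K])
    show "AE z in expm \<Otimes>\<^sub>M P p. norm (case z of (t, w) \<Rightarrow> \<Phi> (max 0 t) w) \<le> K"
      using Tsg_bound[OF f h0 K X_Gam[OF space_PD[of _ p]]]
      by (intro AE_I2) (auto simp: \<Phi>_def space_pair_measure)
    show "(\<lambda>(t, w). \<Phi> (max 0 t) w) \<in> borel_measurable (expm \<Otimes>\<^sub>M P p)"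
      using m by (simp add: case_prod_unfold measurable_cong_sets[OF m' refl])
  qed
  have "Tsg P X s (J h f) p = (\<integral>w. (\<integral>t. \<Phi> (max 0 t) w \<partial>expm) \<partial>P p)"
    unfolding Tsg_def[of P X s "J h f" p] \<Phi>_def
    by (intro Bochner_Integration.integral_cong refl gev_J X_Gam space_PD[of _ p])
  also have "\<dots> = (\<integral>t. (\<integral>w. \<Phi> (max 0 t) w \<partial>P p) \<partial>expm)" by (rule Fubini_integral[OF int])
  also have "\<dots> = (\<integral>t. Tsg P X (s + h * max 0 t) f p \<partial>expm)"
    unfolding \<Phi>_def by (intro Bochner_Integration.integral_cong refl Tsg_X_integral[OF f p s h0])
  finally show ?thesis .
qed

lemma strong_cont:
  assumes "e > 0"
  shows "\<exists>d>0. \<forall>t. 0 \<le> t \<and> t < d \<longrightarrow> (\<forall>p\<in>Gam N. \<bar>Tsg P X t f p - gev f p\<bar> \<le> e)"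
proof -
  have "unif_right0 N (\<lambda>t. Tsg P X t f) (gev f)"
    using gen f unfolding generated_process_def by blast
  then obtain d where d: "d > 0" "\<forall>t. 0 < t \<and> t < d \<longrightarrow> (\<forall>p\<in>Gam N. \<bar>Tsg P X t f p - gev f p\<bar> \<le> e)"
    using assms unfolding unif_right0_def by (elim allE[of _ e]) auto
  have "Tsg P X 0 f p = gev f p" if p: "p \<in> Gam N" for p
  proof -
    interpret prob_space "P p" by (rule prob) fact
    have "AE w in P p. X 0 w = p" using gen p unfolding generated_process_def by blast
    then have "AE w in P p. gev f (X 0 w) = gev f p" by eventually_elim simp
    then have "Tsg P X 0 f p = (\<integral>w. gev f p \<partial>P p)"
      unfolding Tsg_def by (intro integral_cong_AE gev_X_meas f) auto
    then show ?thesis by (simp add: prob_space)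
  qed
  then show ?thesis using d assms by (intro exI[of _ d]) (auto simp: less_le)
qed

text \<open>With \<open>u = s / h\<close>, applying the semigroup for time \<open>s\<close> turns
  the resolvent value \<open>j\<close> into \<open>exp u * (j - I)\<close>, where \<open>I\<close>
  is the part of the exponential integral before \<open>u\<close>. To first order \<open>I\<close>
  is \<open>u\<close> times \<open>f\<close>, so the increment is \<open>u\<close> times the
  difference of \<open>j\<close> and \<open>f\<close>.\<close>

lemma J_generator:
  "unif_right0 N (\<lambda>s p. (Tsg P X s (J h f) p - gev (J h f) p) / s) (gev (comb (1 / h) (J h f) (- 1 / h) f))"
  unfolding unif_right0_def
proof (intro allI impI)
  fix e :: real assume e: "e > 0"
  obtain K where K: "K \<ge> 0" "bd N f K" using C0_bounded[OF f] by blast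
  obtain d where d: "d > 0" "\<And>t p. 0 \<le> t \<Longrightarrow> t < d \<Longrightarrow> p \<in> Gam N \<Longrightarrow> \<bar>Tsg P X t f p - gev f p\<bar> \<le> e * h / 2"
    using strong_cont[of "e * h / 2"] e h by auto
  \<comment> \<open>The bound \<open>d\<close> controls how far the semigroup moves
    \<open>f\<close>, the bound \<open>h\<close> gives \<open>u \<le> 1\<close>, and the last one
    makes the second order error \<open>4 * u * K\<close> at most half of
    \<open>e * h\<close>.\<close>
  define d' where "d' = min d (min h (e * h\<^sup>2 / (8 * (K + 1))))"
  have d': "d' > 0" using d(1) h e K by (simp add: d'_def)
  have "\<bar>(Tsg P X s (J h f) p - gev (J h f) p) / s - gev (comb (1 / h) (J h f) (- 1 / h) f) p\<bar> \<le> e"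
    if s: "0 < s" "s < d'" and p: "p \<in> Gam N" for s p
  proof -
    interpret E: prob_space expm by (rule prob_space_expm)
    define u where "u = s / h"
    have u: "0 < u" "u \<le> 1" "s = h * u" using s h by (auto simp: u_def d'_def)
    define a where "a t = Tsg P X (h * max 0 t) f p" for t
    have am[measurable]: "a \<in> borel_measurable borel" unfolding a_def by (rule ray_measurable[OF p])
    have h0: "0 \<le> h * max 0 t" for t using h by simp
    have ab: "\<bar>a t\<bar> \<le> K" for t unfolding a_def by (rule Tsg_bound[OF f h0 K(2) p])
    define j where "j = (\<integral>t. a t \<partial>expm)"
    define I where "I = (\<integral>t. indicator {0..u} t * (exp (- t) * a t) \<partial>lborel)"
    have gJ: "gev (J h f) p = j" unfolding gev_J[OF p] j_def a_def ..
    have jK: "\<bar>j\<bar> \<le> K" unfolding j_def by (rule E.abs_expectation_le) (rule ab)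
    have "Tsg P X s (J h f) p = (\<integral>t. Tsg P X (s + h * max 0 t) f p \<partial>expm)"
      by (rule Tsg_J[OF p less_imp_le[OF s(1)]])
    also have "\<dots> = (\<integral>t. a (max 0 t + u) \<partial>expm)"
      unfolding a_def u(3) using u(1)
      by (intro Bochner_Integration.integral_cong) (auto simp: algebra_simps max_def)
    also have "\<dots> = exp u * (j - I)" unfolding j_def I_def using u by (intro integral_expm_shift[OF am ab]) simp
    finally have T: "Tsg P X s (J h f) p = exp u * (j - I)" .
    define \<phi> where "\<phi> = gev f p"
    have Iu: "\<bar>I - u * \<phi>\<bar> \<le> u * (e * h / 2 + u * K)"
    proof -
      have i2: "integrable lborel (\<lambda>t. indicator {0..u} t * (exp (- t) * a t))"
        using integrable_mult_indicator[OF _ integrable_expm[OF am ab], of "{0..u}"]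
        by (rule Bochner_Integration.integrable_cong[THEN iffD1, rotated 2]) (auto simp: indicator_def)
      have "I - u * \<phi> = (\<integral>t. indicator {0..u} t * (exp (- t) * a t) - indicator {0..u} t * \<phi> \<partial>lborel)"
        unfolding I_def using i2 u by simp
      also have "\<bar>\<dots>\<bar> \<le> (\<integral>t. indicator {0..u} t * (e * h / 2 + u * K) \<partial>lborel)"
      proof (rule integral_abs_le)
        fix t :: real
        have "\<bar>exp (- t) * a t - \<phi>\<bar> \<le> e * h / 2 + u * K" if t: "0 \<le> t" "t \<le> u"
        proof -
          have "h * t \<le> s" using t u h by (simp add: mult_left_mono)
          then have 1: "\<bar>a t - \<phi>\<bar> \<le> e * h / 2"
            unfolding a_def \<phi>_def using t s h p by (intro d(2)) (auto simp: d'_def)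
          have "1 - t \<le> exp (- t)" using exp_ge_add_one_self[of "- t"] by simp
          then have "\<bar>1 - exp (- t)\<bar> \<le> u" using t by simp
          then have 2: "\<bar>(1 - exp (- t)) * a t\<bar> \<le> u * K" unfolding abs_mult using ab[of t] u by (intro mult_mono) auto
          have "exp (- t) * a t - \<phi> = (a t - \<phi>) - (1 - exp (- t)) * a t" by (simp add: algebra_simps)
          then show ?thesis using 1 2 by linarith
        qed
        then show "\<bar>indicator {0..u} t * (exp (- t) * a t) - indicator {0..u} t * \<phi>\<bar> \<le> indicator {0..u} t * (e * h / 2 + u * K)"
          by (auto simp: indicator_def)
      qed (use i2 u in auto)
      finally show ?thesis using u by simp
    qed
    have "\<bar>I\<bar> \<le> u * K"
    proof -
      have "\<bar>I\<bar> \<le> (\<integral>t. indicator {0..u} t * K \<partial>lborel)"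
        unfolding I_def
      proof (rule integral_abs_le)
        show "integrable lborel (\<lambda>t. indicator {0..u} t * (exp (- t) * a t))"
          using integrable_mult_indicator[OF _ integrable_expm[OF am ab], of "{0..u}"]
          by (rule Bochner_Integration.integrable_cong[THEN iffD1, rotated 2]) (auto simp: indicator_def)
        fix t :: real
        have "\<bar>exp (- t) * a t\<bar> \<le> 1 * K" if "0 \<le> t" unfolding abs_mult using that ab[of t] by (intro mult_mono) auto
        then show "\<bar>indicator {0..u} t * (exp (- t) * a t)\<bar> \<le> indicator {0..u} t * K" by (auto simp: indicator_def)
      qed (use u in auto)
      then show ?thesis using u by simp
    qed
    have ex: "0 \<le> exp u - 1" "exp u - 1 \<le> u + u\<^sup>2" "0 \<le> exp u - 1 - u"
      using exp_minus_1_le[of u] u exp_ge_add_one_self[of u] by linarith+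
    have uu: "u\<^sup>2 \<le> u" using u by (simp add: power2_eq_square mult_left_le)
    have "(exp u * (j - I) - j) - u * (j - \<phi>) = (exp u - 1 - u) * j - (exp u - 1) * I - (I - u * \<phi>)"
      by (simp add: algebra_simps)
    moreover have "\<bar>(exp u - 1 - u) * j\<bar> \<le> u\<^sup>2 * K" unfolding abs_mult using ex jK by (intro mult_mono) auto
    moreover have "\<bar>(exp u - 1) * I\<bar> \<le> (2 * u) * (u * K)" unfolding abs_mult using ex uu u \<open>\<bar>I\<bar> \<le> u * K\<close> by (intro mult_mono) auto
    ultimately have "\<bar>(exp u * (j - I) - j) - u * (j - \<phi>)\<bar> \<le> u\<^sup>2 * K + (2 * u) * (u * K) + u * (e * h / 2 + u * K)"
      using Iu by linarith
    also have "\<dots> = u * (4 * u * K + e * h / 2)" by (simp add: power2_eq_square algebra_simps)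
    also have "\<dots> \<le> u * (e * h)"
    proof -
      have "s * (8 * (K + 1)) \<le> e * h\<^sup>2" using s K unfolding d'_def by (simp add: field_simps)
      then have "8 * u * (K + 1) \<le> e * h" using h unfolding u(3) power2_eq_square by (simp add: mult.assoc mult.left_commute)
      moreover have "8 * u * K \<le> 8 * u * (K + 1)" using u by simp
      ultimately have "4 * u * K + e * h / 2 \<le> e * h" by linarith
      then show ?thesis using u(1) by (intro mult_left_mono) simp_all
    qed
    finally have fin: "\<bar>(exp u * (j - I) - j) - u * (j - \<phi>)\<bar> \<le> u * (e * h)" .
    have "(Tsg P X s (J h f) p - gev (J h f) p) / s - gev (comb (1 / h) (J h f) (- 1 / h) f) p
        = ((exp u * (j - I) - j) - u * (j - \<phi>)) / (u * h)"
    proof -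
      have c: "gev (comb (1 / h) (J h f) (- 1 / h) f) p = (j - \<phi>) / h"
        using gJ by (simp add: gev_def comb_def \<phi>_def diff_divide_distrib)
      have "(exp u * (j - I) - j) / s - (j - \<phi>) / h = ((exp u * (j - I) - j) - u * (j - \<phi>)) / (u * h)"
        unfolding u(3) using u(1) h by (simp add: field_simps)
      then show ?thesis unfolding T gJ c .
    qed
    also have "\<bar>\<dots>\<bar> \<le> e"
      using fin u(1) h by (simp add: abs_mult pos_divide_le_eq mult.commute mult.left_commute)
    finally show ?thesis .
  qed
  then show "\<exists>d>0. \<forall>t. 0 < t \<and> t < d \<longrightarrow> (\<forall>p\<in>Gam N. \<bar>(Tsg P X t (J h f) p - gev (J h f) p) / t - gev (comb (1 / h) (J h f) (- 1 / h) f) p\<bar> \<le> e)"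
    using d' by blast
qed

lemma J_DL: "J h f \<in> D \<eta>"
  by (rule generator_domain[OF J_C0 C0_comb[OF J_C0 f] J_generator])

text \<open>The same difference quotients converge to \<open>L (J h f)\<close>, by the hypothesis on
  the generator, and to the limit computed in \<open>J_generator\<close>. Equating the two limits
  gives the resolvent equation.\<close>

lemma J_equation:
  assumes "i < N" "x \<ge> 0"
  shows "J h f i x - h * L (J h f) i x = f i x"
proof -
  have lim: "unif_right0 N (\<lambda>s p. (Tsg P X s (J h f) p - gev (J h f) p) / s) (gev (L (J h f)))"
    using gen J_DL unfolding generated_process_def by blast
  define p where "p = pt i x"
  have p: "p \<in> Gam N" unfolding p_def by (rule pt_in_Gam[OF assms])
  have "\<bar>gev (L (J h f)) p - gev (comb (1 / h) (J h f) (- 1 / h) f) p\<bar> \<le> e" if e: "e > 0" for e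
  proof -
    have e2: "e / 2 > 0" using e by simp
    obtain d where d: "d > 0" "\<forall>t. 0 < t \<and> t < d \<longrightarrow> (\<forall>p\<in>Gam N. \<bar>(Tsg P X t (J h f) p - gev (J h f) p) / t - gev (L (J h f)) p\<bar> \<le> e / 2)"
      using lim e2 unfolding unif_right0_def by (elim allE[of _ "e / 2"]) auto
    obtain d' where d': "d' > 0" "\<forall>t. 0 < t \<and> t < d' \<longrightarrow> (\<forall>p\<in>Gam N. \<bar>(Tsg P X t (J h f) p - gev (J h f) p) / t - gev (comb (1 / h) (J h f) (- 1 / h) f) p\<bar> \<le> e / 2)"
      using J_generator e2 unfolding unif_right0_def by (elim allE[of _ "e / 2"]) auto
    define t where "t = min d d' / 2"
    have "0 < t \<and> t < d" "0 < t \<and> t < d'" using d(1) d'(1) by (auto simp: t_def)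
    then have "\<bar>(Tsg P X t (J h f) p - gev (J h f) p) / t - gev (L (J h f)) p\<bar> \<le> e / 2"
      "\<bar>(Tsg P X t (J h f) p - gev (J h f) p) / t - gev (comb (1 / h) (J h f) (- 1 / h) f) p\<bar> \<le> e / 2"
      using d(2) d'(2) p by blast+
    then show ?thesis by linarith
  qed
  then have "gev (L (J h f)) p = gev (comb (1 / h) (J h f) (- 1 / h) f) p"
    by (metis abs_le_zero_iff dense_ge eq_iff_diff_eq_0)
  moreover have "gev (L (J h f)) p = L (J h f) i x"
    unfolding p_def by (rule gev_pt_C0[OF DL_D(3)[OF J_DL] assms(1)])
  moreover have "gev (comb (1 / h) (J h f) (- 1 / h) f) p = comb (1 / h) (J h f) (- 1 / h) f i x"
    unfolding p_def by (rule gev_pt_C0[OF C0_comb[OF J_C0 f] assms(1)])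
  ultimately show ?thesis using h by (simp add: comb_def field_simps)
qed

end

lemma J_approx:
  assumes f: "f \<in> C0 N" and e: "e > 0"
  shows "\<exists>h>0. \<forall>i<N. \<forall>x\<ge>0. \<bar>J h f i x - f i x\<bar> \<le> e"
proof -
  interpret E: prob_space expm by (rule prob_space_expm)
  obtain K where K: "K \<ge> 0" "bd N f K" using C0_bounded[OF f] by blast
  \<comment> \<open>On the tail the integrand is at most \<open>2 * K\<close>, which leaves half of
    \<open>e\<close> for the rest; \<open>K + 1\<close> avoids a division by zero.\<close>
  obtain M where M: "M > 0" "measure expm {M<..} \<le> e / (4 * (K + 1))" using expm_tail[of "e / (4 * (K + 1))"] e K by auto
  obtain d where d: "d > 0" "\<And>t p. 0 \<le> t \<Longrightarrow> t < d \<Longrightarrow> p \<in> Gam N \<Longrightarrow> \<bar>Tsg P X t f p - gev f p\<bar> \<le> e / 2"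
    using strong_cont[OF f, of 1 "e / 2"] e by auto
  \<comment> \<open>Exponential times up to \<open>M\<close> are scaled into times up to
    \<open>d / 2\<close>, where the semigroup has hardly moved \<open>f\<close>.\<close>
  define h where "h = d / (2 * M)"
  have h: "h > 0" using d M by (simp add: h_def)
  have h0: "0 \<le> h * max 0 t" for t using h by simp
  have "\<bar>J h f i x - f i x\<bar> \<le> e" if ix: "i < N" "x \<ge> 0" for i x
  proof -
    define p where "p = pt i x"
    have p: "p \<in> Gam N" unfolding p_def by (rule pt_in_Gam[OF ix])
    have fp: "gev f p = f i x" unfolding p_def by (rule gev_pt_C0[OF f ix(1)])
    have m[measurable]: "(\<lambda>t. Tsg P X (h * max 0 t) f p) \<in> borel_measurable expm"
      using ray_measurable[OF f h p] by simp
    have i1: "integrable expm (\<lambda>t. Tsg P X (h * max 0 t) f p)"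
      using Tsg_bound[OF f h0 K(2) p] by (intro E.integrable_const_bound[where B=K]) auto
    have "J h f i x - f i x = (\<integral>t. Tsg P X (h * max 0 t) f p - gev f p \<partial>expm)"
      using i1 E.prob_space by (simp add: J_def p_def[symmetric] fp)
    also have "\<bar>\<dots>\<bar> \<le> (\<integral>t. e / 2 + 2 * K * indicator {M<..} t \<partial>expm)"
    proof (rule integral_abs_le)
      show "integrable expm (\<lambda>t. Tsg P X (h * max 0 t) f p - gev f p)" using i1 by simp
      show "integrable expm (\<lambda>t. e / 2 + 2 * K * indicator {M<..} t)" by (simp add: E.emeasure_eq_measure)
      fix t :: real
      show "\<bar>Tsg P X (h * max 0 t) f p - gev f p\<bar> \<le> e / 2 + 2 * K * indicator {M<..} t"
      proof (cases "t \<le> M")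
        case True
        have "h * max 0 t \<le> h * M" using True M h by (intro mult_left_mono) auto
        also have "\<dots> < d" using M d by (simp add: h_def)
        finally show ?thesis using d(2)[OF h0 _ p] True by simp
      next
        case False
        have "\<bar>Tsg P X (h * max 0 t) f p\<bar> \<le> K" "\<bar>gev f p\<bar> \<le> K"
          using Tsg_bound[OF f h0 K(2) p] gev_bd[OF K(2) p] by auto
        moreover have "(indicator {M<..} t :: real) = 1" using False by simp
        ultimately show ?thesis using e by simp
      qed
    qed
    also have "\<dots> = e / 2 + 2 * K * measure expm {M<..}"
      by (simp add: E.emeasure_eq_measure E.prob_space[simplified])
    also have "\<dots> \<le> e / 2 + 2 * K * (e / (4 * (K + 1)))"
      using M K by (intro add_left_mono mult_left_mono) auto
    also have "\<dots> \<le> e" using K e by (simp add: field_simps)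
    finally show ?thesis .
  qed
  then show ?thesis using h by blast
qed

end

section \<open>Functions whose generator jumps at the vertex\<close>

text \<open>
  \<open>bA\<close>, \<open>bB\<close>, \<open>bC\<close> are a bump and its first two derivatives, and
  likewise \<open>bQ\<close>, \<open>bR\<close>, \<open>bS\<close>. Rescaled by \<open>n\<close>, the first
  changes the second derivatives at the vertex but not the slopes and the second changes the slopes, both
  at an arbitrarily small uniform cost.
\<close>

definition bA :: "real \<Rightarrow> real" where "bA y = y\<^sup>2 / 2 * exp (- y)"
definition bB :: "real \<Rightarrow> real" where "bB y = (y - y\<^sup>2 / 2) * exp (- y)"
definition bC :: "real \<Rightarrow> real" where "bC y = (1 - 2 * y + y\<^sup>2 / 2) * exp (- y)"
definition bQ :: "real \<Rightarrow> real" where "bQ y = y * exp (- y)"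
definition bR :: "real \<Rightarrow> real" where "bR y = (1 - y) * exp (- y)"
definition bS :: "real \<Rightarrow> real" where "bS y = (y - 2) * exp (- y)"

lemma bump_derivs:
  "(bA has_real_derivative bB y) (at y within S)" "(bB has_real_derivative bC y) (at y within S)"
  "(bQ has_real_derivative bR y) (at y within S)" "(bR has_real_derivative bS y) (at y within S)"
  unfolding bA_def[abs_def] bB_def[abs_def] bC_def bQ_def[abs_def] bR_def[abs_def] bS_def
  by (auto intro!: derivative_eq_intros simp: field_simps power2_eq_square)

lemma bump_0: "bA 0 = 0" "bB 0 = 0" "bC 0 = 1" "bQ 0 = 0" "bR 0 = 1" "bS 0 = - 2"
  by (auto simp: bA_def bB_def bC_def bQ_def bR_def bS_def)

lemma bump_continuous: "continuous_on S bA" "continuous_on S bB" "continuous_on S bC" "continuous_on S bQ"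
  "continuous_on S bR" "continuous_on S bS"
  unfolding bA_def[abs_def] bB_def[abs_def] bC_def[abs_def] bQ_def[abs_def] bR_def[abs_def] bS_def[abs_def]
  by (intro continuous_intros; simp)+

lemma power_exp_bounds:
  fixes y :: real
  assumes "y \<ge> 0"
  shows "0 \<le> exp (- y)" "exp (- y) \<le> 1" "0 \<le> y * exp (- y)" "y * exp (- y) \<le> 1"
    "0 \<le> y\<^sup>2 / 2 * exp (- y)" "y\<^sup>2 / 2 * exp (- y) \<le> 1"
proof -
  have 1: "1 + y + y\<^sup>2 / 2 \<le> exp y" using exp_lower_Taylor_quadratic[OF assms] .
  have y2: "0 \<le> y\<^sup>2" by simp
  have "y \<le> exp y" using 1 y2 by linarith
  then show "y * exp (- y) \<le> 1" by (simp add: exp_minus divide_simps)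
  have "y\<^sup>2 / 2 \<le> exp y" using 1 assms by linarith
  then show "y\<^sup>2 / 2 * exp (- y) \<le> 1" by (simp add: exp_minus divide_simps)
qed (use assms in auto)

lemma bump_bounds:
  assumes "y \<ge> 0"
  shows "\<bar>bA y\<bar> \<le> 1" "\<bar>bB y\<bar> \<le> 2" "\<bar>bC y\<bar> \<le> 4" "\<bar>bQ y\<bar> \<le> 1" "\<bar>bR y\<bar> \<le> 2" "\<bar>bS y\<bar> \<le> 3"
proof -
  note p = power_exp_bounds[OF assms]
  show "\<bar>bA y\<bar> \<le> 1" unfolding bA_def using p by linarith
  show "\<bar>bQ y\<bar> \<le> 1" unfolding bQ_def using p by linarith
  have "bB y = y * exp (- y) - y\<^sup>2 / 2 * exp (- y)" by (simp add: bB_def algebra_simps)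
  then show "\<bar>bB y\<bar> \<le> 2" using p by linarith
  have "bC y = exp (- y) - 2 * (y * exp (- y)) + y\<^sup>2 / 2 * exp (- y)" by (simp add: bC_def algebra_simps)
  then show "\<bar>bC y\<bar> \<le> 4" using p by linarith
  have "bR y = exp (- y) - y * exp (- y)" by (simp add: bR_def algebra_simps)
  then show "\<bar>bR y\<bar> \<le> 2" using p by linarith
  have "bS y = y * exp (- y) - 2 * exp (- y)" by (simp add: bS_def algebra_simps)
  then show "\<bar>bS y\<bar> \<le> 3" using p by linarith
qed

lemma tendsto_eqI: "(f \<longlongrightarrow> a) A \<Longrightarrow> g = f \<Longrightarrow> a = b \<Longrightarrow> (g \<longlongrightarrow> b) A"
  by simp

lemma bump_lim:
  "(bA \<longlongrightarrow> 0) at_top" "(bB \<longlongrightarrow> 0) at_top" "(bC \<longlongrightarrow> 0) at_top"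
  "(bQ \<longlongrightarrow> 0) at_top" "(bR \<longlongrightarrow> 0) at_top" "(bS \<longlongrightarrow> 0) at_top"
proof -
  have p: "((\<lambda>y::real. y ^ k * exp (- y)) \<longlongrightarrow> 0) at_top" for k
    using tendsto_power_div_exp_0[of k] by (simp add: exp_minus divide_inverse)
  note p0 = p[of 0, simplified] and p1 = p[of 1, simplified] and p2 = p[of 2]
  have "((\<lambda>y::real. 1 / 2 * (y\<^sup>2 * exp (- y))) \<longlongrightarrow> 1 / 2 * 0) at_top" by (rule tendsto_mult[OF tendsto_const p2])
  then show A: "(bA \<longlongrightarrow> 0) at_top" by (rule tendsto_eqI) (auto simp: fun_eq_iff bA_def)
  show Q: "(bQ \<longlongrightarrow> 0) at_top" using p1 by (rule tendsto_eqI) (auto simp: fun_eq_iff bQ_def)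
  have "((\<lambda>y. bQ y - bA y) \<longlongrightarrow> 0 - 0) at_top" by (rule tendsto_diff[OF Q A])
  then show "(bB \<longlongrightarrow> 0) at_top" by (rule tendsto_eqI) (auto simp: fun_eq_iff bB_def bA_def bQ_def algebra_simps)
  have "((\<lambda>y. exp (- y) - 2 * bQ y + bA y) \<longlongrightarrow> 0 - 2 * 0 + 0) at_top"
    by (rule tendsto_add[OF tendsto_diff[OF p0 tendsto_mult[OF tendsto_const Q]] A])
  then show "(bC \<longlongrightarrow> 0) at_top" by (rule tendsto_eqI) (auto simp: fun_eq_iff bC_def bA_def bQ_def algebra_simps)
  have "((\<lambda>y. exp (- y) - bQ y) \<longlongrightarrow> 0 - 0) at_top" by (rule tendsto_diff[OF p0 Q])
  then show "(bR \<longlongrightarrow> 0) at_top" by (rule tendsto_eqI) (auto simp: fun_eq_iff bR_def bQ_def algebra_simps)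
  have "((\<lambda>y. bQ y - 2 * exp (- y)) \<longlongrightarrow> 0 - 2 * 0) at_top" by (rule tendsto_diff[OF Q tendsto_mult[OF tendsto_const p0]])
  then show "(bS \<longlongrightarrow> 0) at_top" by (rule tendsto_eqI) (auto simp: fun_eq_iff bS_def bQ_def algebra_simps)
qed

text \<open>The limits of a generator along the edges may disagree, so the value that counts while
  \<open>X\<close> sits at the vertex is prescribed separately. The value 0 means integration over
  the time off the vertex.\<close>

definition glue :: "real \<Rightarrow> (point \<Rightarrow> real) \<Rightarrow> point \<Rightarrow> real" where
  "glue c G = (\<lambda>p. if p = vtx then c else G p)"

lemma glue_measurable:
  assumes [measurable]: "G \<in> borel_measurable (GM N)"
  shows "glue c G \<in> borel_measurable (GM N)"
proof -
  have "{p \<in> space (GM N). p = vtx} \<in> sets (GM N)"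
    unfolding GM_def by (auto simp: sets_restrict_space space_restrict_space intro!: image_eqI[where x="{vtx}"])
  then show ?thesis unfolding glue_def by (intro measurable_If) auto
qed

context sticky
begin

text \<open>Dominated convergence, first in time and then over the probability space. Bounded
  pointwise convergence is enough, which is essential because the limiting generators jump at the
  vertex.\<close>

lemma mart_closed:
  assumes m: "\<And>n. mart (\<phi> n) (G n)"
    and me: "\<And>n. \<phi> n \<in> borel_measurable (GM N)" "\<And>n. G n \<in> borel_measurable (GM N)"
    and b: "\<And>n p. p \<in> Gam N \<Longrightarrow> \<bar>\<phi> n p\<bar> \<le> C" "\<And>n p. p \<in> Gam N \<Longrightarrow> \<bar>G n p\<bar> \<le> C"
    and lim: "\<And>p. p \<in> Gam N \<Longrightarrow> (\<lambda>n. \<phi> n p) \<longlonglongrightarrow> \<phi>' p" "\<And>p. p \<in> Gam N \<Longrightarrow> (\<lambda>n. G n p) \<longlonglongrightarrow> G' p"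
  shows "mart \<phi>' G'"
  unfolding mart_def
proof (intro ballI allI impI, elim conjE)
  fix p s t \<Lambda> assume p: "p \<in> Gam N" and st: "0 \<le> s" "s \<le> t" and \<Lambda>: "\<Lambda> \<in> sets (F s)"
  interpret prob_space "P p" by (rule prob) fact
  define Z where "Z n w = indicator \<Lambda> w * (\<phi> n (X t w) - \<phi> n (X s w) - occ X (G n) s t w)" for n w
  define Z' where "Z' w = indicator \<Lambda> w * (\<phi>' (X t w) - \<phi>' (X s w) - occ X G' s t w)" for w
  have \<Lambda>P[measurable]: "\<Lambda> \<in> sets (P p)" using F_sub[OF \<Lambda>] .
  have [measurable]: "Z n \<in> borel_measurable (P p)" for n
  proof -
    have m\<phi>: "(\<lambda>w. \<phi> n (X r w)) \<in> borel_measurable (P p)" if "0 \<le> r" for r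
      by (rule measurable_compose[OF X_meas[OF that] me(1)])
    have mo: "occ X (G n) s t \<in> borel_measurable (P p)"
      by (rule F_meas[OF occ_measurable[OF X_cp me(2) b(2) st]])
    show ?thesis unfolding Z_def
      by (intro borel_measurable_times borel_measurable_diff borel_measurable_indicator \<Lambda>P m\<phi> mo) (use st in auto)
  qed
  have occl: "(\<lambda>n. occ X (G n) s t w) \<longlonglongrightarrow> occ X G' s t w" if w: "w \<in> \<Omega>" for w
    unfolding occ_def
  proof (rule integral_dominated_convergence[where w="\<lambda>u. indicator {s..t} u * C"])
    have im: "(\<lambda>u. indicator {s..t} u * G n (X u w)) \<in> borel_measurable lborel" for n
      using occ_integrable[OF X_cp me(2) w b(2) st(1)] by auto
    show im: "(\<lambda>u. indicator {s..t} u * G n (X u w)) \<in> borel_measurable lborel" for n by (rule im)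
    show "AE u in lborel. (\<lambda>n. indicator {s..t} u * G n (X u w)) \<longlonglongrightarrow> indicator {s..t} u * G' (X u w)"
      by (intro AE_I2 tendsto_mult_left lim X_Gam w)
    show "(\<lambda>u. indicator {s..t} u * G' (X u w)) \<in> borel_measurable lborel"
    proof (rule borel_measurable_LIMSEQ_real)
      show "(\<lambda>n. indicator {s..t} u * G n (X u w)) \<longlonglongrightarrow> indicator {s..t} u * G' (X u w)" for u
        by (rule tendsto_mult_left[OF lim(2)[OF X_Gam[OF w]]])
    qed (rule im)
    show "AE u in lborel. norm (indicator {s..t} u * G n (X u w)) \<le> indicator {s..t} u * C" for n
      using b(2)[OF X_Gam[OF w]] by (intro AE_I2) (auto simp: indicator_def)
  qed (use st in auto)
  have lZ: "(\<lambda>n. Z n w) \<longlonglongrightarrow> Z' w" if w: "w \<in> space (P p)" for w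
    unfolding Z_def Z'_def
    by (intro tendsto_mult_left tendsto_diff lim X_Gam occl space_PD[OF w])
  have bZ: "\<bar>Z n w\<bar> \<le> 2 * C + C * (t - s)" if w: "w \<in> space (P p)" for n w
    unfolding Z_def
  proof (rule abs_indicator_mult_le)
    note w' = space_PD[OF w]
    show "\<bar>\<phi> n (X t w) - \<phi> n (X s w) - occ X (G n) s t w\<bar> \<le> 2 * C + C * (t - s)"
      using b(1)[OF X_Gam[OF w'], of n t] b(1)[OF X_Gam[OF w'], of n s] occ_bound[OF X_cp me(2) w' b(2) st, of n]
      by linarith
  qed
  have "(\<lambda>n. integral\<^sup>L (P p) (Z n)) \<longlonglongrightarrow> integral\<^sup>L (P p) Z'"
  proof (rule integral_dominated_convergence[where w="\<lambda>_. 2 * C + C * (t - s)"])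
    show "Z' \<in> borel_measurable (P p)"
      by (rule borel_measurable_LIMSEQ_real[OF lZ]) auto
  qed (use lZ bZ in auto)
  moreover have "integral\<^sup>L (P p) (Z n) = 0" for n
    unfolding Z_def using m[of n] p st \<Lambda> unfolding mart_def by blast
  ultimately have "integral\<^sup>L (P p) Z' = 0" by (simp add: LIMSEQ_const_iff)
  then show "(\<integral>w. indicator \<Lambda> w * (\<phi>' (X t w) - \<phi>' (X s w) - occ X G' s t w) \<partial>P p) = 0"
    unfolding Z'_def .
qed

lemma \<sigma>_ge: "i < N \<Longrightarrow> x \<ge> 0 \<Longrightarrow> \<sigma> i x \<ge> \<sigma>0"
proof -
  assume i: "i < N" and x: "x \<ge> 0"
  show ?thesis
  proof (cases "x = 0")
    case True
    have "(\<sigma> i \<longlongrightarrow> \<sigma> i 0) (at 0 within {0..})"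
      using \<sigma>_cont i unfolding continuous_on_def by auto
    then have "(\<sigma> i \<longlongrightarrow> \<sigma> i 0) (at_right 0)" by (rule tendsto_within_subset) auto
    then have "\<sigma> i 0 \<ge> \<sigma>0"
    proof (rule tendsto_lowerbound)
      show "\<forall>\<^sub>F x in at_right 0. \<sigma>0 \<le> \<sigma> i x"
        using \<sigma>_low i by (intro eventually_at_right_less[THEN eventually_mono]) (auto intro: less_imp_le)
    qed (simp add: trivial_limit_at_right_real)
    then show ?thesis using True by simp
  next
    case False
    then show ?thesis using \<sigma>_low i x by (auto intro: less_imp_le)
  qed
qed

lemma \<sigma>2_pos: "i < N \<Longrightarrow> x \<ge> 0 \<Longrightarrow> (\<sigma> i x)\<^sup>2 > 0"
  using \<sigma>_ge[of i x] \<sigma>0 by (simp add: zero_less_power2)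

lemma coef_bound: "\<exists>K\<ge>0. \<forall>i<N. \<forall>x\<ge>0. (\<sigma> i x)\<^sup>2 / 2 \<le> K \<and> \<bar>b i x\<bar> \<le> K"
proof -
  obtain S where S: "S \<ge> 0" "bd N \<sigma> S"
    using edge_bound[of N \<sigma>] \<sigma>_cont unfolding bounded_real by (metis atLeast_iff image_eqI)
  obtain B where B: "B \<ge> 0" "bd N b B"
    using edge_bound[of N b] b_cont unfolding bounded_real by (metis atLeast_iff image_eqI)
  have "(\<sigma> i x)\<^sup>2 / 2 \<le> S\<^sup>2 + B \<and> \<bar>b i x\<bar> \<le> S\<^sup>2 + B" if "i < N" "x \<ge> 0" for i x
  proof -
    have "\<bar>\<sigma> i x\<bar> \<le> S" "\<bar>b i x\<bar> \<le> B" using S B that by (auto simp: bd_def)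
    moreover have "(\<sigma> i x)\<^sup>2 \<le> S\<^sup>2" using calculation(1) by (metis S(1) abs_le_square_iff abs_of_nonneg)
    moreover have "0 \<le> S\<^sup>2" "0 \<le> (\<sigma> i x)\<^sup>2" by simp_all
    ultimately show ?thesis using B(1) by linarith
  qed
  then show ?thesis using B(1) by (intro exI[of _ "S\<^sup>2 + B"]) auto
qed

lemma L_cont: "f \<in> C2 N \<Longrightarrow> i < N \<Longrightarrow> continuous_on {0..} (L f i)"
  unfolding Lop_def using C2D(4,5) \<sigma>_cont b_cont
  by (intro continuous_on_add continuous_on_mult continuous_on_divide continuous_on_power continuous_on_const) auto

text \<open>Compared with the domain of the generator, both the boundary condition and the
  continuity of \<open>L f\<close> across the vertex are dropped; the decay at infinity
  stays.\<close>

definition E :: "(nat \<Rightarrow> real \<Rightarrow> real) set" where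
  "E = {f. f \<in> C2 N \<and> f \<in> C0 N \<and> (\<forall>i<N. (L f i \<longlongrightarrow> 0) at_top)}"

text \<open>The weighted flux into the edges. The boundary condition with stickiness \<theta> says
  that it equals \<theta> times the generator at the vertex.\<close>

definition \<kappa> :: "(nat \<Rightarrow> real \<Rightarrow> real) \<Rightarrow> real" where
  "\<kappa> f = (\<Sum>i<N. \<rho> i * d1 (f i) 0)"

lemma C0_lim: "f \<in> C0 N \<Longrightarrow> i < N \<Longrightarrow> (f i \<longlongrightarrow> 0) at_top"
  unfolding C0_def by blast

lemma C0I:
  assumes "\<And>i j. i < N \<Longrightarrow> j < N \<Longrightarrow> f i 0 = f j 0" "\<And>i. i < N \<Longrightarrow> continuous_on {0..} (f i)"
    "\<And>i. i < N \<Longrightarrow> (f i \<longlongrightarrow> 0) at_top"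
  shows "f \<in> C0 N"
  unfolding C0_def using assms by blast

lemma E_D: "f \<in> E \<Longrightarrow> f \<in> C2 N" "f \<in> E \<Longrightarrow> f \<in> C0 N" "f \<in> E \<Longrightarrow> i < N \<Longrightarrow> (L f i \<longlongrightarrow> 0) at_top"
  unfolding E_def by blast+

lemma DL_E: "f \<in> D \<theta> \<Longrightarrow> f \<in> E"
  unfolding E_def using DL_D C0_lim by blast

lemma E_DL:
  assumes "f \<in> E" "\<And>i. i < N \<Longrightarrow> L f i 0 = l" "\<theta> * l = \<kappa> f"
  shows "f \<in> D \<theta>"
proof -
  have "L f \<in> C0 N"
    by (rule C0I) (use assms(2) L_cont[OF E_D(1)[OF assms(1)]] E_D(3)[OF assms(1)] in \<open>metis+\<close>)
  moreover have "L f 0 0 = l" using assms(2)[of 0] N1 by simp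
  ultimately show ?thesis using assms(3) E_D(1,2)[OF assms(1)] unfolding DL_def \<kappa>_def by simp
qed

definition pert :: "real \<Rightarrow> real \<Rightarrow> (nat \<Rightarrow> real) \<Rightarrow> (nat \<Rightarrow> real \<Rightarrow> real) \<Rightarrow> nat \<Rightarrow> real \<Rightarrow> real" where
  "pert n u v f i x = f i x + (u * bQ (n * x) / n + v i * bA (n * x) / n\<^sup>2)"

lemma bump_scaled_lim:
  fixes n :: real
  assumes "n > 0" "(g \<longlongrightarrow> 0) at_top"
  shows "((\<lambda>x. g (n * x)) \<longlongrightarrow> (0::real)) at_top"
  by (rule filterlim_compose[OF assms(2)], rule filterlim_tendsto_pos_mult_at_top[OF tendsto_const assms(1)])
    (rule filterlim_ident)

lemma pert:
  assumes f: "f \<in> E" and n: "n > 0"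
  shows "pert n u v f \<in> E"
    and "\<And>i. i < N \<Longrightarrow> d1 (pert n u v f i) 0 = d1 (f i) 0 + u"
    and "\<And>i x. i < N \<Longrightarrow> x \<ge> 0 \<Longrightarrow> L (pert n u v f) i x = L f i x +
      ((\<sigma> i x)\<^sup>2 / 2 * (u * n * bS (n * x) + v i * bC (n * x)) + b i x * (u * bR (n * x) + v i * bB (n * x) / n))"
    and "\<kappa> (pert n u v f) = \<kappa> f + u"
proof -
  note fE = E_D[OF f]
  note fC = C2D[OF fE(1)]
  let ?f = "pert n u v f"
  let ?f1 = "\<lambda>i x. d1 (f i) x + (u * bR (n * x) + v i * bB (n * x) / n)"
  let ?f2 = "\<lambda>i x. d1 (d1 (f i)) x + (u * n * bS (n * x) + v i * bC (n * x))"
  have ch: "((\<lambda>x. g (n * x)) has_real_derivative n * g' (n * x)) (at x within {0..})"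
    if "\<And>y S. (g has_real_derivative g' y) (at y within S)" for g g' x
  proof -
    have "((\<lambda>x. g (n * x)) has_real_derivative g' (n * x) * n) (at x within {0..})"
      by (rule DERIV_chain2[where f=g and g="\<lambda>x. n * x", OF that]) (auto intro!: derivative_eq_intros)
    then show ?thesis by (simp add: mult.commute)
  qed
  note ders = ch[OF bump_derivs(1)] ch[OF bump_derivs(2)] ch[OF bump_derivs(3)] ch[OF bump_derivs(4)]
  have 1: "?f i 0 = ?f j 0" if "i < N" "j < N" for i j
    using fC(6)[OF that] by (simp add: pert_def bump_0)
  have 2: "(?f i has_vector_derivative ?f1 i x) (at x within {0..})" if "i < N" "x \<ge> 0" for i x
  proof -
    have "((\<lambda>x. u * bQ (n * x) / n + v i * bA (n * x) / n\<^sup>2) has_real_derivative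
        u * (n * bR (n * x)) / n + v i * (n * bB (n * x)) / n\<^sup>2) (at x within {0..})"
      by (intro DERIV_add DERIV_cdivide DERIV_cmult ders)
    from DERIV_add[OF fC(1)[OF that, folded has_real_derivative_iff_has_vector_derivative] this]
    have "(?f i has_real_derivative ?f1 i x) (at x within {0..})"
      unfolding pert_def by (rule DERIV_cong) (use n in \<open>simp add: power2_eq_square\<close>)
    then show ?thesis by (simp add: has_real_derivative_iff_has_vector_derivative)
  qed
  have 3: "(?f1 i has_vector_derivative ?f2 i x) (at x within {0..})" if "i < N" "x \<ge> 0" for i x
  proof -
    have "((\<lambda>x. u * bR (n * x) + v i * bB (n * x) / n) has_real_derivative
        u * (n * bS (n * x)) + v i * (n * bC (n * x)) / n) (at x within {0..})"
      by (intro DERIV_add DERIV_cdivide DERIV_cmult ders)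
    from DERIV_add[OF fC(2)[OF that, folded has_real_derivative_iff_has_vector_derivative] this]
    have "(?f1 i has_real_derivative ?f2 i x) (at x within {0..})"
      by (rule DERIV_cong) (use n in simp)
    then show ?thesis by (simp add: has_real_derivative_iff_has_vector_derivative)
  qed
  have 4: "continuous_on {0..} (?f2 i)" if "i < N" for i
    by (intro continuous_intros fC(5)[OF that] continuous_on_compose2[OF bump_continuous(6)[of UNIV]]
        continuous_on_compose2[OF bump_continuous(3)[of UNIV]]) auto
  have C1: "?f \<in> C2 N" using 1 2 3 4 by (rule C2I(1))
  have Cd: "d1 (?f i) x = ?f1 i x" if "i < N" "x \<ge> 0" for i x using 1 2 3 4 that by (rule C2I(2))
  have Cdd: "d1 (d1 (?f i)) x = ?f2 i x" if "i < N" "x \<ge> 0" for i x using 1 2 3 4 that by (rule C2I(3))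
  show "d1 (?f i) 0 = d1 (f i) 0 + u" if "i < N" for i
    using Cd[OF that order_refl] by (simp add: bump_0)
  then show "\<kappa> ?f = \<kappa> f + u"
    using \<rho>_sum by (simp add: \<kappa>_def algebra_simps sum.distrib sum_distrib_left[symmetric])
  show Lf: "L ?f i x = L f i x + ((\<sigma> i x)\<^sup>2 / 2 * (u * n * bS (n * x) + v i * bC (n * x)) + b i x * (u * bR (n * x) + v i * bB (n * x) / n))"
    if "i < N" "x \<ge> 0" for i x
    unfolding Lop_def Cd[OF that] Cdd[OF that] by (simp add: algebra_simps)
  note sl = bump_scaled_lim[OF n]
  have "((\<lambda>x. L f i x + ((\<sigma> i x)\<^sup>2 / 2 * (u * n * bS (n * x) + v i * bC (n * x)) + b i x * (u * bR (n * x) + v i * bB (n * x) / n))) \<longlongrightarrow> 0) at_top"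
    if i: "i < N" for i
  proof -
    obtain K where K: "K \<ge> 0" "\<forall>i<N. \<forall>x\<ge>0. (\<sigma> i x)\<^sup>2 / 2 \<le> K \<and> \<bar>b i x\<bar> \<le> K" using coef_bound by blast
    have z: "((\<lambda>x. c x * g x) \<longlongrightarrow> 0) at_top" if "\<And>x. x \<ge> 0 \<Longrightarrow> \<bar>c x\<bar> \<le> K" "(g \<longlongrightarrow> 0) at_top" for c g :: "real \<Rightarrow> real"
    proof (rule Lim_null_comparison)
      show "\<forall>\<^sub>F x in at_top. norm (c x * g x) \<le> K * \<bar>g x\<bar>"
        using eventually_ge_at_top[of 0] by eventually_elim (auto simp: abs_mult intro!: mult_right_mono that(1))
      have "((\<lambda>x. K * \<bar>g x\<bar>) \<longlongrightarrow> K * \<bar>0\<bar>) at_top" by (intro tendsto_intros that(2))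
      then show "((\<lambda>x. K * \<bar>g x\<bar>) \<longlongrightarrow> 0) at_top" by simp
    qed
    have a: "((\<lambda>x. u * n * bS (n * x) + v i * bC (n * x)) \<longlongrightarrow> u * n * 0 + v i * 0) at_top"
      by (intro tendsto_intros sl bump_lim)
    have bb: "((\<lambda>x. u * bR (n * x) + v i * bB (n * x) / n) \<longlongrightarrow> u * 0 + v i * 0 / n) at_top"
      using n by (intro tendsto_intros sl bump_lim) simp
    have "((\<lambda>x. L f i x + ((\<sigma> i x)\<^sup>2 / 2 * (u * n * bS (n * x) + v i * bC (n * x)) + b i x * (u * bR (n * x) + v i * bB (n * x) / n))) \<longlongrightarrow> 0 + (0 + 0)) at_top"
      using K(2) i a bb by (intro tendsto_add fE(3)[OF i] z) auto
    then show ?thesis by simp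
  qed
  then have "(L ?f i \<longlongrightarrow> 0) at_top" if "i < N" for i
    using that by (subst tendsto_cong[OF eventually_mono[OF eventually_ge_at_top[of 0] Lf[OF that]]]) auto
  moreover have "?f \<in> C0 N"
  proof (rule C0I)
    show "?f i 0 = ?f j 0" if "i < N" "j < N" for i j by (rule 1[OF that])
    fix i assume i: "i < N"
    show "continuous_on {0..} (?f i)" by (rule C2D(3)[OF C1 i])
    have "((\<lambda>x. f i x + (u * bQ (n * x) / n + v i * bA (n * x) / n\<^sup>2)) \<longlongrightarrow> 0 + (u * 0 / n + v i * 0 / n\<^sup>2)) at_top"
      using n by (intro tendsto_intros C0_lim[OF fE(2) i] sl bump_lim) simp_all
    then show "(?f i \<longlongrightarrow> 0) at_top" by (simp add: pert_def[abs_def])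
  qed
  ultimately show "?f \<in> E" unfolding E_def using C1 by blast
qed

lemma E_L_bounded:
  assumes "f \<in> E"
  shows "\<exists>K\<ge>0. bd N f K \<and> bd N (L f) K"
proof -
  obtain K1 where K1: "K1 \<ge> 0" "bd N f K1" using C0_bounded[OF E_D(2)[OF assms]] by blast
  obtain K2 where K2: "K2 \<ge> 0" "bd N (L f) K2"
    using edge_bound[of N "L f"] bounded_on_atLeast[OF L_cont[OF E_D(1)[OF assms]] E_D(3)[OF assms]] by blast
  have "bd N f (max K1 K2)" "bd N (L f) (max K1 K2)" using K1 K2 by (fastforce simp: bd_def)+
  then show ?thesis using K1 by (intro exI[of _ "max K1 K2"]) auto
qed

lemma gev_L_meas: "f \<in> E \<Longrightarrow> gev (L f) \<in> borel_measurable (GM N)"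
  by (intro gev_measurable L_cont E_D(1))

text \<open>A bump of width \<open>1 / n\<close> moves the limits of \<open>L f\<close> along all
  edges to the one value that the sticky boundary condition asks for, without touching the slopes.
  The result lies in the domain. As \<open>n\<close> grows the bump leaves every point except the
  vertex, so the generators converge boundedly to the glued one.\<close>

lemma mart_E:
  assumes f: "f \<in> E"
  shows "mart (gev f) (glue (\<kappa> f / \<eta>) (gev (L f)))"
proof -
  \<comment> \<open>Solves \<open>(\<sigma> i 0)^2 / 2 * v i = \<kappa> f / \<eta> - L f i 0\<close>
    on each edge; the bump has second derivative 1 and slope 0 at the vertex.\<close>
  define v where "v i = (\<kappa> f / \<eta> - L f i 0) * 2 / (\<sigma> i 0)\<^sup>2" for i
  define g where "g n = pert (real (Suc n)) 0 v f" for n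
  have gE: "g n \<in> E" for n unfolding g_def by (rule pert(1)[OF f]) simp
  have Lg: "L (g n) i x = L f i x + ((\<sigma> i x)\<^sup>2 / 2 * (v i * bC (real (Suc n) * x)) + b i x * (v i * bB (real (Suc n) * x) / real (Suc n)))"
    if "i < N" "x \<ge> 0" for n i x
    unfolding g_def using pert(3)[OF f _ that, of "real (Suc n)" 0 v] by simp
  have Lg0: "L (g n) i 0 = \<kappa> f / \<eta>" if "i < N" for n i
  proof -
    have "(\<sigma> i 0)\<^sup>2 / 2 * v i = \<kappa> f / \<eta> - L f i 0" using \<sigma>2_pos[OF that, of 0] by (simp add: v_def)
    moreover have "L (g n) i 0 = L f i 0 + (\<sigma> i 0)\<^sup>2 / 2 * v i" using Lg[OF that order_refl, of n] by (simp add: bump_0)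
    ultimately show ?thesis by linarith
  qed
  have gD: "g n \<in> D \<eta>" for n
    using pert(4)[OF f, of "real (Suc n)" 0 v] \<eta> by (intro E_DL[OF gE Lg0]) (auto simp: g_def)
  obtain K where K: "K \<ge> 0" "bd N f K" "bd N (L f) K" using E_L_bounded[OF f] by blast
  obtain c where c: "c \<ge> 0" "\<forall>i<N. \<forall>x\<ge>0. (\<sigma> i x)\<^sup>2 / 2 \<le> c \<and> \<bar>b i x\<bar> \<le> c" using coef_bound by blast
  obtain V where V: "V \<ge> 0" "\<And>i. i < N \<Longrightarrow> \<bar>v i\<bar> \<le> V"
    using edge_bound[of N "\<lambda>i x. v i"] unfolding bd_def by (metis order_refl)
  \<comment> \<open>One bound for functions and generators: the diffusion term of the bump costs
    \<open>c * (V * 4)\<close>, its drift term \<open>c * (V * 2)\<close>, and its own size is at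
    most \<open>V\<close>.\<close>
  define M where "M = K + (c * (V * 4) + c * (V * 2)) + V"
  have n1: "real (Suc n) \<ge> 1" for n by simp
  have gb: "bd N (g n) M" for n
    unfolding bd_def
  proof (intro allI impI)
    fix i and x :: real assume ix: "i < N" "x \<ge> 0"
    have sq: "(1::real) \<le> (real (Suc n))\<^sup>2" by (rule one_le_power[OF n1])
    have "\<bar>v i * bA (real (Suc n) * x) / (real (Suc n))\<^sup>2\<bar> \<le> V * 1"
    proof -
      have "\<bar>v i * bA (real (Suc n) * x)\<bar> \<le> V * 1"
        unfolding abs_mult using V ix bump_bounds(1)[of "real (Suc n) * x"] by (intro mult_mono) auto
      moreover have "\<bar>v i * bA (real (Suc n) * x) / (real (Suc n))\<^sup>2\<bar> \<le> \<bar>v i * bA (real (Suc n) * x)\<bar>"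
        using sq by (simp add: divide_le_eq mult_le_cancel_left1 abs_divide del: of_nat_Suc)
      ultimately show ?thesis by linarith
    qed
    moreover have "\<bar>f i x\<bar> \<le> K" using K(2) ix by (auto simp: bd_def)
    moreover have "0 \<le> c * (V * 4) + c * (V * 2)" using c V by simp
    moreover have "g n i x = f i x + v i * bA (real (Suc n) * x) / (real (Suc n))\<^sup>2"
      by (simp add: g_def pert_def)
    ultimately show "\<bar>g n i x\<bar> \<le> M" unfolding M_def by linarith
  qed
  have Lgb: "bd N (L (g n)) M" for n
    unfolding bd_def
  proof (intro allI impI)
    fix i and x :: real assume ix: "i < N" "x \<ge> 0"
    have tri: "\<bar>p + (q + r)\<bar> \<le> K + (A + B) + V" if "\<bar>p\<bar> \<le> K" "\<bar>q\<bar> \<le> A" "\<bar>r\<bar> \<le> B" "0 \<le> V" for p q r A B :: real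
      using that by linarith
    define y where "y = real (Suc n) * x"
    have y: "y \<ge> 0" using ix by (simp add: y_def)
    have "\<bar>(\<sigma> i x)\<^sup>2 / 2 * (v i * bC y)\<bar> \<le> c * (V * 4)"
      unfolding abs_mult using c V ix bump_bounds(3)[OF y] by (intro mult_mono) auto
    moreover have "\<bar>v i * bB y / real (Suc n)\<bar> \<le> V * 2"
    proof -
      have "\<bar>v i * bB y\<bar> \<le> V * 2"
        unfolding abs_mult using V ix bump_bounds(2)[OF y] by (intro mult_mono) auto
      moreover have "\<bar>v i * bB y / real (Suc n)\<bar> \<le> \<bar>v i * bB y\<bar>"
        using n1[of n] by (simp add: divide_le_eq mult_le_cancel_left1 abs_divide del: of_nat_Suc)
      ultimately show ?thesis by linarith
    qed
    then have "\<bar>b i x * (v i * bB y / real (Suc n))\<bar> \<le> c * (V * 2)"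
      unfolding abs_mult[of "b i x"] using c ix V by (intro mult_mono) auto
    moreover have "\<bar>L f i x\<bar> \<le> K" using K(3) ix by (auto simp: bd_def)
    ultimately show "\<bar>L (g n) i x\<bar> \<le> M"
      unfolding Lg[OF ix] y_def[symmetric] M_def using V(1) by (intro tri)
  qed
  have sc: "(\<lambda>n. h (real (Suc n) * x)) \<longlonglongrightarrow> 0" if "x > 0" "(h \<longlongrightarrow> (0::real)) at_top" for x h
  proof (rule filterlim_compose[OF that(2)])
    show "filterlim (\<lambda>n. real (Suc n) * x) at_top sequentially"
      by (rule filterlim_at_top_mult_tendsto_pos[OF tendsto_const that(1)])
        (rule filterlim_compose[OF filterlim_real_sequentially filterlim_Suc])
  qed
  have inv: "(\<lambda>n. 1 / real (Suc n)) \<longlonglongrightarrow> 0" by (rule LIMSEQ_Suc[OF lim_1_over_n])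
  show ?thesis
  proof (rule mart_closed[where \<phi>="\<lambda>n. gev (g n)" and G="\<lambda>n. gev (L (g n))" and C=M])
    show "mart (gev (g n)) (gev (L (g n)))" for n by (rule mart_DL[OF gD])
    show "gev (g n) \<in> borel_measurable (GM N)" for n using DL_D(2)[OF gD] by (rule gev_meas)
    show "gev (L (g n)) \<in> borel_measurable (GM N)" for n by (rule gev_L_meas[OF gE])
    show "\<bar>gev (g n) p\<bar> \<le> M" "\<bar>gev (L (g n)) p\<bar> \<le> M" if "p \<in> Gam N" for n p
      by (rule gev_bd[OF gb that], rule gev_bd[OF Lgb that])
    fix p assume p: "p \<in> Gam N"
    then have pp: "fst p < N" "snd p \<ge> 0" by (auto elim: GamE)
    show "(\<lambda>n. gev (g n) p) \<longlonglongrightarrow> gev f p"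
    proof (cases "snd p = 0")
      case True
      then show ?thesis by (simp add: gev_def g_def pert_def bump_0)
    next
      case False
      then have x: "snd p > 0" using pp by simp
      have "(\<lambda>n. f (fst p) (snd p) + v (fst p) * bA (real (Suc n) * snd p) * (1 / real (Suc n) * (1 / real (Suc n))))
         \<longlonglongrightarrow> f (fst p) (snd p) + v (fst p) * 0 * (0 * 0)"
        by (intro tendsto_intros sc[OF x] bump_lim inv)
      then show ?thesis by (simp add: gev_def g_def pert_def power2_eq_square field_simps)
    qed
    show "(\<lambda>n. gev (L (g n)) p) \<longlonglongrightarrow> glue (\<kappa> f / \<eta>) (gev (L f)) p"
    proof (cases "snd p = 0")
      case True
      then have "p = vtx" using snd_eq_0_iff[OF p] by simp
      then show ?thesis using Lg0[of 0] N1 by (simp add: glue_def gev_def vtx_def)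
    next
      case False
      then have x: "snd p > 0" "p \<noteq> vtx" using pp by (auto simp: vtx_def)
      have "(\<lambda>n. L f (fst p) (snd p) + ((\<sigma> (fst p) (snd p))\<^sup>2 / 2 * (v (fst p) * bC (real (Suc n) * snd p)) + b (fst p) (snd p) * (v (fst p) * bB (real (Suc n) * snd p) * (1 / real (Suc n)))))
         \<longlonglongrightarrow> L f (fst p) (snd p) + ((\<sigma> (fst p) (snd p))\<^sup>2 / 2 * (v (fst p) * 0) + b (fst p) (snd p) * (v (fst p) * 0 * 0))"
        by (intro tendsto_intros sc[OF x(1)] bump_lim inv) simp
      then show ?thesis using x(2) by (simp add: gev_def glue_def Lg[OF pp])
    qed
  qed
qed

text \<open>
  The choice of the second derivatives that compensates a unit change of the slopes, so that the generator
  at the vertex stays the same.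
\<close>

definition flux_corr :: "real \<Rightarrow> nat \<Rightarrow> real" where
  "flux_corr n i = 2 * n - 2 * b i 0 / (\<sigma> i 0)\<^sup>2"

text \<open>A slope change \<open>u\<close> enters the generator at the vertex through the drift and
  through \<open>bS 0 = - 2\<close>, which is amplified by \<open>n\<close>. The correction solves
  the resulting linear equation for the coefficient of \<open>bC 0 = 1\<close>.\<close>

lemma pert_flux_corr:
  assumes f: "f \<in> E" and n: "n > 0" and i: "i < N"
  shows "L (pert n u (\<lambda>i. u * flux_corr n i) f) i 0 = L f i 0"
  using pert(3)[OF f n i order_refl, of u "\<lambda>i. u * flux_corr n i"] \<sigma>2_pos[OF i order_refl]
  by (simp add: bump_0 flux_corr_def field_simps)

lemma zero_E: "(\<lambda>i x. 0) \<in> E" "L (\<lambda>i x. 0) i x = 0" "\<kappa> (\<lambda>i x. 0) = 0" if "x \<ge> 0"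
proof -
  have C: "(\<lambda>i x. 0) \<in> C2 N" "\<And>i x. i < N \<Longrightarrow> x \<ge> 0 \<Longrightarrow> d1 ((\<lambda>i x. 0) i) x = 0" "\<And>i x. i < N \<Longrightarrow> x \<ge> 0 \<Longrightarrow> d1 (d1 ((\<lambda>i x. 0) i)) x = 0"
    using C2I[of N "\<lambda>i x. 0" "\<lambda>i x. 0" "\<lambda>i x. 0"] by auto
  have d: "d1 (\<lambda>x. 0) x = 0" if "x \<ge> 0" for x by (rule d1I[OF _ that]) simp
  have dd: "d1 (d1 (\<lambda>x. 0)) x = 0" if "x \<ge> 0" for x
    using d1_cong[of "d1 (\<lambda>x. 0)" "\<lambda>x. 0" x] d that by simp
  have L0: "L (\<lambda>i x. 0) i x = 0" if "x \<ge> 0" for i x using d dd that by (simp add: Lop_def)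
  show "L (\<lambda>i x. 0) i x = 0" by (rule L0[OF that])
  show "\<kappa> (\<lambda>i x. 0) = 0" using d by (simp add: \<kappa>_def)
  have "(L (\<lambda>i x. 0) i \<longlongrightarrow> 0) at_top" for i
    by (subst tendsto_cong[OF eventually_mono[OF eventually_ge_at_top[of 0] L0]]) auto
  moreover have "(\<lambda>i x. 0) \<in> C0 N" by (rule C0I) auto
  ultimately show "(\<lambda>i x. 0) \<in> E" unfolding E_def using C(1) by blast
qed

text \<open>The zero function with its slopes raised to 1 and the generator at the vertex kept at 0.
  With unit flux, the vertex part of its compensator is exactly \<open>S / \<eta>\<close>, the
  candidate for the local time.\<close>

definition flux_fn :: "nat \<Rightarrow> real \<Rightarrow> real" where
  "flux_fn = pert 1 1 (\<lambda>i. 1 * flux_corr 1 i) (\<lambda>i x. 0)"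

lemma flux_fn: "flux_fn \<in> E" "\<kappa> flux_fn = 1" "\<And>i. i < N \<Longrightarrow> L flux_fn i 0 = 0" "flux_fn i 0 = 0"
  using pert(1,4)[OF zero_E(1)[OF order_refl], of 1 1 "\<lambda>i. 1 * flux_corr 1 i"] zero_E(3)[OF order_refl]
    pert_flux_corr[OF zero_E(1)[OF order_refl], of 1 _ 1] zero_E(2)[OF order_refl]
  by (simp_all add: flux_fn_def) (simp add: pert_def bump_0)

lemma flux_fn_notin: "flux_fn \<notin> D \<eta>"
  using flux_fn DL_D(4)[of flux_fn \<eta>] N1 by (auto simp: \<kappa>_def)

text \<open>The sticky resolvent gives an approximation whose generator is already single-valued at
  the vertex. A slope perturbation then cancels its flux while keeping that vertex value, so the
  result satisfies the nonsticky condition.\<close>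

lemma D0_dense:
  assumes f: "f \<in> C0 N" and e: "e > 0"
  shows "\<exists>g\<in>D 0. \<forall>i<N. \<forall>x\<ge>0. \<bar>g i x - f i x\<bar> \<le> e"
proof -
  obtain h where h: "h > 0" "\<forall>i<N. \<forall>x\<ge>0. \<bar>J h f i x - f i x\<bar> \<le> e / 2"
    using J_approx[OF f, of "e / 2"] e by auto
  define g where "g = J h f"
  have gD: "g \<in> D \<eta>" unfolding g_def by (rule J_DL[OF f h(1)])
  note gE = DL_E[OF gD]
  define u where "u = - \<kappa> g"
  obtain W where W: "W \<ge> 0" "\<And>i. i < N \<Longrightarrow> \<bar>2 * b i 0 / (\<sigma> i 0)\<^sup>2\<bar> \<le> W"
    using edge_bound[of N "\<lambda>i x. 2 * b i 0 / (\<sigma> i 0)\<^sup>2"] unfolding bd_def by (metis order_refl)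
  \<comment> \<open>Although the correction of the second derivatives grows like \<open>n\<close>,
    it is divided by the square of \<open>n\<close>. The whole perturbation is at most
    \<open>\<bar>u\<bar> * (3 + W) / n\<close>, to be made smaller than
    \<open>e / 2\<close>.\<close>
  define n where "n = max 1 (2 * \<bar>u\<bar> * (3 + W) / e)"
  have n: "n \<ge> 1" "2 * \<bar>u\<bar> * (3 + W) / e \<le> n" by (auto simp: n_def)
  define k where "k = pert n u (\<lambda>i. u * flux_corr n i) g"
  have kD: "k \<in> D 0"
  proof (rule E_DL)
    show "k \<in> E" unfolding k_def using n by (intro pert(1)[OF gE]) simp
    show "L k i 0 = L g 0 0" if "i < N" for i
      unfolding k_def using n pert_flux_corr[OF gE _ that, of n u] C0_compat[OF DL_D(3)[OF gD] that] N1 by simp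
    show "0 * L g 0 0 = \<kappa> k" unfolding k_def using n pert(4)[OF gE, of n u "\<lambda>i. u * flux_corr n i"] by (simp add: u_def)
  qed
  have "\<bar>k i x - f i x\<bar> \<le> e" if ix: "i < N" "x \<ge> 0" for i x
  proof -
    have y: "n * x \<ge> 0" using n ix by simp
    have 1: "\<bar>u * bQ (n * x) / n\<bar> \<le> \<bar>u\<bar> / n"
      using n bump_bounds(4)[OF y] by (simp add: abs_mult divide_right_mono mult_left_le)
    have "\<bar>flux_corr n i\<bar> \<le> 2 * n + W" using W(2)[OF ix(1)] n unfolding flux_corr_def by linarith
    also have "\<dots> \<le> (2 + W) * n" using W(1) n mult_left_mono[of 1 n W] by (simp add: algebra_simps)
    finally have "\<bar>u * flux_corr n i * bA (n * x)\<bar> \<le> \<bar>u\<bar> * ((2 + W) * n) * 1"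
      unfolding abs_mult using bump_bounds(1)[OF y] W(1) n by (intro mult_mono) auto
    then have "\<bar>u * flux_corr n i * bA (n * x)\<bar> / n\<^sup>2 \<le> \<bar>u\<bar> * ((2 + W) * n) / n\<^sup>2"
      by (intro divide_right_mono) auto
    then have 2: "\<bar>u * flux_corr n i * bA (n * x) / n\<^sup>2\<bar> \<le> \<bar>u\<bar> * (2 + W) / n"
      using n by (simp add: abs_divide power2_eq_square)
    have "\<bar>k i x - g i x\<bar> \<le> \<bar>u\<bar> / n + \<bar>u\<bar> * (2 + W) / n"
      using 1 2 unfolding k_def pert_def by linarith
    also have "\<dots> = \<bar>u\<bar> * (3 + W) / n" by (simp add: add_divide_distrib[symmetric] algebra_simps)
    also have "\<dots> \<le> e / 2" using n e by (simp add: field_simps)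
    finally show ?thesis using h(2) ix unfolding g_def by (smt (verit) field_sum_of_halves)
  qed
  then show ?thesis using kD by blast
qed

section \<open>The clock off the vertex\<close>

definition G1 :: "point \<Rightarrow> real" where "G1 = glue 0 (\<lambda>_. 1)"
definition Gv :: "point \<Rightarrow> real" where "Gv = glue 1 (\<lambda>_. 0)"

definition A :: "real \<Rightarrow> 'w \<Rightarrow> real" where "A t w = occ X G1 0 t w"
definition S :: "real \<Rightarrow> 'w \<Rightarrow> real" where "S t w = occ X Gv 0 t w"

lemma G_meas: "G1 \<in> borel_measurable (GM N)" "Gv \<in> borel_measurable (GM N)"
  unfolding G1_def Gv_def by (auto intro!: glue_measurable)

lemma G_bound: "\<bar>G1 p\<bar> \<le> 1" "\<bar>Gv p\<bar> \<le> 1" "0 \<le> G1 p" "0 \<le> Gv p"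
  by (auto simp: G1_def Gv_def glue_def)

lemma occ_const: "s \<le> t \<Longrightarrow> occ X (\<lambda>_. 1) s t w = t - s"
  by (simp add: occ_def)

lemma G1_Gv: "w \<in> \<Omega> \<Longrightarrow> 0 \<le> s \<Longrightarrow> s \<le> t \<Longrightarrow> occ X G1 s t w + occ X Gv s t w = t - s"
proof -
  assume w: "w \<in> \<Omega>" and st: "0 \<le> s" "s \<le> t"
  have "(\<lambda>p. 1 * G1 p + 1 * Gv p) = (\<lambda>_. 1)" by (auto simp: fun_eq_iff G1_def Gv_def glue_def)
  then show ?thesis
    using occ_lin[OF X_cp G_meas w G_bound(1,2) st(1), of 1 1 t] occ_const[OF st(2)] by simp
qed

lemma occ_glue:
  assumes w: "w \<in> \<Omega>" and G: "G \<in> borel_measurable (GM N)" "\<And>p. p \<in> Gam N \<Longrightarrow> \<bar>G p\<bar> \<le> C" and s: "0 \<le> s"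
  shows "occ X (glue c G) s t w = occ X (glue 0 G) s t w + c * occ X Gv s t w"
proof -
  have "(\<lambda>p. 1 * glue 0 G p + c * Gv p) = glue c G" by (auto simp: fun_eq_iff Gv_def glue_def)
  moreover have "\<bar>glue 0 G p\<bar> \<le> \<bar>C\<bar>" if "p \<in> Gam N" for p using G(2)[OF that] by (auto simp: glue_def)
  ultimately show ?thesis
    using occ_lin[OF X_cp glue_measurable[OF G(1)] G_meas(2) w _ G_bound(2) s, of 0 "\<bar>C\<bar>" 1 c t] by simp
qed

lemma occ_nonneg:
  assumes w: "w \<in> \<Omega>" and "0 \<le> s" "\<And>p. p \<in> Gam N \<Longrightarrow> 0 \<le> G p"
  shows "0 \<le> occ X G s t w"
  unfolding occ_def using assms X_Gam[OF w] by (intro integral_nonneg_AE AE_I2) (auto simp: indicator_def)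

text \<open>An integral that ignores the vertex is controlled by the clock instead of by elapsed
  time. This is what gives bounds that survive the removal of the truncation
  \<open>h\<close>.\<close>

lemma occ_glue_bound:
  assumes w: "w \<in> \<Omega>" and G: "G \<in> borel_measurable (GM N)" "\<And>p. p \<in> Gam N \<Longrightarrow> \<bar>G p\<bar> \<le> C" and s: "0 \<le> s"
  shows "\<bar>occ X (glue 0 G) s t w\<bar> \<le> C * occ X G1 s t w"
proof -
  have C0: "0 \<le> C" using G(2)[OF vtx_in_Gam[OF N1]] by simp
  have b: "\<bar>glue 0 G p\<bar> \<le> C" if "p \<in> Gam N" for p using G(2)[OF that] C0 by (auto simp: glue_def)
  have i: "integrable lborel (\<lambda>u. indicator {s..t} u * glue 0 G (X u w))"
    by (rule occ_integrable[OF X_cp glue_measurable[OF G(1)] w b s])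
  have i1: "integrable lborel (\<lambda>u. indicator {s..t} u * G1 (X u w))"
    by (rule occ_integrable[OF X_cp G_meas(1) w G_bound(1) s])
  have "\<bar>occ X (glue 0 G) s t w\<bar> \<le> (\<integral>u. C * (indicator {s..t} u * G1 (X u w)) \<partial>lborel)"
    unfolding occ_def
  proof (rule integral_abs_le[OF i])
    show "integrable lborel (\<lambda>u. C * (indicator {s..t} u * G1 (X u w)))" using i1 by simp
    fix u show "\<bar>indicator {s..t} u * glue 0 G (X u w)\<bar> \<le> C * (indicator {s..t} u * G1 (X u w))"
      using G(2)[OF X_Gam[OF w], of u] by (auto simp: indicator_def glue_def G1_def)
  qed
  then show ?thesis by (simp add: occ_def)
qed

lemma A_diff: "w \<in> \<Omega> \<Longrightarrow> 0 \<le> s \<Longrightarrow> s \<le> t \<Longrightarrow> A t w - A s w = occ X G1 s t w"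
  using occ_add[OF X_cp G_meas(1) _ G_bound(1), of w 0 s t] by (simp add: A_def)

lemma S_diff: "w \<in> \<Omega> \<Longrightarrow> 0 \<le> s \<Longrightarrow> s \<le> t \<Longrightarrow> S t w - S s w = occ X Gv s t w"
  using occ_add[OF X_cp G_meas(2) _ G_bound(2), of w 0 s t] by (simp add: S_def)

lemma A_S: "w \<in> \<Omega> \<Longrightarrow> 0 \<le> t \<Longrightarrow> A t w + S t w = t"
  using G1_Gv[of w 0 t] by (simp add: A_def S_def)

lemma A_mono: "w \<in> \<Omega> \<Longrightarrow> 0 \<le> s \<Longrightarrow> s \<le> t \<Longrightarrow> A s w \<le> A t w"
  using A_diff[of w s t] occ_nonneg[of w s G1 t] G_bound(3) by force

lemma S_mono: "w \<in> \<Omega> \<Longrightarrow> 0 \<le> s \<Longrightarrow> s \<le> t \<Longrightarrow> S s w \<le> S t w"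
  using S_diff[of w s t] occ_nonneg[of w s Gv t] G_bound(4) by force

lemma A_0: "A 0 w = 0"
proof -
  have "A 0 w = (\<integral>u. G1 (X 0 w) * indicator {0::real} u \<partial>lborel)"
    unfolding A_def occ_def by (rule Bochner_Integration.integral_cong[OF refl]) (auto simp: indicator_def)
  then show ?thesis by simp
qed

lemma A_nonneg: "w \<in> \<Omega> \<Longrightarrow> 0 \<le> t \<Longrightarrow> 0 \<le> A t w"
  using A_mono[of w 0 t] A_0 by simp

lemma A_continuous: "w \<in> \<Omega> \<Longrightarrow> continuous_on {0..} (\<lambda>t. A t w)"
  unfolding A_def by (rule occ_continuous[OF X_cp G_meas(1) _ G_bound(1)]) auto

lemma S_continuous: "w \<in> \<Omega> \<Longrightarrow> continuous_on {0..} (\<lambda>t. S t w)"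
  unfolding S_def by (rule occ_continuous[OF X_cp G_meas(2) _ G_bound(2)]) auto

lemma A_F: "0 \<le> t \<Longrightarrow> A t \<in> borel_measurable (F t)"
  unfolding A_def using occ_measurable[OF X_cp G_meas(1) G_bound(1), of 0 t] by (simp add: fun_eq_iff[symmetric])

lemma S_F: "0 \<le> t \<Longrightarrow> S t \<in> borel_measurable (F t)"
  unfolding S_def using occ_measurable[OF X_cp G_meas(2) G_bound(2), of 0 t] by (simp add: fun_eq_iff[symmetric])

lemma F_meas_mono: "f \<in> borel_measurable (F s) \<Longrightarrow> s \<le> t \<Longrightarrow> f \<in> borel_measurable (F t)"
  using natfilt_mono[of s t P X] by (auto simp: measurable_def subset_iff)

lemma snd_path: "w \<in> \<Omega> \<Longrightarrow> continuous_on {0..} (\<lambda>t. snd (X t w))"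
proof -
  assume w: "w \<in> \<Omega>"
  have "continuous_on {0..} (\<lambda>t. gev (\<lambda>i x. x) (X t w))"
    using X_cp w X_Gam[OF w] by (intro continuous_on_gev_path[of _ N]) (auto simp: cprocess_def intro: continuous_intros)
  then show ?thesis by (simp add: gev_def)
qed

text \<open>By continuity a visit off the vertex lasts for an interval of positive length, during
  which the clock runs at unit speed.\<close>

lemma A_const_imp_vtx:
  assumes w: "w \<in> \<Omega>" and q: "0 \<le> q" "q < r" and eq: "A q w = A r w" and s: "s \<in> {q..r}"
  shows "X s w = vtx"
proof (rule ccontr)
  assume "X s w \<noteq> vtx"
  then have pos: "snd (X s w) > 0"
    using snd_eq_0_iff[OF X_Gam[OF w]] X_Gam[OF w, of s] by (force elim: GamE)
  obtain d where d: "d > 0" "\<And>u. u \<ge> 0 \<Longrightarrow> \<bar>u - s\<bar> < d \<Longrightarrow> \<bar>snd (X u w) - snd (X s w)\<bar> < snd (X s w)"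
  proof -
    have "s \<in> {0..}" using s q by simp
    then have "\<exists>d>0. \<forall>u\<in>{0..}. dist u s < d \<longrightarrow> dist (snd (X u w)) (snd (X s w)) < snd (X s w)"
      using snd_path[OF w] pos unfolding continuous_on_iff by blast
    then show ?thesis using that by (auto simp: dist_real_def)
  qed
  define a c where "a = max q (s - d / 2)" and "c = min r (s + d / 2)"
  have ac: "0 \<le> a" "a < c" "q \<le> a" "c \<le> r" using q s d(1) by (auto simp: a_def c_def)
  have nv: "X u w \<noteq> vtx" if "u \<in> {a..c}" for u
  proof -
    have "\<bar>snd (X u w) - snd (X s w)\<bar> < snd (X s w)"
      using that ac d(1) by (intro d(2)) (auto simp: a_def c_def abs_less_iff)
    then show ?thesis by (auto simp: vtx_def)
  qed
  have "occ X G1 a c w = (\<integral>u. indicator {a..c} u \<partial>lborel)"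
    unfolding occ_def using nv by (intro Bochner_Integration.integral_cong) (auto simp: G1_def glue_def indicator_def)
  also have "\<dots> = c - a" using ac by simp
  finally have "A c w - A a w = c - a" using A_diff[OF w, of a c] ac by simp
  moreover have "A c w \<le> A r w" "A q w \<le> A a w" using ac q by (auto intro!: A_mono[OF w])
  ultimately show False using eq ac by simp
qed

text \<open>
  The truncation at \<open>h\<close> makes \<open>T q K h\<close> a bounded time. It agrees with the
  inverse of the clock \<open>A\<close> once \<open>h\<close> is large.
\<close>

definition T :: "real \<Rightarrow> real \<Rightarrow> real \<Rightarrow> 'w \<Rightarrow> real" where
  "T q K h w = Inf {s \<in> {q..h}. A s w > A q w + K \<or> s = h}"

lemma T_in:
  assumes "q \<le> h"
  shows "T q K h w \<in> {q..h}"
proof -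
  let ?U = "{s \<in> {q..h}. A s w > A q w + K \<or> s = h}"
  have "h \<in> ?U" using assms by simp
  then have "Inf ?U \<le> h" "q \<le> Inf ?U"
    by (auto intro!: cInf_lower cInf_greatest bdd_belowI[of _ q])
  then show ?thesis by (simp add: T_def)
qed

text \<open>If the level is exceeded at \<open>s\<close>, continuity of the clock provides an
  earlier time at which it is already exceeded. Hence the strict event is decided at time
  \<open>s\<close>, and no right-continuity of the filtration is required.\<close>

lemma T_less:
  assumes w: "w \<in> \<Omega>" and q: "0 \<le> q" "q \<le> s" "s \<le> h" and K: "K \<ge> 0"
  shows "T q K h w < s \<longleftrightarrow> A s w > A q w + K"
proof
  let ?U = "{s \<in> {q..h}. A s w > A q w + K \<or> s = h}"
  assume "T q K h w < s"
  then obtain u where u: "u \<in> ?U" "u < s"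
    unfolding T_def using q by (subst (asm) cInf_less_iff) (auto intro: bdd_belowI[of _ q])
  then have "A q w + K < A u w" using q by auto
  also have "A u w \<le> A s w" using u q by (intro A_mono[OF w]) auto
  finally show "A s w > A q w + K" .
next
  let ?U = "{s \<in> {q..h}. A s w > A q w + K \<or> s = h}"
  assume gt: "A s w > A q w + K"
  then have qs: "q < s" using K q by (cases "q = s") auto
  have "\<exists>d>0. \<forall>u\<in>{0..}. dist u s < d \<longrightarrow> dist (A u w) (A s w) < A s w - (A q w + K)"
  proof -
    have "s \<in> {0..}" using q by simp
    then show ?thesis using A_continuous[OF w] gt unfolding continuous_on_iff by (metis diff_gt_0_iff_gt)
  qed
  then obtain d where d: "d > 0" "\<And>u. u \<ge> 0 \<Longrightarrow> \<bar>u - s\<bar> < d \<Longrightarrow> \<bar>A u w - A s w\<bar> < A s w - (A q w + K)"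
    by (auto simp: dist_real_def)
  define u where "u = max q (s - d / 2)"
  have u: "q \<le> u" "u < s" "\<bar>u - s\<bar> < d" using qs d(1) by (auto simp: u_def)
  then have "\<bar>A u w - A s w\<bar> < A s w - (A q w + K)" using q by (intro d(2)) auto
  then have "A u w > A q w + K" by linarith
  then have "u \<in> ?U" using u q by auto
  then have "Inf ?U \<le> u" by (intro cInf_lower) (auto intro: bdd_belowI[of _ q])
  then show "T q K h w < s" using u by (simp add: T_def)
qed

lemma A_T_le:
  assumes w: "w \<in> \<Omega>" and q: "0 \<le> q" "q \<le> h" and K: "K \<ge> 0"
  shows "A (T q K h w) w \<le> A q w + K"
  using T_less[OF w q(1) _ _ K, of "T q K h w" h] T_in[OF q(2), of K w] by auto

lemma T_F:
  assumes q: "0 \<le> q" "q \<le> s" "s \<le> h" and K: "K \<ge> 0"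
  shows "{w \<in> \<Omega>. T q K h w < s} \<in> sets (F s)"
proof -
  have [measurable]: "A s \<in> borel_measurable (F s)" "A q \<in> borel_measurable (F s)"
    using A_F[of s] F_meas_mono[OF A_F[OF q(1)] q(2)] q by auto
  have "{w \<in> \<Omega>. T q K h w < s} = {w \<in> space (F s). A q w + K < A s w}"
    using T_less[OF _ q K] by auto
  also have "\<dots> \<in> sets (F s)" by measurable
  finally show ?thesis .
qed

lemma T_meas:
  assumes q: "0 \<le> q" "q \<le> h" and K: "K \<ge> 0"
  shows "T q K h \<in> borel_measurable (P p)"
  unfolding borel_measurable_iff_less
proof
  fix a
  show "{w \<in> space (P p). T q K h w < a} \<in> sets (P p)"
  proof (cases "a < q")
    case True
    have "\<not> T q K h w < a" for w using T_in[OF q(2), of K w] True by auto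
    then have "{w \<in> space (P p). T q K h w < a} = {}" by blast
    then show ?thesis by (simp only: sets.empty_sets)
  next
    case False
    show ?thesis
    proof (cases "a > h")
      case True
      have "T q K h w < a" for w using T_in[OF q(2), of K w] True by auto
      then have "{w \<in> space (P p). T q K h w < a} = space (P p)" by blast
      then show ?thesis by (simp only: sets.top)
    next
      case False
      then show ?thesis using F_sub[OF T_F[OF q(1) _ _ K, of a h], of p] \<open>\<not> a < q\<close> unfolding space_P[of p] by simp
    qed
  qed
qed

section \<open>Optional stopping of bounded martingales at clock times\<close>

definition nice :: "(point \<Rightarrow> real) \<Rightarrow> (point \<Rightarrow> real) \<Rightarrow> real \<Rightarrow> bool" where
  "nice \<phi> G C \<longleftrightarrow> mart \<phi> G \<and> \<phi> \<in> borel_measurable (GM N) \<and> G \<in> borel_measurable (GM N) \<and>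
     (\<forall>p\<in>Gam N. \<bar>\<phi> p\<bar> \<le> C \<and> \<bar>G p\<bar> \<le> C) \<and> (\<forall>w\<in>\<Omega>. continuous_on {0..} (\<lambda>s. \<phi> (X s w)))"

lemma niceD:
  assumes "nice \<phi> G C"
  shows "mart \<phi> G" "\<phi> \<in> borel_measurable (GM N)" "G \<in> borel_measurable (GM N)"
    "\<And>p. p \<in> Gam N \<Longrightarrow> \<bar>\<phi> p\<bar> \<le> C" "\<And>p. p \<in> Gam N \<Longrightarrow> \<bar>G p\<bar> \<le> C"
    "\<And>w. w \<in> \<Omega> \<Longrightarrow> continuous_on {0..} (\<lambda>s. \<phi> (X s w))"
  using assms unfolding nice_def by blast+

lemma nice_E:
  assumes f: "f \<in> E"
  shows "\<exists>C\<ge>0. nice (gev f) (glue (\<kappa> f / \<eta>) (gev (L f))) C \<and> bd N f C \<and> bd N (L f) C"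
proof -
  obtain K where K: "K \<ge> 0" "bd N f K" "bd N (L f) K" using E_L_bounded[OF f] by blast
  define C where "C = max K \<bar>\<kappa> f / \<eta>\<bar>"
  have "nice (gev f) (glue (\<kappa> f / \<eta>) (gev (L f))) C"
    unfolding nice_def
  proof (intro conjI ballI)
    show "mart (gev f) (glue (\<kappa> f / \<eta>) (gev (L f)))" by (rule mart_E[OF f])
    show "gev f \<in> borel_measurable (GM N)" by (rule gev_meas[OF E_D(2)[OF f]])
    show "glue (\<kappa> f / \<eta>) (gev (L f)) \<in> borel_measurable (GM N)" by (rule glue_measurable[OF gev_L_meas[OF f]])
    show "\<bar>gev f p\<bar> \<le> C" if "p \<in> Gam N" for p using gev_bd[OF K(2) that] by (simp add: C_def)
    show "\<bar>glue (\<kappa> f / \<eta>) (gev (L f)) p\<bar> \<le> C" if "p \<in> Gam N" for p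
      using gev_bd[OF K(3) that] by (auto simp: C_def glue_def)
    show "continuous_on {0..} (\<lambda>s. gev f (X s w))" if "w \<in> \<Omega>" for w by (rule gev_path[OF E_D(2)[OF f] that])
  qed
  moreover have "bd N f C" "bd N (L f) C" using K(2,3) by (fastforce simp: bd_def C_def)+
  ultimately show ?thesis using K(1) by (intro exI[of _ C]) (auto simp: C_def)
qed

text \<open>The adaptedness assumption \<open>ad\<close> allows null sets: events of the
  time-changed process agree with events known to \<open>X\<close> only on almost every
  path.\<close>

lemma stopped_martingale:
  assumes n: "nice \<phi> G C" and p: "p \<in> Gam N" and q: "0 \<le> q" "q \<le> h"
    and T: "U \<in> borel_measurable (P p)" "\<And>w. w \<in> \<Omega> \<Longrightarrow> U w \<in> {q..h}"
    and \<Lambda>: "\<Lambda> \<in> sets (P p)"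
    and ad: "\<And>s. s \<in> {q..h} \<Longrightarrow> \<exists>B\<in>sets (F s). AE w in P p. w \<in> \<Lambda> \<and> U w < s \<longleftrightarrow> w \<in> B"
  shows "(\<integral>w. indicator \<Lambda> w * (\<phi> (X (U w) w) - occ X G 0 (U w) w) \<partial>P p)
       = (\<integral>w. indicator \<Lambda> w * (\<phi> (X h w) - occ X G 0 h w) \<partial>P p)"
proof -
  interpret prob_space "P p" by (rule prob) fact
  note nD = niceD[OF n]
  define M where "M s w = \<phi> (X s w) - occ X G 0 s w" for s w
  have C0: "0 \<le> C" using nD(4)[OF p] by simp
  have Mm: "M s \<in> borel_measurable (P p)" if "s \<in> {q..h}" for s
    unfolding M_def using that q
    by (intro borel_measurable_diff measurable_compose[OF X_meas nD(2)] F_meas[OF occ_measurable[OF X_cp nD(3,5)]]) auto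
  have Mb: "\<bar>M s w\<bar> \<le> C + C * h" if "s \<in> {q..h}" "w \<in> space (P p)" for s w
  proof -
    note w = space_PD[OF that(2)]
    have "\<bar>occ X G 0 s w\<bar> \<le> C * (s - 0)" using that q by (intro occ_bound[OF X_cp nD(3) w nD(5)]) auto
    also have "\<dots> \<le> C * h" using that C0 by (auto intro: mult_left_mono)
    finally show ?thesis unfolding M_def using nD(4)[OF X_Gam[OF w], of s] by linarith
  qed
  have Mi: "integrable (P p) (\<lambda>w. indicator B w * M s w)" if "s \<in> {q..h}" "B \<in> sets (P p)" for s B
  proof (rule integrable_const_bound[where B="C + C * h"])
    show "AE w in P p. norm (indicator B w * M s w) \<le> C + C * h"
      unfolding real_norm_def by (intro AE_I2 abs_indicator_mult_le Mb that)
  qed (intro borel_measurable_times borel_measurable_indicator that Mm)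
  have "(\<integral>w. indicator \<Lambda> w * M (U w) w \<partial>P p) = (\<integral>w. indicator \<Lambda> w * M h w \<partial>P p)"
  proof (rule optional_stopping[OF finite_measure_axioms q(2) Mm Mb _ T(1) _ \<Lambda>])
    show "continuous_on {q..h} (\<lambda>s. M s w)" if "w \<in> space (P p)" for w
      unfolding M_def using q(1)
      by (intro continuous_on_diff continuous_on_subset[OF nD(6)[OF space_PD[OF that]]]
          continuous_on_subset[OF occ_continuous[OF X_cp nD(3) space_PD[OF that] nD(5) order_refl]]) auto
    show "U w \<in> {q..h}" if "w \<in> space (P p)" for w by (rule T(2)[OF space_PD[OF that]])
    fix s t assume st: "q \<le> s" "s \<le> t" "t \<le> h"
    obtain B where B: "B \<in> sets (F s)" "AE w in P p. w \<in> \<Lambda> \<and> U w < s \<longleftrightarrow> w \<in> B" using ad[of s] st by auto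
    have Bt: "B \<in> sets (F t)" using natfilt_mono[OF st(2)] B(1) by blast
    have Um: "\<Lambda> \<inter> {w \<in> space (P p). U w < s} \<in> sets (P p)"
      using borel_measurable_less[OF T(1), of "\<lambda>_. s"] \<Lambda> by auto
    have eqB: "(\<integral>w. indicator (\<Lambda> \<inter> {w \<in> space (P p). U w < s}) w * M r w \<partial>P p) = (\<integral>w. indicator B w * M r w \<partial>P p)"
      if "r \<in> {q..h}" for r
    proof (rule integral_cong_AE)
      show "AE w in P p. indicator (\<Lambda> \<inter> {w \<in> space (P p). U w < s}) w * M r w = indicator B w * M r w"
        using B(2) AE_space by eventually_elim (auto simp: indicator_def)
    qed (intro borel_measurable_times borel_measurable_indicator Um F_sub[OF B(1)] Mm that)+
    have "0 = (\<integral>w. indicator B w * (\<phi> (X h w) - \<phi> (X t w) - occ X G t h w) \<partial>P p)"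
      using nD(1) p st q Bt unfolding mart_def by simp
    also have "\<dots> = (\<integral>w. indicator B w * M h w - indicator B w * M t w \<partial>P p)"
    proof (rule Bochner_Integration.integral_cong[OF refl])
      fix w assume "w \<in> space (P p)"
      then have "occ X G 0 h w = occ X G 0 t w + occ X G t h w"
        using st q by (intro occ_add[OF X_cp nD(3) _ nD(5)] space_PD[of _ p]) auto
      then show "indicator B w * (\<phi> (X h w) - \<phi> (X t w) - occ X G t h w) = indicator B w * M h w - indicator B w * M t w"
        by (simp add: M_def algebra_simps)
    qed
    also have "\<dots> = (\<integral>w. indicator B w * M h w \<partial>P p) - (\<integral>w. indicator B w * M t w \<partial>P p)"
      using Mi[OF _ F_sub[OF B(1)]] st q by (intro Bochner_Integration.integral_diff) auto
    finally show "(\<integral>w. indicator (\<Lambda> \<inter> {w \<in> space (P p). U w < s}) w * M t w \<partial>P p) =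
       (\<integral>w. indicator (\<Lambda> \<inter> {w \<in> space (P p). U w < s}) w * M h w \<partial>P p)"
      using eqB[of t] eqB[of h] st q by simp
  qed
  then show ?thesis unfolding M_def .
qed

lemma stopped_integrable:
  assumes n: "nice \<phi> G C" and p: "p \<in> Gam N" and h: "0 \<le> h"
    and T: "U \<in> borel_measurable (P p)" "\<And>w. w \<in> \<Omega> \<Longrightarrow> U w \<in> {0..h}"
  shows "integrable (P p) (\<lambda>w. \<phi> (X (U w) w))" "integrable (P p) (\<lambda>w. occ X G 0 (U w) w)"
proof -
  interpret prob_space "P p" by (rule prob) fact
  note nD = niceD[OF n]
  have C0: "0 \<le> C" using nD(4)[OF p] by simp
  have jm: "(\<lambda>w. \<Phi> (U w) w) \<in> borel_measurable (P p)"
    if "\<And>w. w \<in> \<Omega> \<Longrightarrow> continuous_on {0..} (\<lambda>s. \<Phi> s w)" "\<And>s. 0 \<le> s \<Longrightarrow> \<Phi> s \<in> borel_measurable (P p)"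
    for \<Phi> :: "real \<Rightarrow> 'w \<Rightarrow> real"
  proof -
    have m1: "(\<lambda>z. \<Phi> (max 0 (fst z)) (snd z)) \<in> borel_measurable (borel \<Otimes>\<^sub>M P p)"
      by (rule joint_measurable_real_atLeast) (auto intro: that space_PD)
    have m2: "(\<lambda>w. (U w, w)) \<in> measurable (P p) (borel \<Otimes>\<^sub>M P p)" using T(1) by simp
    have m3: "(\<lambda>w. \<Phi> (max 0 (U w)) w) \<in> borel_measurable (P p)"
      using measurable_compose[OF m2 m1] by simp
    have "(\<lambda>w. \<Phi> (U w) w) \<in> borel_measurable (P p) \<longleftrightarrow> (\<lambda>w. \<Phi> (max 0 (U w)) w) \<in> borel_measurable (P p)"
    proof (rule measurable_cong)
      fix w assume "w \<in> space (P p)"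
      from T(2)[OF space_PD[OF this]] show "\<Phi> (U w) w = \<Phi> (max 0 (U w)) w" by simp
    qed
    then show ?thesis using m3 by blast
  qed
  show "integrable (P p) (\<lambda>w. \<phi> (X (U w) w))"
  proof (rule integrable_const_bound[where B=C])
    show "AE w in P p. norm (\<phi> (X (U w) w)) \<le> C"
      unfolding real_norm_def by (intro AE_I2 nD(4) X_Gam space_PD[of _ p])
    show "(\<lambda>w. \<phi> (X (U w) w)) \<in> borel_measurable (P p)"
      by (intro jm[of "\<lambda>s w. \<phi> (X s w)"] nD(6) measurable_compose[OF X_meas nD(2)])
  qed
  show "integrable (P p) (\<lambda>w. occ X G 0 (U w) w)"
  proof (rule integrable_const_bound[where B="C * h"])
    show "AE w in P p. norm (occ X G 0 (U w) w) \<le> C * h"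
    proof (rule AE_I2)
      fix w assume "w \<in> space (P p)"
      note w = space_PD[OF this]
      have "\<bar>occ X G 0 (U w) w\<bar> \<le> C * (U w - 0)" using T(2)[OF w] by (intro occ_bound[OF X_cp nD(3) w nD(5)]) auto
      also have "\<dots> \<le> C * h" using T(2)[OF w] C0 by (auto intro: mult_left_mono)
      finally show "norm (occ X G 0 (U w) w) \<le> C * h" by simp
    qed
    show "(\<lambda>w. occ X G 0 (U w) w) \<in> borel_measurable (P p)"
      by (intro jm[of "\<lambda>s w. occ X G 0 s w"] occ_continuous[OF X_cp nD(3) _ nD(5)] F_meas[OF occ_measurable[OF X_cp nD(3,5)]]) auto
  qed
qed

text \<open>The difference of two applications of \<open>stopped_martingale\<close>, one with the
  time \<open>U\<close> and one with the constant time \<open>q\<close>, both compared with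
  \<open>h\<close>.\<close>

lemma stopped_difference_general:
  assumes n: "nice \<phi> G C" and p: "p \<in> Gam N" and q: "0 \<le> q" "q \<le> h"
    and Tm: "U \<in> borel_measurable (P p)" and Tin: "\<And>w. U w \<in> {q..h}"
    and \<Lambda>: "\<Lambda> \<in> sets (F q)" and ad: "\<And>s. s \<in> {q..h} \<Longrightarrow> \<Lambda> \<inter> {w \<in> \<Omega>. U w < s} \<in> sets (F s)"
  shows "(\<integral>w. indicator \<Lambda> w * (\<phi> (X (U w) w) - \<phi> (X q w) - occ X G q (U w) w) \<partial>P p) = 0"
proof -
  interpret prob_space "P p" by (rule prob) fact
  note nD = niceD[OF n]
  have \<Lambda>P: "\<Lambda> \<in> sets (P p)" by (rule F_sub[OF \<Lambda>])
  have h: "0 \<le> h" using q by simp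
  have st: "(\<integral>w. indicator \<Lambda> w * (\<phi> (X (U w) w) - occ X G 0 (U w) w) \<partial>P p)
       = (\<integral>w. indicator \<Lambda> w * (\<phi> (X h w) - occ X G 0 h w) \<partial>P p)"
  proof (rule stopped_martingale[OF n p q Tm Tin \<Lambda>P])
    fix s assume s: "s \<in> {q..h}"
    have "\<Lambda> \<inter> {w \<in> \<Omega>. U w < s} \<in> sets (F s)"
      by (rule ad[OF s])
    moreover have "AE w in P p. w \<in> \<Lambda> \<and> U w < s \<longleftrightarrow> w \<in> \<Lambda> \<inter> {w \<in> \<Omega>. U w < s}"
      by (rule AE_I2) (auto dest: space_PD)
    ultimately show "\<exists>B\<in>sets (F s). AE w in P p. w \<in> \<Lambda> \<and> U w < s \<longleftrightarrow> w \<in> B" by blast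
  qed
  have sq: "(\<integral>w. indicator \<Lambda> w * (\<phi> (X q w) - occ X G 0 q w) \<partial>P p)
       = (\<integral>w. indicator \<Lambda> w * (\<phi> (X h w) - occ X G 0 h w) \<partial>P p)"
  proof (rule stopped_martingale[OF n p q _ _ \<Lambda>P, of "\<lambda>_. q"])
    fix s assume s: "s \<in> {q..h}"
    show "\<exists>B\<in>sets (F s). AE w in P p. w \<in> \<Lambda> \<and> q < s \<longleftrightarrow> w \<in> B"
    proof (cases "q < s")
      case True
      then show ?thesis using natfilt_mono[of q s P X] \<Lambda> by (intro bexI[of _ \<Lambda>]) auto
    next
      case False
      then show ?thesis by (intro bexI[of _ "{}"]) auto
    qed
  qed (use q in auto)
  have Tin0: "U w \<in> {0..h}" for w using Tin[of w] q by simp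
  note i = stopped_integrable[OF n p h Tm Tin0] stopped_integrable[OF n p h, of "\<lambda>_. q"]
  note j = integrable_mult_indicator[OF \<Lambda>P]
  have "(\<integral>w. indicator \<Lambda> w * (\<phi> (X (U w) w) - \<phi> (X q w) - occ X G q (U w) w) \<partial>P p) =
     (\<integral>w. indicator \<Lambda> w * (\<phi> (X (U w) w) - occ X G 0 (U w) w) - indicator \<Lambda> w * (\<phi> (X q w) - occ X G 0 q w) \<partial>P p)"
  proof (rule Bochner_Integration.integral_cong[OF refl])
    fix w assume "w \<in> space (P p)"
    then have "occ X G 0 (U w) w = occ X G 0 q w + occ X G q (U w) w"
      using q Tin[of w] by (intro occ_add[OF X_cp nD(3) _ nD(5)] space_PD[of _ p]) auto
    then show "indicator \<Lambda> w * (\<phi> (X (U w) w) - \<phi> (X q w) - occ X G q (U w) w) =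
      indicator \<Lambda> w * (\<phi> (X (U w) w) - occ X G 0 (U w) w) - indicator \<Lambda> w * (\<phi> (X q w) - occ X G 0 q w)"
      by (simp add: algebra_simps)
  qed
  also have "\<dots> = 0"
  proof (subst Bochner_Integration.integral_diff)
    show "integrable (P p) (\<lambda>w. indicator \<Lambda> w * (\<phi> (X (U w) w) - occ X G 0 (U w) w))"
      using j[OF Bochner_Integration.integrable_diff[OF i(1,2)]] by simp
    show "integrable (P p) (\<lambda>w. indicator \<Lambda> w * (\<phi> (X q w) - occ X G 0 q w))"
      using j[OF Bochner_Integration.integrable_diff[OF i(3,4)]] q by simp
  qed (simp add: st sq)
  finally show ?thesis .
qed

lemma stopped_difference:
  assumes n: "nice \<phi> G C" and p: "p \<in> Gam N" and q: "0 \<le> q" "q \<le> h" and K: "K \<ge> 0"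
    and \<Lambda>: "\<Lambda> \<in> sets (F q)"
  shows "(\<integral>w. indicator \<Lambda> w * (\<phi> (X (T q K h w) w) - \<phi> (X q w) - occ X G q (T q K h w) w) \<partial>P p) = 0"
proof (rule stopped_difference_general[OF n p q T_meas[OF q K] T_in[OF q(2)] \<Lambda>])
  fix s assume s: "s \<in> {q..h}"
  then show "\<Lambda> \<inter> {w \<in> \<Omega>. T q K h w < s} \<in> sets (F s)"
    using natfilt_mono[of q s P X] \<Lambda> T_F[OF q(1) _ _ K, of s h] by auto
qed

lemma space_F[simp]: "space (P vtx) \<in> sets (F t)"
  using sets.top[of "F t"] by simp

text \<open>A bound for the expected local time when the clock shows \<open>K\<close>. The constant
  depends only on \<open>flux_fn\<close>, neither on the starting point nor on the truncation, and
  choosing it once makes the bound a function of \<open>K\<close> alone.\<close>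

definition lt_bound :: "real \<Rightarrow> real" where
  "lt_bound K = (let C = (SOME C. C \<ge> 0 \<and> nice (gev flux_fn) (glue (1 / \<eta>) (gev (L flux_fn))) C \<and> bd N flux_fn C \<and> bd N (L flux_fn) C) in 2 * C + C * K)"

lemma flux_fn_const:
  "\<exists>C\<ge>0. nice (gev flux_fn) (glue (1 / \<eta>) (gev (L flux_fn))) C \<and> bd N flux_fn C \<and> bd N (L flux_fn) C \<and> (\<forall>K. lt_bound K = 2 * C + C * K)"
proof -
  let ?P = "\<lambda>C. C \<ge> 0 \<and> nice (gev flux_fn) (glue (1 / \<eta>) (gev (L flux_fn))) C \<and> bd N flux_fn C \<and> bd N (L flux_fn) C"
  have "\<exists>C. ?P C" using nice_E[OF flux_fn(1)] flux_fn(2) by metis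
  then have "?P (SOME C. ?P C)" by (rule someI_ex)
  then show ?thesis by (intro exI[of _ "SOME C. ?P C"]) (simp add: lt_bound_def Let_def)
qed

lemma lt_bound_mono: "K \<le> K' \<Longrightarrow> lt_bound K \<le> lt_bound K'"
proof -
  assume le: "K \<le> K'"
  obtain C where "C \<ge> 0" "\<And>K. lt_bound K = 2 * C + C * K" using flux_fn_const by metis
  then show ?thesis using mult_left_mono[OF le, of C] by simp
qed

text \<open>The martingale of \<open>flux_fn\<close> expresses the expected local time as an
  expected change of a bounded function minus an integral over the time off the vertex. At the
  stopping time the clock is at most \<open>K\<close>, so the bound does not involve
  \<open>h\<close>.\<close>

lemma local_time_bound:
  assumes p: "p \<in> Gam N" and h: "0 \<le> h" and K: "K \<ge> 0"
  shows "(\<integral>w. S (T 0 K h w) w / \<eta> \<partial>P p) \<le> lt_bound K" "integrable (P p) (\<lambda>w. S (T 0 K h w) w)"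
proof -
  interpret prob_space "P p" by (rule prob) fact
  obtain C where C: "C \<ge> 0" "nice (gev flux_fn) (glue (1 / \<eta>) (gev (L flux_fn))) C" "bd N flux_fn C" "bd N (L flux_fn) C"
    "\<And>K. lt_bound K = 2 * C + C * K" using flux_fn_const by metis
  note nD = niceD[OF C(2)]
  note Tm = T_meas[OF order_refl h K, of p]
  have Tin: "T 0 K h w \<in> {0..h}" for w by (rule T_in[OF h])
  have b: "\<bar>gev (L flux_fn) p\<bar> \<le> C" if "p \<in> Gam N" for p by (rule gev_bd[OF C(4) that])
  note i = stopped_integrable[OF C(2) p h Tm Tin]
  define f1 where "f1 w = gev flux_fn (X (T 0 K h w) w) - gev flux_fn (X 0 w)" for w
  define f2 where "f2 w = occ X (glue 0 (gev (L flux_fn))) 0 (T 0 K h w) w" for w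
  have split: "occ X (glue (1 / \<eta>) (gev (L flux_fn))) 0 (T 0 K h w) w = f2 w + S (T 0 K h w) w / \<eta>" if "w \<in> \<Omega>" for w
    using occ_glue[OF that gev_L_meas[OF flux_fn(1)] b order_refl, of "1 / \<eta>" "T 0 K h w"] by (simp add: f2_def S_def)
  have f2b: "\<bar>f2 w\<bar> \<le> C * K" if w: "w \<in> \<Omega>" for w
  proof -
    have "\<bar>f2 w\<bar> \<le> C * A (T 0 K h w) w"
      unfolding f2_def A_def by (rule occ_glue_bound[OF w gev_L_meas[OF flux_fn(1)] b order_refl])
    also have "\<dots> \<le> C * K" using A_T_le[OF w order_refl h K] A_0[of w] C(1) by (intro mult_left_mono) auto
    finally show ?thesis .
  qed
  have f1b: "\<bar>f1 w\<bar> \<le> 2 * C" if w: "w \<in> \<Omega>" for w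
    unfolding f1_def using nD(4)[OF X_Gam[OF w], of "T 0 K h w"] nD(4)[OF X_Gam[OF w], of 0] by linarith
  have Sm: "(\<lambda>w. S (T 0 K h w) w) \<in> borel_measurable (P p)"
  proof -
    have m1: "(\<lambda>z. S (max 0 (fst z)) (snd z)) \<in> borel_measurable (borel \<Otimes>\<^sub>M P p)"
      by (rule joint_measurable_real_atLeast) (auto intro!: S_continuous space_PD[of _ p] F_meas[OF S_F])
    have m2: "(\<lambda>w. (T 0 K h w, w)) \<in> measurable (P p) (borel \<Otimes>\<^sub>M P p)" using Tm by simp
    have "max 0 (T 0 K h w) = T 0 K h w" for w using Tin[of w] by simp
    then show ?thesis using measurable_compose[OF m2 m1] by simp
  qed
  show iS: "integrable (P p) (\<lambda>w. S (T 0 K h w) w)"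
  proof (rule integrable_const_bound[where B=h])
    show "AE w in P p. norm (S (T 0 K h w) w) \<le> h"
    proof (rule AE_I2)
      fix w assume "w \<in> space (P p)"
      note w = space_PD[OF this]
      have "0 \<le> S (T 0 K h w) w" unfolding S_def by (rule occ_nonneg[OF w order_refl G_bound(4)])
      moreover have "S (T 0 K h w) w \<le> T 0 K h w" using A_S[OF w, of "T 0 K h w"] A_nonneg[OF w, of "T 0 K h w"] Tin[of w] by auto
      ultimately show "norm (S (T 0 K h w) w) \<le> h" using Tin[of w] by auto
    qed
  qed (rule Sm)
  have z: "(\<integral>w. indicator \<Omega> w * (gev flux_fn (X (T 0 K h w) w) - gev flux_fn (X 0 w) - occ X (glue (1 / \<eta>) (gev (L flux_fn))) 0 (T 0 K h w) w) \<partial>P p) = 0"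
    by (rule stopped_difference[OF C(2) p order_refl h K space_F])
  have "(\<integral>w. S (T 0 K h w) w / \<eta> \<partial>P p) = (\<integral>w. f1 w - f2 w \<partial>P p)"
  proof -
    have "integrable (P p) (\<lambda>w. f1 w - occ X (glue (1 / \<eta>) (gev (L flux_fn))) 0 (T 0 K h w) w)"
      unfolding f1_def using i gev_X_integrable[OF E_D(2)[OF flux_fn(1)] order_refl p] by simp
    then have "(\<integral>w. f1 w - occ X (glue (1 / \<eta>) (gev (L flux_fn))) 0 (T 0 K h w) w + S (T 0 K h w) w / \<eta> \<partial>P p)
      = (\<integral>w. f1 w - occ X (glue (1 / \<eta>) (gev (L flux_fn))) 0 (T 0 K h w) w \<partial>P p) + (\<integral>w. S (T 0 K h w) w / \<eta> \<partial>P p)"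
      using iS by (intro Bochner_Integration.integral_add) auto
    moreover have "(\<integral>w. f1 w - occ X (glue (1 / \<eta>) (gev (L flux_fn))) 0 (T 0 K h w) w \<partial>P p) = 0"
    proof -
      have "(\<integral>w. f1 w - occ X (glue (1 / \<eta>) (gev (L flux_fn))) 0 (T 0 K h w) w \<partial>P p) =
        (\<integral>w. indicator \<Omega> w * (gev flux_fn (X (T 0 K h w) w) - gev flux_fn (X 0 w) - occ X (glue (1 / \<eta>) (gev (L flux_fn))) 0 (T 0 K h w) w) \<partial>P p)"
        by (rule Bochner_Integration.integral_cong[OF refl]) (simp add: f1_def space_PD)
      then show ?thesis using z by simp
    qed
    moreover have "(\<integral>w. f1 w - occ X (glue (1 / \<eta>) (gev (L flux_fn))) 0 (T 0 K h w) w + S (T 0 K h w) w / \<eta> \<partial>P p) = (\<integral>w. f1 w - f2 w \<partial>P p)"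
      by (rule Bochner_Integration.integral_cong[OF refl]) (simp add: split[OF space_PD[of _ p]])
    ultimately show ?thesis by simp
  qed
  also have "\<dots> \<le> 2 * C + C * K"
  proof -
    have "\<bar>\<integral>w. f1 w - f2 w \<partial>P p\<bar> \<le> 2 * C + C * K"
    proof (rule abs_expectation_le)
      fix w assume "w \<in> space (P p)"
      then show "\<bar>f1 w - f2 w\<bar> \<le> 2 * C + C * K" using f1b[OF space_PD[of w p]] f2b[OF space_PD[of w p]] by linarith
    qed
    then show ?thesis by simp
  qed
  finally show "(\<integral>w. S (T 0 K h w) w / \<eta> \<partial>P p) \<le> lt_bound K" by (simp add: C(5))
qed

text \<open>On the event that the clock never passes \<open>K\<close>, the truncated time equals
  \<open>h\<close>. Its expectation is bounded by \<open>K\<close> plus the expected time at the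
  vertex, uniformly in \<open>h\<close>, so \<open>h\<close> times the probability of the event
  stays bounded and the probability is 0.\<close>

lemma A_unbounded:
  assumes p: "p \<in> Gam N"
  shows "AE w in P p. \<forall>K::nat. \<exists>h::nat. A (real h) w > real K"
proof -
  interpret prob_space "P p" by (rule prob) fact
  have "AE w in P p. \<exists>h::nat. A (real h) w > real K" for K :: nat
  proof (rule AE_I')
    define B where "B = {w \<in> space (P p). \<forall>h::nat. A (real h) w \<le> real K}"
    have Bm: "B \<in> sets (P p)"
      unfolding B_def using F_meas[OF A_F] by measurable
    define c where "c = real K + \<eta> * lt_bound (real K)"
    have le: "real h * measure (P p) B \<le> c" for h :: nat
    proof -
      let ?T = "T 0 (real K) (real h)"
      have h: "0 \<le> real h" and K: "0 \<le> real K" by auto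
      note lt = local_time_bound[OF p h K]
      have TS: "?T w \<le> real K + \<eta> * (S (?T w) w / \<eta>)" if w: "w \<in> \<Omega>" for w
        using A_S[OF w, of "?T w"] A_T_le[OF w order_refl h K] A_0[of w] T_in[OF h, of "real K" w] \<eta> by auto
      have "real h * measure (P p) B = (\<integral>w. real h * indicator B w \<partial>P p)" using Bm by simp
      also have "\<dots> \<le> (\<integral>w. real K + \<eta> * (S (?T w) w / \<eta>) \<partial>P p)"
      proof (rule integral_mono)
        fix w assume "w \<in> space (P p)"
        note w = space_PD[OF this]
        show "real h * indicator B w \<le> real K + \<eta> * (S (?T w) w / \<eta>)"
        proof (cases "w \<in> B")
          case True
          then have "\<not> ?T w < real h" using T_less[OF w order_refl h order_refl K] A_0[of w] by (auto simp: B_def not_less)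
          then show ?thesis using TS[OF w] True by simp
        next
          case False
          then show ?thesis using TS[OF w] T_in[OF h, of "real K" w] by auto
        qed
      qed (use Bm lt(2) \<eta> in \<open>auto simp: emeasure_eq_measure\<close>)
      also have "\<dots> = real K + \<eta> * (\<integral>w. S (?T w) w / \<eta> \<partial>P p)" using lt(2) by (simp add: prob_space)
      also have "\<dots> \<le> c" unfolding c_def using lt(1) \<eta> by (intro add_left_mono mult_left_mono) auto
      finally show ?thesis .
    qed
    have "measure (P p) B \<le> 0"
    proof (rule ccontr)
      assume "\<not> measure (P p) B \<le> 0"
      then have pos: "measure (P p) B > 0" by simp
      obtain h :: nat where "real h > c / measure (P p) B" using reals_Archimedean2 by blast
      then show False using le[of h] pos by (simp add: divide_less_eq)
    qed
    then have "measure (P p) B = 0" using measure_nonneg[of "P p" B] by linarith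
    then show "B \<in> null_sets (P p)" using Bm by (auto simp: emeasure_eq_measure)
    show "{w \<in> space (P p). \<not> (\<exists>h::nat. A (real h) w > real K)} \<subseteq> B" by (auto simp: B_def not_less)
  qed
  then show ?thesis by (simp add: AE_all_countable)
qed

text \<open>A flat piece of the clock means that \<open>X\<close> rests at the vertex. On such a
  piece \<open>flux_fn\<close> stays 0 while its compensator grows at rate
  \<open>1 / \<eta>\<close>, so optional stopping leaves no room for a piece of positive
  length.\<close>

lemma A_increases:
  assumes p: "p \<in> Gam N" and qr: "0 \<le> q" "q < r"
  shows "AE w in P p. A q w < A r w"
proof -
  interpret prob_space "P p" by (rule prob) fact
  obtain C where C: "C \<ge> 0" "nice (gev flux_fn) (glue (1 / \<eta>) (gev (L flux_fn))) C" "bd N flux_fn C" "bd N (L flux_fn) C"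
    using flux_fn_const by metis
  have b: "\<bar>gev (L flux_fn) p\<bar> \<le> C" if "p \<in> Gam N" for p by (rule gev_bd[OF C(4) that])
  have qr': "q \<le> r" using qr by simp
  \<comment> \<open>Level 0: the first time at which the clock moves on from its value at
    \<open>q\<close>, truncated at \<open>r\<close>.\<close>
  let ?T = "T q 0 r"
  have Tin: "?T w \<in> {q..r}" for w by (rule T_in[OF qr'])
  define \<Lambda> where "\<Lambda> = {w \<in> \<Omega>. X q w = vtx}"
  have \<Lambda>F: "\<Lambda> \<in> sets (F q)"
  proof -
    have "\<Lambda> = X q -` {vtx} \<inter> space (F q)" by (auto simp: \<Lambda>_def)
    also have "\<dots> \<in> sets (F q)" by (rule measurable_sets[OF measurable_natfilt[OF qr(1) order_refl] vtx_in_sets])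
    finally show ?thesis .
  qed
  have z: "(\<integral>w. indicator \<Lambda> w * (gev flux_fn (X (?T w) w) - gev flux_fn (X q w) - occ X (glue (1 / \<eta>) (gev (L flux_fn))) q (?T w) w) \<partial>P p) = 0"
    by (rule stopped_difference[OF C(2) p qr(1) qr' order_refl \<Lambda>F])
  have on: "indicator \<Lambda> w * (gev flux_fn (X (?T w) w) - gev flux_fn (X q w) - occ X (glue (1 / \<eta>) (gev (L flux_fn))) q (?T w) w)
      = - (indicator \<Lambda> w * (?T w - q)) / \<eta>" if "w \<in> space (P p)" for w
  proof (cases "w \<in> \<Lambda>")
    case True
    note w = space_PD[OF that]
    have ev: "gev flux_fn vtx = 0" by (simp add: gev_def vtx_def flux_fn(4))
    have AT: "A (?T w) w = A q w"
      using A_T_le[OF w qr(1) qr' order_refl] A_mono[OF w qr(1), of "?T w"] Tin[of w] by simp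
    have XT: "X (?T w) w = vtx"
    proof (cases "?T w = q")
      case True
      then show ?thesis using \<open>w \<in> \<Lambda>\<close> by (simp add: \<Lambda>_def)
    next
      case False
      then show ?thesis using Tin[of w] AT by (intro A_const_imp_vtx[OF w qr(1), of "?T w"]) auto
    qed
    have g1: "occ X G1 q (?T w) w = 0" using A_diff[OF w qr(1), of "?T w"] AT Tin[of w] by simp
    then have "occ X (glue 0 (gev (L flux_fn))) q (?T w) w = 0"
      using occ_glue_bound[OF w gev_L_meas[OF flux_fn(1)] b qr(1), of "?T w"] by simp
    moreover have "occ X Gv q (?T w) w = ?T w - q" using G1_Gv[OF w qr(1), of "?T w"] g1 Tin[of w] by simp
    ultimately have "occ X (glue (1 / \<eta>) (gev (L flux_fn))) q (?T w) w = (?T w - q) / \<eta>"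
      using occ_glue[OF w gev_L_meas[OF flux_fn(1)] b qr(1), of "1 / \<eta>" "?T w"] by simp
    moreover have "X q w = vtx" using True by (simp add: \<Lambda>_def)
    ultimately show ?thesis using XT ev True by (simp add: diff_divide_distrib)
  qed simp
  have "(\<integral>w. indicator \<Lambda> w * (?T w - q) \<partial>P p) = 0"
  proof -
    have "(\<integral>w. - (indicator \<Lambda> w * (?T w - q)) / \<eta> \<partial>P p) = 0"
    proof -
      have "(\<integral>w. - (indicator \<Lambda> w * (?T w - q)) / \<eta> \<partial>P p) = (\<integral>w. indicator \<Lambda> w * (gev flux_fn (X (?T w) w) - gev flux_fn (X q w) - occ X (glue (1 / \<eta>) (gev (L flux_fn))) q (?T w) w) \<partial>P p)"
        by (rule Bochner_Integration.integral_cong[OF refl]) (simp only: on)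
      then show ?thesis using z by simp
    qed
    then show ?thesis using \<eta> by simp
  qed
  moreover have "integrable (P p) (\<lambda>w. indicator \<Lambda> w * (?T w - q))"
  proof (rule integrable_const_bound[where B="r - q"])
    show "AE w in P p. norm (indicator \<Lambda> w * (?T w - q)) \<le> r - q"
      using Tin qr' by (intro AE_I2) (auto simp: indicator_def)
    show "(\<lambda>w. indicator \<Lambda> w * (?T w - q)) \<in> borel_measurable (P p)"
      using T_meas[OF qr(1) qr' order_refl, of p] F_sub[OF \<Lambda>F, of p] by simp
  qed
  ultimately have "AE w in P p. indicator \<Lambda> w * (?T w - q) = 0"
    using Tin by (subst integral_nonneg_eq_0_iff_AE[symmetric]) (auto simp: indicator_def)
  then show ?thesis
    using AE_space
  proof eventually_elim
    case (elim w)
    note w = space_PD[OF elim(2)]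
    show ?case
    proof (rule ccontr)
      assume "\<not> A q w < A r w"
      then have eq: "A q w = A r w" using A_mono[OF w qr(1) qr'] by simp
      then have "X q w = vtx" using qr by (intro A_const_imp_vtx[OF w qr eq]) auto
      then have "?T w = q" using elim(1) w by (simp add: \<Lambda>_def)
      moreover have "\<not> ?T w < r" using T_less[OF w qr(1) qr' order_refl order_refl] eq by simp
      ultimately show False using qr by simp
    qed
  qed
qed

end

section \<open>The occupation time near the vertex\<close>

definition pos :: "real \<Rightarrow> real" where "pos s = max 0 s"

lemma pos_power_deriv:
  assumes "k \<ge> 1"
  shows "((\<lambda>s. pos s ^ Suc k) has_real_derivative real (Suc k) * pos s ^ k) (at s)"
proof (cases "s = 0")
  case True
  have "((\<lambda>y. pos y ^ Suc k / y) \<longlongrightarrow> 0) (at 0)"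
  proof (rule Lim_null_comparison)
    show "\<forall>\<^sub>F y in at 0. norm (pos y ^ Suc k / y) \<le> \<bar>y\<bar> ^ k"
      by (rule always_eventually) (auto simp: pos_def max_def abs_mult power_abs)
    have "((\<lambda>y::real. \<bar>y\<bar> ^ k) \<longlongrightarrow> \<bar>0\<bar> ^ k) (at 0)" by (intro tendsto_intros)
    then show "((\<lambda>y::real. \<bar>y\<bar> ^ k) \<longlongrightarrow> 0) (at 0)" by (rule tendsto_eqI) (use assms in \<open>auto simp: power_0_left\<close>)
  qed
  then show ?thesis using True assms by (simp add: has_field_derivative_iff pos_def power_0_left)
next
  case False
  show ?thesis
  proof (cases "s > 0")
    case True
    have "((\<lambda>s. s ^ Suc k) has_real_derivative real (Suc k) * s ^ k) (at s)" by (rule DERIV_cong[OF DERIV_pow]) simp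
    then have "((\<lambda>s. pos s ^ Suc k) has_real_derivative real (Suc k) * s ^ k) (at s)"
      by (rule has_field_derivative_transform_within_open[where S="{0<..}"]) (use True in \<open>auto simp: pos_def\<close>)
    then show ?thesis using True by (simp add: pos_def)
  next
    case False
    have "((\<lambda>s. 0) has_real_derivative 0) (at s)" by simp
    then have "((\<lambda>s. pos s ^ Suc k) has_real_derivative 0) (at s)"
      by (rule has_field_derivative_transform_within_open[where S="{..<0}"]) (use False \<open>s \<noteq> 0\<close> in \<open>auto simp: pos_def\<close>)
    then show ?thesis using False assms by (simp add: pos_def power_0_left)
  qed
qed

text \<open>
  \<open>kC n\<close> is a continuous approximation of the indicator of \<open>{0..}\<close>, and
  \<open>kT n\<close>, \<open>kP n\<close> are its iterated antiderivatives. They smooth the test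
  functions, whose second derivative jumps at \<open>x = d\<close>.
\<close>

definition kP :: "real \<Rightarrow> real \<Rightarrow> real" where "kP n a = n / 6 * (pos (a + 1 / n) ^ 3 - pos a ^ 3)"
definition kT :: "real \<Rightarrow> real \<Rightarrow> real" where "kT n a = n / 2 * (pos (a + 1 / n) ^ 2 - pos a ^ 2)"
definition kC :: "real \<Rightarrow> real \<Rightarrow> real" where "kC n a = n * (pos (a + 1 / n) - pos a)"

lemma k_deriv:
  "((\<lambda>x. kP n (d - x)) has_real_derivative - kT n (d - x)) (at x within S)"
  "((\<lambda>x. kT n (d - x)) has_real_derivative - kC n (d - x)) (at x within S)"
proof -
  have s: "((\<lambda>x. d - x + c) has_real_derivative - 1) (at x within S)" for c
    by (auto intro!: derivative_eq_intros)
  have p: "((\<lambda>x. pos (d - x + c) ^ 3) has_real_derivative 3 * pos (d - x + c) ^ 2 * - 1) (at x within S)" for c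
    using DERIV_chain2[where f="\<lambda>s. pos s ^ 3", OF _ s[of c]] pos_power_deriv[of 2 "d - x + c"] by (simp add: numeral_eq_Suc)
  have p2: "((\<lambda>x. pos (d - x + c) ^ 2) has_real_derivative 2 * pos (d - x + c) * - 1) (at x within S)" for c
    using DERIV_chain2[where f="\<lambda>s. pos s ^ 2", OF _ s[of c]] pos_power_deriv[of 1 "d - x + c"] by (simp add: numeral_eq_Suc)
  have "((\<lambda>x. n / 6 * (pos (d - x + 1 / n) ^ 3 - pos (d - x + 0) ^ 3)) has_real_derivative
      n / 6 * (3 * pos (d - x + 1 / n) ^ 2 * - 1 - 3 * pos (d - x + 0) ^ 2 * - 1)) (at x within S)"
    by (intro DERIV_cmult DERIV_diff p)
  then show "((\<lambda>x. kP n (d - x)) has_real_derivative - kT n (d - x)) (at x within S)"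
    unfolding kP_def kT_def by (simp add: algebra_simps)
  have "((\<lambda>x. n / 2 * (pos (d - x + 1 / n) ^ 2 - pos (d - x + 0) ^ 2)) has_real_derivative
      n / 2 * (2 * pos (d - x + 1 / n) * - 1 - 2 * pos (d - x + 0) * - 1)) (at x within S)"
    by (intro DERIV_cmult DERIV_diff p2)
  then show "((\<lambda>x. kT n (d - x)) has_real_derivative - kC n (d - x)) (at x within S)"
    unfolding kT_def kC_def by (simp add: algebra_simps)
qed

text \<open>Each kernel factors into \<open>n * (p - r)\<close> and a bounded polynomial in the
  positive parts \<open>p\<close> and \<open>r\<close>; the first factor is at most 1 because
  \<open>pos\<close> is Lipschitz with constant 1.\<close>

lemma k_bounds:
  assumes n: "n \<ge> 1" and a: "a \<le> 1"
  shows "\<bar>kC n a\<bar> \<le> 1" "\<bar>kT n a\<bar> \<le> 2" "\<bar>kP n a\<bar> \<le> 2"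
proof -
  define p r where "p = pos (a + 1 / n)" and "r = pos a"
  have n1: "0 \<le> 1 / n" "1 / n \<le> 1" using n by auto
  have r: "0 \<le> r" "r \<le> 1" and p: "r \<le> p" "p \<le> 2" "p - r \<le> 1 / n"
  proof -
    define m where "m = 1 / n"
    have m: "0 \<le> m" "m \<le> 1" using n1 by (simp_all add: m_def)
    show "0 \<le> r" "r \<le> 1" "r \<le> p" "p \<le> 2" "p - r \<le> 1 / n"
      unfolding p_def r_def pos_def m_def[symmetric] using m a by (auto simp: max_def)
  qed
  have k: "0 \<le> n * (p - r)" "n * (p - r) \<le> 1" using p n by (auto simp: field_simps)
  show "\<bar>kC n a\<bar> \<le> 1" using k by (simp add: kC_def p_def r_def)
  have "kT n a = n * (p - r) * ((p + r) / 2)" by (simp add: kT_def p_def r_def power2_eq_square algebra_simps)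
  also have "\<bar>\<dots>\<bar> \<le> 1 * 2" unfolding abs_mult[of "n * (p - r)"] using k p r by (intro mult_mono) auto
  finally show "\<bar>kT n a\<bar> \<le> 2" by simp
  have "kP n a = n * (p - r) * ((p * p + p * r + r * r) / 6)" by (simp add: kP_def p_def r_def power3_eq_cube algebra_simps)
  also have "\<bar>\<dots>\<bar> \<le> 1 * 2"
    unfolding abs_mult[of "n * (p - r)"]
  proof (rule mult_mono)
    have "p * p \<le> 2 * 2" "p * r \<le> 2 * 1" "r * r \<le> 1 * 1" using p r by (intro mult_mono; simp)+
    moreover have "0 \<le> p * p + p * r + r * r" using p r by simp
    ultimately show "\<bar>(p * p + p * r + r * r) / 6\<bar> \<le> 2" by simp
  qed (use k in auto)
  finally show "\<bar>kP n a\<bar> \<le> 2" by simp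
qed

text \<open>The shift by \<open>1 / n\<close> makes \<open>kC\<close> equal to 1 already at
  \<open>a = 0\<close>. The limit is thus the indicator of a closed half-line, which matches the
  closed condition \<open>x \<le> d\<close> in the occupation times.\<close>

lemma k_limits:
  "(\<lambda>n. kC (real (Suc n)) a) \<longlonglongrightarrow> (if a \<ge> 0 then 1 else 0)"
  "(\<lambda>n. kT (real (Suc n)) a) \<longlonglongrightarrow> pos a"
  "(\<lambda>n. kP (real (Suc n)) a) \<longlonglongrightarrow> (pos a)\<^sup>2 / 2"
proof -
  have inv: "(\<lambda>n. 1 / real (Suc n)) \<longlonglongrightarrow> 0" by (rule LIMSEQ_Suc[OF lim_1_over_n])
  have "(\<lambda>n. kC (real (Suc n)) a) \<longlonglongrightarrow> (if a \<ge> 0 then 1 else 0) \<and> (\<lambda>n. kT (real (Suc n)) a) \<longlonglongrightarrow> pos a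
    \<and> (\<lambda>n. kP (real (Suc n)) a) \<longlonglongrightarrow> (pos a)\<^sup>2 / 2"
  proof (cases "a \<ge> 0")
    case True
    have C: "kC (real (Suc n)) a = 1" for n
      using True by (simp add: kC_def pos_def max_def field_simps)
    have T: "kT (real (Suc n)) a = a + 1 / 2 * (1 / real (Suc n))" for n
    proof -
      define m where "m = real (Suc n)"
      have "m > 0" by (simp add: m_def)
      then have "kT m a = a + 1 / 2 * (1 / m)" using True
        by (simp add: kT_def pos_def max_def power2_eq_square) (simp add: field_simps)
      then show ?thesis by (simp only: m_def)
    qed
    have P: "kP (real (Suc n)) a = a\<^sup>2 / 2 + a / 2 * (1 / real (Suc n)) + 1 / 6 * (1 / real (Suc n) * (1 / real (Suc n)))" for n
    proof -
      define m where "m = real (Suc n)"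
      have "m > 0" by (simp add: m_def)
      then have "kP m a = a\<^sup>2 / 2 + a / 2 * (1 / m) + 1 / 6 * (1 / m * (1 / m))" using True
        by (simp add: kP_def pos_def max_def power2_eq_square power3_eq_cube) (simp add: field_simps)
      then show ?thesis by (simp only: m_def)
    qed
    have "(\<lambda>n. a + 1 / 2 * (1 / real (Suc n))) \<longlonglongrightarrow> a + 1 / 2 * 0" by (intro tendsto_intros inv)
    moreover have "(\<lambda>n. a\<^sup>2 / 2 + a / 2 * (1 / real (Suc n)) + 1 / 6 * (1 / real (Suc n) * (1 / real (Suc n)))) \<longlonglongrightarrow> a\<^sup>2 / 2 + a / 2 * 0 + 1 / 6 * (0 * 0)"
      by (intro tendsto_intros inv) simp
    ultimately show ?thesis using True unfolding C T P by (simp add: pos_def)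
  next
    case False
    have "\<forall>\<^sub>F n in sequentially. 1 / real (Suc n) < - a"
      using False by (intro order_tendstoD(2)[OF inv]) simp
    then have ev: "\<forall>\<^sub>F n in sequentially. kC (real (Suc n)) a = 0 \<and> kT (real (Suc n)) a = 0 \<and> kP (real (Suc n)) a = 0"
    proof eventually_elim
      case (elim n)
      then have "pos (a + 1 / real (Suc n)) = 0" "pos a = 0" using False unfolding pos_def by linarith+
      then show ?case unfolding kC_def kT_def kP_def by simp
    qed
    show ?thesis using False
      by (auto simp: pos_def intro!: tendsto_eventually eventually_mono[OF ev])
  qed
  then show "(\<lambda>n. kC (real (Suc n)) a) \<longlonglongrightarrow> (if a \<ge> 0 then 1 else 0)"
    "(\<lambda>n. kT (real (Suc n)) a) \<longlonglongrightarrow> pos a" "(\<lambda>n. kP (real (Suc n)) a) \<longlonglongrightarrow> (pos a)\<^sup>2 / 2" by blast+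
qed

context sticky
begin

text \<open>The second derivative for which the diffusion term of \<open>L\<close> equals 1 at the
  vertex. Averaged with the weights \<open>\<rho>\<close> it becomes \<open>lt_const\<close>, the
  normalization in the definition of the vertex local time.\<close>

definition lt_weight :: "nat \<Rightarrow> real" where "lt_weight i = 2 / (\<sigma> i 0)\<^sup>2"
definition lt_const :: real where "lt_const = (\<Sum>i<N. 2 * \<rho> i / (\<sigma> i 0)\<^sup>2)"

text \<open>
  On each edge, \<open>test_fn d\<close> has second derivative \<open>2 / ((\<sigma> i 0)^2 * d)\<close>
  for \<open>x \<le> d\<close> and is constant for larger \<open>x\<close>; \<open>test_gen d\<close>
  stands for \<open>L\<close> applied to it.
\<close>

definition test_fn :: "real \<Rightarrow> nat \<Rightarrow> real \<Rightarrow> real" where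
  "test_fn d i x = - lt_weight i / d * (d\<^sup>2 / 2 - (pos (d - x))\<^sup>2 / 2)"

definition test_gen :: "real \<Rightarrow> nat \<Rightarrow> real \<Rightarrow> real" where
  "test_gen d i x = (\<sigma> i x)\<^sup>2 / 2 * (lt_weight i / d * (if x \<le> d then 1 else 0)) + b i x * (- lt_weight i / d * pos (d - x))"

lemma lt_weight_bound: "\<exists>W\<ge>0. \<forall>i<N. 0 < lt_weight i \<and> lt_weight i \<le> W"
proof -
  obtain W where W: "W \<ge> 0" "bd N (\<lambda>i x. lt_weight i) W" using edge_bound[of N "\<lambda>i x. lt_weight i"] by blast
  have "0 < lt_weight i \<and> lt_weight i \<le> W" if "i < N" for i
  proof -
    have "\<bar>lt_weight i\<bar> \<le> W" using W(2) that unfolding bd_def by (metis order_refl)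
    moreover have "0 < lt_weight i" using \<sigma>2_pos[OF that order_refl] by (simp add: lt_weight_def)
    ultimately show ?thesis by simp
  qed
  then show ?thesis using W(1) by blast
qed

text \<open>The test function lies outside \<open>E\<close> for two reasons: its second derivative
  jumps, and it does not vanish at infinity. It is a bounded pointwise limit of functions that are
  smoothed by the kernels and damped at infinity.\<close>

lemma nice_test_fn:
  assumes d: "0 < d" "d \<le> 1"
  shows "\<exists>C. nice (gev (test_fn d)) (glue (- lt_const / \<eta>) (gev (test_gen d))) C"
proof -
  obtain W where W: "W \<ge> 0" "\<And>i. i < N \<Longrightarrow> 0 < lt_weight i" "\<And>i. i < N \<Longrightarrow> lt_weight i \<le> W" using lt_weight_bound by blast
  obtain k where k: "k \<ge> 0" "\<And>i x. i < N \<Longrightarrow> x \<ge> 0 \<Longrightarrow> (\<sigma> i x)\<^sup>2 / 2 \<le> k" "\<And>i x. i < N \<Longrightarrow> x \<ge> 0 \<Longrightarrow> \<bar>b i x\<bar> \<le> k"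
    using coef_bound by blast
  \<comment> \<open>The damping factor. Its derivatives carry powers of \<open>1 / n\<close>, so in
    the limit it leaves no trace in the function, its slopes or its generator.\<close>
  define ex where "ex n x = exp (- (1 / real (Suc n) * x))" for n x
  define q where "q n x = kP (real (Suc n)) d - kP (real (Suc n)) (d - x)" for n x
  define q1 where "q1 n x = kT (real (Suc n)) (d - x) - q n x * (1 / real (Suc n))" for n x
  define q2 where "q2 n x = - kC (real (Suc n)) (d - x) - 2 * kT (real (Suc n)) (d - x) * (1 / real (Suc n)) + q n x * (1 / real (Suc n)) * (1 / real (Suc n))" for n x
  define f where "f n i x = - lt_weight i / d * (q n x * ex n x)" for n i x
  define f1 where "f1 n i x = - lt_weight i / d * (q1 n x * ex n x)" for n i x
  define f2 where "f2 n i x = - lt_weight i / d * (q2 n x * ex n x)" for n i x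
  have n1: "real (Suc n) \<ge> 1" for n by simp
  have i01: "0 \<le> 1 / real (Suc n)" "1 / real (Suc n) \<le> 1" for n by auto
  have exb: "0 \<le> ex n x" "ex n x \<le> 1" if "x \<ge> 0" for n x using that unfolding ex_def by auto
  have qb: "\<bar>q n x\<bar> \<le> 4" if "x \<ge> 0" for n x
    using k_bounds(3)[OF n1, of d n] k_bounds(3)[OF n1, of "d - x" n] d that unfolding q_def by linarith
  have mi: "\<bar>y * (1 / real (Suc n))\<bar> \<le> \<bar>y\<bar>" for y n
    unfolding abs_mult using i01[of n] mult_left_mono[of "1 / real (Suc n)" 1 "\<bar>y\<bar>"] by simp
  have q1b: "\<bar>q1 n x\<bar> \<le> 6" if "x \<ge> 0" for n x
    using k_bounds(2)[OF n1, of "d - x" n] d that mi[of "q n x" n] qb[OF that, of n] unfolding q1_def by linarith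
  have q2b: "\<bar>q2 n x\<bar> \<le> 9" if "x \<ge> 0" for n x
    using k_bounds(1)[OF n1, of "d - x" n] k_bounds(2)[OF n1, of "d - x" n] d that qb[OF that, of n]
      mi[of "2 * kT (real (Suc n)) (d - x)" n] mi[of "q n x" n] mi[of "q n x * (1 / real (Suc n))" n]
    unfolding q2_def by linarith
  have exd: "(ex n has_real_derivative ex n x * - (1 / real (Suc n))) (at x within {0..})" for n x
    unfolding ex_def by (auto intro!: derivative_eq_intros)
  have qd: "(q n has_real_derivative kT (real (Suc n)) (d - x)) (at x within {0..})" for n x
  proof -
    have "((\<lambda>x. kP (real (Suc n)) d - kP (real (Suc n)) (d - x)) has_real_derivative 0 - - kT (real (Suc n)) (d - x)) (at x within {0..})"
      by (intro DERIV_diff DERIV_const k_deriv)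
    then show ?thesis unfolding q_def[abs_def] by simp
  qed
  have fd: "(f n i has_real_derivative f1 n i x) (at x within {0..})" for n i x
  proof -
    have "((\<lambda>x. - lt_weight i / d * (q n x * ex n x)) has_real_derivative - lt_weight i / d * (kT (real (Suc n)) (d - x) * ex n x + (ex n x * - (1 / real (Suc n))) * q n x)) (at x within {0..})"
      by (intro DERIV_cmult DERIV_mult qd exd)
    then show ?thesis unfolding f_def[abs_def] f1_def by (rule DERIV_cong) (simp add: q1_def algebra_simps)
  qed
  have f1d: "(f1 n i has_real_derivative f2 n i x) (at x within {0..})" for n i x
  proof -
    have "((\<lambda>x. - lt_weight i / d * ((kT (real (Suc n)) (d - x) - q n x * (1 / real (Suc n))) * ex n x)) has_real_derivative
       - lt_weight i / d * ((- kC (real (Suc n)) (d - x) - kT (real (Suc n)) (d - x) * (1 / real (Suc n))) * ex n x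
         + (ex n x * - (1 / real (Suc n))) * (kT (real (Suc n)) (d - x) - q n x * (1 / real (Suc n))))) (at x within {0..})"
      by (intro DERIV_cmult DERIV_mult DERIV_diff DERIV_cmult_right k_deriv qd exd)
    then show ?thesis unfolding f1_def[abs_def] f2_def q1_def[abs_def]
      by (rule DERIV_cong) (simp only: q2_def, simp add: algebra_simps del: of_nat_Suc)
  qed
  have f2c: "continuous_on {0..} (f2 n i)" for n i
  proof -
    have "continuous_on {0..} (\<lambda>x. kC (real (Suc n)) (d - x))" unfolding kC_def pos_def by (intro continuous_intros)
    moreover have "continuous_on {0..} (\<lambda>x. kT (real (Suc n)) (d - x))" unfolding kT_def pos_def by (intro continuous_intros)
    moreover have "continuous_on {0..} (q n)" unfolding q_def[abs_def] kP_def pos_def by (intro continuous_intros)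
    ultimately show ?thesis unfolding f2_def[abs_def] q2_def ex_def by (intro continuous_intros)
  qed
  have comp: "f n i 0 = f n j 0" for n i j by (simp add: f_def q_def)
  note C2 = C2I[of N "f n" "f1 n" "f2 n" for n, OF comp fd[unfolded has_real_derivative_iff_has_vector_derivative]
      f1d[unfolded has_real_derivative_iff_has_vector_derivative] f2c]
  have exl: "(ex n \<longlongrightarrow> 0) at_top" for n
  proof -
    have "((\<lambda>y::real. exp (- y)) \<longlongrightarrow> 0) at_top"
      using filterlim_compose[OF exp_at_bot filterlim_uminus_at_bot_at_top] by simp
    from bump_scaled_lim[OF _ this, of "1 / real (Suc n)"] show ?thesis unfolding ex_def[abs_def] by simp
  qed
  have nul: "((\<lambda>x. c * (y x * ex n x)) \<longlongrightarrow> 0) at_top" if "\<And>x. x \<ge> 0 \<Longrightarrow> \<bar>y x\<bar> \<le> B" for c B n and y :: "real \<Rightarrow> real"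
  proof (rule Lim_null_comparison)
    show "\<forall>\<^sub>F x in at_top. norm (c * (y x * ex n x)) \<le> \<bar>c\<bar> * B * ex n x"
      using eventually_ge_at_top[of 0]
    proof eventually_elim
      case (elim x)
      show ?case using mult_left_mono[OF mult_right_mono[OF that[OF elim] exb(1)[OF elim, of n]], of "\<bar>c\<bar>"] exb(1)[OF elim, of n]
        by (simp add: abs_mult mult.assoc)
    qed
    have "((\<lambda>x. \<bar>c\<bar> * B * ex n x) \<longlongrightarrow> \<bar>c\<bar> * B * 0) at_top" by (intro tendsto_intros exl)
    then show "((\<lambda>x. \<bar>c\<bar> * B * ex n x) \<longlongrightarrow> 0) at_top" by simp
  qed
  have Lf: "L (f n) i x = (\<sigma> i x)\<^sup>2 / 2 * f2 n i x + b i x * f1 n i x" if "i < N" "x \<ge> 0" for n i x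
    unfolding Lop_def using C2(2)[OF that, of n] C2(3)[OF that, of n] by simp
  have fb: "\<bar>f n i x\<bar> \<le> W / d * 4" "\<bar>f1 n i x\<bar> \<le> W / d * 6" "\<bar>f2 n i x\<bar> \<le> W / d * 9" if "i < N" "x \<ge> 0" for n i x
  proof -
    have g: "\<bar>- lt_weight i / d * (y * ex n x)\<bar> \<le> W / d * B" if y: "\<bar>y\<bar> \<le> B" for y B
    proof -
      have "\<bar>y * ex n x\<bar> \<le> B * 1" unfolding abs_mult using y exb[OF \<open>x \<ge> 0\<close>, of n] by (intro mult_mono) auto
      moreover have "\<bar>- lt_weight i / d\<bar> \<le> W / d" using W(2,3)[OF \<open>i < N\<close>] d by (simp add: divide_right_mono)
      ultimately show ?thesis unfolding abs_mult[of "- lt_weight i / d"] using W d by (intro mult_mono) auto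
    qed
    show "\<bar>f n i x\<bar> \<le> W / d * 4" unfolding f_def by (rule g[OF qb[OF \<open>x \<ge> 0\<close>]])
    show "\<bar>f1 n i x\<bar> \<le> W / d * 6" unfolding f1_def by (rule g[OF q1b[OF \<open>x \<ge> 0\<close>]])
    show "\<bar>f2 n i x\<bar> \<le> W / d * 9" unfolding f2_def by (rule g[OF q2b[OF \<open>x \<ge> 0\<close>]])
  qed
  have zk: "((\<lambda>x. c x * g x) \<longlongrightarrow> 0) at_top" if "\<And>x. x \<ge> 0 \<Longrightarrow> \<bar>c x\<bar> \<le> k" "(g \<longlongrightarrow> 0) at_top" for c g :: "real \<Rightarrow> real"
  proof (rule Lim_null_comparison)
    show "\<forall>\<^sub>F x in at_top. norm (c x * g x) \<le> k * \<bar>g x\<bar>"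
      using eventually_ge_at_top[of 0] by eventually_elim (auto simp: abs_mult intro!: mult_right_mono that(1))
    have "((\<lambda>x. k * \<bar>g x\<bar>) \<longlongrightarrow> k * \<bar>0\<bar>) at_top" by (intro tendsto_intros that(2))
    then show "((\<lambda>x. k * \<bar>g x\<bar>) \<longlongrightarrow> 0) at_top" by simp
  qed
  have fE: "f n \<in> E" for n
  proof -
    have "(f n i \<longlongrightarrow> 0) at_top" for i unfolding f_def[abs_def] by (rule nul[OF qb])
    then have "f n \<in> C0 N"
      using comp C2D(3)[OF C2(1)] by (intro C0I) blast+
    moreover have "(L (f n) i \<longlongrightarrow> 0) at_top" if i: "i < N" for i
    proof -
      have "((\<lambda>x. (\<sigma> i x)\<^sup>2 / 2 * f2 n i x + b i x * f1 n i x) \<longlongrightarrow> 0 + 0) at_top"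
      proof (intro tendsto_add zk)
        show "(f2 n i \<longlongrightarrow> 0) at_top" unfolding f2_def[abs_def] by (rule nul[OF q2b])
        show "(f1 n i \<longlongrightarrow> 0) at_top" unfolding f1_def[abs_def] by (rule nul[OF q1b])
      qed (use k(2,3)[OF i] in auto)
      then show ?thesis by (subst tendsto_cong[OF eventually_mono[OF eventually_ge_at_top[of 0] Lf[OF i]]]) auto
    qed
    ultimately show ?thesis unfolding E_def using C2(1) by blast
  qed
  \<comment> \<open>The slopes at the origin are proportional to \<open>kT d\<close>, which tends to
    \<open>d\<close> and cancels the factor \<open>1 / d\<close>. The limiting flux is
    \<open>- lt_const\<close> for every \<open>d\<close>.\<close>
  have \<kappa>f: "\<kappa> (f n) = - (lt_const / d) * kT (real (Suc n)) d" for n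
  proof -
    have "\<kappa> (f n) = (\<Sum>i<N. \<rho> i * f1 n i 0)" unfolding \<kappa>_def
      by (intro sum.cong refl) (use C2(2)[OF _ order_refl, of _ n] in simp)
    also have "\<dots> = (\<Sum>i<N. - (2 * \<rho> i / (\<sigma> i 0)\<^sup>2) / d * kT (real (Suc n)) d)"
      by (intro sum.cong refl) (simp add: f1_def q1_def q_def ex_def lt_weight_def)
    also have "\<dots> = - (lt_const / d) * kT (real (Suc n)) d"
      unfolding lt_const_def sum_divide_distrib sum_distrib_right sum_negf[symmetric] by (rule sum.cong[OF refl]) simp
    finally show ?thesis .
  qed
  define C where "C = W / d * 4 + (k * (W / d * 9) + k * (W / d * 6)) + \<bar>lt_const / d\<bar> * 2 / \<eta>"
  have nn: "0 \<le> W / d * 4" "0 \<le> k * (W / d * 9) + k * (W / d * 6)" "0 \<le> \<bar>lt_const / d\<bar> * 2 / \<eta>" using W k d \<eta> by auto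
  have Lfb: "\<bar>L (f n) i x\<bar> \<le> k * (W / d * 9) + k * (W / d * 6)" if "i < N" "x \<ge> 0" for n i x
  proof -
    have "\<bar>(\<sigma> i x)\<^sup>2 / 2 * f2 n i x\<bar> \<le> k * (W / d * 9)" unfolding abs_mult using k(1) k(2)[OF that] fb(3)[OF that] by (intro mult_mono) auto
    moreover have "\<bar>b i x * f1 n i x\<bar> \<le> k * (W / d * 6)" unfolding abs_mult using k(1) k(3)[OF that] fb(2)[OF that] by (intro mult_mono) auto
    ultimately show ?thesis unfolding Lf[OF that] by (intro order_trans[OF abs_triangle_ineq add_mono])
  qed
  have gb: "\<bar>gev (f n) p\<bar> \<le> C" if "p \<in> Gam N" for n p
  proof -
    have "bd N (f n) (W / d * 4)" unfolding bd_def using fb(1) by blast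
    from gev_bd[OF this that] show ?thesis using nn unfolding C_def by linarith
  qed
  have Gb: "\<bar>glue (\<kappa> (f n) / \<eta>) (gev (L (f n))) p\<bar> \<le> C" if "p \<in> Gam N" for n p
  proof -
    have "bd N (L (f n)) (k * (W / d * 9) + k * (W / d * 6))" unfolding bd_def using Lfb by blast
    note 1 = gev_bd[OF this that]
    have "\<bar>\<kappa> (f n)\<bar> \<le> \<bar>lt_const / d\<bar> * 2"
      unfolding \<kappa>f abs_mult using k_bounds(2)[OF n1 d(2)] by (intro mult_mono) auto
    then have "\<bar>\<kappa> (f n)\<bar> / \<eta> \<le> \<bar>lt_const / d\<bar> * 2 / \<eta>" using \<eta> by (intro divide_right_mono) auto
    then have "\<bar>\<kappa> (f n) / \<eta>\<bar> \<le> \<bar>lt_const / d\<bar> * 2 / \<eta>" using \<eta> by (simp only: abs_divide abs_of_pos)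
    then show ?thesis using 1 nn unfolding C_def glue_def by auto
  qed
  have inv: "(\<lambda>n. 1 / real (Suc n)) \<longlonglongrightarrow> 0" by (rule LIMSEQ_Suc[OF lim_1_over_n])
  have exlim: "(\<lambda>n. ex n x) \<longlonglongrightarrow> 1" for x
  proof -
    have "(\<lambda>n. exp (- (1 / real (Suc n) * x))) \<longlonglongrightarrow> exp (- (0 * x))" by (intro tendsto_intros inv)
    then show ?thesis by (simp add: ex_def)
  qed
  have qlim: "(\<lambda>n. q n x) \<longlonglongrightarrow> d\<^sup>2 / 2 - (pos (d - x))\<^sup>2 / 2" for x
  proof -
    have "(\<lambda>n. q n x) \<longlonglongrightarrow> (pos d)\<^sup>2 / 2 - (pos (d - x))\<^sup>2 / 2" unfolding q_def by (intro tendsto_diff k_limits)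
    then show ?thesis using d by (simp add: pos_def)
  qed
  have flim: "(\<lambda>n. f n i x) \<longlonglongrightarrow> test_fn d i x" for i x
  proof -
    have "(\<lambda>n. f n i x) \<longlonglongrightarrow> - lt_weight i / d * ((d\<^sup>2 / 2 - (pos (d - x))\<^sup>2 / 2) * 1)"
      unfolding f_def by (intro tendsto_mult tendsto_const qlim exlim)
    then show ?thesis by (simp add: test_fn_def)
  qed
  have f1lim: "(\<lambda>n. f1 n i x) \<longlonglongrightarrow> - lt_weight i / d * pos (d - x)" for i x
  proof -
    have "(\<lambda>n. f1 n i x) \<longlonglongrightarrow> - lt_weight i / d * ((pos (d - x) - (d\<^sup>2 / 2 - (pos (d - x))\<^sup>2 / 2) * 0) * 1)"
      unfolding f1_def q1_def by (intro tendsto_mult tendsto_const tendsto_diff k_limits qlim exlim inv)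
    then show ?thesis by simp
  qed
  have f2lim: "(\<lambda>n. f2 n i x) \<longlonglongrightarrow> lt_weight i / d * (if x \<le> d then 1 else 0)" for i x
  proof -
    have "(\<lambda>n. f2 n i x) \<longlonglongrightarrow> - lt_weight i / d * ((- (if d - x \<ge> 0 then 1 else 0) - 2 * pos (d - x) * 0 + (d\<^sup>2 / 2 - (pos (d - x))\<^sup>2 / 2) * 0 * 0) * 1)"
      unfolding f2_def q2_def by (intro tendsto_mult tendsto_const tendsto_diff tendsto_add tendsto_minus k_limits qlim exlim inv)
    then show ?thesis by (rule tendsto_eqI) auto
  qed
  have Llim: "(\<lambda>n. L (f n) i x) \<longlonglongrightarrow> test_gen d i x" if "i < N" "x \<ge> 0" for i x
    unfolding Lf[OF that] test_gen_def by (intro tendsto_add tendsto_mult tendsto_const f1lim f2lim)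
  have glim: "(\<lambda>n. gev (f n) p) \<longlonglongrightarrow> gev (test_fn d) p" for p unfolding gev_def by (rule flim)
  have Glim: "(\<lambda>n. glue (\<kappa> (f n) / \<eta>) (gev (L (f n))) p) \<longlonglongrightarrow> glue (- lt_const / \<eta>) (gev (test_gen d)) p" if p: "p \<in> Gam N" for p
  proof (cases "p = vtx")
    case True
    have "(\<lambda>n. \<kappa> (f n) / \<eta>) \<longlonglongrightarrow> - (lt_const / d) * pos d / \<eta>"
      unfolding \<kappa>f using \<eta> by (intro tendsto_divide tendsto_mult tendsto_const k_limits) simp
    moreover have "- (lt_const / d) * pos d / \<eta> = - lt_const / \<eta>" using d by (simp add: pos_def)
    ultimately show ?thesis using True by (simp add: glue_def)
  next
    case False
    have "fst p < N" "snd p \<ge> 0" using p by (auto elim: GamE)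
    from Llim[OF this] show ?thesis using False by (simp add: glue_def gev_def)
  qed
  have Gm: "glue (\<kappa> (f n) / \<eta>) (gev (L (f n))) \<in> borel_measurable (GM N)" for n
    by (rule glue_measurable[OF gev_L_meas[OF fE]])
  have fm: "gev (f n) \<in> borel_measurable (GM N)" for n by (rule gev_meas[OF E_D(2)[OF fE]])
  have "nice (gev (test_fn d)) (glue (- lt_const / \<eta>) (gev (test_gen d))) C"
    unfolding nice_def
  proof (intro conjI ballI)
    show "mart (gev (test_fn d)) (glue (- lt_const / \<eta>) (gev (test_gen d)))"
      by (rule mart_closed[OF mart_E[OF fE] fm Gm gb Gb glim Glim])
    show "gev (test_fn d) \<in> borel_measurable (GM N)"
      by (rule borel_measurable_LIMSEQ_real[OF glim fm])
    show "glue (- lt_const / \<eta>) (gev (test_gen d)) \<in> borel_measurable (GM N)"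
      by (rule borel_measurable_LIMSEQ_real[OF Glim Gm]) simp
    show "\<bar>gev (test_fn d) p\<bar> \<le> C" if "p \<in> Gam N" for p
      by (rule tendsto_upperbound[OF tendsto_rabs[OF glim]]) (use gb[OF that] in auto)
    show "\<bar>glue (- lt_const / \<eta>) (gev (test_gen d)) p\<bar> \<le> C" if "p \<in> Gam N" for p
      by (rule tendsto_upperbound[OF tendsto_rabs[OF Glim[OF that]]]) (use Gb[OF that] in auto)
    show "continuous_on {0..} (\<lambda>s. gev (test_fn d) (X s w))" if "w \<in> \<Omega>" for w
    proof (rule continuous_on_gev_path[of _ N])
      show "path_cont (\<lambda>t. X t w)" using X_cp that unfolding cprocess_def by blast
      show "X t w \<in> Gam N" for t by (rule X_Gam[OF that])
      show "test_fn d i 0 = test_fn d j 0" for i j using d by (simp add: test_fn_def pos_def)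
      show "continuous_on {0..} (test_fn d i)" for i unfolding test_fn_def[abs_def] pos_def by (intro continuous_intros) (use d in auto)
    qed
  qed
  then show ?thesis by blast
qed

lemma joint_P:
  assumes "0 \<le> t" "G \<in> borel_measurable (GM N)"
  shows "(\<lambda>z. G (X (max 0 (min (fst z) t)) (snd z))) \<in> borel_measurable (borel \<Otimes>\<^sub>M P p)"
proof (rule measurable_compose[OF joint_measurable_GM[OF assms(1)] assms(2)])
  show "X s \<in> measurable (P p) Gmeas" if "s \<in> {0..t}" for s
    using that by (intro measurable_GM_D(1)[OF X_meas]) auto
  show "X s w \<in> Gam N" if "w \<in> space (P p)" for s w by (rule X_Gam[OF space_PD[OF that]])
  show "path_cont (\<lambda>t. X t w)" if "w \<in> space (P p)" for w
    using X_cp space_PD[OF that] unfolding cprocess_def by blast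
qed

lemma occ_P: "G \<in> borel_measurable (GM N) \<Longrightarrow> (\<And>p. p \<in> Gam N \<Longrightarrow> \<bar>G p\<bar> \<le> C) \<Longrightarrow> 0 \<le> t \<Longrightarrow>
    occ X G 0 t \<in> borel_measurable (P p)"
  using occ_measurable[OF X_cp, of G C 0 t] by (intro F_meas[of _ t]) (simp add: fun_eq_iff[symmetric])

text \<open>The square of the additive functional is twice the integral of \<open>G (X u)\<close>
  against its remaining part after \<open>u\<close>. Given the past of \<open>u\<close>, the
  remaining part has the conditional mean of a change of \<phi>, hence at most
  \<open>2 * \<epsilon>\<close>. A small \<phi> thus forces a small functional even if
  \<open>G\<close> is large.\<close>

lemma second_moment:
  assumes n: "nice \<phi> G C" and \<epsilon>: "\<And>p. p \<in> Gam N \<Longrightarrow> \<bar>\<phi> p\<bar> \<le> \<epsilon>"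
    and p: "p \<in> Gam N" and h: "0 \<le> h" and K: "K \<ge> 0"
  shows "(\<integral>w. (occ X G 0 (T 0 K h w) w)\<^sup>2 \<partial>P p) \<le> 4 * \<epsilon> * (\<integral>w. occ X (\<lambda>p. \<bar>G p\<bar>) 0 (T 0 K h w) w \<partial>P p)"
proof -
  interpret prob_space "P p" by (rule prob) fact
  note nD = niceD[OF n]
  have C0: "0 \<le> C" using nD(4)[OF p] by simp
  have \<epsilon>0: "0 \<le> \<epsilon>" using \<epsilon>[OF p] by simp
  let ?\<tau> = "T 0 K h"
  note \<tau>m = T_meas[OF order_refl h K, of p]
  have \<tau>in: "?\<tau> w \<in> {0..h}" for w by (rule T_in[OF h])
  \<comment> \<open>Whether \<open>u\<close> precedes the stopping time is rephrased through the
    clock at \<open>u\<close>, which makes it an event of the past of \<open>u\<close>.\<close>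
  have A\<tau>: "A u w \<le> K \<longleftrightarrow> u \<le> ?\<tau> w" if "w \<in> \<Omega>" "u \<in> {0..h}" for u w
    using T_less[OF that(1) order_refl, of u h K] that K A_0[of w] by (auto simp: not_less[symmetric])
  define D where "D w = occ X G 0 (?\<tau> w) w" for w
  define cl where "cl u = max 0 (min u h)" for u
  have cl: "cl u \<in> {0..h}" "u \<in> {0..h} \<Longrightarrow> cl u = u" for u using h by (auto simp: cl_def)
  define \<psi> where "\<psi> z = (if A (cl (fst z)) (snd z) \<le> K then G (X (cl (fst z)) (snd z)) * (D (snd z) - occ X G 0 (cl (fst z)) (snd z)) else 0)" for z
  define \<psi>2 where "\<psi>2 z = (if A (cl (fst z)) (snd z) \<le> K then \<bar>G (X (cl (fst z)) (snd z))\<bar> else 0)" for z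
  have Dm[measurable]: "D \<in> borel_measurable (P p)"
    using stopped_integrable(2)[OF n p h \<tau>m \<tau>in] unfolding D_def by auto
  have jA[measurable]: "(\<lambda>z. A (cl (fst z)) (snd z)) \<in> borel_measurable (borel \<Otimes>\<^sub>M P p)"
    unfolding cl_def
  proof (rule joint_measurable_real[OF h])
    show "continuous_on {0..h} (\<lambda>s. A s w)" if "w \<in> space (P p)" for w
      by (rule continuous_on_subset[OF A_continuous[OF space_PD[OF that]]]) auto
    show "A s \<in> borel_measurable (P p)" if "s \<in> {0..h}" for s using that by (intro F_meas[OF A_F]) auto
  qed
  have jO[measurable]: "(\<lambda>z. occ X G 0 (cl (fst z)) (snd z)) \<in> borel_measurable (borel \<Otimes>\<^sub>M P p)"
    unfolding cl_def
  proof (rule joint_measurable_real[OF h])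
    show "continuous_on {0..h} (\<lambda>s. occ X G 0 s w)" if "w \<in> space (P p)" for w
      by (rule continuous_on_subset[OF occ_continuous[OF X_cp nD(3) space_PD[OF that] nD(5) order_refl]]) auto
    show "occ X G 0 s \<in> borel_measurable (P p)" if "s \<in> {0..h}" for s
      using that by (intro occ_P[OF nD(3,5)]) auto
  qed
  have jG[measurable]: "(\<lambda>z. G (X (cl (fst z)) (snd z))) \<in> borel_measurable (borel \<Otimes>\<^sub>M P p)"
    unfolding cl_def by (rule joint_P[OF h nD(3)])
  have \<psi>m: "\<psi> \<in> borel_measurable (borel \<Otimes>\<^sub>M P p)" "\<psi>2 \<in> borel_measurable (borel \<Otimes>\<^sub>M P p)"
    unfolding \<psi>_def[abs_def] \<psi>2_def[abs_def] by measurable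
  have Ob: "\<bar>occ X G 0 s w\<bar> \<le> C * h" if "w \<in> \<Omega>" "s \<in> {0..h}" for s w
  proof -
    have "\<bar>occ X G 0 s w\<bar> \<le> C * (s - 0)" using that by (intro occ_bound[OF X_cp nD(3) that(1) nD(5)]) auto
    also have "\<dots> \<le> C * h" using that C0 by (auto intro: mult_left_mono)
    finally show ?thesis .
  qed
  have tri: "\<bar>x - y\<bar> \<le> 2 * B" if "\<bar>x\<bar> \<le> B" "\<bar>y\<bar> \<le> B" for x y B :: real using that by linarith
  have \<psi>b: "\<bar>\<psi> (u, w)\<bar> \<le> C * (2 * (C * h))" "\<bar>\<psi>2 (u, w)\<bar> \<le> C" if "w \<in> space (P p)" for u w
  proof -
    note w = space_PD[OF that]
    have "\<bar>D w - occ X G 0 (cl u) w\<bar> \<le> 2 * (C * h)"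
      unfolding D_def by (rule tri[OF Ob[OF w \<tau>in] Ob[OF w cl(1)]])
    then have "\<bar>G (X (cl u) w) * (D w - occ X G 0 (cl u) w)\<bar> \<le> C * (2 * (C * h))"
      unfolding abs_mult using nD(5)[OF X_Gam[OF w]] C0 by (intro mult_mono) auto
    then show "\<bar>\<psi> (u, w)\<bar> \<le> C * (2 * (C * h))" using C0 h by (simp add: \<psi>_def)
    show "\<bar>\<psi>2 (u, w)\<bar> \<le> C" using nD(5)[OF X_Gam[OF w]] C0 by (simp add: \<psi>2_def)
  qed
  have sq: "(D w)\<^sup>2 = 2 * (\<integral>u. indicator {0..h} u * \<psi> (u, w) \<partial>lborel)" if w: "w \<in> space (P p)" for w
  proof -
    note w' = space_PD[OF w]
    define H where "H u = indicator {0..?\<tau> w} u * G (X u w)" for u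
    have Hi: "integrable lborel H" unfolding H_def by (rule occ_integrable[OF X_cp nD(3) w' nD(5) order_refl])
    have [measurable]: "H \<in> borel_measurable borel" using Hi by auto
    have "H u * (\<integral>v. indicator {u<..} v * H v \<partial>lborel) = indicator {0..h} u * \<psi> (u, w)" for u
    proof (cases "u \<in> {0..?\<tau> w}")
      case True
      then have uh: "u \<in> {0..h}" using \<tau>in[of w] by auto
      have "(\<integral>v. indicator {u<..} v * H v \<partial>lborel) = (\<integral>v. indicator {u..?\<tau> w} v * G (X v w) \<partial>lborel)"
      proof (rule integral_cong_AE)
        show "AE v in lborel. indicator {u<..} v * H v = indicator {u..?\<tau> w} v * G (X v w)"
          by (rule AE_mp[OF AE_lborel_singleton[of u]], rule AE_I2) (use True in \<open>auto simp: indicator_def H_def\<close>)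
        show "(\<lambda>v. indicator {u..?\<tau> w} v * G (X v w)) \<in> borel_measurable lborel"
          using occ_integrable[OF X_cp nD(3) w' nD(5), of u "?\<tau> w"] True by auto
      qed measurable
      also have "\<dots> = D w - occ X G 0 u w"
        unfolding D_def using occ_add[OF X_cp nD(3) w' nD(5) order_refl, of u "?\<tau> w"] True by (simp add: occ_def)
      finally have "(\<integral>v. indicator {u<..} v * H v \<partial>lborel) = D w - occ X G 0 u w" .
      then show ?thesis using A\<tau>[OF w' uh] True uh cl(2)[OF uh] by (simp add: H_def \<psi>_def)
    next
      case False
      show ?thesis
      proof (cases "u \<in> {0..h}")
        case True
        then have "\<not> A u w \<le> K" using A\<tau>[OF w' True] False by simp
        then show ?thesis using False cl(2)[OF True] by (simp add: H_def \<psi>_def)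
      next
        case False
        then show ?thesis using \<open>u \<notin> {0..?\<tau> w}\<close> by (simp add: H_def)
      qed
    qed
    then show ?thesis using square_integral[OF Hi] by (simp add: D_def occ_def H_def)
  qed
  have inner: "\<bar>\<integral>w. \<psi> (u, w) \<partial>P p\<bar> \<le> 2 * \<epsilon> * (\<integral>w. \<psi>2 (u, w) \<partial>P p)" if u: "u \<in> {0..h}" for u
  proof -
    interpret sigma_finite_subalgebra "P p" "F u" by (rule sigma_finite_subalg) fact
    have u0: "0 \<le> u" "u \<le> h" using u by auto
    define B where "B = {w \<in> \<Omega>. A u w \<le> K}"
    have BF: "B \<in> sets (F u)"
    proof -
      have "{w \<in> space (F u). A u w \<le> K} \<in> sets (F u)"
        using A_F[OF u0(1)] by measurable
      then show ?thesis by (simp add: B_def)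
    qed
    \<comment> \<open>The stopping time restarted at \<open>u\<close>; on \<open>B\<close> it agrees
      with the original one.\<close>
    define U where "U w = max u (?\<tau> w)" for w
    have Um: "U \<in> borel_measurable (P p)" unfolding U_def using \<tau>m by simp
    have Uin: "U w \<in> {u..h}" "U w \<in> {0..h}" for w using \<tau>in[of w] u0 by (auto simp: U_def)
    have UB: "U w = ?\<tau> w" "u \<le> ?\<tau> w" if "w \<in> B" for w
      using A\<tau>[of w u] that u by (auto simp: U_def B_def)
    define \<zeta> where "\<zeta> w = indicator B w * (\<phi> (X (U w) w) - \<phi> (X u w) - occ X G u (U w) w)" for w
    define Z where "Z w = indicator B w * G (X u w)" for w
    note BP = F_sub[OF BF, of p]
    have ZF: "Z \<in> borel_measurable (F u)"
      unfolding Z_def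
      by (intro borel_measurable_times borel_measurable_indicator BF measurable_compose[OF cprocess_GM[OF X_cp u0(1) order_refl] nD(3)])
    have ocu: "occ X G u (U w) w = occ X G 0 (U w) w - occ X G 0 u w" if "w \<in> \<Omega>" for w
      using occ_add[OF X_cp nD(3) that nD(5) order_refl u0(1), of "U w"] Uin(1)[of w] by auto
    note i1 = stopped_integrable[OF n p h Um Uin(2)]
    have i2: "integrable (P p) (\<lambda>w. \<phi> (X u w))" "integrable (P p) (occ X G 0 u)"
      using stopped_integrable[OF n p h, of "\<lambda>_. u"] u by auto
    have \<zeta>i: "integrable (P p) \<zeta>"
    proof -
      have "integrable (P p) (\<lambda>w. indicator B w *\<^sub>R (\<phi> (X (U w) w) - \<phi> (X u w) - (occ X G 0 (U w) w - occ X G 0 u w)))"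
        using i1 i2 by (intro integrable_mult_indicator[OF BP] Bochner_Integration.integrable_diff)
      then show ?thesis unfolding \<zeta>_def
        by (rule Bochner_Integration.integrable_cong[OF refl, THEN iffD1, rotated]) (simp add: ocu space_PD)
    qed
    have \<zeta>b: "\<bar>\<zeta> w\<bar> \<le> 2 * C + 2 * (C * h)" if "w \<in> space (P p)" for w
      unfolding \<zeta>_def
    proof (rule abs_indicator_mult_le)
      note w = space_PD[OF that]
      have "\<bar>\<phi> (X (U w) w) - \<phi> (X u w)\<bar> \<le> 2 * C" by (rule tri[OF nD(4)[OF X_Gam[OF w]] nD(4)[OF X_Gam[OF w]]])
      moreover have "\<bar>occ X G 0 (U w) w - occ X G 0 u w\<bar> \<le> 2 * (C * h)" by (rule tri[OF Ob[OF w Uin(2)] Ob[OF w u]])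
      ultimately show "\<bar>\<phi> (X (U w) w) - \<phi> (X u w) - occ X G u (U w) w\<bar> \<le> 2 * C + 2 * (C * h)"
        unfolding ocu[OF w] by linarith
    qed
    have Zb: "\<bar>Z w\<bar> \<le> C" if "w \<in> space (P p)" for w
      unfolding Z_def by (intro abs_indicator_mult_le nD(5) X_Gam space_PD[OF that])
    have Zm: "Z \<in> borel_measurable (P p)" by (rule F_meas[OF ZF])
    have Zi: "integrable (P p) (\<lambda>w. Z w * \<zeta> w)"
    proof (rule integrable_const_bound[where B="C * (2 * C + 2 * (C * h))"])
      show "AE w in P p. norm (Z w * \<zeta> w) \<le> C * (2 * C + 2 * (C * h))"
        unfolding real_norm_def abs_mult using C0 by (intro AE_I2 mult_mono Zb \<zeta>b) auto
    qed (use Zm \<zeta>i in auto)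
    \<comment> \<open>Optional stopping between \<open>u\<close> and \<open>U\<close>, tested on
      events of the past inside \<open>B\<close>, says that the conditional mean of the stopped
      increment is 0. The factor \<open>Z\<close> is known at \<open>u\<close> and may be pulled
      out.\<close>
    have ae: "AE w in P p. real_cond_exp (P p) (F u) \<zeta> w = 0"
    proof (rule real_cond_exp_charact)
      fix \<Lambda> assume \<Lambda>: "\<Lambda> \<in> sets (F u)"
      have "(\<integral>w. indicator (\<Lambda> \<inter> B) w * (\<phi> (X (U w) w) - \<phi> (X u w) - occ X G u (U w) w) \<partial>P p) = 0"
      proof (rule stopped_difference_general[OF n p u0 Um Uin(1)])
        show "\<Lambda> \<inter> B \<in> sets (F u)" using \<Lambda> BF by auto
        fix s assume s: "s \<in> {u..h}"
        have "\<Lambda> \<inter> B \<inter> {w \<in> \<Omega>. U w < s} = \<Lambda> \<inter> B \<inter> {w \<in> \<Omega>. ?\<tau> w < s}"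
          using UB by auto
        also have "\<dots> \<in> sets (F s)"
          using natfilt_mono[of u s P X] \<Lambda> BF T_F[OF order_refl _ _ K, of s h] s u0 by auto
        finally show "\<Lambda> \<inter> B \<inter> {w \<in> \<Omega>. U w < s} \<in> sets (F s)" .
      qed
      then show "(\<integral>w\<in>\<Lambda>. \<zeta> w \<partial>P p) = (\<integral>w\<in>\<Lambda>. 0 \<partial>P p)"
        unfolding set_lebesgue_integral_def \<zeta>_def by (simp add: indicator_inter_arith mult.assoc)
    qed (use \<zeta>i in auto)
    have "(\<integral>w. Z w * \<zeta> w \<partial>P p) = (\<integral>w. Z w * real_cond_exp (P p) (F u) \<zeta> w \<partial>P p)"
      using \<zeta>i by (intro real_cond_exp_intg(2)[symmetric] Zi ZF) auto
    also have "\<dots> = (\<integral>w. 0 \<partial>P p)"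
      by (rule integral_cong_AE) (use ae Zm in auto)
    finally have Z0: "(\<integral>w. Z w * \<zeta> w \<partial>P p) = 0" by simp
    have Zd: "integrable (P p) (\<lambda>w. Z w * (\<phi> (X (U w) w) - \<phi> (X u w)))"
    proof (rule integrable_const_bound[where B="C * (2 * C)"])
      show "AE w in P p. norm (Z w * (\<phi> (X (U w) w) - \<phi> (X u w))) \<le> C * (2 * C)"
        unfolding real_norm_def abs_mult using C0
        by (intro AE_I2 mult_mono Zb tri nD(4) X_Gam space_PD[of _ p]) auto
    qed (use Zm i1 i2 in auto)
    have "(\<integral>w. \<psi> (u, w) \<partial>P p) = (\<integral>w. Z w * (\<phi> (X (U w) w) - \<phi> (X u w)) - Z w * \<zeta> w \<partial>P p)"
    proof (rule Bochner_Integration.integral_cong[OF refl])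
      fix w assume "w \<in> space (P p)"
      note w = space_PD[OF this]
      show "\<psi> (u, w) = Z w * (\<phi> (X (U w) w) - \<phi> (X u w)) - Z w * \<zeta> w"
      proof (cases "w \<in> B")
        case True
        have e: "D w - occ X G 0 u w = occ X G u (U w) w"
          using ocu[OF w] UB(1)[OF True] by (simp add: D_def)
        have "\<psi> (u, w) = G (X u w) * occ X G u (U w) w"
          using True cl(2)[OF u] by (simp add: \<psi>_def B_def e)
        then show ?thesis using True by (simp add: Z_def \<zeta>_def right_diff_distrib)
      next
        case False
        then show ?thesis using w cl(2)[OF u] by (simp add: \<psi>_def Z_def B_def)
      qed
    qed
    also have "\<dots> = (\<integral>w. Z w * (\<phi> (X (U w) w) - \<phi> (X u w)) \<partial>P p)"
      by (subst Bochner_Integration.integral_diff[OF Zd Zi]) (simp add: Z0)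
    also have "\<bar>\<dots>\<bar> \<le> (\<integral>w. 2 * \<epsilon> * \<psi>2 (u, w) \<partial>P p)"
    proof (rule integral_abs_le[OF Zd])
      have pw: "(\<lambda>w. \<psi>2 (u, w)) \<in> borel_measurable (P p)"
      proof -
        have "(\<lambda>w. (u, w)) \<in> measurable (P p) (borel \<Otimes>\<^sub>M P p)" by simp
        from measurable_compose[OF this \<psi>m(2)] show ?thesis .
      qed
      have "integrable (P p) (\<lambda>w. \<psi>2 (u, w))"
        by (rule integrable_const_bound[where B=C]) (use \<psi>b(2) pw in auto)
      then show "integrable (P p) (\<lambda>w. 2 * \<epsilon> * \<psi>2 (u, w))" by simp
      fix w assume w: "w \<in> space (P p)"
      have "\<bar>\<phi> (X (U w) w) - \<phi> (X u w)\<bar> \<le> 2 * \<epsilon>"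
        by (intro tri \<epsilon> X_Gam space_PD[OF w])
      then have "\<bar>Z w\<bar> * \<bar>\<phi> (X (U w) w) - \<phi> (X u w)\<bar> \<le> \<bar>Z w\<bar> * (2 * \<epsilon>)" by (intro mult_left_mono) auto
      moreover have "\<bar>Z w\<bar> = \<psi>2 (u, w)" using cl(2)[OF u] space_PD[OF w] by (simp add: Z_def \<psi>2_def B_def indicator_def)
      ultimately show "\<bar>Z w * (\<phi> (X (U w) w) - \<phi> (X u w))\<bar> \<le> 2 * \<epsilon> * \<psi>2 (u, w)"
        unfolding abs_mult by (simp add: mult.commute)
    qed
    finally show ?thesis by simp
  qed
  note Fub = bounded_Fubini[OF finite_measure_axioms \<psi>m(1) \<psi>b(1), of 0 h]
  note Fub2 = bounded_Fubini[OF finite_measure_axioms \<psi>m(2) \<psi>b(2), of 0 h]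
  have "(\<integral>w. (D w)\<^sup>2 \<partial>P p) = (\<integral>w. 2 * (\<integral>u. indicator {0..h} u * \<psi> (u, w) \<partial>lborel) \<partial>P p)"
    by (rule Bochner_Integration.integral_cong[OF refl sq])
  also have "\<dots> = 2 * (\<integral>u. indicator {0..h} u * (\<integral>w. \<psi> (u, w) \<partial>P p) \<partial>lborel)"
    using Fub(1) by simp
  also have "\<dots> \<le> 2 * (\<integral>u. indicator {0..h} u * (2 * \<epsilon> * (\<integral>w. \<psi>2 (u, w) \<partial>P p)) \<partial>lborel)"
  proof (rule mult_left_mono, rule integral_mono)
    show "integrable lborel (\<lambda>u. indicator {0..h} u * (\<integral>w. \<psi> (u, w) \<partial>P p))" by (rule Fub(4))
    have "integrable lborel (\<lambda>u. 2 * \<epsilon> * (indicator {0..h} u * (\<integral>w. \<psi>2 (u, w) \<partial>P p)))" using Fub2(4) by simp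
    then show "integrable lborel (\<lambda>u. indicator {0..h} u * (2 * \<epsilon> * (\<integral>w. \<psi>2 (u, w) \<partial>P p)))" by (simp add: mult.left_commute)
    show "indicator {0..h} u * (\<integral>w. \<psi> (u, w) \<partial>P p) \<le> indicator {0..h} u * (2 * \<epsilon> * (\<integral>w. \<psi>2 (u, w) \<partial>P p))" for u
      using inner[of u] by (auto simp: indicator_def)
  qed simp
  also have "\<dots> = 4 * \<epsilon> * (\<integral>u. indicator {0..h} u * (\<integral>w. \<psi>2 (u, w) \<partial>P p) \<partial>lborel)"
    by (simp add: mult.left_commute)
  also have "\<dots> = 4 * \<epsilon> * (\<integral>w. (\<integral>u. indicator {0..h} u * \<psi>2 (u, w) \<partial>lborel) \<partial>P p)"
    using Fub2(1) by simp
  also have "(\<integral>w. (\<integral>u. indicator {0..h} u * \<psi>2 (u, w) \<partial>lborel) \<partial>P p) = (\<integral>w. occ X (\<lambda>p. \<bar>G p\<bar>) 0 (?\<tau> w) w \<partial>P p)"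
  proof (rule Bochner_Integration.integral_cong[OF refl])
    fix w assume "w \<in> space (P p)"
    note w = space_PD[OF this]
    show "(\<integral>u. indicator {0..h} u * \<psi>2 (u, w) \<partial>lborel) = occ X (\<lambda>p. \<bar>G p\<bar>) 0 (?\<tau> w) w"
      unfolding occ_def
    proof (rule Bochner_Integration.integral_cong[OF refl])
      fix u
      show "indicator {0..h} u * \<psi>2 (u, w) = indicator {0..?\<tau> w} u * \<bar>G (X u w)\<bar>"
      proof (cases "u \<in> {0..h}")
        case True
        then show ?thesis using A\<tau>[OF w True] cl(2)[OF True] by (simp add: indicator_def \<psi>2_def)
      next
        case False
        then show ?thesis using \<tau>in[of w] by (auto simp: indicator_def)
      qed
    qed
  qed
  finally show ?thesis unfolding D_def .
qed

end

text \<open>The expectations are summable, so the series of absolute values is almost surely finite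
  and its terms tend to 0.\<close>

lemma AE_tendsto_0:
  fixes f :: "nat \<Rightarrow> 'a \<Rightarrow> real"
  assumes [measurable]: "\<And>n. integrable M (f n)" and b: "\<And>n. n \<ge> m \<Longrightarrow> (\<integral>x. \<bar>f n x\<bar> \<partial>M) \<le> (1 / 2) ^ n"
  shows "AE x in M. (\<lambda>n. f n x) \<longlonglongrightarrow> 0"
proof -
  have [measurable]: "f n \<in> borel_measurable M" for n using assms(1) by auto
  have "(\<integral>\<^sup>+x. (\<Sum>n. ennreal \<bar>f (n + m) x\<bar>) \<partial>M) = (\<Sum>n. \<integral>\<^sup>+x. ennreal \<bar>f (n + m) x\<bar> \<partial>M)"
    by (rule nn_integral_suminf) measurable
  also have "\<dots> \<le> (\<Sum>n. ennreal ((1 / 2) ^ n))"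
  proof (rule suminf_le)
    fix n
    have "(\<integral>\<^sup>+x. ennreal \<bar>f (n + m) x\<bar> \<partial>M) = ennreal (\<integral>x. \<bar>f (n + m) x\<bar> \<partial>M)"
      using assms(1) by (intro nn_integral_eq_integral) auto
    also have "\<dots> \<le> ennreal ((1 / 2) ^ n)"
      by (intro ennreal_leI order_trans[OF b power_decreasing]) auto
    finally show "(\<integral>\<^sup>+x. ennreal \<bar>f (n + m) x\<bar> \<partial>M) \<le> ennreal ((1 / 2) ^ n)" .
  qed auto
  also have "\<dots> = ennreal (\<Sum>n. (1 / 2) ^ n)"
    by (rule suminf_ennreal2) (auto intro: summable_geometric)
  also have "\<dots> < \<infinity>" by simp
  finally have "(\<integral>\<^sup>+x. (\<Sum>n. ennreal \<bar>f (n + m) x\<bar>) \<partial>M) \<noteq> \<infinity>" by simp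
  then have "AE x in M. (\<Sum>n. ennreal \<bar>f (n + m) x\<bar>) \<noteq> \<infinity>"
    by (intro nn_integral_noteq_infinite) auto
  then show ?thesis
  proof eventually_elim
    case (elim x)
    then have "summable (\<lambda>n. \<bar>f (n + m) x\<bar>)" by (intro summable_suminf_not_top) auto
    then have "(\<lambda>n. \<bar>f (n + m) x\<bar>) \<longlonglongrightarrow> 0" by (rule summable_LIMSEQ_zero)
    then have "(\<lambda>n. f (n + m) x) \<longlonglongrightarrow> 0" by (simp add: tendsto_rabs_zero_iff)
    then show ?case by (rule LIMSEQ_offset)
  qed
qed

context sticky
begin

lemma stopped_measurable:
  fixes \<Phi> :: "real \<Rightarrow> 'w \<Rightarrow> real"
  assumes "\<And>w. w \<in> \<Omega> \<Longrightarrow> continuous_on {0..} (\<lambda>s. \<Phi> s w)" "\<And>s. 0 \<le> s \<Longrightarrow> \<Phi> s \<in> borel_measurable (P p)"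
    and U: "U \<in> borel_measurable (P p)" "\<And>w. w \<in> \<Omega> \<Longrightarrow> U w \<ge> 0"
  shows "(\<lambda>w. \<Phi> (U w) w) \<in> borel_measurable (P p)"
proof -
  have m1: "(\<lambda>z. \<Phi> (max 0 (fst z)) (snd z)) \<in> borel_measurable (borel \<Otimes>\<^sub>M P p)"
    by (rule joint_measurable_real_atLeast) (auto intro: assms space_PD)
  have m2: "(\<lambda>w. (U w, w)) \<in> measurable (P p) (borel \<Otimes>\<^sub>M P p)" using U(1) by simp
  have m3: "(\<lambda>w. \<Phi> (max 0 (U w)) w) \<in> borel_measurable (P p)"
    using measurable_compose[OF m2 m1] by simp
  have "(\<lambda>w. \<Phi> (U w) w) \<in> borel_measurable (P p) \<longleftrightarrow> (\<lambda>w. \<Phi> (max 0 (U w)) w) \<in> borel_measurable (P p)"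
  proof (rule measurable_cong)
    fix w assume "w \<in> space (P p)"
    from U(2)[OF space_PD[OF this]] show "\<Phi> (U w) w = \<Phi> (max 0 (U w)) w" by simp
  qed
  then show ?thesis using m3 by blast
qed

lemma stopped_occ_measurable:
  assumes G: "G \<in> borel_measurable (GM N)" "\<And>p. p \<in> Gam N \<Longrightarrow> \<bar>G p\<bar> \<le> C"
    and U: "U \<in> borel_measurable (P p)" "\<And>w. w \<in> \<Omega> \<Longrightarrow> U w \<ge> 0"
  shows "(\<lambda>w. occ X G 0 (U w) w) \<in> borel_measurable (P p)"
proof (rule stopped_measurable[OF _ _ U])
  show "continuous_on {0..} (\<lambda>s. occ X G 0 s w)" if "w \<in> \<Omega>" for w
    by (rule occ_continuous[OF X_cp G(1) that G(2) order_refl])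
  show "occ X G 0 s \<in> borel_measurable (P p)" if "0 \<le> s" for s by (rule occ_P[OF G that])
qed

lemma stopped_occ_integrable:
  assumes G: "G \<in> borel_measurable (GM N)" "\<And>p. p \<in> Gam N \<Longrightarrow> \<bar>G p\<bar> \<le> C"
    and p: "p \<in> Gam N" and U: "U \<in> borel_measurable (P p)" "\<And>w. w \<in> \<Omega> \<Longrightarrow> U w \<in> {0..h}"
  shows "integrable (P p) (\<lambda>w. occ X G 0 (U w) w)"
proof -
  interpret prob_space "P p" by (rule prob) fact
  have C0: "0 \<le> C" using G(2)[OF p] by simp
  show ?thesis
  proof (rule integrable_const_bound[where B="C * h"])
    show "AE w in P p. norm (occ X G 0 (U w) w) \<le> C * h"
    proof (rule AE_I2)
      fix w assume "w \<in> space (P p)"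
      note w = space_PD[OF this]
      have "\<bar>occ X G 0 (U w) w\<bar> \<le> C * (U w - 0)" using U(2)[OF w] by (intro occ_bound[OF X_cp G(1) w G(2)]) auto
      also have "\<dots> \<le> C * h" using U(2)[OF w] C0 by (auto intro: mult_left_mono)
      finally show "norm (occ X G 0 (U w) w) \<le> C * h" by simp
    qed
    show "(\<lambda>w. occ X G 0 (U w) w) \<in> borel_measurable (P p)"
      by (rule stopped_occ_measurable[OF G U(1)]) (use U(2) in auto)
  qed
qed

text \<open>Scaled indicator of a punctured neighbourhood. The vertex is left out because the clock
  of the time-changed process does not run there.\<close>

definition near_avg :: "real \<Rightarrow> point \<Rightarrow> real" where
  "near_avg d = glue 0 (\<lambda>p. if snd p \<le> d then 1 / d else 0)"

lemma near_avg_meas: "near_avg d \<in> borel_measurable (GM N)"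
proof -
  have [measurable]: "snd \<in> borel_measurable (GM N)" unfolding GM_def by (auto intro: measurable_restrict_space1)
  show ?thesis unfolding near_avg_def by (intro glue_measurable) measurable
qed

lemma near_avg_bound: "d > 0 \<Longrightarrow> \<bar>near_avg d p\<bar> \<le> 1 / d" "d > 0 \<Longrightarrow> 0 \<le> near_avg d p"
  by (auto simp: near_avg_def glue_def)

text \<open>Near the vertex the diffusion term of the test function is \<open>1 / d\<close> times a
  quotient of variances close to 1, while its drift term stays bounded and is thus of relative order
  \<open>d\<close>. Beyond \<open>d\<close> both sides vanish, so the error is relative to
  \<open>near_avg\<close>.\<close>

lemma test_gen_close:
  assumes e: "e > 0"
  shows "\<exists>d0>0. \<forall>d. 0 < d \<and> d < d0 \<longrightarrow> (\<forall>p\<in>Gam N. \<bar>glue 0 (gev (test_gen d)) p - near_avg d p\<bar> \<le> e * near_avg d p)"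
proof -
  obtain W where W: "W \<ge> 0" "\<And>i. i < N \<Longrightarrow> 0 < lt_weight i" "\<And>i. i < N \<Longrightarrow> lt_weight i \<le> W" using lt_weight_bound by blast
  obtain k where k: "k \<ge> 0" "\<And>i x. i < N \<Longrightarrow> x \<ge> 0 \<Longrightarrow> \<bar>b i x\<bar> \<le> k" using coef_bound by blast
  have "\<forall>i\<in>{..<N}. \<exists>d>0. \<forall>x\<ge>0. x < d \<longrightarrow> \<bar>(\<sigma> i x)\<^sup>2 / (\<sigma> i 0)\<^sup>2 - 1\<bar> < e / 2"
  proof
    fix i assume "i \<in> {..<N}"
    then have i: "i < N" by simp
    have "continuous_on {0..} (\<lambda>x. (\<sigma> i x)\<^sup>2 / (\<sigma> i 0)\<^sup>2)"
      using \<sigma>_cont i \<sigma>2_pos[OF i order_refl] by (intro continuous_intros) auto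
    then have "\<exists>d>0. \<forall>x\<in>{0..}. dist x 0 < d \<longrightarrow> dist ((\<sigma> i x)\<^sup>2 / (\<sigma> i 0)\<^sup>2) ((\<sigma> i 0)\<^sup>2 / (\<sigma> i 0)\<^sup>2) < e / 2"
      using e unfolding continuous_on_iff by (metis atLeast_iff half_gt_zero order_refl)
    then show "\<exists>d>0. \<forall>x\<ge>0. x < d \<longrightarrow> \<bar>(\<sigma> i x)\<^sup>2 / (\<sigma> i 0)\<^sup>2 - 1\<bar> < e / 2"
      using \<sigma>2_pos[OF i order_refl] by (auto simp: dist_real_def)
  qed
  then obtain D where D: "\<And>i. i < N \<Longrightarrow> D i > 0" "\<And>i x. i < N \<Longrightarrow> x \<ge> 0 \<Longrightarrow> x < D i \<Longrightarrow> \<bar>(\<sigma> i x)\<^sup>2 / (\<sigma> i 0)\<^sup>2 - 1\<bar> < e / 2"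
    by (metis lessThan_iff)
  define d1' where "d1' = Min (insert 1 (D ` {..<N}))"
  have d1': "d1' > 0" "\<And>i. i < N \<Longrightarrow> d1' \<le> D i" using D(1) by (auto simp: d1'_def)
  \<comment> \<open>The first bound controls the oscillation of the variances, the second makes the
    relative drift error \<open>k * W * d\<close> at most \<open>e / 2\<close>.\<close>
  define d0 where "d0 = min d1' (e / (2 * (k * W + 1)))"
  have kW: "0 \<le> k * W" using k W by simp
  have d0: "d0 > 0" using d1' e kW by (simp add: d0_def)
  have "\<bar>glue 0 (gev (test_gen d)) p - near_avg d p\<bar> \<le> e * near_avg d p" if d: "0 < d" "d < d0" and p: "p \<in> Gam N" for d p
  proof (cases "p = vtx \<or> snd p > d")
    case True
    then show ?thesis using d by (auto simp: glue_def near_avg_def gev_def test_gen_def pos_def)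
  next
    case False
    then have pv: "p \<noteq> vtx" "snd p \<le> d" by auto
    define i x where "i = fst p" and "x = snd p"
    have ix: "i < N" "x \<ge> 0" "x \<le> d" using p pv by (auto simp: i_def x_def elim: GamE)
    have xD: "x < D i" using ix d d1'(2)[OF ix(1)] by (simp add: d0_def)
    note 1 = D(2)[OF ix(1,2) xD]
    have "\<bar>b i x * lt_weight i * (d - x)\<bar> \<le> k * W * d"
      unfolding abs_mult using k W(2,3)[OF ix(1)] ix W(1) by (intro mult_mono) (auto intro: less_imp_le)
    also have "\<dots> \<le> (k * W + 1) * d" using d by (simp add: mult_right_mono)
    also have "\<dots> \<le> e / 2"
    proof -
      have "d \<le> e / (2 * (k * W + 1))" using d by (simp add: d0_def)
      then show ?thesis using kW by (simp add: field_simps)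
    qed
    finally have 2: "\<bar>b i x * lt_weight i * (d - x)\<bar> \<le> e / 2" .
    have "test_gen d i x - 1 / d = ((\<sigma> i x)\<^sup>2 / (\<sigma> i 0)\<^sup>2 - 1 - b i x * lt_weight i * (d - x)) / d"
    proof -
      have "(\<sigma> i x)\<^sup>2 / 2 * lt_weight i = (\<sigma> i x)\<^sup>2 / (\<sigma> i 0)\<^sup>2" by (simp add: lt_weight_def)
      then have "test_gen d i x = ((\<sigma> i x)\<^sup>2 / (\<sigma> i 0)\<^sup>2 - b i x * lt_weight i * (d - x)) / d"
        using ix d by (simp add: test_gen_def pos_def diff_divide_distrib)
      then show ?thesis by (simp add: diff_divide_distrib)
    qed
    moreover have "\<bar>(\<sigma> i x)\<^sup>2 / (\<sigma> i 0)\<^sup>2 - 1 - b i x * lt_weight i * (d - x)\<bar> \<le> e" using 1 2 by linarith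
    ultimately have "\<bar>test_gen d i x - 1 / d\<bar> \<le> e / d"
      using d divide_right_mono[of _ e d] by (simp only: abs_divide abs_of_pos)
    then show ?thesis using pv by (simp add: glue_def near_avg_def gev_def i_def x_def)
  qed
  then show ?thesis using d0 by blast
qed

text \<open>The compensator of the test function is the near-vertex occupation minus
  \<open>lt_const\<close> times the local time, up to the relative error \<open>e1\<close>. The
  function has size of order \<open>d\<close>, so \<open>second_moment\<close> makes its compensator
  small. Uniformity in \<open>h\<close>, \<open>K\<close> and the starting point allows later
  limits.\<close>

lemma occupation_estimate:
  assumes e: "e > 0" and Kx: "Kx \<ge> 0"
  shows "\<exists>d0>0. \<forall>d. 0 < d \<and> d < d0 \<longrightarrow> (\<forall>p\<in>Gam N. \<forall>h\<ge>0. \<forall>K. 0 \<le> K \<and> K \<le> Kx \<longrightarrow>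
    (\<integral>w. \<bar>occ X (near_avg d) 0 (T 0 K h w) w - lt_const * (S (T 0 K h w) w / \<eta>)\<bar> \<partial>P p) \<le> e)"
proof -
  obtain W where W: "W \<ge> 0" "\<And>i. i < N \<Longrightarrow> 0 < lt_weight i" "\<And>i. i < N \<Longrightarrow> lt_weight i \<le> W" using lt_weight_bound by blast
  have cc0: "lt_const \<ge> 0" unfolding lt_const_def using \<rho>_pos by (intro sum_nonneg) (auto intro: less_imp_le)
  have ceK0: "lt_bound Kx \<ge> 0"
  proof -
    obtain C where "C \<ge> 0" "\<And>K. lt_bound K = 2 * C + C * K" using flux_fn_const by metis
    then show ?thesis using Kx by simp
  qed
  \<comment> \<open>Bounds the expected off-vertex part of the compensator: its martingale
    contributes at most \<open>2 * \<epsilon> \<le> W\<close>, the local time at most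
    \<open>lt_const * lt_bound Kx\<close>.\<close>
  define B where "B = W + lt_const * lt_bound Kx"
  have B: "B \<ge> 0" using W cc0 ceK0 by (simp add: B_def)
  \<comment> \<open>At most a half, so that the relative error can be absorbed, and small enough
    that \<open>e1\<close> times the expected occupation is at most \<open>e / 4\<close>.\<close>
  define e1 where "e1 = min (1 / 2) (e / (8 * (B + 1)))"
  have e1: "e1 > 0" "e1 \<le> 1 / 2" "2 * e1 * B \<le> e / 4"
  proof -
    show "e1 > 0" using e B by (simp add: e1_def)
    show "e1 \<le> 1 / 2" unfolding e1_def by (rule min.cobounded1)
    have "e1 \<le> e / (8 * (B + 1))" unfolding e1_def by (rule min.cobounded2)
    then have "e1 * (8 * (B + 1)) \<le> e" using B by (simp add: pos_le_divide_eq)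
    moreover have "8 * (e1 * B) \<le> e1 * (8 * (B + 1))" using \<open>e1 > 0\<close> by (simp add: algebra_simps)
    ultimately show "2 * e1 * B \<le> e / 4" by simp
  qed
  obtain d1' where d1': "d1' > 0" "\<And>d p. 0 < d \<Longrightarrow> d < d1' \<Longrightarrow> p \<in> Gam N \<Longrightarrow> \<bar>glue 0 (gev (test_gen d)) p - near_avg d p\<bar> \<le> e1 * near_avg d p"
    using test_gen_close[OF e1(1)] by blast
  \<comment> \<open>With \<open>\<epsilon> = W * d / 2\<close> the second moment bound is
    \<open>16 * \<epsilon> * B\<close>; the last condition pushes it below a quarter of the square
    of \<open>e\<close>.\<close>
  define d0 where "d0 = min d1' (min 1 (e\<^sup>2 / (32 * (B + 1) * (W + 1))))"
  have d0: "d0 > 0" using d1' e B W by (simp add: d0_def)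
  have "(\<integral>w. \<bar>occ X (near_avg d) 0 (T 0 K h w) w - lt_const * (S (T 0 K h w) w / \<eta>)\<bar> \<partial>P p) \<le> e"
    if d: "0 < d" "d < d0" and p: "p \<in> Gam N" and h: "h \<ge> 0" and K: "0 \<le> K" "K \<le> Kx" for d p h K
  proof -
    interpret prob_space "P p" by (rule prob) fact
    have dd: "d \<le> 1" "d < d1'" "d \<le> e\<^sup>2 / (32 * (B + 1) * (W + 1))" using d by (auto simp: d0_def)
    let ?\<tau> = "T 0 K h"
    note \<tau>m = T_meas[OF order_refl h K(1), of p]
    have \<tau>in: "?\<tau> w \<in> {0..h}" for w by (rule T_in[OF h])
    obtain C where n: "nice (gev (test_fn d)) (glue (- lt_const / \<eta>) (gev (test_gen d))) C" using nice_test_fn[OF d(1) dd(1)] by blast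
    note nD = niceD[OF n]
    define \<epsilon> where "\<epsilon> = W * d / 2"
    have \<epsilon>0: "\<epsilon> \<ge> 0" using W d by (simp add: \<epsilon>_def)
    have fle: "\<bar>gev (test_fn d) p\<bar> \<le> \<epsilon>" if "p \<in> Gam N" for p
    proof (rule gev_bd[OF _ that], unfold bd_def, intro allI impI)
      fix i and x :: real assume ix: "i < N" "0 \<le> x"
      have "0 \<le> pos (d - x)" "pos (d - x) \<le> d" using ix d by (auto simp: pos_def)
      then have "(pos (d - x))\<^sup>2 \<le> d\<^sup>2" by (intro power_mono) auto
      then have "\<bar>d\<^sup>2 / 2 - (pos (d - x))\<^sup>2 / 2\<bar> \<le> d\<^sup>2 / 2" by simp
      moreover have "\<bar>- lt_weight i / d\<bar> \<le> W / d" using W(2,3)[OF ix(1)] d by (simp add: divide_right_mono)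
      ultimately have "\<bar>test_fn d i x\<bar> \<le> W / d * (d\<^sup>2 / 2)"
        unfolding test_fn_def abs_mult using W d by (intro mult_mono) auto
      then show "\<bar>test_fn d i x\<bar> \<le> \<epsilon>" using d by (simp add: \<epsilon>_def power2_eq_square)
    qed
    define Gg where "Gg = glue 0 (gev (test_gen d))"
    have close: "\<bar>Gg p - near_avg d p\<bar> \<le> e1 * near_avg d p" if "p \<in> Gam N" for p
      unfolding Gg_def by (rule d1'(2)[OF d(1) dd(2) that])
    have Io0: "0 \<le> near_avg d p" for p by (rule near_avg_bound(2)[OF d(1)])
    have "Gg = (\<lambda>p. 1 * glue (- lt_const / \<eta>) (gev (test_gen d)) p + (lt_const / \<eta>) * Gv p)"
      by (auto simp: fun_eq_iff Gg_def glue_def Gv_def)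
    moreover have "(\<lambda>p. 1 * glue (- lt_const / \<eta>) (gev (test_gen d)) p + (lt_const / \<eta>) * Gv p) \<in> borel_measurable (GM N)"
      using nD(3) G_meas(2) by measurable
    ultimately have Ggm: "Gg \<in> borel_measurable (GM N)" by simp
    have Ggb: "\<bar>Gg p\<bar> \<le> C" if "p \<in> Gam N" for p
      using nD(5)[OF that] nD(4)[OF that] by (auto simp: Gg_def glue_def split: if_splits)
    note Iob = near_avg_bound(1)[OF d(1)]
    define O' where "O' w = occ X (near_avg d) 0 (?\<tau> w) w" for w
    define Og where "Og w = occ X Gg 0 (?\<tau> w) w" for w
    define l where "l w = S (?\<tau> w) w / \<eta>" for w
    define Dw where "Dw w = occ X (glue (- lt_const / \<eta>) (gev (test_gen d))) 0 (?\<tau> w) w" for w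
    have Oi: "integrable (P p) O'" unfolding O'_def by (rule stopped_occ_integrable[OF near_avg_meas Iob p \<tau>m \<tau>in])
    have Ogi: "integrable (P p) Og" unfolding Og_def by (rule stopped_occ_integrable[OF Ggm Ggb p \<tau>m \<tau>in])
    have Di: "integrable (P p) Dw" unfolding Dw_def by (rule stopped_integrable(2)[OF n p h \<tau>m \<tau>in])
    have li: "integrable (P p) l" unfolding l_def using local_time_bound(2)[OF p h K(1)] by simp
    have O0: "0 \<le> O' w" if "w \<in> \<Omega>" for w unfolding O'_def by (rule occ_nonneg[OF that order_refl Io0])
    have Deq: "Dw w = Og w - lt_const * l w" if w: "w \<in> \<Omega>" for w
    proof -
      have "(\<lambda>p. 1 * Gg p + (- lt_const / \<eta>) * Gv p) = glue (- lt_const / \<eta>) (gev (test_gen d))"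
        by (auto simp: fun_eq_iff Gg_def glue_def Gv_def)
      then show ?thesis
        using occ_lin[OF X_cp Ggm G_meas(2) w Ggb G_bound(2) order_refl, of 1 "- lt_const / \<eta>" "?\<tau> w"]
        by (simp add: Dw_def Og_def l_def S_def)
    qed
    have Ocl: "\<bar>Og w - O' w\<bar> \<le> e1 * O' w" if w: "w \<in> \<Omega>" for w
    proof -
      have z: "\<bar>0::real\<bar> \<le> 0" by simp
      \<comment> \<open>The added multiple 0 of \<open>Gv\<close> lets the linearity lemma for two
        functions serve for scaling.\<close>
      have up: "occ X Gg 0 (?\<tau> w) w \<le> occ X (\<lambda>p. (1 + e1) * near_avg d p + 0 * Gv p) 0 (?\<tau> w) w"
      proof (rule occ_mono[OF X_cp Ggm _ w Ggb _ order_refl])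
        show "(\<lambda>p. (1 + e1) * near_avg d p + 0 * Gv p) \<in> borel_measurable (GM N)" using near_avg_meas by simp
        show "\<bar>(1 + e1) * near_avg d p + 0 * Gv p\<bar> \<le> (1 + e1) * (1 / d)" for p
          unfolding mult_zero_left add_0_right abs_mult using e1 by (intro mult_mono Iob) auto
        show "Gg p \<le> (1 + e1) * near_avg d p + 0 * Gv p" if "p \<in> Gam N" for p
          using close[OF that] by (simp add: algebra_simps abs_le_iff)
      qed
      have lo: "occ X (\<lambda>p. (1 - e1) * near_avg d p + 0 * Gv p) 0 (?\<tau> w) w \<le> occ X Gg 0 (?\<tau> w) w"
      proof (rule occ_mono[OF X_cp _ Ggm w _ Ggb order_refl])
        show "(\<lambda>p. (1 - e1) * near_avg d p + 0 * Gv p) \<in> borel_measurable (GM N)" using near_avg_meas by simp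
        show "\<bar>(1 - e1) * near_avg d p + 0 * Gv p\<bar> \<le> \<bar>1 - e1\<bar> * (1 / d)" for p
          unfolding mult_zero_left add_0_right abs_mult by (rule mult_left_mono[OF Iob]) simp
        show "(1 - e1) * near_avg d p + 0 * Gv p \<le> Gg p" if "p \<in> Gam N" for p
          using close[OF that] by (simp add: algebra_simps abs_le_iff)
      qed
      have lin: "occ X (\<lambda>p. c * near_avg d p + 0 * Gv p) 0 (?\<tau> w) w = c * O' w" for c
        using occ_lin[OF X_cp near_avg_meas G_meas(2) w Iob G_bound(2) order_refl, of c 0 "?\<tau> w"] by (simp add: O'_def)
      show ?thesis using up[unfolded lin] lo[unfolded lin] by (simp add: Og_def algebra_simps abs_le_iff)
    qed
    have Eabs: "(\<integral>w. occ X (\<lambda>p. \<bar>glue (- lt_const / \<eta>) (gev (test_gen d)) p\<bar>) 0 (?\<tau> w) w \<partial>P p) \<le> (\<integral>w. (1 + e1) * O' w + lt_const * l w \<partial>P p)"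
    proof (rule integral_mono)
      have absm: "(\<lambda>p. \<bar>glue (- lt_const / \<eta>) (gev (test_gen d)) p\<bar>) \<in> borel_measurable (GM N)" using nD(3) by simp
      have absb: "\<bar>\<bar>glue (- lt_const / \<eta>) (gev (test_gen d)) p\<bar>\<bar> \<le> C" if "p \<in> Gam N" for p using nD(5)[OF that] by simp
      show "integrable (P p) (\<lambda>w. occ X (\<lambda>p. \<bar>glue (- lt_const / \<eta>) (gev (test_gen d)) p\<bar>) 0 (?\<tau> w) w)"
        by (rule stopped_occ_integrable[OF absm absb p \<tau>m \<tau>in])
      show "integrable (P p) (\<lambda>w. (1 + e1) * O' w + lt_const * l w)" using Oi li by simp
      fix w assume "w \<in> space (P p)"
      note w = space_PD[OF this]
      have "occ X (\<lambda>p. \<bar>glue (- lt_const / \<eta>) (gev (test_gen d)) p\<bar>) 0 (?\<tau> w) w \<le> occ X (\<lambda>p. (1 + e1) * near_avg d p + (lt_const / \<eta>) * Gv p) 0 (?\<tau> w) w"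
      proof (rule occ_mono[OF X_cp absm _ w absb _ order_refl])
        show "(\<lambda>p. (1 + e1) * near_avg d p + (lt_const / \<eta>) * Gv p) \<in> borel_measurable (GM N)"
          using near_avg_meas[of d] G_meas(2) by measurable
        show "\<bar>(1 + e1) * near_avg d p + (lt_const / \<eta>) * Gv p\<bar> \<le> (1 + e1) * (1 / d) + (lt_const / \<eta>) * 1" for p
        proof (rule order_trans[OF abs_triangle_ineq add_mono])
          show "\<bar>(1 + e1) * near_avg d p\<bar> \<le> (1 + e1) * (1 / d)"
            unfolding abs_mult using e1 by (intro mult_mono Iob) auto
          show "\<bar>(lt_const / \<eta>) * Gv p\<bar> \<le> (lt_const / \<eta>) * 1"
            unfolding abs_mult using cc0 \<eta> by (intro mult_mono G_bound) auto
        qed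
        show "\<bar>glue (- lt_const / \<eta>) (gev (test_gen d)) p\<bar> \<le> (1 + e1) * near_avg d p + (lt_const / \<eta>) * Gv p" if p': "p \<in> Gam N" for p
        proof (cases "p = vtx")
          case True
          then show ?thesis using cc0 \<eta> by (simp add: glue_def Gv_def near_avg_def)
        next
          case False
          then have "glue (- lt_const / \<eta>) (gev (test_gen d)) p = Gg p" "Gv p = 0" by (auto simp: glue_def Gg_def Gv_def)
          moreover have "\<bar>Gg p\<bar> \<le> (1 + e1) * near_avg d p"
            using close[OF p'] Io0[of p] by (simp add: algebra_simps abs_le_iff)
          ultimately show ?thesis by simp
        qed
      qed
      also have "\<dots> = (1 + e1) * O' w + lt_const * l w"
        using occ_lin[OF X_cp near_avg_meas G_meas(2) w Iob G_bound(2) order_refl, of "1 + e1" "lt_const / \<eta>" "?\<tau> w"]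
        by (simp add: O'_def l_def S_def)
      finally show "occ X (\<lambda>p. \<bar>glue (- lt_const / \<eta>) (gev (test_gen d)) p\<bar>) 0 (?\<tau> w) w \<le> (1 + e1) * O' w + lt_const * l w" .
    qed
    have El: "lt_const * (\<integral>w. l w \<partial>P p) \<le> lt_const * lt_bound Kx"
      using local_time_bound(1)[OF p h K(1)] lt_bound_mono[OF K(2)] cc0 unfolding l_def by (intro mult_left_mono) auto
    have ED: "(\<integral>w. Dw w \<partial>P p) \<le> 2 * \<epsilon>"
    proof -
      have z: "(\<integral>w. indicator \<Omega> w * (gev (test_fn d) (X (?\<tau> w) w) - gev (test_fn d) (X 0 w) - Dw w) \<partial>P p) = 0"
        unfolding Dw_def by (rule stopped_difference[OF n p order_refl h K(1) space_F])
      have i: "integrable (P p) (\<lambda>w. gev (test_fn d) (X (?\<tau> w) w) - gev (test_fn d) (X 0 w))"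
        using stopped_integrable(1)[OF n p h \<tau>m \<tau>in] stopped_integrable(1)[OF n p h, of "\<lambda>_. 0"] h by simp
      have "(\<integral>w. indicator \<Omega> w * (gev (test_fn d) (X (?\<tau> w) w) - gev (test_fn d) (X 0 w) - Dw w) \<partial>P p)
         = (\<integral>w. (gev (test_fn d) (X (?\<tau> w) w) - gev (test_fn d) (X 0 w)) - Dw w \<partial>P p)"
        by (rule Bochner_Integration.integral_cong[OF refl]) (simp add: space_PD)
      then have "(\<integral>w. Dw w \<partial>P p) = (\<integral>w. gev (test_fn d) (X (?\<tau> w) w) - gev (test_fn d) (X 0 w) \<partial>P p)"
        using z Bochner_Integration.integral_diff[OF i Di] by simp
      also have "\<bar>\<dots>\<bar> \<le> 2 * \<epsilon>"
      proof (rule abs_expectation_le)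
        fix w assume w: "w \<in> space (P p)"
        show "\<bar>gev (test_fn d) (X (?\<tau> w) w) - gev (test_fn d) (X 0 w)\<bar> \<le> 2 * \<epsilon>"
          using fle[OF X_Gam[OF space_PD[OF w]], of "?\<tau> w"] fle[OF X_Gam[OF space_PD[OF w]], of 0] by linarith
      qed
      finally show ?thesis by simp
    qed
    have e2W: "2 * \<epsilon> \<le> W" using W d dd by (simp add: \<epsilon>_def mult_left_le)
    \<comment> \<open>Absorption: the occupation exceeds the generator integral by at most a
      fraction \<open>e1 \<le> 1 / 2\<close> of itself, so its expectation is at most twice the
      bound \<open>B\<close>.\<close>
    have EO: "(\<integral>w. O' w \<partial>P p) \<le> 2 * B"
    proof -
      have EOg: "(\<integral>w. Og w \<partial>P p) = (\<integral>w. Dw w \<partial>P p) + lt_const * (\<integral>w. l w \<partial>P p)"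
      proof -
        have "(\<integral>w. Og w \<partial>P p) = (\<integral>w. Dw w + lt_const * l w \<partial>P p)"
          by (rule Bochner_Integration.integral_cong[OF refl]) (simp add: Deq space_PD)
        then show ?thesis using Di li by simp
      qed
      have "(1 - e1) * (\<integral>w. O' w \<partial>P p) = (\<integral>w. (1 - e1) * O' w \<partial>P p)" by simp
      also have "\<dots> \<le> (\<integral>w. Og w \<partial>P p)"
      proof (rule integral_mono)
        fix w assume "w \<in> space (P p)"
        from Ocl[OF space_PD[OF this]] show "(1 - e1) * O' w \<le> Og w" by (simp add: algebra_simps abs_le_iff)
      qed (use Oi Ogi in auto)
      also have "\<dots> \<le> B" using EOg ED El e2W by (simp add: B_def)
      finally have 1: "(1 - e1) * (\<integral>w. O' w \<partial>P p) \<le> B" .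
      have "0 \<le> (\<integral>w. O' w \<partial>P p)" using O0 by (intro integral_nonneg_AE AE_I2) (auto dest: space_PD)
      then have "1 / 2 * (\<integral>w. O' w \<partial>P p) \<le> (1 - e1) * (\<integral>w. O' w \<partial>P p)" using e1 by (intro mult_right_mono) auto
      then show ?thesis using 1 by simp
    qed
    have Eabs2: "(\<integral>w. occ X (\<lambda>p. \<bar>glue (- lt_const / \<eta>) (gev (test_gen d)) p\<bar>) 0 (?\<tau> w) w \<partial>P p) \<le> 4 * B"
    proof -
      have "(\<integral>w. (1 + e1) * O' w + lt_const * l w \<partial>P p) = (1 + e1) * (\<integral>w. O' w \<partial>P p) + lt_const * (\<integral>w. l w \<partial>P p)"
        using Oi li by simp
      also have "\<dots> \<le> (3 / 2) * (2 * B) + B"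
      proof (rule add_mono)
        have "(1 + e1) * (\<integral>w. O' w \<partial>P p) \<le> (1 + e1) * (2 * B)" using EO e1 by (intro mult_left_mono) auto
        also have "\<dots> \<le> (3 / 2) * (2 * B)" using e1 B by (intro mult_right_mono) auto
        finally show "(1 + e1) * (\<integral>w. O' w \<partial>P p) \<le> (3 / 2) * (2 * B)" .
        show "lt_const * (\<integral>w. l w \<partial>P p) \<le> B" using El W by (simp add: B_def)
      qed
      finally show ?thesis using Eabs by simp
    qed
    have "(\<integral>w. (Dw w)\<^sup>2 \<partial>P p) \<le> 4 * \<epsilon> * (\<integral>w. occ X (\<lambda>p. \<bar>glue (- lt_const / \<eta>) (gev (test_gen d)) p\<bar>) 0 (?\<tau> w) w \<partial>P p)"
      unfolding Dw_def by (rule second_moment[OF n fle p h K(1)])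
    also have "\<dots> \<le> 4 * \<epsilon> * (4 * B)" using Eabs2 \<epsilon>0 by (intro mult_left_mono) auto
    finally have D2: "(\<integral>w. (Dw w)\<^sup>2 \<partial>P p) \<le> 16 * \<epsilon> * B" by simp
    have De: "16 * \<epsilon> * B \<le> e * (e / 4)"
    proof -
      have "0 < 32 * (B + 1) * (W + 1)" using B W by (intro mult_pos_pos) auto
      from pos_le_divide_eq[OF this, THEN iffD1, OF dd(3)]
      have "d * (32 * (B + 1) * (W + 1)) \<le> e\<^sup>2" .
      moreover have "d * (W * B) \<le> d * ((W + 1) * (B + 1))" using d W B by (intro mult_left_mono mult_mono) auto
      ultimately show ?thesis by (simp add: \<epsilon>_def power2_eq_square algebra_simps)
    qed
    have D2i: "integrable (P p) (\<lambda>w. (Dw w)\<^sup>2)"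
    proof (rule integrable_const_bound[where B="(C * h)\<^sup>2"])
      show "AE w in P p. norm ((Dw w)\<^sup>2) \<le> (C * h)\<^sup>2"
      proof (rule AE_I2)
        fix w assume "w \<in> space (P p)"
        note w = space_PD[OF this]
        have C0: "0 \<le> C" using nD(4)[OF p] by simp
        have "\<bar>Dw w\<bar> \<le> C * (?\<tau> w - 0)" unfolding Dw_def using \<tau>in[of w] by (intro occ_bound[OF X_cp nD(3) w nD(5)]) auto
        also have "\<dots> \<le> C * h" using \<tau>in[of w] C0 by (auto intro: mult_left_mono)
        finally have "\<bar>Dw w\<bar>\<^sup>2 \<le> (C * h)\<^sup>2" by (intro power_mono) auto
        then show "norm ((Dw w)\<^sup>2) \<le> (C * h)\<^sup>2" by simp
      qed
    qed (use Di in auto)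
    have "(\<integral>w. \<bar>O' w - lt_const * l w\<bar> \<partial>P p) \<le> (\<integral>w. ((Dw w)\<^sup>2 / (e / 2) + e / 2) / 2 + e1 * O' w \<partial>P p)"
    proof (rule integral_mono)
      show "integrable (P p) (\<lambda>w. \<bar>O' w - lt_const * l w\<bar>)" using Oi li by auto
      show "integrable (P p) (\<lambda>w. ((Dw w)\<^sup>2 / (e / 2) + e / 2) / 2 + e1 * O' w)" using D2i Oi by simp
      fix w assume "w \<in> space (P p)"
      note w = space_PD[OF this]
      \<comment> \<open>Passes from the second to the first moment with a free parameter;
        \<open>s = e / 2\<close> balances it against the bound on the second moment.\<close>
      have amgm: "\<bar>y\<bar> \<le> (y\<^sup>2 / s + s) / 2" if "s > 0" for y s :: real
      proof -
        have "0 \<le> (\<bar>y\<bar> - s)\<^sup>2" by simp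
        then have "2 * (\<bar>y\<bar> * s) \<le> y\<^sup>2 + s\<^sup>2" by (simp add: power2_diff)
        then show ?thesis using that by (simp add: field_simps power2_eq_square)
      qed
      have "\<bar>O' w - lt_const * l w\<bar> \<le> \<bar>Dw w\<bar> + e1 * O' w" using Deq[OF w] Ocl[OF w] by linarith
      also have "\<bar>Dw w\<bar> \<le> ((Dw w)\<^sup>2 / (e / 2) + e / 2) / 2" using e by (intro amgm) simp
      finally show "\<bar>O' w - lt_const * l w\<bar> \<le> ((Dw w)\<^sup>2 / (e / 2) + e / 2) / 2 + e1 * O' w" by simp
    qed
    also have "\<dots> = ((\<integral>w. (Dw w)\<^sup>2 \<partial>P p) / (e / 2) + e / 2) / 2 + e1 * (\<integral>w. O' w \<partial>P p)"
      using D2i Oi by (simp add: prob_space)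
    also have "\<dots> \<le> (e / 2 + e / 2) / 2 + e / 4"
    proof -
      have "(\<integral>w. (Dw w)\<^sup>2 \<partial>P p) / (e / 2) \<le> e / 2" using D2 De e by (simp add: divide_le_eq)
      moreover have "e1 * (\<integral>w. O' w \<partial>P p) \<le> e1 * (2 * B)" using EO e1 by (intro mult_left_mono) auto
      then have "e1 * (\<integral>w. O' w \<partial>P p) \<le> e / 4" using e1(3) by simp
      ultimately show ?thesis by (intro add_mono divide_right_mono) auto
    qed
    also have "\<dots> \<le> e" using e by simp
    finally show ?thesis unfolding O'_def l_def .
  qed
  then show ?thesis using d0 by blast
qed

section \<open>The time change\<close>

text \<open>Rational times and integer levels make this a countable intersection of events;
  monotonicity of the clock extends strictness to all real times.\<close>

definition clock_paths :: "'w set" where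
  "clock_paths = {w \<in> \<Omega>. (\<forall>q\<in>\<rat>. \<forall>r\<in>\<rat>. 0 \<le> q \<and> q < r \<longrightarrow> A q w < A r w) \<and> (\<forall>K::nat. \<exists>h::nat. A (real h) w > real K)}"

lemma clock_paths_\<Omega>: "w \<in> clock_paths \<Longrightarrow> w \<in> \<Omega>" by (simp add: clock_paths_def)

lemma A_P: "0 \<le> t \<Longrightarrow> A t \<in> borel_measurable (P p)"
  by (rule F_meas[OF A_F])

lemma clock_paths_sets: "clock_paths \<in> sets (P p)"
proof -
  have 1: "{w \<in> space (P p). A q w < A r w} \<in> sets (P p)" if "0 \<le> q" "0 \<le> r" for q r
    using A_P[OF that(1)] A_P[OF that(2)] by (rule borel_measurable_less)
  have "clock_paths = (\<Inter>q\<in>\<rat>. \<Inter>r\<in>\<rat>. (if 0 \<le> q \<and> q < r then {w \<in> space (P p). A q w < A r w} else space (P p)))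
     \<inter> {w \<in> space (P p). \<forall>K::nat. \<exists>h::nat. A (real h) w > real K}"
    unfolding clock_paths_def space_P[of p, symmetric] by (auto split: if_splits)
  also have "\<dots> \<in> sets (P p)"
  proof (rule sets.Int)
    show "(\<Inter>q\<in>\<rat>. \<Inter>r\<in>\<rat>. (if 0 \<le> q \<and> q < r then {w \<in> space (P p). A q w < A r w} else space (P p))) \<in> sets (P p)"
    proof (intro sets.countable_INT'[OF countable_rat])
      show "(\<rat>::real set) \<noteq> {}" using Rats_0 by blast
      have "(\<Inter>r\<in>\<rat>. (if 0 \<le> q \<and> q < r then {w \<in> space (P p). A q w < A r w} else space (P p))) \<in> sets (P p)" for q
      proof (intro sets.countable_INT'[OF countable_rat])
        show "(\<rat>::real set) \<noteq> {}" using Rats_0 by blast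
        show "(\<lambda>r. (if 0 \<le> q \<and> q < r then {w \<in> space (P p). A q w < A r w} else space (P p))) ` \<rat> \<subseteq> sets (P p)"
          using 1[of q] by (auto simp: image_subset_iff)
      qed
      then show "(\<lambda>q. \<Inter>r\<in>\<rat>. (if 0 \<le> q \<and> q < r then {w \<in> space (P p). A q w < A r w} else space (P p))) ` \<rat> \<subseteq> sets (P p)"
        by blast
    qed
    have [measurable]: "A (real h) \<in> borel_measurable (P p)" for h :: nat by (rule A_P) simp
    show "{w \<in> space (P p). \<forall>K::nat. \<exists>h::nat. A (real h) w > real K} \<in> sets (P p)" by measurable
  qed
  finally show ?thesis .
qed

lemma AE_clock_paths:
  assumes p: "p \<in> Gam N"
  shows "AE w in P p. w \<in> clock_paths"
proof -
  have "AE w in P p. \<forall>q\<in>\<rat>. \<forall>r\<in>\<rat>. 0 \<le> q \<and> q < r \<longrightarrow> A q w < A r w"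
  proof (subst AE_ball_countable[OF countable_rat], intro ballI, subst AE_ball_countable[OF countable_rat], intro ballI)
    fix q r :: real
    show "AE w in P p. 0 \<le> q \<and> q < r \<longrightarrow> A q w < A r w"
      using A_increases[OF p, of q r] by (cases "0 \<le> q \<and> q < r") auto
  qed
  with A_unbounded[OF p] show ?thesis
    using AE_space by eventually_elim (auto simp: clock_paths_def dest: space_PD)
qed

text \<open>The inverse clock. It is only meaningful on \<open>clock_paths\<close>, where the clock
  maps the half-line bijectively onto itself.\<close>

definition tau :: "real \<Rightarrow> 'w \<Rightarrow> real" where
  "tau t w = inv_into {0..} (\<lambda>s. A s w) t"

context
  fixes w assumes w: "w \<in> clock_paths"
begin

lemma A_strict: "0 \<le> s \<Longrightarrow> s < t \<Longrightarrow> A s w < A t w"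
proof -
  assume s: "0 \<le> s" "s < t"
  obtain q where q: "q \<in> \<rat>" "s < q" "q < t" using Rats_dense_in_real[OF s(2)] by blast
  obtain r where r: "r \<in> \<rat>" "q < r" "r < t" using Rats_dense_in_real[OF q(3)] by blast
  have "A s w \<le> A q w" using s q by (intro A_mono[OF clock_paths_\<Omega>[OF w]]) auto
  also have "A q w < A r w" using w q r s unfolding clock_paths_def by auto
  also have "A r w \<le> A t w" using s q r by (intro A_mono[OF clock_paths_\<Omega>[OF w]]) auto
  finally show ?thesis .
qed

lemma A_le_iff: "0 \<le> s \<Longrightarrow> 0 \<le> t \<Longrightarrow> A s w \<le> A t w \<longleftrightarrow> s \<le> t"
  using A_strict[of t s] A_mono[OF clock_paths_\<Omega>[OF w], of s t] by (meson not_le)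

lemma A_less_iff: "0 \<le> s \<Longrightarrow> 0 \<le> t \<Longrightarrow> A s w < A t w \<longleftrightarrow> s < t"
  using A_le_iff[of t s] by (simp add: not_le[symmetric])

lemma tau: "0 \<le> t \<Longrightarrow> 0 \<le> tau t w" "0 \<le> t \<Longrightarrow> A (tau t w) w = t" "0 \<le> s \<Longrightarrow> tau (A s w) w = s"
proof -
  have inj: "inj_on (\<lambda>s. A s w) {0..}"
    by (intro inj_onI antisym) (auto simp: A_le_iff[symmetric])
  have sur: "t \<in> (\<lambda>s. A s w) ` {0..}" if t: "0 \<le> t" for t
  proof -
    obtain K :: nat where K: "t \<le> real K" using real_arch_simple by blast
    obtain h :: nat where h: "real K < A (real h) w" using w unfolding clock_paths_def by blast
    have "\<exists>s\<ge>0. s \<le> real h \<and> A s w = t"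
      using t K h A_0[of w] by (intro IVT' continuous_on_subset[OF A_continuous[OF clock_paths_\<Omega>[OF w]]]) auto
    then show ?thesis by force
  qed
  show "0 \<le> tau t w" if "0 \<le> t" unfolding tau_def using inv_into_into[OF sur[OF that]] by simp
  show "A (tau t w) w = t" if "0 \<le> t" unfolding tau_def using f_inv_into_f[OF sur[OF that]] by simp
  show "tau (A s w) w = s" if "0 \<le> s" unfolding tau_def using inv_into_f_f[OF inj, of s] that by simp
qed

lemma tau_0: "tau 0 w = 0"
  using tau(3)[of 0] A_0[of w] by simp

lemma tau_le_iff: "0 \<le> s \<Longrightarrow> 0 \<le> t \<Longrightarrow> tau s w \<le> tau t w \<longleftrightarrow> s \<le> t"
  using A_le_iff[of "tau s w" "tau t w"] tau(1,2) by simp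

lemma tau_continuous: "continuous_on {0..} (\<lambda>t. tau t w)"
  unfolding continuous_on_iff
proof (intro ballI allI impI)
  fix t e :: real assume t: "t \<in> {0..}" and e: "e > 0"
  then have t0: "0 \<le> t" by simp
  define s where "s = tau t w"
  have s: "0 \<le> s" "A s w = t" using tau(1,2)[OF t0] by (auto simp: s_def)
  define e' where "e' = e / 2"
  have e': "e' > 0" "e' < e" using e by (auto simp: e'_def)
  define d1' where "d1' = A (s + e') w - t"
  have d1': "d1' > 0" using A_strict[OF s(1), of "s + e'"] e' s(2) by (simp add: d1'_def)
  define d2 where "d2 = (if s - e' \<ge> 0 then t - A (s - e') w else 1)"
  have d2: "d2 > 0" using A_strict[of "s - e'" s] e' s(2) by (simp add: d2_def)
  have "dist (tau r w) (tau t w) < e" if r: "r \<in> {0..}" "dist r t < min d1' d2" for r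
  proof -
    have r0: "0 \<le> r" using r by simp
    have rd: "\<bar>r - t\<bar> < d1'" "\<bar>r - t\<bar> < d2" using r(2) by (auto simp: dist_real_def)
    have "A (tau r w) w < A (s + e') w" using tau(2)[OF r0] rd(1) unfolding d1'_def by linarith
    then have up: "tau r w < s + e'" using A_less_iff[of "tau r w" "s + e'"] tau(1)[OF r0] s e' by simp
    have lo: "s - e' < tau r w"
    proof (cases "s - e' \<ge> 0")
      case True
      then have "d2 = t - A (s - e') w" by (simp add: d2_def)
      then have "A (s - e') w < A (tau r w) w" using tau(2)[OF r0] rd(2) by linarith
      then show ?thesis using A_less_iff[OF True tau(1)[OF r0]] by simp
    next
      case False
      then show ?thesis using tau(1)[OF r0] by simp
    qed
    show ?thesis using up lo e' by (simp add: dist_real_def s_def[symmetric] abs_less_iff)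
  qed
  then show "\<exists>d>0. \<forall>x'\<in>{0..}. dist x' t < d \<longrightarrow> dist (tau x' w) (tau t w) < e"
    using d1' d2 by (intro exI[of _ "min d1' d2"]) auto
qed

text \<open>Both sides are compared through the events of lying below \<open>s\<close>, which for
  \<open>T\<close> and for \<open>tau\<close> are decided by the value of the clock at
  \<open>s\<close>.\<close>

lemma T_tau:
  assumes "0 \<le> t" "0 \<le> h"
  shows "T 0 t h w = min (tau t w) h"
proof -
  note Tin = T_in[OF assms(2), of t w]
  have less: "T 0 t h w < s \<longleftrightarrow> tau t w < s" if "0 \<le> s" "s \<le> h" for s
    using T_less[OF clock_paths_\<Omega>[OF w] order_refl that assms(1)] A_0[of w] tau(2)[OF assms(1)] A_less_iff[OF tau(1)[OF assms(1)] that(1)] by simp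
  have "\<not> T 0 t h w < T 0 t h w" by simp
  then have 1: "T 0 t h w \<le> tau t w" using less[of "T 0 t h w"] Tin by auto
  have 2: "T 0 t h w \<ge> min (tau t w) h"
  proof (rule ccontr)
    assume "\<not> T 0 t h w \<ge> min (tau t w) h"
    then have lt: "T 0 t h w < min (tau t w) h" by (simp only: not_le)
    then show False using less[of "min (tau t w) h"] tau(1)[OF assms(1)] assms(2) by auto
  qed
  show ?thesis using 1 2 Tin by (intro antisym min.boundedI) auto
qed

lemma T_tau_eventually: "0 \<le> t \<Longrightarrow> \<forall>\<^sub>F n in sequentially. T 0 t (real n) w = tau t w"
proof -
  assume t: "0 \<le> t"
  obtain m :: nat where "tau t w \<le> real m" using real_arch_simple by blast
  then show ?thesis
    using T_tau[OF t] by (intro eventually_sequentiallyI[of m]) (simp add: min_def)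
qed

end

text \<open>The value 0 off \<open>clock_paths\<close> makes the time measurable and nonnegative
  everywhere.\<close>

definition gtau :: "real \<Rightarrow> 'w \<Rightarrow> real" where "gtau t w = (if w \<in> clock_paths then tau t w else 0)"

lemma gtau_meas: "0 \<le> t \<Longrightarrow> gtau t \<in> borel_measurable (P p)"
proof (rule borel_measurable_LIMSEQ_real)
  assume t: "0 \<le> t"
  show "(\<lambda>w. if w \<in> clock_paths then T 0 t (real n) w else 0) \<in> borel_measurable (P p)" for n
    using T_meas[OF order_refl _ t, of "real n" p] clock_paths_sets[of p] by (intro measurable_If_set) auto
  fix w
  show "(\<lambda>n. if w \<in> clock_paths then T 0 t (real n) w else 0) \<longlonglongrightarrow> gtau t w"
    unfolding gtau_def using T_tau_eventually[OF _ t] by (auto intro: tendsto_eventually)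
qed

lemma gtau_nonneg: "0 \<le> t \<Longrightarrow> 0 \<le> gtau t w"
  using tau(1) by (simp add: gtau_def)

text \<open>Monotone convergence as the truncation is removed; the bound \<open>lt_bound t\<close>
  does not depend on it.\<close>

lemma local_time_integrable:
  assumes p: "p \<in> Gam N" and t: "0 \<le> t"
  shows "integrable (P p) (\<lambda>w. S (gtau t w) w / \<eta>)"
proof -
  interpret prob_space "P p" by (rule prob) fact
  define f where "f n w = (if w \<in> clock_paths then S (T 0 t (real n) w) w / \<eta> else 0)" for n w
  have Sg: "S (gtau t w) w / \<eta> = (if w \<in> clock_paths then S (tau t w) w / \<eta> else 0)" if "w \<in> space (P p)" for w
  proof -
    have "S 0 w = 0" using A_S[OF space_PD[OF that], of 0] A_0[of w] by simp
    then show ?thesis by (simp add: gtau_def)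
  qed
  have fi: "integrable (P p) (f n)" for n
  proof -
    have "integrable (P p) (\<lambda>w. indicator clock_paths w *\<^sub>R (S (T 0 t (real n) w) w / \<eta>))"
      using local_time_bound(2)[OF p _ t, of "real n"] by (intro integrable_mult_indicator[OF clock_paths_sets]) auto
    then show ?thesis
      by (rule Bochner_Integration.integrable_cong[OF refl, THEN iffD1, rotated]) (simp add: f_def indicator_def)
  qed
  have Tmono: "T 0 t (real m) w \<le> T 0 t (real n) w" if "m \<le> n" "w \<in> clock_paths" for m n w
    using T_tau[OF that(2) t] that(1) by (simp add: min.coboundedI2)
  have fmono: "f m w \<le> f n w" if "m \<le> n" for m n w
    using S_mono[OF clock_paths_\<Omega>, of w "T 0 t (real m) w" "T 0 t (real n) w"] Tmono[OF that, of w] T_in[of 0 "real m" t w] \<eta>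
    by (auto simp: f_def divide_right_mono)
  have Ef: "(\<integral>w. f n w \<partial>P p) \<le> lt_bound t" for n
  proof -
    have "(\<integral>w. f n w \<partial>P p) \<le> (\<integral>w. S (T 0 t (real n) w) w / \<eta> \<partial>P p)"
    proof (rule integral_mono[OF fi])
      show "integrable (P p) (\<lambda>w. S (T 0 t (real n) w) w / \<eta>)" using local_time_bound(2)[OF p _ t, of "real n"] by simp
      fix w assume "w \<in> space (P p)"
      then have "0 \<le> S (T 0 t (real n) w) w" unfolding S_def by (intro occ_nonneg space_PD[of w p] G_bound) auto
      then show "f n w \<le> S (T 0 t (real n) w) w / \<eta>" using \<eta> by (simp add: f_def)
    qed
    also have "\<dots> \<le> lt_bound t" by (rule local_time_bound(1)[OF p _ t]) simp
    finally show ?thesis .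
  qed
  have "incseq (\<lambda>n. \<integral>w. f n w \<partial>P p)"
    by (intro incseq_SucI integral_mono fi fmono) simp
  then obtain l where l: "(\<lambda>n. \<integral>w. f n w \<partial>P p) \<longlonglongrightarrow> l" using incseq_convergent[of _ "lt_bound t"] Ef by blast
  have Sm: "(\<lambda>w. S (gtau t w) w / \<eta>) \<in> borel_measurable (P p)"
    unfolding S_def using stopped_occ_measurable[OF G_meas(2) G_bound(2) gtau_meas[OF t] gtau_nonneg[OF t], of p] by simp
  show ?thesis
  proof (rule integrable_monotone_convergence[OF fi _ _ l Sm])
    show "AE w in P p. mono (\<lambda>n. f n w)" by (intro AE_I2 monoI fmono)
    show "AE w in P p. (\<lambda>n. f n w) \<longlonglongrightarrow> S (gtau t w) w / \<eta>"
    proof (rule AE_I2)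
      fix w assume ww: "w \<in> space (P p)"
      show "(\<lambda>n. f n w) \<longlonglongrightarrow> S (gtau t w) w / \<eta>"
      proof (cases "w \<in> clock_paths")
        case True
        show ?thesis
          by (rule tendsto_eventually, rule eventually_mono[OF T_tau_eventually[OF True t]]) (simp add: Sg[OF ww] f_def True)
      next
        case False
        then show ?thesis by (simp add: Sg[OF ww] f_def)
      qed
    qed
  qed
qed

lemma occupation_integrable:
  assumes p: "p \<in> Gam N" and t: "0 \<le> t" and d: "d > 0"
  shows "integrable (P p) (\<lambda>w. occ X (near_avg d) 0 (gtau t w) w)"
    and "\<And>w. w \<in> \<Omega> \<Longrightarrow> 0 \<le> t \<Longrightarrow> \<bar>occ X (near_avg d) 0 (gtau t w) w\<bar> \<le> t / d"
proof -
  interpret prob_space "P p" by (rule prob) fact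
  show b: "\<bar>occ X (near_avg d) 0 (gtau t w) w\<bar> \<le> t / d" if w: "w \<in> \<Omega>" for w
  proof -
    have m: "(\<lambda>p. if snd p \<le> d then 1 / d else 0) \<in> borel_measurable (GM N)"
    proof -
      have [measurable]: "snd \<in> borel_measurable (GM N)" unfolding GM_def by (auto intro: measurable_restrict_space1)
      show ?thesis by measurable
    qed
    have "\<bar>occ X (near_avg d) 0 (gtau t w) w\<bar> \<le> 1 / d * A (gtau t w) w"
      unfolding near_avg_def A_def using d by (intro occ_glue_bound[OF w m]) auto
    also have "A (gtau t w) w \<le> t" using tau(2)[OF _ t] A_0[of w] t by (simp add: gtau_def)
    finally show ?thesis using d by (simp add: divide_right_mono)
  qed
  show "integrable (P p) (\<lambda>w. occ X (near_avg d) 0 (gtau t w) w)"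
  proof (rule integrable_const_bound[where B="t / d"])
    show "AE w in P p. norm (occ X (near_avg d) 0 (gtau t w) w) \<le> t / d"
      unfolding real_norm_def by (intro AE_I2 b space_PD[of _ p])
    show "(\<lambda>w. occ X (near_avg d) 0 (gtau t w) w) \<in> borel_measurable (P p)"
      by (rule stopped_occ_measurable[OF near_avg_meas near_avg_bound(1)[OF d] gtau_meas[OF t] gtau_nonneg[OF t]])
  qed
qed

text \<open>The truncated estimate is uniform in \<open>h\<close>, so it passes to the limit. Up to
  \<open>tau t\<close> the occupation is at most \<open>t / d\<close> because the clock is at most
  \<open>t\<close>, and the local time is integrable, which supplies a dominating function.\<close>

lemma occupation_estimate_Y:
  assumes e: "e > 0" and Kx: "Kx \<ge> 0"
  shows "\<exists>d0>0. \<forall>d. 0 < d \<and> d < d0 \<longrightarrow> (\<forall>p\<in>Gam N. \<forall>t. 0 \<le> t \<and> t \<le> Kx \<longrightarrow>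
    (\<integral>w. \<bar>occ X (near_avg d) 0 (gtau t w) w - lt_const * (S (gtau t w) w / \<eta>)\<bar> \<partial>P p) \<le> e)"
proof -
  obtain d0 where d0: "d0 > 0" "\<forall>d. 0 < d \<and> d < d0 \<longrightarrow> (\<forall>p\<in>Gam N. \<forall>h\<ge>0. \<forall>K. 0 \<le> K \<and> K \<le> Kx \<longrightarrow>
    (\<integral>w. \<bar>occ X (near_avg d) 0 (T 0 K h w) w - lt_const * (S (T 0 K h w) w / \<eta>)\<bar> \<partial>P p) \<le> e)"
    using occupation_estimate[OF e Kx] by blast
  have cc0: "lt_const \<ge> 0" unfolding lt_const_def using \<rho>_pos by (intro sum_nonneg) (auto intro: less_imp_le)
  have "(\<integral>w. \<bar>occ X (near_avg d) 0 (gtau t w) w - lt_const * (S (gtau t w) w / \<eta>)\<bar> \<partial>P p) \<le> e"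
    if d: "0 < d" "d < d0" and p: "p \<in> Gam N" and t: "0 \<le> t" "t \<le> Kx" for d p t
  proof (rule LIMSEQ_le_const2)
    interpret prob_space "P p" by (rule prob) fact
    define f where "f n w = \<bar>occ X (near_avg d) 0 (T 0 t (real n) w) w - lt_const * (S (T 0 t (real n) w) w / \<eta>)\<bar>" for n w
    have Tm: "T 0 t (real n) \<in> borel_measurable (P p)" for n by (rule T_meas[OF order_refl _ t(1)]) simp
    have T0: "T 0 t (real n) w \<ge> 0" for n w using T_in[of 0 "real n" t w] by simp
    show "(\<lambda>n. \<integral>w. f n w \<partial>P p) \<longlonglongrightarrow> (\<integral>w. \<bar>occ X (near_avg d) 0 (gtau t w) w - lt_const * (S (gtau t w) w / \<eta>)\<bar> \<partial>P p)"
    proof (rule integral_dominated_convergence[where w="\<lambda>w. t / d + lt_const * (S (gtau t w) w / \<eta>)"])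
      show "f n \<in> borel_measurable (P p)" for n
        unfolding f_def S_def
        using stopped_occ_measurable[OF near_avg_meas near_avg_bound(1)[OF d(1)] Tm T0] stopped_occ_measurable[OF G_meas(2) G_bound(2) Tm T0]
        by simp
      show "(\<lambda>w. \<bar>occ X (near_avg d) 0 (gtau t w) w - lt_const * (S (gtau t w) w / \<eta>)\<bar>) \<in> borel_measurable (P p)"
        using occupation_integrable(1)[OF p t(1) d(1)] local_time_integrable[OF p t(1)] by (intro borel_measurable_abs borel_measurable_diff borel_measurable_times) auto
      show "integrable (P p) (\<lambda>w. t / d + lt_const * (S (gtau t w) w / \<eta>))"
        by (intro Bochner_Integration.integrable_add integrable_mult_right local_time_integrable[OF p t(1)]) simp
      show "AE w in P p. (\<lambda>n. f n w) \<longlonglongrightarrow> \<bar>occ X (near_avg d) 0 (gtau t w) w - lt_const * (S (gtau t w) w / \<eta>)\<bar>"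
        using AE_clock_paths[OF p]
      proof eventually_elim
        case (elim w)
        show ?case
          by (rule tendsto_eventually, rule eventually_mono[OF T_tau_eventually[OF elim t(1)]]) (simp add: f_def gtau_def elim)
      qed
      show "AE w in P p. norm (f n w) \<le> t / d + lt_const * (S (gtau t w) w / \<eta>)" for n
        using AE_clock_paths[OF p]
      proof eventually_elim
        case (elim w)
        note w = clock_paths_\<Omega>[OF elim]
        have le: "T 0 t (real n) w \<le> gtau t w" using T_tau[OF elim t(1), of "real n"] elim by (simp add: gtau_def)
        have O: "0 \<le> occ X (near_avg d) 0 r w" for r by (rule occ_nonneg[OF w order_refl near_avg_bound(2)[OF d(1)]])
        have "occ X (near_avg d) 0 (gtau t w) w = occ X (near_avg d) 0 (T 0 t (real n) w) w + occ X (near_avg d) (T 0 t (real n) w) (gtau t w) w"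
          by (rule occ_add[OF X_cp near_avg_meas w near_avg_bound(1)[OF d(1)] order_refl T0 le])
        moreover have "0 \<le> occ X (near_avg d) (T 0 t (real n) w) (gtau t w) w" by (rule occ_nonneg[OF w T0 near_avg_bound(2)[OF d(1)]])
        ultimately have 1: "occ X (near_avg d) 0 (T 0 t (real n) w) w \<le> t / d"
          using occupation_integrable(2)[OF p t(1) d(1) w t(1)] by linarith
        have "S (T 0 t (real n) w) w \<le> S (gtau t w) w" by (rule S_mono[OF w T0 le])
        then have 2: "lt_const * (S (T 0 t (real n) w) w / \<eta>) \<le> lt_const * (S (gtau t w) w / \<eta>)"
          using cc0 \<eta> by (intro mult_left_mono divide_right_mono) auto
        have "0 \<le> S (T 0 t (real n) w) w" unfolding S_def by (rule occ_nonneg[OF w order_refl G_bound(4)])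
        then have 3: "0 \<le> lt_const * (S (T 0 t (real n) w) w / \<eta>)" using cc0 \<eta> by simp
        show ?case unfolding f_def using 1 2 3 O[of "T 0 t (real n) w"] by simp
      qed
    qed
    have "(\<integral>w. f n w \<partial>P p) \<le> e" for n
      unfolding f_def using d0(2) d p t by simp
    then show "\<exists>M. \<forall>n\<ge>M. (\<integral>w. f n w \<partial>P p) \<le> e" by blast
  qed
  then show ?thesis using d0(1) by blast
qed

text \<open>One sequence of widths that works for all starting points and, eventually, for every
  time, with summable errors. It turns convergence in mean into almost sure convergence on an event
  that does not depend on the law. Widths less than 1 matter for the paths parked at distance
  1.\<close>

lemma widths_ex: "\<exists>d. \<forall>n. 0 < d n \<and> d n < 1 \<and> (\<forall>p\<in>Gam N. \<forall>t. 0 \<le> t \<and> t \<le> real n \<longrightarrow>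
    (\<integral>w. \<bar>occ X (near_avg (d n)) 0 (gtau t w) w - lt_const * (S (gtau t w) w / \<eta>)\<bar> \<partial>P p) \<le> (1 / 2) ^ n)"
proof (rule choice, rule allI)
  fix n :: nat
  obtain d0 where d0: "d0 > 0" "\<forall>d. 0 < d \<and> d < d0 \<longrightarrow> (\<forall>p\<in>Gam N. \<forall>t. 0 \<le> t \<and> t \<le> real n \<longrightarrow>
    (\<integral>w. \<bar>occ X (near_avg d) 0 (gtau t w) w - lt_const * (S (gtau t w) w / \<eta>)\<bar> \<partial>P p) \<le> (1 / 2) ^ n)"
    using occupation_estimate_Y[of "(1 / 2) ^ n" "real n"] by auto
  define d where "d = min (d0 / 2) (1 / 2)"
  have "0 < d" "d < d0" "d < 1" using d0(1) by (auto simp: d_def)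
  then show "\<exists>d. 0 < d \<and> d < 1 \<and> (\<forall>p\<in>Gam N. \<forall>t. 0 \<le> t \<and> t \<le> real n \<longrightarrow>
    (\<integral>w. \<bar>occ X (near_avg d) 0 (gtau t w) w - lt_const * (S (gtau t w) w / \<eta>)\<bar> \<partial>P p) \<le> (1 / 2) ^ n)"
    using d0(2) by (intro exI[of _ d]) auto
qed

definition widths :: "nat \<Rightarrow> real" where
  "widths = (SOME d. \<forall>n. 0 < d n \<and> d n < 1 \<and> (\<forall>p\<in>Gam N. \<forall>t. 0 \<le> t \<and> t \<le> real n \<longrightarrow>
    (\<integral>w. \<bar>occ X (near_avg (d n)) 0 (gtau t w) w - lt_const * (S (gtau t w) w / \<eta>)\<bar> \<partial>P p) \<le> (1 / 2) ^ n))"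

lemma widths: "0 < widths n" "widths n < 1"
    "p \<in> Gam N \<Longrightarrow> 0 \<le> t \<Longrightarrow> t \<le> real n \<Longrightarrow> (\<integral>w. \<bar>occ X (near_avg (widths n)) 0 (gtau t w) w - lt_const * (S (gtau t w) w / \<eta>)\<bar> \<partial>P p) \<le> (1 / 2) ^ n"
  using someI_ex[OF widths_ex, folded widths_def] by blast+

text \<open>
  The extra condition makes \<open>lY\<close> a pointwise limit of functionals of \<open>Y\<close> at
  rational times, hence adapted to the uncompleted filtration of \<open>Y\<close>. It is also why
  \<open>Y\<close> is parked off the vertex on the exceptional paths, where \<open>lY\<close> is zero.
\<close>

definition good_paths :: "'w set" where
  "good_paths = {w \<in> clock_paths. \<forall>t\<in>\<rat>. 0 \<le> t \<longrightarrow> (\<lambda>n. occ X (near_avg (widths n)) 0 (gtau t w) w - lt_const * (S (gtau t w) w / \<eta>)) \<longlonglongrightarrow> 0}"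

lemma good_paths_clock_paths: "w \<in> good_paths \<Longrightarrow> w \<in> clock_paths" by (simp add: good_paths_def)

lemma good_paths_sets: "good_paths \<in> sets (P p)"
proof -
  define f where "f t n w = occ X (near_avg (widths n)) 0 (gtau t w) w - lt_const * (S (gtau t w) w / \<eta>)" for t n w
  have fm: "f t n \<in> borel_measurable (P p)" if "0 \<le> t" for t n
    unfolding f_def S_def
    using stopped_occ_measurable[OF near_avg_meas near_avg_bound(1)[OF widths(1)] gtau_meas[OF that] gtau_nonneg[OF that]]
      stopped_occ_measurable[OF G_meas(2) G_bound(2) gtau_meas[OF that] gtau_nonneg[OF that]]
    by simp
  have 1: "{w \<in> space (P p). (\<lambda>n. f t n w) \<longlonglongrightarrow> 0} \<in> sets (P p)" if "0 \<le> t" for t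
    using fm[OF that] by measurable
  have "good_paths = clock_paths \<inter> (\<Inter>t\<in>\<rat>. (if 0 \<le> t then {w \<in> space (P p). (\<lambda>n. f t n w) \<longlonglongrightarrow> 0} else space (P p)))"
    unfolding good_paths_def f_def space_P[of p] using clock_paths_\<Omega> by (auto split: if_splits)
  also have "\<dots> \<in> sets (P p)"
  proof (rule sets.Int[OF clock_paths_sets], intro sets.countable_INT'[OF countable_rat])
    show "(\<rat>::real set) \<noteq> {}" using Rats_0 by blast
    show "(\<lambda>t. (if 0 \<le> t then {w \<in> space (P p). (\<lambda>n. f t n w) \<longlonglongrightarrow> 0} else space (P p))) ` \<rat> \<subseteq> sets (P p)"
      using 1 by (auto simp: image_subset_iff)
  qed
  finally show ?thesis .
qed

lemma AE_good_paths:
  assumes p: "p \<in> Gam N"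
  shows "AE w in P p. w \<in> good_paths"
proof -
  have "AE w in P p. \<forall>t\<in>\<rat>. 0 \<le> t \<longrightarrow> (\<lambda>n. occ X (near_avg (widths n)) 0 (gtau t w) w - lt_const * (S (gtau t w) w / \<eta>)) \<longlonglongrightarrow> 0"
  proof (subst AE_ball_countable[OF countable_rat], intro ballI)
    fix t :: real
    show "AE w in P p. 0 \<le> t \<longrightarrow> (\<lambda>n. occ X (near_avg (widths n)) 0 (gtau t w) w - lt_const * (S (gtau t w) w / \<eta>)) \<longlonglongrightarrow> 0"
    proof (cases "0 \<le> t")
      case True
      obtain m :: nat where m: "t \<le> real m" using real_arch_simple by blast
      have "AE w in P p. (\<lambda>n. occ X (near_avg (widths n)) 0 (gtau t w) w - lt_const * (S (gtau t w) w / \<eta>)) \<longlonglongrightarrow> 0"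
      proof (rule AE_tendsto_0[where m=m])
        show "integrable (P p) (\<lambda>w. occ X (near_avg (widths n)) 0 (gtau t w) w - lt_const * (S (gtau t w) w / \<eta>))" for n
          by (intro Bochner_Integration.integrable_diff integrable_mult_right local_time_integrable[OF p True] occupation_integrable(1)[OF p True widths(1)])
        show "(\<integral>w. \<bar>occ X (near_avg (widths n)) 0 (gtau t w) w - lt_const * (S (gtau t w) w / \<eta>)\<bar> \<partial>P p) \<le> (1 / 2) ^ n" if "m \<le> n" for n
          using m that by (intro widths(3)[OF p True]) simp
      qed
      then show ?thesis by simp
    qed simp
  qed
  with AE_clock_paths[OF p] show ?thesis by eventually_elim (simp add: good_paths_def)
qed

section \<open>The time-changed process and its vertex local time\<close>

definition Y :: "real \<Rightarrow> 'w \<Rightarrow> point" where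
  "Y t w = (if w \<in> good_paths then X (tau (max 0 t) w) w else (0, 1))"

definition lY :: "real \<Rightarrow> 'w \<Rightarrow> real" where
  "lY t w = (if w \<in> good_paths then S (tau t w) w / \<eta> else 0)"

text \<open>The identity on exceptional paths, since the clock must be strictly increasing and
  continuous on every path.\<close>

definition Vinv :: "'w \<Rightarrow> real \<Rightarrow> real" where
  "Vinv w t = (if w \<in> good_paths then A t w else t)"

definition lX :: "real \<Rightarrow> 'w \<Rightarrow> real" where
  "lX t w = S t w / \<eta>"

lemma Y_Gam: "w \<in> \<Omega> \<Longrightarrow> Y t w \<in> Gam N"
  using X_Gam N1 by (simp add: Y_def Gam_def)

lemma good_paths_\<Omega>: "w \<in> good_paths \<Longrightarrow> w \<in> \<Omega>"
  by (rule clock_paths_\<Omega>[OF good_paths_clock_paths])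

lemma Y_path: "w \<in> \<Omega> \<Longrightarrow> path_cont (\<lambda>t. Y t w)"
proof (cases "w \<in> good_paths")
  case True
  note w = good_paths_clock_paths[OF True]
  have Xp: "path_cont (\<lambda>t. X t w)" using X_cp clock_paths_\<Omega>[OF w] unfolding cprocess_def by blast
  show ?thesis
    unfolding path_cont_def
  proof (intro allI impI)
    fix t e :: real assume t: "0 \<le> t" and e: "0 < e"
    obtain d where d: "d > 0" "\<And>s. s \<ge> 0 \<Longrightarrow> \<bar>s - tau t w\<bar> < d \<Longrightarrow> gdist (X s w) (X (tau t w) w) < e"
      using Xp tau(1)[OF w t] e unfolding path_cont_def by blast
    obtain d' where d': "d' > 0" "\<And>s. s \<ge> 0 \<Longrightarrow> \<bar>s - t\<bar> < d' \<Longrightarrow> \<bar>tau s w - tau t w\<bar> < d"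
      using tau_continuous[OF w] t d(1) unfolding continuous_on_iff dist_real_def by (metis atLeast_iff)
    show "\<exists>d>0. \<forall>s\<ge>0. \<bar>s - t\<bar> < d \<longrightarrow> gdist (Y s w) (Y t w) < e"
      using d'(1) d(2)[OF tau(1)[OF w] d'(2)] t True by (intro exI[of _ d']) (auto simp: Y_def)
  qed
next
  case False
  then show ?thesis by (auto simp: Y_def path_cont_def gdist_def intro: exI[of _ 1])
qed

lemma Y_Gmeas: "0 \<le> t \<Longrightarrow> Y t \<in> measurable (P p) (GM N)"
proof (rule measurable_GM_I)
  assume t: "0 \<le> t"
  show "Y t w \<in> Gam N" if "w \<in> space (P p)" for w by (rule Y_Gam[OF space_PD[OF that]])
  fix i assume i: "i < N"
  have lt_const: "continuous_on {0..} (coord i j)" for j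
    by (cases "j = i") (auto simp: coord_def[abs_def] intro!: continuous_intros)
  have m: "(\<lambda>w. gev (coord i) (X (gtau t w) w)) \<in> borel_measurable (P p)"
  proof (rule stopped_measurable[of "\<lambda>s w. gev (coord i) (X s w)", OF _ _ gtau_meas[OF t] gtau_nonneg[OF t]])
    show "continuous_on {0..} (\<lambda>s. gev (coord i) (X s w))" if "w \<in> \<Omega>" for w
    proof (rule continuous_on_gev_path[of _ N])
      show "path_cont (\<lambda>t. X t w)" using X_cp that unfolding cprocess_def by blast
    qed (use X_Gam[OF that] lt_const in \<open>auto simp: coord_def\<close>)
    show "(\<lambda>w. gev (coord i) (X s w)) \<in> borel_measurable (P p)" if "0 \<le> s" for s
      by (rule measurable_compose[OF X_meas[OF that] gev_measurable[OF lt_const]])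
  qed
  have "(\<lambda>w. if w \<in> good_paths then gev (coord i) (X (gtau t w) w) else gev (coord i) (0, 1)) \<in> borel_measurable (P p)"
    using good_paths_sets[of p] by (intro measurable_If_set m) auto
  moreover have "(\<lambda>w. if w \<in> good_paths then gev (coord i) (X (gtau t w) w) else gev (coord i) (0, 1)) = (\<lambda>w. gev (coord i) (Y t w))"
    using t by (auto simp: fun_eq_iff Y_def gtau_def good_paths_clock_paths max_def)
  ultimately show "(\<lambda>w. gev (coord i) (Y t w)) \<in> borel_measurable (P p)" by simp
qed

lemma Y_cp: "cprocess N P Y"
  unfolding cprocess_def using Y_Gam Y_path Y_Gmeas[THEN measurable_GM_D(1)] by blast

text \<open>Change of variables along the inverse clock. Integrals of \<open>Y\<close> become
  integrals of \<open>X\<close> over the time off the vertex, so the value of \<open>G\<close> at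
  the vertex drops out.\<close>

lemma occ_Y:
  assumes w: "w \<in> good_paths" and t: "0 \<le> t" and G: "G \<in> borel_measurable (GM N)" "\<And>p. p \<in> Gam N \<Longrightarrow> \<bar>G p\<bar> \<le> C"
  shows "occ Y G 0 t w = occ X (glue 0 G) 0 (tau t w) w"
proof -
  note wG = good_paths_clock_paths[OF w] and w\<Omega> = good_paths_\<Omega>[OF w]
  define h where "h = tau t w"
  have h: "0 \<le> h" unfolding h_def by (rule tau(1)[OF wG t])
  define g where "g u = G (X (max 0 (min u h)) w)" for u
  have gm: "g \<in> borel_measurable borel" unfolding g_def by (rule path_measurable[OF X_cp h G(1) w\<Omega>])
  \<comment> \<open>Described through the distance to the vertex and defined for all reals, so that
    it is a Borel set of the line.\<close>
  define Sv where "Sv = {u. snd (X (max 0 u) w) \<noteq> 0}"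
  have "continuous_on UNIV (\<lambda>u. snd (X (max 0 u) w))"
    by (rule continuous_on_compose2[OF snd_path[OF w\<Omega>]]) (auto intro!: continuous_intros)
  then have "(\<lambda>u. snd (X (max 0 u) w)) \<in> borel_measurable borel" by (rule borel_measurable_continuous_onI)
  then have Svm: "Sv \<in> sets borel"
    unfolding Sv_def using measurable_sets[of "\<lambda>u. snd (X (max 0 u) w)" borel borel "- {0}"] by (simp add: vimage_def Compl_eq)
  have Sv: "u \<in> Sv \<longleftrightarrow> X u w \<noteq> vtx" if "0 \<le> u" for u
    using snd_eq_0_iff[OF X_Gam[OF w\<Omega>, of u]] that by (simp add: Sv_def)
  have AS: "A u w = measure lborel ({0..u} \<inter> Sv)" if "0 \<le> u" for u
  proof -
    have "A u w = (\<integral>v. indicator ({0..u} \<inter> Sv) v \<partial>lborel)"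
      unfolding A_def occ_def by (rule Bochner_Integration.integral_cong[OF refl]) (auto simp: indicator_def G1_def glue_def Sv)
    then show ?thesis by simp
  qed
  have "(\<integral>r. indicator {0..t} r * g (tau r w) \<partial>lborel) = (\<integral>u. indicator ({0..tau t w} \<inter> Sv) u * g u \<partial>lborel)"
    by (rule time_change_integral[where A="\<lambda>s. A s w", OF Svm gm AS tau[OF wG] t])
  moreover have "occ Y G 0 t w = (\<integral>r. indicator {0..t} r * g (tau r w) \<partial>lborel)"
    unfolding occ_def
  proof (rule Bochner_Integration.integral_cong[OF refl])
    fix r
    show "indicator {0..t} r * G (Y r w) = indicator {0..t} r * g (tau r w)"
    proof (cases "r \<in> {0..t}")
      case True
      then have "tau r w \<le> h" "0 \<le> tau r w" using tau_le_iff[OF wG, of r t] tau(1)[OF wG, of r] t by (auto simp: h_def)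
      then show ?thesis using True w by (simp add: g_def Y_def)
    qed simp
  qed
  moreover have "occ X (glue 0 G) 0 (tau t w) w = (\<integral>u. indicator ({0..tau t w} \<inter> Sv) u * g u \<partial>lborel)"
    unfolding occ_def
    by (rule Bochner_Integration.integral_cong[OF refl]) (auto simp: indicator_def glue_def Sv g_def h_def)
  ultimately show ?thesis by simp
qed

lemma lt_const_pos: "lt_const > 0"
  unfolding lt_const_def
proof (rule sum_pos)
  show "{..<N} \<noteq> {}" using N1 by (intro ex_in_conv[THEN iffD1] exI[of _ 0]) simp
qed (use \<rho>_pos \<sigma>2_pos[OF _ order_refl] in auto)

lemma lY_continuous: "continuous_on {0..} (\<lambda>t. lY t w)"
proof (cases "w \<in> good_paths")
  case True
  have "continuous_on {0..} (\<lambda>t. S (tau t w) w / \<eta>)"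
    by (intro continuous_on_divide continuous_on_const continuous_on_compose2[OF S_continuous[OF good_paths_\<Omega>[OF True]] tau_continuous[OF good_paths_clock_paths[OF True]]])
      (use \<eta> tau(1)[OF good_paths_clock_paths[OF True]] in auto)
  then show ?thesis using True by (simp add: lY_def)
qed (simp add: lY_def)

lemma lY_mono: "mono_on {0..} (\<lambda>t. lY t w)"
proof (cases "w \<in> good_paths")
  case True
  note w = good_paths_clock_paths[OF True]
  show ?thesis
  proof (rule mono_onI)
    fix s t :: real assume st: "s \<in> {0..}" "t \<in> {0..}" "s \<le> t"
    then have "S (tau s w) w \<le> S (tau t w) w"
      using tau(1)[OF w] tau_le_iff[OF w] by (intro S_mono[OF clock_paths_\<Omega>[OF w]]) auto
    then show "lY s w \<le> lY t w" using True \<eta> by (simp add: lY_def divide_right_mono)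
  qed
qed (simp add: lY_def mono_on_def)

text \<open>The integrals in the statement are gauge integrals, whereas measurability and Fubini
  need the Lebesgue integral.\<close>

lemma occ_HK:
  assumes Z: "cprocess N P Z" and G: "G \<in> borel_measurable (GM N)" and w: "w \<in> \<Omega>"
    and b: "\<And>p. p \<in> Gam N \<Longrightarrow> \<bar>G p\<bar> \<le> C"
  shows "integral {0..t} (\<lambda>s. G (Z s w)) = occ Z G 0 t w"
proof -
  have "set_integrable lborel {0..t} (\<lambda>s. G (Z s w))"
    using occ_integrable[OF Z G w b order_refl, of t] by (simp add: set_integrable_def)
  from set_borel_integral_eq_integral(2)[OF this] show ?thesis
    by (simp add: set_lebesgue_integral_def occ_def)
qed

definition near :: "real \<Rightarrow> point \<Rightarrow> real" where "near d p = (if snd p \<le> d then 1 else 0)"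

lemma near_meas: "near d \<in> borel_measurable (GM N)"
proof -
  have [measurable]: "snd \<in> borel_measurable (GM N)" unfolding GM_def by (auto intro: measurable_restrict_space1)
  show ?thesis unfolding near_def by measurable
qed

lemma near_bound: "\<bar>near d p\<bar> \<le> 1" by (simp add: near_def)

lemma occ_near:
  assumes w: "w \<in> good_paths" and t: "0 \<le> t"
  shows "1 / d * occ Y (near d) 0 t w = occ X (near_avg d) 0 (gtau t w) w"
proof -
  have "occ X (near_avg d) 0 (tau t w) w = (\<integral>u. 1 / d * (indicator {0..tau t w} u * glue 0 (near d) (X u w)) \<partial>lborel)"
    unfolding occ_def by (rule Bochner_Integration.integral_cong[OF refl]) (auto simp: near_avg_def glue_def near_def indicator_def)
  also have "\<dots> = 1 / d * occ X (glue 0 (near d)) 0 (tau t w) w" by (simp add: occ_def)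
  finally show ?thesis using occ_Y[OF w t near_meas near_bound, of d] good_paths_clock_paths[OF w] by (simp add: gtau_def)
qed

text \<open>At rational times the local time is, on every path, the limit of normalized occupation
  times of \<open>Y\<close> along \<open>widths\<close>; this holds on \<open>good_paths\<close> by
  definition. Real times follow by continuity.\<close>

lemma lY_natfilt:
  assumes t: "0 \<le> t"
  shows "lY t \<in> borel_measurable (natfilt P Y t)"
proof -
  have rat: "lY q \<in> borel_measurable (natfilt P Y t)" if q: "q \<in> \<rat>" "0 \<le> q" "q \<le> t" for q
  proof (rule borel_measurable_LIMSEQ_real)
    show "(\<lambda>w. 1 / lt_const * (1 / widths n * occ Y (near (widths n)) 0 q w)) \<in> borel_measurable (natfilt P Y t)" for n
    proof -
      have "occ Y (near (widths n)) 0 q \<in> borel_measurable (natfilt P Y q)"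
        by (rule occ_measurable[OF Y_cp near_meas near_bound order_refl q(2)])
      then have "occ Y (near (widths n)) 0 q \<in> borel_measurable (natfilt P Y t)"
        using natfilt_mono[OF q(3), of P Y] by (auto simp: measurable_def subset_iff)
      then show ?thesis by simp
    qed
    fix w assume "w \<in> space (natfilt P Y t)"
    show "(\<lambda>n. 1 / lt_const * (1 / widths n * occ Y (near (widths n)) 0 q w)) \<longlonglongrightarrow> lY q w"
    proof (cases "w \<in> good_paths")
      case True
      have "(\<lambda>n. occ X (near_avg (widths n)) 0 (gtau q w) w - lt_const * (S (gtau q w) w / \<eta>)) \<longlonglongrightarrow> 0"
        using True q(1,2) unfolding good_paths_def by blast
      then have "(\<lambda>n. occ X (near_avg (widths n)) 0 (gtau q w) w) \<longlonglongrightarrow> lt_const * (S (gtau q w) w / \<eta>)"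
        by (rule LIM_zero_cancel)
      then have "(\<lambda>n. 1 / lt_const * occ X (near_avg (widths n)) 0 (gtau q w) w) \<longlonglongrightarrow> 1 / lt_const * (lt_const * (S (gtau q w) w / \<eta>))"
        by (intro tendsto_mult_left)
      moreover have "1 / lt_const * (lt_const * (S (gtau q w) w / \<eta>)) = lY q w"
        using lt_const_pos True good_paths_clock_paths[OF True] by (simp add: lY_def gtau_def)
      ultimately show ?thesis by (simp only: occ_near[OF True q(2)])
    next
      case False
      \<comment> \<open>An exceptional path sits at distance 1 from the vertex, beyond every width,
        so the approximations vanish just as \<open>lY\<close> does.\<close>
      have "occ Y (near (widths n)) 0 q w = 0" for n
        unfolding occ_def using widths(2)[of n] False by (simp add: Y_def near_def)
      then show ?thesis using False by (simp add: lY_def)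
    qed
  qed
  show ?thesis
  proof (rule borel_measurable_LIMSEQ_real)
    \<comment> \<open>Rounded down: the rational times stay at most \<open>t\<close>, so their
      values are known at \<open>t\<close>.\<close>
    define q where "q k = of_int \<lfloor>t * real (Suc k)\<rfloor> / real (Suc k)" for k
    have q: "0 \<le> q k" "q k \<le> t" "t - q k \<le> 1 / real (Suc k)" for k
    proof -
      have f: "of_int \<lfloor>t * real (Suc k)\<rfloor> \<le> t * real (Suc k)" "t * real (Suc k) - 1 \<le> of_int \<lfloor>t * real (Suc k)\<rfloor>" by linarith+
      show "0 \<le> q k" unfolding q_def using t by simp
      show "q k \<le> t" unfolding q_def using f(1) by (simp add: divide_le_eq)
      have "(t * real (Suc k) - 1) / real (Suc k) \<le> q k" unfolding q_def using f(2) by (intro divide_right_mono) auto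
      moreover have "(t * real (Suc k) - 1) / real (Suc k) = t - 1 / real (Suc k)" by (simp add: diff_divide_distrib)
      ultimately show "t - q k \<le> 1 / real (Suc k)" by linarith
    qed
    have qr: "q k \<in> \<rat>" for k unfolding q_def by simp
    have ql: "q \<longlonglongrightarrow> t"
    proof (rule LIM_zero_cancel, rule Lim_null_comparison)
      show "\<forall>\<^sub>F k in sequentially. norm (q k - t) \<le> 1 / real (Suc k)"
      proof (rule always_eventually, rule allI)
        show "norm (q k - t) \<le> 1 / real (Suc k)" for k using q(2,3)[of k] by (simp add: abs_real_def)
      qed
      show "(\<lambda>k. 1 / real (Suc k)) \<longlonglongrightarrow> 0" by (rule LIMSEQ_Suc[OF lim_1_over_n])
    qed
    show "lY (q k) \<in> borel_measurable (natfilt P Y t)" for k by (rule rat[OF qr q(1,2)])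
    show "(\<lambda>k. lY (q k) w) \<longlonglongrightarrow> lY t w" for w
      by (rule continuous_on_tendsto_compose[OF lY_continuous ql]) (use t q in auto)
  qed
qed

lemma vertex_local_time_Y: "vertex_local_time N \<sigma> \<rho> P Y lY"
  unfolding vertex_local_time_def
proof (intro conjI ballI allI impI)
  show "continuous_on {0..} (\<lambda>t. lY t w)" for w by (rule lY_continuous)
  show "mono_on {0..} (\<lambda>t. lY t w)" for w by (rule lY_mono)
  show "lY t \<in> borel_measurable (natfilt P Y t)" if "0 \<le> t" for t by (rule lY_natfilt[OF that])
next
  fix p t assume p: "p \<in> Gam N" and t: "0 \<le> (t::real)"
  interpret prob_space "P p" by (rule prob) fact
  have aeq: "AE w in P p. S (gtau t w) w / \<eta> = lY t w"
    using AE_good_paths[OF p] by eventually_elim (simp add: lY_def gtau_def good_paths_clock_paths)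
  have lYm: "lY t \<in> borel_measurable (P p)"
    using lY_natfilt[OF t] natfilt_sub[OF Y_cp, of t] sets_P[of p] space_P[of p] by (auto simp: measurable_def subset_iff)
  show "integrable (P p) (lY t)"
    by (rule integrable_cong_AE_imp[OF local_time_integrable[OF p t] lYm]) (use aeq in auto)
  show "((\<lambda>\<delta>. \<integral>w. \<bar>(1 / \<delta>) * integral {0..t} (\<lambda>s. if snd (Y s w) \<le> \<delta> then 1 else 0)
                    - (\<Sum>i<N. 2 * \<rho> i / (\<sigma> i 0)\<^sup>2) * lY t w\<bar> \<partial>(P p)) \<longlongrightarrow> 0) (at_right 0)"
  proof (rule tendstoI)
    fix e :: real assume e: "e > 0"
    obtain d0 where d0: "d0 > 0" "\<forall>d. 0 < d \<and> d < d0 \<longrightarrow> (\<forall>p\<in>Gam N. \<forall>s. 0 \<le> s \<and> s \<le> t \<longrightarrow>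
      (\<integral>w. \<bar>occ X (near_avg d) 0 (gtau s w) w - lt_const * (S (gtau s w) w / \<eta>)\<bar> \<partial>P p) \<le> e / 2)"
      using occupation_estimate_Y[of "e / 2" t] e t by auto
    have "dist (\<integral>w. \<bar>(1 / d) * integral {0..t} (\<lambda>s. if snd (Y s w) \<le> d then 1 else 0)
                    - (\<Sum>i<N. 2 * \<rho> i / (\<sigma> i 0)\<^sup>2) * lY t w\<bar> \<partial>(P p)) 0 < e" if d: "0 < d" "d < d0" for d
    proof -
      have HK: "integral {0..t} (\<lambda>s. if snd (Y s w) \<le> d then 1 else 0) = occ Y (near d) 0 t w" if "w \<in> space (P p)" for w
        using occ_HK[OF Y_cp near_meas space_PD[OF that] near_bound, of t d] by (simp add: near_def[abs_def])
      have om: "occ Y (near d) 0 t \<in> borel_measurable (P p)"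
        using occ_measurable[OF Y_cp near_meas near_bound order_refl t] natfilt_sub[OF Y_cp, of t] sets_P[of p] space_P[of p]
        by (auto simp: measurable_def subset_iff)
      have "(\<integral>w. \<bar>(1 / d) * integral {0..t} (\<lambda>s. if snd (Y s w) \<le> d then 1 else 0)
                    - (\<Sum>i<N. 2 * \<rho> i / (\<sigma> i 0)\<^sup>2) * lY t w\<bar> \<partial>(P p)) = (\<integral>w. \<bar>1 / d * occ Y (near d) 0 t w - lt_const * lY t w\<bar> \<partial>(P p))"
        by (rule Bochner_Integration.integral_cong[OF refl]) (simp only: HK lt_const_def)
      also have "\<dots> = (\<integral>w. \<bar>occ X (near_avg d) 0 (gtau t w) w - lt_const * (S (gtau t w) w / \<eta>)\<bar> \<partial>P p)"
      proof (rule integral_cong_AE)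
        show "AE w in P p. \<bar>1 / d * occ Y (near d) 0 t w - lt_const * lY t w\<bar> = \<bar>occ X (near_avg d) 0 (gtau t w) w - lt_const * (S (gtau t w) w / \<eta>)\<bar>"
          using AE_good_paths[OF p] aeq by eventually_elim (simp only: occ_near[OF _ t])
        show "(\<lambda>w. \<bar>1 / d * occ Y (near d) 0 t w - lt_const * lY t w\<bar>) \<in> borel_measurable (P p)" using om lYm by simp
        have "integrable (P p) (\<lambda>w. \<bar>occ X (near_avg d) 0 (gtau t w) w - lt_const * (S (gtau t w) w / \<eta>)\<bar>)"
          by (intro integrable_abs Bochner_Integration.integrable_diff integrable_mult_right local_time_integrable[OF p t] occupation_integrable(1)[OF p t d(1)])
        then show "(\<lambda>w. \<bar>occ X (near_avg d) 0 (gtau t w) w - lt_const * (S (gtau t w) w / \<eta>)\<bar>) \<in> borel_measurable (P p)" by auto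
      qed
      also have "\<dots> \<le> e / 2" using d0(2) d p t by simp
      finally have "(\<integral>w. \<bar>(1 / d) * integral {0..t} (\<lambda>s. if snd (Y s w) \<le> d then 1 else 0)
                    - (\<Sum>i<N. 2 * \<rho> i / (\<sigma> i 0)\<^sup>2) * lY t w\<bar> \<partial>(P p)) \<le> e / 2" .
      moreover have "0 \<le> (\<integral>w. \<bar>(1 / d) * integral {0..t} (\<lambda>s. if snd (Y s w) \<le> d then 1 else 0)
                    - (\<Sum>i<N. 2 * \<rho> i / (\<sigma> i 0)\<^sup>2) * lY t w\<bar> \<partial>(P p))" by (rule integral_nonneg_AE) simp
      ultimately show ?thesis unfolding dist_real_def using e by linarith
    qed
    then show "\<forall>\<^sub>F d in at_right 0. dist (\<integral>w. \<bar>(1 / d) * integral {0..t} (\<lambda>s. if snd (Y s w) \<le> d then 1 else 0)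
                    - (\<Sum>i<N. 2 * \<rho> i / (\<sigma> i 0)\<^sup>2) * lY t w\<bar> \<partial>(P p)) 0 < e"
      unfolding eventually_at_right_field using d0(1) by blast
  qed
qed

lemma T_F_meas:
  assumes "0 \<le> r" "0 \<le> s"
  shows "T 0 r s \<in> borel_measurable (F s)"
  unfolding borel_measurable_iff_less
proof
  fix a
  show "{w \<in> space (F s). T 0 r s w < a} \<in> sets (F s)"
  proof (cases "a < 0")
    case True
    have "\<not> T 0 r s w < a" for w using T_in[OF assms(2), of r w] True by auto
    then show ?thesis by simp
  next
    case False
    show ?thesis
    proof (cases "a > s")
      case True
      have "T 0 r s w < a" for w using T_in[OF assms(2), of r w] True by auto
      then show ?thesis by simp
    next
      case False
      then show ?thesis using T_F[OF order_refl _ _ assms(1), of a s] natfilt_mono[of a s P X] \<open>\<not> a < 0\<close> by auto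
    qed
  qed
qed

text \<open>If the clock at \<open>s\<close> exceeds \<open>t\<close>, then the inverse clock at
  every time up to \<open>t\<close> lies before \<open>s\<close>, so what \<open>Y\<close> shows up
  to \<open>t\<close> can be read off from \<open>X\<close> up to \<open>s\<close>. The identity
  holds only on \<open>good_paths\<close>, which need not be an event of the filtration of
  \<open>X\<close>.\<close>

lemma Y_adapted:
  assumes t: "0 \<le> t" and \<Lambda>: "\<Lambda> \<in> sets (natfilt P Y t)" and s: "0 \<le> s"
  shows "\<exists>B\<in>sets (F s). \<Lambda> \<inter> {w. t < A s w} \<inter> good_paths = B \<inter> good_paths"
  using \<Lambda>[unfolded sets_natfilt]
proof (induction rule: sigma_sets.induct)
  case (Basic \<Lambda>)
  then obtain r C where rC: "0 \<le> r" "r \<le> t" "C \<in> sets Gmeas" "\<Lambda> = Y r -` C \<inter> \<Omega>" by auto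
  \<comment> \<open>The truncated time is known at \<open>s\<close>; where the clock at
    \<open>s\<close> exceeds \<open>t\<close> it agrees with the inverse clock at
    \<open>r\<close>.\<close>
  define B where "B = {w \<in> space (F s). X (T 0 r s w) w \<in> C} \<inter> {w \<in> space (F s). t < A s w}"
  have Tin: "T 0 r s w \<in> {0..s}" for w by (rule T_in[OF s])
  have "(\<lambda>w. (T 0 r s w, w)) \<in> measurable (F s) (borel \<Otimes>\<^sub>M F s)" using T_F_meas[OF rC(1) s] by simp
  moreover have "(\<lambda>z. X (max 0 (min (fst z) s)) (snd z)) \<in> measurable (borel \<Otimes>\<^sub>M F s) (GM N)"
  proof (rule joint_measurable_GM[OF s])
    show "X u \<in> measurable (F s) Gmeas" if "u \<in> {0..s}" for u using that by (intro measurable_natfilt) auto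
  qed (use X_cp in \<open>auto simp: cprocess_def\<close>)
  ultimately have "(\<lambda>w. X (max 0 (min (fst (T 0 r s w, w)) s)) (snd (T 0 r s w, w))) \<in> measurable (F s) (GM N)"
    by (rule measurable_compose)
  moreover have "max 0 (min (T 0 r s w) s) = T 0 r s w" for w using Tin[of w] by simp
  ultimately have "(\<lambda>w. X (T 0 r s w) w) \<in> measurable (F s) (GM N)" by simp
  from measurable_sets[OF measurable_GM_D(1)[OF this] rC(3)]
  have "{w \<in> space (F s). X (T 0 r s w) w \<in> C} \<in> sets (F s)" by (simp add: vimage_def Int_def conj_commute)
  moreover have "{w \<in> space (F s). t < A s w} \<in> sets (F s)"
    using borel_measurable_less[OF borel_measurable_const A_F[OF s]] .
  ultimately have BF: "B \<in> sets (F s)" unfolding B_def by (rule sets.Int)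
  have "w \<in> \<Lambda> \<longleftrightarrow> X (T 0 r s w) w \<in> C" if w: "w \<in> good_paths" "t < A s w" for w
  proof -
    note wG = good_paths_clock_paths[OF w(1)]
    have "tau r w < s"
    proof -
      have "A (tau r w) w < A s w" using tau(2)[OF wG rC(1)] w(2) rC by simp
      then show ?thesis using A_less_iff[OF wG tau(1)[OF wG rC(1)] s] by simp
    qed
    then have "T 0 r s w = tau r w" using T_tau[OF wG rC(1) s] by simp
    then show ?thesis using w good_paths_\<Omega>[OF w(1)] rC by (simp add: Y_def)
  qed
  then have "\<Lambda> \<inter> {w. t < A s w} \<inter> good_paths = B \<inter> good_paths"
    unfolding B_def using good_paths_\<Omega> by auto
  then show ?case by (rule bexI[OF _ BF])
next
  case Empty
  then show ?case by (intro bexI[of _ "{}"]) auto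
next
  case (Compl \<Lambda>)
  then obtain B where B: "B \<in> sets (F s)" "\<Lambda> \<inter> {w. t < A s w} \<inter> good_paths = B \<inter> good_paths" by blast
  have m: "{w \<in> space (F s). t < A s w} \<in> sets (F s)"
    using borel_measurable_less[OF borel_measurable_const A_F[OF s]] .
  have "(\<Omega> - \<Lambda>) \<inter> {w. t < A s w} \<inter> good_paths = ({w \<in> space (F s). t < A s w} - B) \<inter> good_paths"
    using B(2) good_paths_\<Omega> by auto
  then show ?case by (rule bexI[OF _ sets.Diff[OF m B(1)]])
next
  case (Union a)
  then obtain B where B: "\<And>i. B i \<in> sets (F s)" "\<And>i. a i \<inter> {w. t < A s w} \<inter> good_paths = B i \<inter> good_paths" by metis
  have "\<Union> (range a) \<inter> {w. t < A s w} \<inter> good_paths = (\<Union>i. a i \<inter> {w. t < A s w} \<inter> good_paths)" by auto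
  also have "\<dots> = (\<Union>i. B i) \<inter> good_paths" unfolding B(2) by auto
  finally have "\<Union> (range a) \<inter> {w. t < A s w} \<inter> good_paths = (\<Union>i. B i) \<inter> good_paths" .
  then show ?case by (rule bexI) (use B(1) in blast)
qed

text \<open>The martingale of \<open>X\<close> is stopped at the truncated inverse clock times of
  \<open>t\<close> and \<open>t + r\<close>. The vertex part of its compensator is 0, so what is
  left is an integral off the vertex, which the time change turns into an integral along
  \<open>Y\<close>.\<close>

lemma Y_martingale:
  assumes n: "nice \<phi> (glue 0 G) C" and G: "G \<in> borel_measurable (GM N)" "\<And>p. p \<in> Gam N \<Longrightarrow> \<bar>G p\<bar> \<le> C"
    and p: "p \<in> Gam N" and t: "0 \<le> t" and r: "0 \<le> r" and \<Lambda>: "\<Lambda> \<in> sets (natfilt P Y t)"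
  shows "(\<integral>w. indicator \<Lambda> w * (\<phi> (Y (t + r) w) - \<phi> (Y t w) - occ Y G t (t + r) w) \<partial>P p) = 0"
proof -
  interpret prob_space "P p" by (rule prob) fact
  note nD = niceD[OF n]
  have C0: "0 \<le> C" using nD(4)[OF p] by simp
  have \<Lambda>P: "\<Lambda> \<in> sets (P p)" using natfilt_sub[OF Y_cp, of t] \<Lambda> sets_P[of p] by blast
  have tr: "0 \<le> t + r" using t r by simp
  \<comment> \<open>Restricting to paths whose inverse clock at \<open>t\<close> lies before the
    truncation makes the stopped event adapted; the restriction disappears in the limit.\<close>
  define \<Lambda>n where "\<Lambda>n n = \<Lambda> \<inter> {w \<in> space (P p). t < A (real n) w}" for n :: nat
  have \<Lambda>nP: "\<Lambda>n n \<in> sets (P p)" for n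
    unfolding \<Lambda>n_def using borel_measurable_less[OF borel_measurable_const A_P[of "real n" p], of t] \<Lambda>P by auto
  define M where "M U w = \<phi> (X (U w) w) - occ X (glue 0 G) 0 (U w) w" for U :: "'w \<Rightarrow> real" and w
  have Tin: "T 0 K (real n) w \<in> {0..real n}" for K n w by (rule T_in) simp
  have Tm: "T 0 K (real n) \<in> borel_measurable (P p)" if "0 \<le> K" for K n by (rule T_meas[OF order_refl _ that]) simp
  have n0: "0 \<le> real n" for n by simp
  have st: "(\<integral>w. indicator (\<Lambda>n n) w * M (T 0 K (real n)) w \<partial>P p) = (\<integral>w. indicator (\<Lambda>n n) w * (\<phi> (X (real n) w) - occ X (glue 0 G) 0 (real n) w) \<partial>P p)"
    if K: "t \<le> K" for K n
    unfolding M_def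
  proof (rule stopped_martingale[OF n p order_refl n0 Tm Tin \<Lambda>nP])
    show "0 \<le> K" using t K by simp
    fix s assume s: "s \<in> {0..real n}"
    then have s0: "0 \<le> s" "s \<le> real n" by auto
    obtain B where B: "B \<in> sets (F s)" "\<Lambda> \<inter> {w. t < A s w} \<inter> good_paths = B \<inter> good_paths" using Y_adapted[OF t \<Lambda> s0(1)] by blast
    have m: "{w \<in> space (F s). K < A s w} \<in> sets (F s)"
      using borel_measurable_less[OF borel_measurable_const A_F[OF s0(1)]] .
    show "\<exists>B\<in>sets (F s). AE w in P p. w \<in> \<Lambda>n n \<and> T 0 K (real n) w < s \<longleftrightarrow> w \<in> B"
    proof (intro bexI)
      show "B \<inter> {w \<in> space (F s). K < A s w} \<in> sets (F s)" using B(1) m by (rule sets.Int)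
      show "AE w in P p. w \<in> \<Lambda>n n \<and> T 0 K (real n) w < s \<longleftrightarrow> w \<in> B \<inter> {w \<in> space (F s). K < A s w}"
        using AE_good_paths[OF p] AE_space
      proof eventually_elim
        case (elim w)
        note w = space_PD[OF elim(2)]
        have T: "T 0 K (real n) w < s \<longleftrightarrow> K < A s w"
          using T_less[OF w order_refl s0, of K] A_0[of w] t K by simp
        have mono: "A s w \<le> A (real n) w" by (rule A_mono[OF w s0])
        have Bw: "w \<in> B \<longleftrightarrow> w \<in> \<Lambda> \<and> t < A s w" using B(2) elim(1) by blast
        show ?case unfolding T \<Lambda>n_def using Bw mono K w elim(2) by auto
      qed
    qed
  qed
  have Mi: "integrable (P p) (M (T 0 K (real n)))" if "0 \<le> K" for K n
    unfolding M_def using stopped_integrable[OF n p n0 Tm[OF that] Tin] by simp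
  have eq0: "(\<integral>w. indicator (\<Lambda>n n) w * (M (T 0 (t + r) (real n)) w - M (T 0 t (real n)) w) \<partial>P p) = 0" for n
  proof -
    have i: "integrable (P p) (\<lambda>w. indicator (\<Lambda>n n) w * M (T 0 K (real n)) w)" if "0 \<le> K" for K
      using integrable_mult_indicator[OF \<Lambda>nP Mi[OF that]] by simp
    show ?thesis using i[OF t] i[OF tr] st[of t n] st[of "t + r" n] r by (simp add: right_diff_distrib)
  qed
  define Z where "Z w = indicator \<Lambda> w * (\<phi> (Y (t + r) w) - \<phi> (Y t w) - occ Y G t (t + r) w)" for w
  have "(\<lambda>n. \<integral>w. indicator (\<Lambda>n n) w * (M (T 0 (t + r) (real n)) w - M (T 0 t (real n)) w) \<partial>P p) \<longlonglongrightarrow> (\<integral>w. Z w \<partial>P p)"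
  proof (rule integral_dominated_convergence[where w="\<lambda>_. 2 * (C + C * (t + r))"])
    have "(\<lambda>w. \<phi> (Y u w)) \<in> borel_measurable (P p)" if "0 \<le> u" for u
      by (rule measurable_compose[OF Y_Gmeas[OF that] nD(2)])
    moreover have "occ Y G t (t + r) \<in> borel_measurable (P p)"
      using occ_measurable[OF Y_cp G t, of "t + r"] r natfilt_sub[OF Y_cp, of "t + r"] sets_P[of p] space_P[of p]
      by (auto simp: measurable_def subset_iff)
    ultimately show "Z \<in> borel_measurable (P p)"
      unfolding Z_def using t tr \<Lambda>P by (intro borel_measurable_times borel_measurable_diff borel_measurable_indicator)
    show "(\<lambda>w. indicator (\<Lambda>n n) w * (M (T 0 (t + r) (real n)) w - M (T 0 t (real n)) w)) \<in> borel_measurable (P p)" for n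
      using Mi[OF t, of n] Mi[OF tr, of n] \<Lambda>nP by simp
    show "AE w in P p. (\<lambda>n. indicator (\<Lambda>n n) w * (M (T 0 (t + r) (real n)) w - M (T 0 t (real n)) w)) \<longlonglongrightarrow> Z w"
      using AE_good_paths[OF p] AE_space
    proof eventually_elim
      case (elim w)
      note wG = good_paths_clock_paths[OF elim(1)]
      have Zeq: "Z w = indicator \<Lambda> w * ((\<phi> (X (tau (t + r) w) w) - occ X (glue 0 G) 0 (tau (t + r) w) w) - (\<phi> (X (tau t w) w) - occ X (glue 0 G) 0 (tau t w) w))"
      proof -
        have "occ Y G 0 (t + r) w = occ Y G 0 t w + occ Y G t (t + r) w"
          using r by (intro occ_add[OF Y_cp G(1) good_paths_\<Omega>[OF elim(1)] G(2) order_refl t]) auto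
        then show ?thesis
          using occ_Y[OF elim(1) t G] occ_Y[OF elim(1) tr G] elim(1) t tr by (simp add: Z_def Y_def)
      qed
      obtain h :: nat where h: "tau t w < real h" using reals_Archimedean2 by blast
      have "\<forall>\<^sub>F n in sequentially. indicator (\<Lambda>n n) w = (indicator \<Lambda> w :: real)"
        using eventually_ge_at_top[of h]
      proof eventually_elim
        case (elim n)
        have "A (tau t w) w < A (real n) w"
          using A_less_iff[OF wG tau(1)[OF wG t], of "real n"] h elim by simp
        then show ?case using tau(2)[OF wG t] \<open>w \<in> space (P p)\<close> by (simp add: \<Lambda>n_def indicator_def)
      qed
      then have "\<forall>\<^sub>F n in sequentially. indicator (\<Lambda>n n) w * (M (T 0 (t + r) (real n)) w - M (T 0 t (real n)) w) = Z w"
        using T_tau_eventually[OF wG t] T_tau_eventually[OF wG tr]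
        by eventually_elim (simp add: Zeq M_def)
      then show ?case by (rule tendsto_eventually)
    qed
    \<comment> \<open>A compensator that ignores the vertex is bounded by the clock, hence by
      \<open>t + r\<close>, however long the truncation is.\<close>
    show "AE w in P p. norm (indicator (\<Lambda>n n) w * (M (T 0 (t + r) (real n)) w - M (T 0 t (real n)) w)) \<le> 2 * (C + C * (t + r))" for n
    proof (rule AE_I2)
      fix w assume "w \<in> space (P p)"
      note w = space_PD[OF this]
      have "\<bar>M (T 0 K (real n)) w\<bar> \<le> C + C * (t + r)" if K: "0 \<le> K" "K \<le> t + r" for K
      proof -
        have "\<bar>occ X (glue 0 G) 0 (T 0 K (real n) w) w\<bar> \<le> C * A (T 0 K (real n) w) w"
          unfolding A_def by (rule occ_glue_bound[OF w G order_refl])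
        also have "\<dots> \<le> C * (t + r)"
          using A_T_le[OF w order_refl n0 K(1), of n] A_0[of w] K C0 by (intro mult_left_mono) auto
        finally show ?thesis unfolding M_def using nD(4)[OF X_Gam[OF w], of "T 0 K (real n) w"] by linarith
      qed
      note Mb = this
      have "\<bar>M (T 0 t (real n)) w\<bar> \<le> C + C * (t + r)" by (rule Mb) (use t r in auto)
      moreover have "\<bar>M (T 0 (t + r) (real n)) w\<bar> \<le> C + C * (t + r)" by (rule Mb) (use t r in auto)
      ultimately have "\<bar>M (T 0 (t + r) (real n)) w - M (T 0 t (real n)) w\<bar> \<le> 2 * (C + C * (t + r))"
        by (intro order_trans[OF abs_triangle_ineq4]) (simp only: mult_2 add_mono)
      then show "norm (indicator (\<Lambda>n n) w * (M (T 0 (t + r) (real n)) w - M (T 0 t (real n)) w)) \<le> 2 * (C + C * (t + r))"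
        unfolding real_norm_def by (rule abs_indicator_mult_le)
    qed
  qed simp
  then have "(\<integral>w. Z w \<partial>P p) = 0" by (simp add: eq0 LIMSEQ_const_iff)
  then show ?thesis unfolding Z_def .
qed

end

section \<open>The semigroup of the time-changed process\<close>

lemma (in prob_space) bounded_measurable_integrable:
  fixes f :: "'a \<Rightarrow> real"
  assumes "f \<in> borel_measurable M" "\<And>w. w \<in> space M \<Longrightarrow> \<bar>f w\<bar> \<le> K"
  shows "integrable M f"
  by (rule integrable_const_bound[where B=K]) (use assms in auto)

lemma has_integral_deviation:
  fixes k :: "real \<Rightarrow> real"
  assumes "(k has_integral I) {a..b}" "a \<le> b" "0 \<le> B" "\<And>r. r \<in> {a..b} \<Longrightarrow> \<bar>k r - c\<bar> \<le> B"
  shows "\<bar>I - (b - a) * c\<bar> \<le> B * (b - a)"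
proof -
  have "((\<lambda>r. k r - c) has_integral (I - (b - a) * c)) {a..b}"
    using has_integral_diff[OF assms(1) has_integral_const_real[of c a b]] assms(2) by simp
  from has_integral_bound_real[OF assms(3) finite.emptyI this] assms(2,4) show ?thesis by simp
qed

text \<open>Applied to the supremum, the hypothesis says that it is at most a convex combination of
  itself and \<open>K\<close>. The a priori bound makes the supremum finite, so it can be
  cancelled.\<close>

lemma bd_contraction:
  assumes f: "\<exists>C. bd N f C" and N: "N \<ge> 1" and \<theta>: "0 \<le> \<theta>" "\<theta> < 1"
    and c: "\<And>C. bd N f C \<Longrightarrow> bd N f (\<theta> * C + (1 - \<theta>) * K)"
  shows "bd N f K"
proof -
  obtain C where C: "bd N f C" using f by blast
  define V where "V = {\<bar>f i x\<bar> | i x. i < N \<and> x \<ge> 0}"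
  define M where "M = Sup V"
  have "\<bar>f 0 0\<bar> \<in> V" unfolding V_def using N by (intro CollectI exI[of _ 0]) simp
  then have ne: "V \<noteq> {}" by blast
  have bV: "bdd_above V" using C unfolding V_def bd_def by (auto intro!: bdd_aboveI[of _ C])
  have "bd N f M" unfolding bd_def M_def using bV by (auto intro!: cSup_upper simp: V_def)
  from c[OF this] have "M \<le> \<theta> * M + (1 - \<theta>) * K"
    unfolding M_def by (intro cSup_least[OF ne]) (auto simp: V_def bd_def)
  then have "(1 - \<theta>) * (M - K) \<le> 0" by (simp add: algebra_simps)
  then have "M \<le> K" using \<theta>(2) by (simp add: mult_le_0_iff)
  then show ?thesis using \<open>bd N f M\<close> unfolding bd_def by (meson order_trans)
qed

lemma bd_limit:
  assumes "\<And>e. e > 0 \<Longrightarrow> bd N f (K + e)"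
  shows "bd N f K"
  unfolding bd_def
proof (intro allI impI)
  fix i x assume ix: "i < N" "0 \<le> (x::real)"
  show "\<bar>f i x\<bar> \<le> K"
  proof (rule field_le_epsilon)
    fix e :: real assume "e > 0"
    from assms[OF this] show "\<bar>f i x\<bar> \<le> K + e" using ix by (simp add: bd_def)
  qed
qed

context sticky
begin

lemma gev_comb: "gev (comb \<alpha> f \<beta> g) p = \<alpha> * gev f p + \<beta> * gev g p"
  by (simp add: gev_def comb_def)

lemma E_comb:
  assumes f: "f \<in> E" and g: "g \<in> E"
  shows "comb \<alpha> f \<beta> g \<in> E" "\<kappa> (comb \<alpha> f \<beta> g) = \<alpha> * \<kappa> f + \<beta> * \<kappa> g"
proof -
  have "(L (comb \<alpha> f \<beta> g) i \<longlongrightarrow> 0) at_top" if i: "i < N" for i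
  proof (rule Lim_transform_eventually)
    show "((\<lambda>x. \<alpha> * L f i x + \<beta> * L g i x) \<longlongrightarrow> 0) at_top"
      using tendsto_add[OF tendsto_mult_left[OF E_D(3)[OF f i]] tendsto_mult_left[OF E_D(3)[OF g i]], of \<alpha> \<beta>] by simp
    show "\<forall>\<^sub>F x in at_top. \<alpha> * L f i x + \<beta> * L g i x = L (comb \<alpha> f \<beta> g) i x"
      using eventually_ge_at_top[of 0] by eventually_elim (simp add: Lop_comb[OF E_D(1)[OF f] E_D(1)[OF g] i])
  qed
  then show "comb \<alpha> f \<beta> g \<in> E"
    unfolding E_def using C2_comb(1)[OF E_D(1)[OF f] E_D(1)[OF g]] C0_comb[OF E_D(2)[OF f] E_D(2)[OF g]] by simp
  show "\<kappa> (comb \<alpha> f \<beta> g) = \<alpha> * \<kappa> f + \<beta> * \<kappa> g"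
    unfolding \<kappa>_def sum_distrib_left sum.distrib[symmetric]
    by (rule sum.cong[OF refl]) (simp add: C2_comb(2)[OF E_D(1)[OF f] E_D(1)[OF g]] algebra_simps)
qed

text \<open>
  The weak form of the forward equation satisfied by \<open>m s f = E[f(Y s)]\<close>, possibly restricted
  to an event that is known at time \<open>t\<close>.
\<close>

definition evolution :: "real \<Rightarrow> (real \<Rightarrow> (nat \<Rightarrow> real \<Rightarrow> real) \<Rightarrow> real) \<Rightarrow> bool" where
  "evolution t m \<longleftrightarrow> (\<forall>f\<in>C0 N. \<forall>s\<ge>t. \<forall>K. bd N f K \<longrightarrow> \<bar>m s f\<bar> \<le> K) \<and>
     (\<forall>f\<in>C0 N. \<forall>g\<in>C0 N. \<forall>\<alpha> \<beta>. \<forall>s\<ge>t. m s (comb \<alpha> f \<beta> g) = \<alpha> * m s f + \<beta> * m s g) \<and>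
     (\<forall>u\<in>D 0. \<forall>x y. t \<le> x \<and> x \<le> y \<longrightarrow> ((\<lambda>s. m s (L u)) has_integral (m y u - m x u)) {x..y})"

lemma dpD:
  assumes "evolution t m"
  shows "f \<in> C0 N \<Longrightarrow> t \<le> s \<Longrightarrow> bd N f K \<Longrightarrow> \<bar>m s f\<bar> \<le> K"
    and "f \<in> C0 N \<Longrightarrow> g \<in> C0 N \<Longrightarrow> t \<le> s \<Longrightarrow> m s (comb \<alpha> f \<beta> g) = \<alpha> * m s f + \<beta> * m s g"
    and "u \<in> D 0 \<Longrightarrow> t \<le> x \<Longrightarrow> x \<le> y \<Longrightarrow> ((\<lambda>s. m s (L u)) has_integral (m y u - m x u)) {x..y}"
  using assms unfolding evolution_def by blast+

lemma evolution_close: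
  assumes m: "evolution t m" and f: "f \<in> C0 N" "g \<in> C0 N" and s: "t \<le> s"
    and e: "\<And>i x. i < N \<Longrightarrow> 0 \<le> x \<Longrightarrow> \<bar>f i x - g i x\<bar> \<le> e"
  shows "\<bar>m s f - m s g\<bar> \<le> e"
proof -
  have "\<bar>m s (comb 1 f (- 1) g)\<bar> \<le> e"
    by (rule dpD(1)[OF m C0_comb[OF f] s]) (use e in \<open>simp add: bd_def comb_def\<close>)
  then show ?thesis using dpD(2)[OF m f s, of 1 "- 1"] by simp
qed

lemma evolution_cong:
  assumes m: "evolution t m" and f: "f \<in> C0 N" "g \<in> C0 N" and s: "t \<le> s" and fg: "feq N f g"
  shows "m s f = m s g"
proof -
  have "\<bar>m s f - m s g\<bar> \<le> 0" by (rule evolution_close[OF m f s]) (use fg in \<open>simp add: feq_def\<close>)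
  then show ?thesis by simp
qed

lemma evolution_lipschitz:
  assumes m: "evolution t m" and u: "u \<in> D 0" and K: "bd N (L u) K" "0 \<le> K" and xy: "t \<le> x" "x \<le> y"
  shows "\<bar>m y u - m x u\<bar> \<le> K * (y - x)"
  using has_integral_deviation[OF dpD(3)[OF m u xy] xy(2) K(2), of 0] dpD(1)[OF m DL_D(3)[OF u] _ K(1)] xy by simp

section \<open>Laws of the time-changed process and the nonsticky resolvent\<close>

lemma gev_Y_integrable:
  assumes "f \<in> C0 N" "0 \<le> t" "p \<in> Gam N"
  shows "integrable (P p) (\<lambda>w. gev f (Y t w))"
proof -
  interpret prob_space "P p" by (rule prob) fact
  obtain K where "bd N f K" using C0_bounded[OF assms(1)] by blast
  then show ?thesis
    using measurable_compose[OF Y_Gmeas[OF assms(2)] gev_meas[OF assms(1)]] gev_bd[OF _ Y_Gam[OF space_PD[of _ p]]]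
    by (intro bounded_measurable_integrable[where K=K]) auto
qed

lemma natfilt_Y_sub: "\<Lambda> \<in> sets (natfilt P Y t) \<Longrightarrow> \<Lambda> \<in> sets (P p)"
  using natfilt_sub[OF Y_cp, of t] sets_P[of p] by blast

lemma Y_occ_Fubini:
  assumes p: "p \<in> Gam N" and \<Lambda>: "\<Lambda> \<in> sets (P p)" and f: "f \<in> C0 N" and st: "0 \<le> s" "s \<le> t"
  shows "((\<lambda>r. \<integral>w. indicator \<Lambda> w * gev f (Y r w) \<partial>P p) has_integral (\<integral>w. indicator \<Lambda> w * occ Y (gev f) s t w \<partial>P p)) {s..t}"
proof -
  interpret prob_space "P p" by (rule prob) fact
  obtain K where K: "bd N f K" using C0_bounded[OF f] by blast
  define \<phi> where "\<phi> z = indicator \<Lambda> (snd z) * gev f (Y (max 0 (min (fst z) t)) (snd z))" for z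
  have \<phi>m: "\<phi> \<in> borel_measurable (borel \<Otimes>\<^sub>M P p)"
    unfolding \<phi>_def
  proof (rule borel_measurable_times)
    show "(\<lambda>x. indicat_real \<Lambda> (snd x)) \<in> borel_measurable (borel \<Otimes>\<^sub>M P p)" using \<Lambda> by measurable
    have "(\<lambda>z. Y (max 0 (min (fst z) t)) (snd z)) \<in> measurable (borel \<Otimes>\<^sub>M P p) (GM N)"
    proof (rule joint_measurable_GM)
      show "Y s w \<in> Gam N" if "w \<in> space (P p)" for w s by (rule Y_Gam[OF space_PD[OF that]])
      show "path_cont (\<lambda>t. Y t w)" if "w \<in> space (P p)" for w by (rule Y_path[OF space_PD[OF that]])
      show "Y s \<in> measurable (P p) Gmeas" if "s \<in> {0..t}" for s using measurable_GM_D(1)[OF Y_Gmeas] that by simp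
    qed (use st in simp)
    from measurable_compose[OF this gev_meas[OF f]]
    show "(\<lambda>z. gev f (Y (max 0 (min (fst z) t)) (snd z))) \<in> borel_measurable (borel \<Otimes>\<^sub>M P p)" .
  qed
  have \<phi>b: "\<bar>\<phi> (u, w)\<bar> \<le> K" if "w \<in> space (P p)" for u w
    unfolding \<phi>_def using gev_bd[OF K Y_Gam[OF space_PD[OF that]]] by (simp add: abs_indicator_mult_le)
  define k where "k u = (\<integral>w. \<phi> (u, w) \<partial>P p)" for u
  note fub = bounded_Fubini(1,4)[OF finite_measure_axioms \<phi>m \<phi>b, of s t, folded k_def]
  have in_eq: "(\<integral>u. indicator {s..t} u * \<phi> (u, w) \<partial>lborel) = indicator \<Lambda> w * occ Y (gev f) s t w" for w
    unfolding occ_eq_clamped[OF st(1)] \<phi>_def by (simp add: mult.left_commute)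
  have "set_integrable lborel {s..t} k" using fub(2) by (simp add: set_integrable_def)
  then have "(k has_integral (\<integral>u. indicator {s..t} u * k u \<partial>lborel)) {s..t}"
    using set_borel_integral_eq_integral[of "{s..t}" k] by (simp add: has_integral_iff set_lebesgue_integral_def)
  then have "(k has_integral (\<integral>w. indicator \<Lambda> w * occ Y (gev f) s t w \<partial>P p)) {s..t}"
    by (simp only: fub(1)[symmetric] in_eq)
  then show ?thesis
    by (rule has_integral_eq[rotated]) (use st in \<open>simp add: k_def \<phi>_def\<close>)
qed

text \<open>The nonsticky condition says that the flux of \<open>u\<close> is 0, so its compensator
  has no vertex part and \<open>Y_martingale\<close> applies. Allowing an event of the past is what
  later yields the Markov property.\<close>

lemma evolution_Y:
  assumes p: "p \<in> Gam N" and t: "0 \<le> t" and \<Lambda>: "\<Lambda> \<in> sets (natfilt P Y t)"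
  shows "evolution t (\<lambda>s f. \<integral>w. indicator \<Lambda> w * gev f (Y s w) \<partial>P p)"
  unfolding evolution_def
proof (intro conjI ballI allI impI)
  interpret prob_space "P p" by (rule prob) fact
  note \<Lambda>P = natfilt_Y_sub[OF \<Lambda>, of p]
  have int: "integrable (P p) (\<lambda>w. indicator \<Lambda> w * gev g (Y r w))" if "g \<in> C0 N" "t \<le> r" for g r
    using integrable_mult_indicator[OF \<Lambda>P gev_Y_integrable[OF that(1) _ p, of r]] that(2) t by simp
  show "\<bar>\<integral>w. indicator \<Lambda> w * gev f (Y s w) \<partial>P p\<bar> \<le> K" if "bd N f K" for f s K
    by (intro abs_expectation_le abs_indicator_mult_le gev_bd[OF that Y_Gam] space_PD[of _ p])
  show "(\<integral>w. indicator \<Lambda> w * gev (comb \<alpha> f \<beta> g) (Y s w) \<partial>P p) =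
      \<alpha> * (\<integral>w. indicator \<Lambda> w * gev f (Y s w) \<partial>P p) + \<beta> * (\<integral>w. indicator \<Lambda> w * gev g (Y s w) \<partial>P p)"
    if "f \<in> C0 N" "g \<in> C0 N" "t \<le> s" for f g \<alpha> \<beta> s
    using int[OF that(1,3)] int[OF that(2,3)] by (simp add: gev_comb distrib_left mult.left_commute)
  fix u x y assume u: "u \<in> D 0" and xy: "t \<le> x \<and> x \<le> y"
  then have x0: "0 \<le> x" "0 \<le> y" "x \<le> y" using t by auto
  note uD = DL_D[OF u]
  have "\<kappa> u = 0" using uD(4) by (simp add: \<kappa>_def)
  then obtain C where C: "nice (gev u) (glue 0 (gev (L u))) C" "bd N (L u) C" "0 \<le> C"
    using nice_E[OF DL_E[OF u]] by auto
  have occb: "\<bar>occ Y (gev (L u)) x y w\<bar> \<le> C * (y - x)" if "w \<in> \<Omega>" for w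
    by (rule occ_bound[OF Y_cp gev_meas[OF uD(3)] that gev_bd[OF C(2)] x0(1,3)])
  have occm: "occ Y (gev (L u)) x y \<in> borel_measurable (P p)"
    using occ_measurable[OF Y_cp gev_meas[OF uD(3)] gev_bd[OF C(2)] x0(1,3)] natfilt_sub[OF Y_cp, of y] sets_P[of p] space_P[of p]
    by (auto simp: measurable_def subset_iff)
  have occi: "integrable (P p) (\<lambda>w. indicator \<Lambda> w * occ Y (gev (L u)) x y w)"
    using integrable_mult_indicator[OF \<Lambda>P bounded_measurable_integrable[OF occm occb[OF space_PD[of _ p]]]] by simp
  have "\<Lambda> \<in> sets (natfilt P Y x)" using natfilt_mono[of t x P Y] xy \<Lambda> by blast
  from Y_martingale[OF C(1) gev_meas[OF uD(3)] gev_bd[OF C(2)] p x0(1) _ this, of "y - x"]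
  have "(\<integral>w. indicator \<Lambda> w * (gev u (Y y w) - gev u (Y x w) - occ Y (gev (L u)) x y w) \<partial>P p) = 0"
    using x0 by simp
  then have "(\<integral>w. indicator \<Lambda> w * gev u (Y y w) \<partial>P p) - (\<integral>w. indicator \<Lambda> w * gev u (Y x w) \<partial>P p)
      = (\<integral>w. indicator \<Lambda> w * occ Y (gev (L u)) x y w \<partial>P p)"
    using int[OF uD(2), of x] int[OF uD(2), of y] xy occi by (simp add: right_diff_distrib)
  then show "((\<lambda>s. \<integral>w. indicator \<Lambda> w * gev (L u) (Y s w) \<partial>P p) has_integral
      ((\<integral>w. indicator \<Lambda> w * gev u (Y y w) \<partial>P p) - (\<integral>w. indicator \<Lambda> w * gev u (Y x w) \<partial>P p))) {x..y}"
    using Y_occ_Fubini[OF p \<Lambda>P uD(3) x0(1,3)] by simp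
qed

lemma Y_0: "p \<in> Gam N \<Longrightarrow> AE w in P p. Y 0 w = p"
proof -
  assume p: "p \<in> Gam N"
  have "AE w in P p. X 0 w = p" using gen p unfolding generated_process_def by blast
  with AE_good_paths[OF p] show ?thesis
    by eventually_elim (simp add: Y_def tau_0[OF good_paths_clock_paths])
qed

lemma Tsg_Y_0:
  assumes p: "p \<in> Gam N" and f: "f \<in> C0 N"
  shows "Tsg P Y 0 f p = gev f p"
proof -
  interpret prob_space "P p" by (rule prob) fact
  have "Tsg P Y 0 f p = (\<integral>w. gev f p \<partial>P p)"
    unfolding Tsg_def
  proof (rule integral_cong_AE)
    show "AE w in P p. gev f (Y 0 w) = gev f p" using Y_0[OF p] by eventually_elim simp
  qed (use measurable_compose[OF Y_Gmeas[OF order_refl] gev_meas[OF f]] in auto)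
  then show ?thesis by (simp add: prob_space)
qed

lemma evolution_Tsg:
  assumes p: "p \<in> Gam N"
  shows "evolution 0 (\<lambda>s f. Tsg P Y s f p)"
proof -
  have "\<Omega> \<in> sets (natfilt P Y 0)" using sets.top[of "natfilt P Y 0"] by simp
  from evolution_Y[OF p order_refl this]
  have 1: "evolution 0 (\<lambda>s f. \<integral>w. indicator \<Omega> w * gev f (Y s w) \<partial>P p)" .
  have "(\<integral>w. indicator \<Omega> w * gev f (Y s w) \<partial>P p) = Tsg P Y s f p" for s f
    unfolding Tsg_def by (rule Bochner_Integration.integral_cong[OF refl]) (simp add: space_PD[of _ p])
  with 1 show ?thesis by simp
qed

text \<open>Dissipativity of \<open>L\<close> on the nonsticky domain, obtained from the process.
  Running \<open>Y\<close> for a short time \<open>s\<close> and replacing \<open>L w\<close> by the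
  difference of \<open>w\<close> and \<open>f\<close> over \<open>h\<close> writes the value of
  \<open>w\<close> as a convex combination of a later mean of \<open>w\<close> and a term of size
  \<open>K\<close>, up to \<open>e\<close>.\<close>

lemma resolvent_bound:
  assumes w: "w \<in> D 0" and h: "h > 0" and f: "bd N f K"
    and eq: "\<And>i x. i < N \<Longrightarrow> 0 \<le> x \<Longrightarrow> w i x - h * L w i x = f i x"
  shows "bd N w K"
proof (rule bd_limit)
  fix e :: real assume e: "e > 0"
  note wD = DL_D[OF w]
  obtain C' where C': "C' \<ge> 0" "bd N (L w) C'" using C0_bounded[OF wD(3)] by blast
  have K0: "0 \<le> K" using f N1 unfolding bd_def by (meson abs_ge_zero less_le_trans order_refl order_trans zero_less_one)
  \<comment> \<open>Over a time \<open>s\<close> the mean of \<open>w\<close> moves by at most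
    \<open>s * C'\<close>, which must not exceed \<open>e\<close>.\<close>
  define s where "s = e / (C' + 1)"
  have s: "s > 0" "s * C' \<le> e" using e C' by (auto simp: s_def field_simps)
  define \<theta> where "\<theta> = h / (h + s)"
  have \<theta>: "0 \<le> \<theta>" "\<theta> < 1" using h s by (auto simp: \<theta>_def)
  show "bd N w (K + e)"
  proof (rule bd_contraction[OF _ N1 \<theta>])
    show "\<exists>C. bd N w C" using C0_bounded[OF wD(2)] by blast
    fix M assume M: "bd N w M"
    have g: "\<bar>gev w p\<bar> \<le> \<theta> * M + (1 - \<theta>) * (K + e)" if p: "p \<in> Gam N" for p
    proof -
      define m where "m s f = Tsg P Y s f p" for s f
      have m: "evolution 0 m" unfolding m_def by (rule evolution_Tsg[OF p])
      define f' where "f' = comb 1 w (- h) (L w)"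
      have f': "f' \<in> C0 N" unfolding f'_def by (rule C0_comb[OF wD(2,3)])
      have f'b: "bd N f' K" using f eq unfolding f'_def bd_def comb_def by simp
      have dev: "\<bar>m r (L w) - m 0 w / h\<bar> \<le> (C' * s + K) / h" if r: "r \<in> {0..s}" for r
      proof -
        have "m r f' = m r w - h * m r (L w)" unfolding f'_def using dpD(2)[OF m wD(2,3), of r 1 "- h"] r by simp
        then have "m r (L w) - m 0 w / h = ((m r w - m 0 w) - m r f') / h" using h by (simp add: field_simps)
        moreover have "\<bar>m r w - m 0 w\<bar> \<le> C' * s"
          using evolution_lipschitz[OF m w C'(2,1) order_refl, of r] r mult_left_mono[of r s C'] C' by auto
        moreover have "\<bar>m r f'\<bar> \<le> K" using dpD(1)[OF m f' _ f'b, of r] r by simp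
        ultimately show ?thesis using h by (simp add: abs_divide divide_right_mono abs_triangle_ineq4[THEN order_trans] add_mono)
      qed
      have "\<bar>(m s w - m 0 w) - (s - 0) * (m 0 w / h)\<bar> \<le> (C' * s + K) / h * (s - 0)"
        by (rule has_integral_deviation[OF dpD(3)[OF m w order_refl] _ _ dev]) (use s h C' K0 in auto)
      then have "h * \<bar>(m s w - m 0 w) - s * (m 0 w / h)\<bar> \<le> h * ((C' * s + K) / h * s)"
        using h by (intro mult_left_mono) auto
      also have "\<dots> = (C' * s + K) * s" using h by simp
      also have "h * \<bar>(m s w - m 0 w) - s * (m 0 w / h)\<bar> = \<bar>h * ((m s w - m 0 w) - s * (m 0 w / h))\<bar>"
        using h by (simp only: abs_mult abs_of_pos)
      also have "h * ((m s w - m 0 w) - s * (m 0 w / h)) = h * m s w - (h + s) * m 0 w"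
        using h by (simp add: field_simps)
      finally have 1: "\<bar>h * m s w - (h + s) * m 0 w\<bar> \<le> (C' * s + K) * s" .
      have "\<bar>m s w\<bar> \<le> M" using dpD(1)[OF m wD(2) _ M, of s] s by simp
      then have 2: "\<bar>h * m s w\<bar> \<le> h * M" using h by (simp add: abs_mult)
      have "(C' * s + K) * s \<le> (K + e) * s" using s by (intro mult_right_mono) (auto simp: mult.commute)
      then have "(C' * s + K) * s \<le> s * (K + e)" by (simp only: mult.commute)
      then have "\<bar>(h + s) * m 0 w\<bar> \<le> h * M + s * (K + e)" using 1 2 by linarith
      then have "\<bar>m 0 w\<bar> \<le> (h * M + s * (K + e)) / (h + s)"
        using h s by (simp add: abs_mult pos_le_divide_eq mult.commute)
      also have "\<dots> = \<theta> * M + (1 - \<theta>) * (K + e)"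
      proof -
        have "1 - \<theta> = s / (h + s)" using h s by (simp add: \<theta>_def field_simps)
        then show ?thesis by (simp add: \<theta>_def add_divide_distrib)
      qed
      finally show ?thesis by (simp add: m_def Tsg_Y_0[OF p wD(2)])
    qed
    show "bd N w (\<theta> * M + (1 - \<theta>) * (K + e))"
      unfolding bd_def
    proof (intro allI impI)
      fix i x assume "i < N" "0 \<le> (x::real)"
      then show "\<bar>w i x\<bar> \<le> \<theta> * M + (1 - \<theta>) * (K + e)"
        using g[OF pt_in_Gam] gev_pt_C0[OF wD(2)] by metis
    qed
  qed
qed

lemma resolvent_unique:
  assumes v: "v \<in> D 0" "w \<in> D 0" and h: "h > 0"
    and eq: "\<And>i x. i < N \<Longrightarrow> 0 \<le> x \<Longrightarrow> v i x - h * L v i x = w i x - h * L w i x"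
  shows "feq N v w"
proof -
  have "bd N (comb 1 v (- 1) w) 0"
  proof (rule resolvent_bound[OF DL_comb[OF v N1] h])
    show "bd N (\<lambda>i x. 0) 0" by (simp add: bd_def)
    fix i x assume ix: "i < N" "0 \<le> (x::real)"
    show "comb 1 v (- 1) w i x - h * L (comb 1 v (- 1) w) i x = 0"
      using eq[OF ix] by (simp add: Lop_comb[OF DL_D(1)[OF v(1)] DL_D(1)[OF v(2)] ix]) (simp add: comb_def algebra_simps)
  qed
  then show ?thesis by (simp add: bd_def feq_def comb_def)
qed

text \<open>The sticky resolvent solves the equation with the wrong boundary condition. One
  homogeneous solution of nonzero flux corrects that, and \<open>flux_fn\<close> yields it without
  solving a differential equation.\<close>

lemma resolvent_exists:
  assumes f: "f \<in> C0 N" and h: "h > 0"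
  shows "\<exists>w. w \<in> D 0 \<and> (\<forall>i<N. \<forall>x\<ge>0. w i x - h * L w i x = f i x)"
proof -
  have Lee: "L flux_fn \<in> C0 N"
  proof (rule C0I)
    show "L flux_fn i 0 = L flux_fn j 0" if "i < N" "j < N" for i j using flux_fn(3) that by simp
    show "continuous_on {0..} (L flux_fn i)" if "i < N" for i by (rule L_cont[OF E_D(1)[OF flux_fn(1)] that])
    show "(L flux_fn i \<longlongrightarrow> 0) at_top" if "i < N" for i by (rule E_D(3)[OF flux_fn(1) that])
  qed
  define g0 where "g0 = comb 1 flux_fn (- h) (L flux_fn)"
  have g0: "g0 \<in> C0 N" unfolding g0_def by (rule C0_comb[OF E_D(2)[OF flux_fn(1)] Lee])
  have JE: "J h g \<in> E" if "g \<in> C0 N" for g by (rule DL_E[OF J_DL[OF that h]])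
  \<comment> \<open>Both \<open>flux_fn\<close> and \<open>J h g0\<close> solve the equation with
    right-hand side \<open>g0\<close>, so their difference is homogeneous.\<close>
  define \<phi> where "\<phi> = comb 1 flux_fn (- 1) (J h g0)"
  have \<phi>E: "\<phi> \<in> E" unfolding \<phi>_def by (rule E_comb(1)[OF flux_fn(1) JE[OF g0]])
  have \<phi>eq: "\<phi> i x - h * L \<phi> i x = 0" if ix: "i < N" "0 \<le> x" for i x
    using J_equation[OF g0 h ix]
    by (simp add: \<phi>_def Lop_comb[OF E_D(1)[OF flux_fn(1)] E_D(1)[OF JE[OF g0]] ix]) (simp add: g0_def comb_def algebra_simps)
  \<comment> \<open>The equation itself forces a common limit of \<open>L w\<close> at the vertex,
    because \<open>w\<close> and \<open>g\<close> are single-valued there. Only the flux condition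
    remains.\<close>
  have E_D0: "w \<in> D 0" if w: "w \<in> E" "\<kappa> w = 0" and g: "g \<in> C0 N"
    and eq: "\<And>i x. i < N \<Longrightarrow> 0 \<le> x \<Longrightarrow> w i x - h * L w i x = g i x" for w g
  proof (rule E_DL[OF w(1)])
    fix i assume i: "i < N"
    have "0 < N" using N1 by simp
    have "h * L w i 0 = w i 0 - g i 0" using eq[OF i order_refl] by linarith
    also have "\<dots> = w 0 0 - g 0 0"
      using C0_compat[OF E_D(2)[OF w(1)] i \<open>0 < N\<close>] C0_compat[OF g i \<open>0 < N\<close>] by linarith
    finally show "L w i 0 = (w 0 0 - g 0 0) / h" using h by (simp add: field_simps)
  qed (simp add: w(2))
  have zero: "(\<lambda>i x. 0) \<in> C0 N" using E_D(2)[OF zero_E(1)[OF order_refl]] .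
  \<comment> \<open>With zero flux, \<phi> would be a homogeneous solution in the nonsticky domain
    and vanish by \<open>resolvent_bound\<close>. Then \<open>flux_fn\<close> would coincide with a
    sticky resolvent and satisfy the sticky boundary condition, which it does not.\<close>
  have "\<kappa> \<phi> \<noteq> 0"
  proof
    assume "\<kappa> \<phi> = 0"
    then have "\<phi> \<in> D 0" by (rule E_D0[OF \<phi>E _ zero \<phi>eq])
    then have "bd N \<phi> 0" by (rule resolvent_bound[OF _ h _ \<phi>eq]) (simp add: bd_def)
    then have "feq N (J h g0) flux_fn" by (simp add: bd_def feq_def \<phi>_def comb_def)
    from DL_cong[OF this J_DL[OF g0 h] N1] show False using flux_fn_notin by blast
  qed
  define c where "c = \<kappa> (J h f) / \<kappa> \<phi>"
  define w where "w = comb 1 (J h f) (- c) \<phi>"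
  have wE: "w \<in> E" unfolding w_def by (rule E_comb(1)[OF JE[OF f] \<phi>E])
  have "\<kappa> w = 0" using \<open>\<kappa> \<phi> \<noteq> 0\<close> by (simp add: w_def E_comb(2)[OF JE[OF f] \<phi>E] c_def)
  moreover have weq: "w i x - h * L w i x = f i x" if ix: "i < N" "0 \<le> x" for i x
  proof -
    have "L w i x = L (J h f) i x - c * L \<phi> i x"
      unfolding w_def using Lop_comb[OF E_D(1)[OF JE[OF f]] E_D(1)[OF \<phi>E] ix, of \<sigma> b 1 "- c"] by simp
    moreover have "w i x = J h f i x - c * \<phi> i x" by (simp add: w_def comb_def)
    moreover have "c * \<phi> i x = h * (c * L \<phi> i x)" using \<phi>eq[OF ix] by simp
    ultimately show ?thesis using J_equation[OF f h ix] by (simp add: right_diff_distrib)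
  qed
  ultimately have "w \<in> D 0" by (intro E_D0[OF wE _ f])
  then show ?thesis using weq by blast
qed

section \<open>Implicit Euler steps with the nonsticky resolvent\<close>

definition J0 :: "real \<Rightarrow> (nat \<Rightarrow> real \<Rightarrow> real) \<Rightarrow> nat \<Rightarrow> real \<Rightarrow> real" where
  "J0 h f = (SOME w. w \<in> D 0 \<and> (\<forall>i<N. \<forall>x\<ge>0. w i x - h * L w i x = f i x))"

lemma J0:
  assumes "f \<in> C0 N" "h > 0"
  shows "J0 h f \<in> D 0" "\<And>i x. i < N \<Longrightarrow> 0 \<le> x \<Longrightarrow> J0 h f i x - h * L (J0 h f) i x = f i x"
  using someI_ex[OF resolvent_exists[OF assms], folded J0_def] by blast+

lemma J0_bd: "f \<in> C0 N \<Longrightarrow> h > 0 \<Longrightarrow> bd N f K \<Longrightarrow> bd N (J0 h f) K"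
  by (rule resolvent_bound[OF J0(1) _ _ J0(2)])

text \<open>By uniqueness it is enough that \<open>v + h * J0 h (L v)\<close> solves the equation
  for \<open>J0 h v\<close>; comparing the two descriptions then shows that the generator commutes
  with its resolvent.\<close>

lemma J0_commute:
  assumes v: "v \<in> D 0" and h: "h > 0"
  shows "feq N (L (J0 h v)) (J0 h (L v))" "feq N (J0 h v) (comb 1 v h (J0 h (L v)))"
proof -
  note vD = DL_D[OF v]
  note z = J0[OF vD(3) h] and y = J0[OF vD(2) h]
  show 1: "feq N (J0 h v) (comb 1 v h (J0 h (L v)))"
  proof (rule resolvent_unique[OF y(1) DL_comb[OF v z(1) N1] h])
    fix i x assume ix: "i < N" "0 \<le> (x::real)"
    have "h * (J0 h (L v) i x - h * L (J0 h (L v)) i x) = h * L v i x" using z(2)[OF ix] by (simp only:)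
    then have "h * J0 h (L v) i x - h * (h * L (J0 h (L v)) i x) = h * L v i x" by (simp only: right_diff_distrib)
    moreover have "comb 1 v h (J0 h (L v)) i x = v i x + h * J0 h (L v) i x" by (simp add: comb_def)
    ultimately show "J0 h v i x - h * L (J0 h v) i x
        = comb 1 v h (J0 h (L v)) i x - h * L (comb 1 v h (J0 h (L v))) i x"
      using y(2)[OF ix] unfolding Lop_comb[OF vD(1) DL_D(1)[OF z(1)] ix] by (simp only: mult_1 distrib_left)
  qed
  show "feq N (L (J0 h v)) (J0 h (L v))"
    unfolding feq_def
  proof (intro allI impI)
    fix i x assume ix: "i < N" "0 \<le> (x::real)"
    have "h * L (J0 h v) i x = h * J0 h (L v) i x"
      using y(2)[OF ix] 1[unfolded feq_def comb_def, rule_format, OF ix] by linarith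
    then show "L (J0 h v) i x = J0 h (L v) i x" using h by simp
  qed
qed

text \<open>Functions to which the generator applies twice. The bound on the second iterate is all
  that the local Euler error depends on, and the resolvent preserves it.\<close>

definition D2 :: "real \<Rightarrow> (nat \<Rightarrow> real \<Rightarrow> real) set" where
  "D2 K = {u \<in> D 0. L u \<in> D 0 \<and> bd N (L (L u)) K}"

lemma L_feq: "feq N f g \<Longrightarrow> feq N (L f) (L g)"
  unfolding feq_def by (metis Lop_cong)

lemma D2_J0:
  assumes u: "u \<in> D2 K" and h: "h > 0"
  shows "J0 h u \<in> D2 K"
proof -
  have uD: "u \<in> D 0" "L u \<in> D 0" "bd N (L (L u)) K" using u by (auto simp: D2_def)
  have sym: "feq N f g \<Longrightarrow> feq N g f" for f g by (simp add: feq_def)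
  have 1: "L (J0 h u) \<in> D 0"
    by (rule DL_cong[OF sym[OF J0_commute(1)[OF uD(1) h]] J0(1)[OF DL_D(3)[OF uD(1)] h] N1])
  have 2: "bd N (J0 h (L (L u))) K" by (rule J0_bd[OF DL_D(3)[OF uD(2)] h uD(3)])
  have "bd N (L (L (J0 h u))) K"
    using 2 L_feq[OF J0_commute(1)[OF uD(1) h]] J0_commute(1)[OF uD(2) h] by (simp add: bd_def feq_def)
  then show ?thesis using 1 J0(1)[OF DL_D(2)[OF uD(1)] h] by (simp add: D2_def)
qed

text \<open>One resolvent step moves an element of the nonsticky domain by at most \<open>h\<close>
  times the bound of its generator, and lands where the generator can be applied twice.\<close>

lemma D2_dense:
  assumes f: "f \<in> C0 N" and e: "e > 0"
  shows "\<exists>K\<ge>0. \<exists>u\<in>D2 K. \<forall>i<N. \<forall>x\<ge>0. \<bar>f i x - u i x\<bar> \<le> e"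
proof -
  obtain g where g: "g \<in> D 0" "\<And>i x. i < N \<Longrightarrow> 0 \<le> x \<Longrightarrow> \<bar>g i x - f i x\<bar> \<le> e / 2"
    using D0_dense[OF f, of "e / 2"] e by auto
  obtain K where K: "K \<ge> 0" "bd N (L g) K" using C0_bounded[OF DL_D(3)[OF g(1)]] by blast
  define h where "h = e / (2 * (K + 1))"
  have h: "h > 0" "h * K \<le> e / 2" using e K by (auto simp: h_def field_simps)
  note Jg = J0(1)[OF DL_D(2)[OF g(1)] h(1)]
  have LJ: "L (J0 h g) \<in> D 0"
    by (rule DL_cong[OF _ J0(1)[OF DL_D(3)[OF g(1)] h(1)] N1]) (use J0_commute(1)[OF g(1) h(1)] in \<open>simp add: feq_def\<close>)
  obtain K' where K': "K' \<ge> 0" "bd N (L (L (J0 h g))) K'" using C0_bounded[OF DL_D(3)[OF LJ]] by blast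
  have "\<bar>f i x - J0 h g i x\<bar> \<le> e" if ix: "i < N" "0 \<le> x" for i x
  proof -
    have "J0 h g i x = g i x + h * J0 h (L g) i x" using J0_commute(2)[OF g(1) h(1)] ix by (simp add: feq_def comb_def)
    moreover have "\<bar>J0 h (L g) i x\<bar> \<le> K" using J0_bd[OF DL_D(3)[OF g(1)] h(1) K(2)] ix by (simp add: bd_def)
    then have "\<bar>h * J0 h (L g) i x\<bar> \<le> h * K" using h by (simp add: abs_mult)
    ultimately show ?thesis using g(2)[OF ix] h(2) by linarith
  qed
  then show ?thesis using K' LJ Jg by (auto simp: D2_def intro!: exI[of _ K'])
qed

text \<open>The true increment integrates \<open>m r (L u)\<close>, the Euler increment is
  \<open>h * m x (J0 h (L u))\<close>. Both integrands are within \<open>K * h\<close> of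
  \<open>m x (L u)\<close>, one by the Lipschitz bound in time and the other by the commutation
  identity.\<close>

lemma Euler_step:
  assumes m: "evolution t m" and u: "u \<in> D2 K" and K: "0 \<le> K" and h: "h > 0" and x: "t \<le> x"
  shows "\<bar>m (x + h) u - m x (J0 h u)\<bar> \<le> 2 * h\<^sup>2 * K"
proof -
  have uD: "u \<in> D 0" "L u \<in> D 0" "bd N (L (L u)) K" using u by (auto simp: D2_def)
  note uD' = DL_D[OF uD(1)] and LuD = DL_D[OF uD(2)]
  note z = J0(1)[OF uD'(3) h]
  have dev: "\<bar>m r (L u) - m x (J0 h (L u))\<bar> \<le> 2 * h * K" if r: "r \<in> {x..x + h}" for r
  proof -
    have "\<bar>m r (L u) - m x (L u)\<bar> \<le> K * (r - x)" by (rule evolution_lipschitz[OF m uD(2,3) K x]) (use r in simp)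
    also have "\<dots> \<le> K * h" using r by (intro mult_left_mono K) simp
    finally have 1: "\<bar>m r (L u) - m x (L u)\<bar> \<le> K * h" .
    have "\<bar>m x (L u) - m x (J0 h (L u))\<bar> \<le> K * h"
    proof (rule evolution_close[OF m uD'(3) DL_D(2)[OF z] x])
      fix i y assume iy: "i < N" "0 \<le> (y::real)"
      have "J0 h (L u) i y = L u i y + h * J0 h (L (L u)) i y" using J0_commute(2)[OF uD(2) h] iy by (simp add: feq_def comb_def)
      moreover have "\<bar>J0 h (L (L u)) i y\<bar> \<le> K" using J0_bd[OF LuD(3) h uD(3)] iy by (simp add: bd_def)
      ultimately show "\<bar>L u i y - J0 h (L u) i y\<bar> \<le> K * h" using h by (simp add: abs_mult mult.commute)
    qed
    with 1 have "\<bar>m r (L u) - m x (J0 h (L u))\<bar> \<le> K * h + K * h" by linarith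
    also have "\<dots> = 2 * h * K" by simp
    finally show ?thesis .
  qed
  have "\<bar>(m (x + h) u - m x u) - (x + h - x) * m x (J0 h (L u))\<bar> \<le> 2 * h * K * (x + h - x)"
    by (rule has_integral_deviation[OF dpD(3)[OF m uD(1) x] _ _ dev]) (use h K in auto)
  moreover have "m x (J0 h u) = m x u + h * m x (J0 h (L u))"
    using evolution_cong[OF m DL_D(2)[OF J0(1)[OF uD'(2) h]] C0_comb[OF uD'(2) DL_D(2)[OF z]] x J0_commute(2)[OF uD(1) h]]
      dpD(2)[OF m uD'(2) DL_D(2)[OF z] x, of 1 h] by simp
  ultimately show ?thesis by (simp add: power2_eq_square algebra_simps)
qed

text \<open>Steps are peeled off at the end of the time interval, where \<open>u\<close> is replaced
  by \<open>J0 h u\<close>. This stays in \<open>D2\<close> with the same constant, so local errors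
  add up without amplification.\<close>

lemma Euler_iterate:
  assumes m: "evolution t m" and K: "0 \<le> K" and h: "h > 0"
  shows "u \<in> D2 K \<Longrightarrow> (J0 h ^^ n) u \<in> D2 K \<and> \<bar>m (t + real n * h) u - m t ((J0 h ^^ n) u)\<bar> \<le> real n * (2 * h\<^sup>2 * K)"
proof (induction n arbitrary: u)
  case (Suc n)
  have eq: "(J0 h ^^ Suc n) u = (J0 h ^^ n) (J0 h u)" by (simp add: funpow_swap1)
  have "t \<le> t + real n * h" using h by simp
  from Euler_step[OF m Suc.prems K h this] Suc.IH[OF D2_J0[OF Suc.prems h]]
  have "(J0 h ^^ n) (J0 h u) \<in> D2 K"
    "\<bar>m (t + real n * h + h) u - m t ((J0 h ^^ n) (J0 h u))\<bar> \<le> 2 * h\<^sup>2 * K + real n * (2 * h\<^sup>2 * K)"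
    by linarith+
  moreover have "t + real n * h + h = t + real (Suc n) * h" "2 * h\<^sup>2 * K + real n * (2 * h\<^sup>2 * K) = real (Suc n) * (2 * h\<^sup>2 * K)"
    by (simp_all add: distrib_right)
  ultimately show ?case unfolding eq by (simp only:)
qed simp

text \<open>The implicit Euler scheme converges with a rate that does not depend on \<open>m\<close>. Hence the evolution
  of \<open>m\<close> is determined by its initial value, which yields both the Feller and the Markov property of \<open>Y\<close>.\<close>

lemma evolution_approx:
  assumes f: "f \<in> C0 N" and s: "0 \<le> s" and e: "e > 0"
  shows "\<exists>g\<in>C0 N. \<forall>t m. evolution t m \<longrightarrow> \<bar>m (t + s) f - m t g\<bar> \<le> e"
proof (cases "s = 0")
  case True
  then show ?thesis using e by (intro bexI[OF _ f]) simp
next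
  case False
  obtain K u where K: "K \<ge> 0" and u: "u \<in> D2 K" and fu: "\<And>i x. i < N \<Longrightarrow> 0 \<le> x \<Longrightarrow> \<bar>f i x - u i x\<bar> \<le> e / 2"
    using D2_dense[OF f, of "e / 2"] e by auto
  have uC: "u \<in> C0 N" using u DL_D(2) by (auto simp: D2_def)
  \<comment> \<open>The accumulated error with \<open>n\<close> steps of length \<open>s / n\<close>
    is \<open>2 * s^2 * K / n\<close>, to be made at most \<open>e / 2\<close>.\<close>
  obtain k :: nat where k: "real k > 4 * s\<^sup>2 * K / e" using reals_Archimedean2 by blast
  define n where "n = Suc k"
  define h where "h = s / real n"
  have h: "h > 0" using s False by (simp add: h_def n_def)
  have n: "real n > 0" "real n > 4 * s\<^sup>2 * K / e" using k by (auto simp: n_def)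
  define g where "g = (J0 h ^^ n) u"
  have nh: "real n * h = s" using n(1) by (simp add: h_def)
  have rate: "real n * (2 * h\<^sup>2 * K) \<le> e / 2"
  proof -
    have "real n * (2 * h\<^sup>2 * K) = 2 * s\<^sup>2 * K / real n"
      using n(1) by (simp add: h_def power2_eq_square field_simps)
    also have "\<dots> \<le> e / 2" using n e by (simp add: pos_divide_less_eq pos_divide_le_eq field_simps)
    finally show ?thesis .
  qed
  have "g \<in> C0 N \<and> \<bar>m (t + s) f - m t g\<bar> \<le> e" if m: "evolution t m" for t m
  proof -
    note Eu = Euler_iterate[OF m K h u, of n, folded g_def, unfolded nh]
    have "\<bar>m (t + s) f - m (t + s) u\<bar> \<le> e / 2" by (rule evolution_close[OF m f uC _ fu]) (use s in simp)
    then have "\<bar>m (t + s) f - m t g\<bar> \<le> e" using Eu rate by linarith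
    moreover have "g \<in> C0 N" using Eu DL_D(2) by (auto simp: D2_def)
    ultimately show ?thesis by simp
  qed
  moreover have "g \<in> C0 N" using calculation evolution_Tsg[OF vtx_in_Gam[OF N1]] by blast
  ultimately show ?thesis by blast
qed

text \<open>The function \<open>g\<close> of \<open>evolution_approx\<close> is the same for all
  starting points, so the semigroup applied to \<open>f\<close> is a uniform limit of functions in
  \<open>C0\<close>.\<close>

lemma Tsg_Y_C0:
  assumes f: "f \<in> C0 N" and t: "0 \<le> t"
  shows "\<exists>g\<in>C0 N. \<forall>p\<in>Gam N. Tsg P Y t f p = gev g p"
proof -
  define g where "g i x = Tsg P Y t f (pt i x)" for i x
  have "g \<in> C0 N"
  proof (rule C0_closed)
    fix e :: real assume "e > 0"
    from evolution_approx[OF f t this] obtain g' where g': "g' \<in> C0 N" "\<And>t' m. evolution t' m \<Longrightarrow> \<bar>m (t' + t) f - m t' g'\<bar> \<le> e" by blast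
    have "\<bar>g i x - g' i x\<bar> \<le> e" if ix: "i < N" "0 \<le> x" for i x
      using g'(2)[OF evolution_Tsg[OF pt_in_Gam[OF ix]]] Tsg_Y_0[OF pt_in_Gam[OF ix] g'(1)] gev_pt_C0[OF g'(1) ix(1)] by (simp add: g_def)
    then show "\<exists>g'\<in>C0 N. \<forall>i<N. \<forall>x\<ge>0. \<bar>g i x - g' i x\<bar> \<le> e" using g'(1) by blast
  qed
  moreover have "Tsg P Y t f p = gev g p" if "p \<in> Gam N" for p
    using that by (rule GamE) (simp add: gev_def g_def)
  ultimately show ?thesis by blast
qed

text \<open>One function \<open>g\<close> approximates the expectation after time \<open>s\<close>
  both for a fixed starting point and on an event of the past. The first use says that
  \<open>g\<close> is close to the semigroup applied to \<open>f\<close>; the second then identifies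
  the conditional expectation.\<close>

lemma Y_markov:
  assumes p: "p \<in> Gam N" and f: "f \<in> C0 N" and s: "0 \<le> s" and t: "0 \<le> t"
  shows "AE w in P p. real_cond_exp (P p) (natfilt P Y t) (\<lambda>w. gev f (Y (t + s) w)) w = Tsg P Y s f (Y t w)"
proof -
  interpret prob_space "P p" by (rule prob) fact
  have sub: "subalgebra (P p) (natfilt P Y t)"
    unfolding subalgebra_def using natfilt_Y_sub[of _ t p] space_P[of p] by auto
  interpret sigma_finite_subalgebra "P p" "natfilt P Y t"
    by (rule finite_measure_subalgebra_is_sigma_finite)
      (simp add: finite_measure_subalgebra_def finite_measure_subalgebra_axioms_def sub finite_measure_axioms)
  obtain h where h: "h \<in> C0 N" "\<And>q. q \<in> Gam N \<Longrightarrow> Tsg P Y s f q = gev h q" using Tsg_Y_C0[OF f s] by blast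
  have ts: "0 \<le> t + s" "t \<le> t + s" using s t by auto
  have "AE w in P p. real_cond_exp (P p) (natfilt P Y t) (\<lambda>w. gev f (Y (t + s) w)) w = gev h (Y t w)"
  proof (rule real_cond_exp_charact)
    fix \<Lambda> assume \<Lambda>: "\<Lambda> \<in> sets (natfilt P Y t)"
    define m where "m r f = (\<integral>w. indicator \<Lambda> w * gev f (Y r w) \<partial>P p)" for r f
    have m: "evolution t m" unfolding m_def by (rule evolution_Y[OF p t \<Lambda>])
    have "\<bar>m (t + s) f - m t h\<bar> \<le> 0"
    proof (rule field_le_epsilon)
      fix e :: real assume e: "e > 0"
      then have "e / 2 > 0" by simp
      from evolution_approx[OF f s this] obtain g where g: "g \<in> C0 N" "\<And>t' m. evolution t' m \<Longrightarrow> \<bar>m (t' + s) f - m t' g\<bar> \<le> e / 2" by blast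
      have "\<bar>m t h - m t g\<bar> \<le> e / 2"
      proof (rule evolution_close[OF m h(1) g(1) order_refl])
        fix i x assume ix: "i < N" "0 \<le> (x::real)"
        show "\<bar>h i x - g i x\<bar> \<le> e / 2"
          using g(2)[OF evolution_Tsg[OF pt_in_Gam[OF ix]]] Tsg_Y_0[OF pt_in_Gam[OF ix] g(1)] h(2)[OF pt_in_Gam[OF ix]]
            gev_pt_C0[OF g(1) ix(1)] gev_pt_C0[OF h(1) ix(1)] by simp
      qed
      then show "\<bar>m (t + s) f - m t h\<bar> \<le> 0 + e" using g(2)[OF m] by linarith
    qed
    then have "m (t + s) f = m t h" by simp
    then show "(\<integral>w\<in>\<Lambda>. gev f (Y (t + s) w) \<partial>P p) = (\<integral>w\<in>\<Lambda>. gev h (Y t w) \<partial>P p)"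
      by (simp add: m_def set_lebesgue_integral_def)
  next
    show "integrable (P p) (\<lambda>w. gev f (Y (t + s) w))" by (rule gev_Y_integrable[OF f ts(1) p])
    show "integrable (P p) (\<lambda>w. gev h (Y t w))" by (rule gev_Y_integrable[OF h(1) t p])
    show "(\<lambda>w. gev h (Y t w)) \<in> borel_measurable (natfilt P Y t)"
      by (rule measurable_compose[OF cprocess_GM[OF Y_cp t order_refl] gev_meas[OF h(1)]])
  qed
  then show ?thesis
    using AE_space by eventually_elim (simp add: h(2)[OF Y_Gam[OF space_PD[of _ p]]])
qed

lemma Tsg_Y_comb:
  assumes p: "p \<in> Gam N" and fg: "f \<in> C0 N" "g \<in> C0 N" and s: "0 \<le> s"
  shows "Tsg P Y s (comb \<alpha> f \<beta> g) p = \<alpha> * Tsg P Y s f p + \<beta> * Tsg P Y s g p"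
  by (rule dpD(2)[OF evolution_Tsg[OF p] fg s])

text \<open>Immediate on the nonsticky domain, where means are Lipschitz in time with a constant
  independent of the starting point, and extended by density.\<close>

lemma Y_strong_cont:
  assumes f: "f \<in> C0 N" and e: "e > 0"
  shows "\<exists>d>0. \<forall>t. 0 \<le> t \<and> t < d \<longrightarrow> (\<forall>p\<in>Gam N. \<bar>Tsg P Y t f p - gev f p\<bar> \<le> e)"
proof -
  obtain u where u: "u \<in> D 0" "\<And>i x. i < N \<Longrightarrow> 0 \<le> x \<Longrightarrow> \<bar>u i x - f i x\<bar> \<le> e / 3"
    using D0_dense[OF f, of "e / 3"] e by auto
  note uD = DL_D[OF u(1)]
  obtain K where K: "K \<ge> 0" "bd N (L u) K" using C0_bounded[OF uD(3)] by blast
  define d where "d = e / (3 * (K + 1))"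
  have d: "d > 0" "K * d \<le> e / 3" using e K by (auto simp: d_def field_simps)
  have "\<bar>Tsg P Y t f p - gev f p\<bar> \<le> e" if t: "0 \<le> t" "t < d" and p: "p \<in> Gam N" for t p
  proof -
    note m = evolution_Tsg[OF p]
    have "\<bar>Tsg P Y t u p - Tsg P Y 0 u p\<bar> \<le> K * (t - 0)"
      by (rule evolution_lipschitz[OF m u(1) K(2,1) order_refl t(1)])
    also have "\<dots> \<le> K * d" using t by (intro mult_left_mono K) simp
    finally have "\<bar>Tsg P Y t u p - Tsg P Y 0 u p\<bar> \<le> K * d" .
    moreover have "\<bar>Tsg P Y t u p - Tsg P Y t f p\<bar> \<le> e / 3" by (rule evolution_close[OF m uD(2) f t(1) u(2)])
    moreover have "\<bar>Tsg P Y 0 u p - Tsg P Y 0 f p\<bar> \<le> e / 3" by (rule evolution_close[OF m uD(2) f order_refl u(2)])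
    ultimately show ?thesis using d(2) Tsg_Y_0[OF p f] by linarith
  qed
  then show ?thesis using d(1) by blast
qed

lemma Y_generator:
  assumes u: "u \<in> D 0"
  shows "unif_right0 N (\<lambda>t p. (Tsg P Y t u p - gev u p) / t) (gev (L u))"
  unfolding unif_right0_def
proof (intro allI impI)
  fix e :: real assume e: "e > 0"
  note uD = DL_D[OF u]
  obtain d where d: "d > 0" "\<And>t p. 0 \<le> t \<Longrightarrow> t < d \<Longrightarrow> p \<in> Gam N \<Longrightarrow> \<bar>Tsg P Y t (L u) p - gev (L u) p\<bar> \<le> e"
    using Y_strong_cont[OF uD(3) e] by blast
  have "\<bar>(Tsg P Y t u p - gev u p) / t - gev (L u) p\<bar> \<le> e" if t: "0 < t" "t < d" and p: "p \<in> Gam N" for t p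
  proof -
    have "\<bar>(Tsg P Y t u p - Tsg P Y 0 u p) - (t - 0) * gev (L u) p\<bar> \<le> e * (t - 0)"
      by (rule has_integral_deviation[OF dpD(3)[OF evolution_Tsg[OF p] u order_refl]]) (use t e d(2)[OF _ _ p] in auto)
    then have "\<bar>(Tsg P Y t u p - gev u p) - t * gev (L u) p\<bar> / t \<le> e"
      using t by (simp add: Tsg_Y_0[OF p uD(2)] pos_divide_le_eq)
    also have "\<bar>(Tsg P Y t u p - gev u p) - t * gev (L u) p\<bar> / t = \<bar>((Tsg P Y t u p - gev u p) - t * gev (L u) p) / t\<bar>"
      using t by (simp add: abs_divide)
    also have "((Tsg P Y t u p - gev u p) - t * gev (L u) p) / t = (Tsg P Y t u p - gev u p) / t - gev (L u) p"
      using t by (simp add: diff_divide_distrib)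
    finally show ?thesis .
  qed
  then show "\<exists>d>0. \<forall>t. 0 < t \<and> t < d \<longrightarrow> (\<forall>p\<in>Gam N. \<bar>(Tsg P Y t u p - gev u p) / t - gev (L u) p\<bar> \<le> e)"
    using d(1) by blast
qed

text \<open>Maximality of the generator. The resolvent supplies \<open>w\<close> in the nonsticky
  domain with \<open>w - L w = f - g\<close>, so \<open>v = f - w\<close> is reproduced by the
  generator of \<open>Y\<close>. Since the semigroup contracts, such a function must vanish.\<close>

lemma Y_generator_domain:
  assumes f: "f \<in> C0 N" and g: "g \<in> C0 N"
    and gen_f: "unif_right0 N (\<lambda>t p. (Tsg P Y t f p - gev f p) / t) (gev g)"
  shows "f \<in> D 0"
proof -
  obtain w where w: "w \<in> D 0" "\<And>i x. i < N \<Longrightarrow> 0 \<le> x \<Longrightarrow> w i x - 1 * L w i x = comb 1 f (- 1) g i x"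
    using resolvent_exists[OF C0_comb[OF f g], of 1] by (metis zero_less_one)
  note wD = DL_D[OF w(1)]
  define v where "v = comb 1 f (- 1) w"
  have v: "v \<in> C0 N" unfolding v_def by (rule C0_comb[OF f wD(2)])
  have "bd N v 0"
  proof (rule bd_limit)
    fix e :: real assume e: "e > 0"
    then have e2: "e / 2 > 0" by simp
    obtain d where d: "d > 0" "\<And>t p. 0 < t \<Longrightarrow> t < d \<Longrightarrow> p \<in> Gam N \<Longrightarrow> \<bar>(Tsg P Y t f p - gev f p) / t - gev g p\<bar> \<le> e / 2"
      using gen_f[unfolded unif_right0_def, rule_format, OF e2] by blast
    obtain d' where d': "d' > 0" "\<And>t p. 0 < t \<Longrightarrow> t < d' \<Longrightarrow> p \<in> Gam N \<Longrightarrow> \<bar>(Tsg P Y t w p - gev w p) / t - gev (L w) p\<bar> \<le> e / 2"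
      using Y_generator[OF w(1), unfolded unif_right0_def, rule_format, OF e2] by blast
    define t where "t = min d d' / 2"
    have t: "0 < t" "t < d" "t < d'" using d(1) d'(1) by (auto simp: t_def)
    \<comment> \<open>From the mean after time \<open>t\<close> being close to
      \<open>(1 + t) * v\<close>: the weight of the old bound is \<open>1 / (1 + t)\<close>, the
      rest goes to the error \<open>e\<close>.\<close>
    define \<theta> where "\<theta> = 1 / (1 + t)"
    have \<theta>: "0 \<le> \<theta>" "\<theta> < 1" using t by (auto simp: \<theta>_def)
    show "bd N v (0 + e)"
    proof (rule bd_contraction[OF _ N1 \<theta>])
      show "\<exists>C. bd N v C" using C0_bounded[OF v] by blast
      fix M assume M: "bd N v M"
      show "bd N v (\<theta> * M + (1 - \<theta>) * (0 + e))"
        unfolding bd_def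
      proof (intro allI impI)
        fix i x assume ix: "i < N" "0 \<le> (x::real)"
        define p where "p = pt i x"
        have p: "p \<in> Gam N" unfolding p_def by (rule pt_in_Gam[OF ix])
        have vp: "gev v p = gev f p - gev w p" by (simp add: v_def gev_comb)
        have Tv: "Tsg P Y t v p = Tsg P Y t f p - Tsg P Y t w p"
          unfolding v_def using Tsg_Y_comb[OF p f wD(2), of t 1 "- 1"] t by simp
        have "gev w p - gev (L w) p = gev f p - gev g p"
          using w(2)[OF ix] by (simp add: p_def gev_pt_C0[OF f ix(1)] gev_pt_C0[OF g ix(1)] gev_pt_C0[OF wD(2) ix(1)] gev_pt_C0[OF wD(3) ix(1)] comb_def)
        then have "\<bar>((Tsg P Y t f p - gev f p) / t - (Tsg P Y t w p - gev w p) / t) - gev v p\<bar> \<le> e"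
          using d(2)[OF t(1,2) p] d'(2)[OF t(1,3) p] vp by linarith
        moreover have "(Tsg P Y t f p - gev f p) / t - (Tsg P Y t w p - gev w p) / t = (Tsg P Y t v p - gev v p) / t"
          by (simp add: Tv vp diff_divide_distrib)
        ultimately have "\<bar>(Tsg P Y t v p - gev v p) / t - gev v p\<bar> * t \<le> e * t"
          using t by (intro mult_right_mono) auto
        also have "\<bar>(Tsg P Y t v p - gev v p) / t - gev v p\<bar> * t = \<bar>((Tsg P Y t v p - gev v p) / t - gev v p) * t\<bar>"
          using t by (simp only: abs_mult abs_of_pos)
        also have "((Tsg P Y t v p - gev v p) / t - gev v p) * t = Tsg P Y t v p - (1 + t) * gev v p"
          using t by (simp add: field_simps)
        finally have "\<bar>Tsg P Y t v p - (1 + t) * gev v p\<bar> \<le> e * t" .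
        moreover have "\<bar>Tsg P Y t v p\<bar> \<le> M" using dpD(1)[OF evolution_Tsg[OF p] v _ M, of t] t by simp
        ultimately have "\<bar>(1 + t) * gev v p\<bar> \<le> M + e * t" by linarith
        then have "\<bar>gev v p\<bar> \<le> (M + e * t) / (1 + t)" using t by (simp add: abs_mult pos_le_divide_eq mult.commute)
        also have "\<dots> = \<theta> * M + (1 - \<theta>) * (0 + e)"
        proof -
          have "1 - \<theta> = t / (1 + t)" using t by (simp add: \<theta>_def field_simps)
          then show ?thesis by (simp add: \<theta>_def add_divide_distrib mult.commute)
        qed
        finally show "\<bar>v i x\<bar> \<le> \<theta> * M + (1 - \<theta>) * (0 + e)" by (simp only: p_def gev_pt_C0[OF v ix(1)])
      qed
    qed
  qed
  then have "feq N w f" by (simp add: bd_def feq_def v_def comb_def)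
  from DL_cong[OF this w(1) N1] show ?thesis .
qed

lemma generated_Y: "generated_process N \<sigma> b \<rho> 0 P Y"
  unfolding generated_process_def
proof (intro conjI allI ballI impI iffI)
  show "sets (P p) = sets (P q)" for p q using sets_P[of p] sets_P[of q] by simp
  show "prob_space (P p)" if "p \<in> Gam N" for p by (rule prob[OF that])
  show "Y t w \<in> Gam N" if "w \<in> \<Omega>" for t w by (rule Y_Gam[OF that])
  show "Y t \<in> measurable (P vtx) Gmeas" if "0 \<le> t" for t by (rule measurable_GM_D(1)[OF Y_Gmeas[OF that]])
  show "path_cont (\<lambda>t. Y t w)" if "w \<in> \<Omega>" for w by (rule Y_path[OF that])
  show "AE w in P p. Y 0 w = p" if "p \<in> Gam N" for p by (rule Y_0[OF that])
  show "AE w in P p. real_cond_exp (P p) (natfilt P Y t) (\<lambda>w. gev f (Y (t + s) w)) w = Tsg P Y s f (Y t w)"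
    if "p \<in> Gam N" "f \<in> C0 N" "0 \<le> s" "0 \<le> t" for p f s t by (rule Y_markov[OF that])
  show "\<exists>g\<in>C0 N. \<forall>p\<in>Gam N. Tsg P Y t f p = gev g p" if "0 \<le> t" "f \<in> C0 N" for t f by (rule Tsg_Y_C0[OF that(2,1)])
  show "unif_right0 N (\<lambda>t. Tsg P Y t f) (gev f)" if "f \<in> C0 N" for f
    unfolding unif_right0_def using Y_strong_cont[OF that] by (meson less_imp_le)
  show "f \<in> DL N \<sigma> b \<rho> 0" if "f \<in> C0 N \<and> (\<exists>g\<in>C0 N. unif_right0 N (\<lambda>t p. (Tsg P Y t f p - gev f p) / t) (gev g))" for f
    using that Y_generator_domain by blast
  show "f \<in> C0 N" if "f \<in> DL N \<sigma> b \<rho> 0" for f by (rule DL_D(2)[OF that])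
  show "\<exists>g\<in>C0 N. unif_right0 N (\<lambda>t p. (Tsg P Y t f p - gev f p) / t) (gev g)" if "f \<in> DL N \<sigma> b \<rho> 0" for f
    using Y_generator[OF that] by (rule bexI[of _ "Lop \<sigma> b f"]) (rule DL_D(3)[OF that])
  show "unif_right0 N (\<lambda>t p. (Tsg P Y t f p - gev f p) / t) (gev (Lop \<sigma> b f))" if "f \<in> DL N \<sigma> b \<rho> 0" for f
    by (rule Y_generator[OF that])
qed

section \<open>The time change and the local time of the sticky process\<close>

lemma Vinv_path:
  assumes w: "w \<in> \<Omega>"
  shows "strict_mono_on {0..} (Vinv w)" "continuous_on {0..} (Vinv w)" "Vinv w ` {0..} \<subseteq> {0..}"
proof -
  show "strict_mono_on {0..} (Vinv w)"
    by (rule strict_mono_onI) (auto simp: Vinv_def A_strict[OF good_paths_clock_paths])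
  show "continuous_on {0..} (Vinv w)"
    using A_continuous[OF w] by (cases "w \<in> good_paths") (simp_all add: Vinv_def[abs_def])
  show "Vinv w ` {0..} \<subseteq> {0..}" using A_nonneg[OF w] by (auto simp: Vinv_def)
qed

lemma Vinv_measurable: "0 \<le> t \<Longrightarrow> (\<lambda>w. Vinv w t) \<in> borel_measurable (P p)"
  unfolding Vinv_def using A_P good_paths_sets[of p] by (intro measurable_If_set) auto

lemma X_time_change: "w \<in> good_paths \<Longrightarrow> 0 \<le> t \<Longrightarrow> X t w = Y (Vinv w t) w"
  using A_nonneg[OF good_paths_\<Omega>] by (simp add: Vinv_def Y_def tau(3)[OF good_paths_clock_paths])

lemma lX_time_change: "w \<in> good_paths \<Longrightarrow> 0 \<le> t \<Longrightarrow> lX t w = lY (Vinv w t) w"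
  by (simp add: Vinv_def lY_def lX_def tau(3)[OF good_paths_clock_paths])

text \<open>The occupation time of the vertex is already measurable for the uncompleted filtration,
  so the empty set serves as the exceptional set under every law.\<close>

lemma lX_compl_filt:
  assumes t: "0 \<le> t" and B: "B \<in> sets borel"
  shows "lX t -` B \<inter> \<Omega> \<in> compl_filt N P X t"
proof -
  have "lX t \<in> borel_measurable (F t)" unfolding lX_def using S_F[OF t] by simp
  from measurable_sets[OF this B] have "lX t -` B \<inter> \<Omega> \<in> sets (F t)" by simp
  then have "\<exists>B'\<in>sets (F t). \<exists>Z\<in>null_sets (P p). (lX t -` B \<inter> \<Omega> - B') \<union> (B' - lX t -` B \<inter> \<Omega>) \<subseteq> Z" for p
    by (rule bexI[rotated]) (rule bexI[of _ "{}"], auto)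
  then show ?thesis unfolding compl_filt_def by blast
qed

lemma lX_mono: "w \<in> \<Omega> \<Longrightarrow> mono_on {0..} (\<lambda>t. lX t w)"
  using S_mono \<eta> by (intro mono_onI) (simp add: lX_def divide_right_mono)

lemma lX_increases_at_vtx:
  assumes w: "w \<in> \<Omega>" and st: "0 \<le> s" "s \<le> t" and off: "\<And>u. u \<in> {s..t} \<Longrightarrow> X u w \<noteq> vtx"
  shows "lX t w = lX s w"
proof -
  have "indicator {s..t} u * Gv (X u w) = 0" for u
    using off by (auto simp: indicator_def Gv_def glue_def)
  then have "occ X Gv s t w = 0" unfolding occ_def by (simp only: Bochner_Integration.integral_zero)
  then show ?thesis using S_diff[OF w st] by (simp add: lX_def)
qed

lemma lX_occupation:
  assumes w: "w \<in> \<Omega>"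
  shows "\<eta> * lX t w = integral {0..t} (\<lambda>s. if X s w = vtx then 1 else 0)"
  using occ_HK[OF X_cp G_meas(2) w G_bound(2), of t] \<eta> by (simp add: lX_def S_def Gv_def glue_def)

end

theorem theorem4p3:
  fixes N :: nat and \<sigma> b :: "nat \<Rightarrow> real \<Rightarrow> real" and \<rho> :: "nat \<Rightarrow> real"
    and \<eta> \<sigma>0 :: real and P :: "point \<Rightarrow> 'w measure" and X :: "real \<Rightarrow> 'w \<Rightarrow> point"
  assumes "N \<ge> 1"
    and "\<forall>i<N. continuous_on {0..} (\<sigma> i) \<and> bounded (\<sigma> i ` {0..})"
    and "\<forall>i<N. continuous_on {0..} (b i) \<and> bounded (b i ` {0..})"
    and "\<sigma>0 > 0" and "\<forall>i<N. \<forall>x>0. \<sigma> i x > \<sigma>0"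
    and "\<forall>i<N. \<rho> i > 0" and "(\<Sum>i<N. \<rho> i) = 1"
    and "\<eta> > 0"
    and "generated_process N \<sigma> b \<rho> \<eta> P X"
  shows "\<exists>(Y :: real \<Rightarrow> 'w \<Rightarrow> point) (Vinv :: 'w \<Rightarrow> real \<Rightarrow> real)
            (lY :: real \<Rightarrow> 'w \<Rightarrow> real) (lX :: real \<Rightarrow> 'w \<Rightarrow> real).
     generated_process N \<sigma> b \<rho> 0 P Y \<and>
     vertex_local_time N \<sigma> \<rho> P Y lY \<and>
     (\<forall>w\<in>space (P vtx). strict_mono_on {0..} (Vinv w) \<and> continuous_on {0..} (Vinv w)
                         \<and> Vinv w ` {0..} \<subseteq> {0..}) \<and>
     (\<forall>t\<ge>0. (\<lambda>w. Vinv w t) \<in> borel_measurable (P vtx)) \<and>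
     (\<forall>p\<in>Gam N. AE w in P p. \<forall>t\<ge>0. X t w = Y (Vinv w t) w) \<and>
     (\<forall>t\<ge>0. \<forall>B\<in>sets borel. lX t -` B \<inter> space (P vtx) \<in> compl_filt N P X t) \<and>
     (\<forall>w\<in>space (P vtx). mono_on {0..} (\<lambda>t. lX t w)) \<and>
     (\<forall>p\<in>Gam N. AE w in P p.
        (\<forall>s t. 0 \<le> s \<and> s \<le> t \<and> (\<forall>u\<in>{s..t}. X u w \<noteq> vtx) \<longrightarrow> lX t w = lX s w) \<and>
        (\<forall>t\<ge>0. \<eta> * lX t w = integral {0..t} (\<lambda>s. if X s w = vtx then 1 else 0))) \<and>
     (\<forall>p\<in>Gam N. \<forall>t\<ge>0. AE w in P p. lX t w = lY (Vinv w t) w)"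
proof -
  interpret sticky N \<sigma> b \<rho> \<eta> \<sigma>0 P X
    by (rule sticky.intro) fact+
  have lt: "vertex_local_time N \<sigma> \<rho> P Y lY" by (rule vertex_local_time_Y)
  have tc: "\<forall>p\<in>Gam N. AE w in P p. \<forall>t\<ge>0. X t w = Y (Vinv w t) w"
  proof
    fix p assume "p \<in> Gam N"
    from AE_good_paths[OF this] show "AE w in P p. \<forall>t\<ge>0. X t w = Y (Vinv w t) w"
      by eventually_elim (simp add: X_time_change)
  qed
  have ltc: "\<forall>p\<in>Gam N. \<forall>t\<ge>0. AE w in P p. lX t w = lY (Vinv w t) w"
  proof (intro ballI allI impI)
    fix p t assume "p \<in> Gam N" and t: "0 \<le> (t::real)"
    from AE_good_paths[OF this(1)] show "AE w in P p. lX t w = lY (Vinv w t) w"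
      by eventually_elim (rule lX_time_change[OF _ t])
  qed
  \<comment> \<open>These two properties of \<open>lX\<close> hold on every path; the almost sure
    form is all that is claimed.\<close>
  have inc: "\<forall>p\<in>Gam N. AE w in P p.
        (\<forall>s t. 0 \<le> s \<and> s \<le> t \<and> (\<forall>u\<in>{s..t}. X u w \<noteq> vtx) \<longrightarrow> lX t w = lX s w) \<and>
        (\<forall>t\<ge>0. \<eta> * lX t w = integral {0..t} (\<lambda>s. if X s w = vtx then 1 else 0))"
  proof (intro ballI AE_I2 conjI allI impI; (elim conjE)?)
    fix p w s t assume "w \<in> space (P p)" "0 \<le> s" "s \<le> (t::real)" "\<forall>u\<in>{s..t}. X u w \<noteq> vtx"
    then show "lX t w = lX s w" by (intro lX_increases_at_vtx space_PD[of w p]) auto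
  next
    fix p w t assume "w \<in> space (P p)"
    then show "\<eta> * lX t w = integral {0..t} (\<lambda>s. if X s w = vtx then 1 else 0)"
      by (intro lX_occupation space_PD[of w p])
  qed
  have Vp: "\<forall>w\<in>\<Omega>. strict_mono_on {0..} (Vinv w) \<and> continuous_on {0..} (Vinv w) \<and> Vinv w ` {0..} \<subseteq> {0..}"
    by (intro ballI conjI Vinv_path)
  have Vm: "\<forall>t\<ge>0. (\<lambda>w. Vinv w t) \<in> borel_measurable (P vtx)"
    by (intro allI impI Vinv_measurable)
  have lF: "\<forall>t\<ge>0. \<forall>B\<in>sets borel. lX t -` B \<inter> \<Omega> \<in> compl_filt N P X t"
    by (intro allI impI ballI lX_compl_filt)
  have lm: "\<forall>w\<in>\<Omega>. mono_on {0..} (\<lambda>t. lX t w)"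
    by (intro ballI lX_mono)
  show ?thesis
    by (rule exI[of _ Y], rule exI[of _ Vinv], rule exI[of _ lY], rule exI[of _ lX])
      (rule conjI[OF generated_Y conjI[OF lt conjI[OF Vp conjI[OF Vm conjI[OF tc conjI[OF lF conjI[OF lm conjI[OF inc ltc]]]]]]]])
qed

end
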